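(* Let $m,n,d\ge1$ and $k\ge0$ be integers. Suppose $U\subset\mathbb{R}^m$ is an open set, $f:U\to\mathcal{A}_d(\mathbb{R}^n)$ is Lipschitz and $\omega\in\Omega^k(\mathcal{A}_d(\mathbb{R}^n))$. Then $d(f^*\omega)=f^*(d\omega)$ weakly. In particular, $f^*\omega$ is a flat form on $U$ in the sense of Whitney.
   Context: $\mathcal{A}_d(\mathbb{R}^n)=(\mathbb{R}^n)^d/S_d$ is the space of unordered $d$-tuples $[\![x_1,\dots,x_d]\!]$ with metric $d_{\mathcal A}([\![x]\!],[\![y]\!])=\min_{\sigma\in S_d}(\sum_j|x_j-y_{\sigma(j)}|^2)^{1/2}$. $\Omega^k(\mathcal{A}_d(\mathbb{R}^n))$ denotes the space of smooth $k$-forms $\omega$ on $(\mathbb{R}^n)^d$ that are $S_d$-invariant, i.e. $\sigma^*\omega=\omega$ for all $\sigma\in S_d$ (acting by permutation of factors). Lipschitz maps $f:U\to\mathcal{A}_d(\mathbb{R}^n)$ are differentiable a.e.: for a.e. $x_0$ there are a labeling $f(x_0)=[\![y_1,\dots,y_d]\!]$ and linear maps $L_1,\dots,L_d:\mathbb{R}^m\to\mathbb{R}^n$ with $L_i=L_j$ whenever $y_i=y_j$ and $d_{\mathcal A}\big(f(x),[\![y_1+L_1(x-x_0),\dots,y_d+L_d(x-x_0)]\!]\big)/|x-x_0|\to0$ as $x\to x_0$. The pull-back is the a.e. defined form $(f^*\omega)_{x_0}(v_1,\dots,v_k)=\omega_{(y_1,\dots,y_d)}(Lv_1,\dots,Lv_k)$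 with $L=(L_1,\dots,L_d)$, independent of the ordering by invariance. "Weakly" means $\int_Uf^*(d\omega)\wedge\alpha=(-1)^{k+1}\int_Uf^*\omega\wedge d\alpha$ for every smooth compactly supported $(m-k-1)$-form $\alpha$ on $U$. A flat $k$-form in the sense of Whitney is an $L^\infty$ differential $k$-form whose weak exterior derivative is an $L^\infty$ form.
   Formalization: Flatness on all of U fails for unbounded f (U=ℝ, f=id, ω(x)=x, k=0); it is stated instead on every open V⊆U with f(V) bounded, and on U when ω and dω are bounded over f(U). The weak identity d(f*ω)=f*(dω) is unconditional. *)

theory Defs
  imports "HOL-Analysis.Analysis" "HOL-Combinatorics.Permutations"
begin

section \<open>Unordered tuples\<close>

definition permute_vec :: "('d \<Rightarrow> 'd) \<Rightarrow> 'a ^ 'd \<Rightarrow> 'a ^ 'd::finite" where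
  "permute_vec \<sigma> x = (\<chi> j. x $ \<sigma> j)"

definition same_up_to_order :: "'a ^ 'd::finite \<Rightarrow> 'a ^ 'd \<Rightarrow> bool" where
  "same_up_to_order x y \<longleftrightarrow> (\<exists>\<sigma>. \<sigma> permutes UNIV \<and> y = permute_vec \<sigma> x)"

lemma permute_vec_id [simp]: "permute_vec id x = x" "permute_vec (\<lambda>j. j) x = x"
  by (simp_all add: permute_vec_def vec_eq_iff)

lemma permute_vec_permute_vec [simp]:
  "permute_vec \<sigma> (permute_vec \<tau> x) = permute_vec (\<tau> \<circ> \<sigma>) x"
  by (simp add: permute_vec_def vec_eq_iff)

lemma same_up_to_order_equivp: "equivp (same_up_to_order :: 'a ^ 'd::finite \<Rightarrow> _)"
proof (rule equivpI)
  show "reflp (same_up_to_order :: 'a ^ 'd \<Rightarrow> _)"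
    by (auto simp: reflp_def same_up_to_order_def intro!: exI[of _ id] permutes_id)
  show "symp (same_up_to_order :: 'a ^ 'd \<Rightarrow> _)"
  proof (rule sympI)
    fix x y :: "'a ^ 'd" assume "same_up_to_order x y"
    then obtain \<sigma> where \<sigma>: "\<sigma> permutes UNIV" "y = permute_vec \<sigma> x"
      by (auto simp: same_up_to_order_def)
    then have "x = permute_vec (inv \<sigma>) y"
      by (simp add: permutes_inv_o)
    with \<sigma> show "same_up_to_order y x"
      using permutes_inv same_up_to_order_def by blast
  qed
  show "transp (same_up_to_order :: 'a ^ 'd \<Rightarrow> _)"
  proof (rule transpI)
    fix x y z :: "'a ^ 'd" assume "same_up_to_order x y" "same_up_to_order y z"
    then show "same_up_to_order x z"
      unfolding same_up_to_order_def by (metis permute_vec_permute_vec permutes_compose)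
  qed
qed

text \<open>The type \<open>('a, 'd) utuple\<close> is the quotient of the \<open>d\<close>-fold power of \<open>'a\<close> by the
  symmetric group, where \<open>d = CARD('d)\<close>.\<close>

quotient_type (overloaded) ('a, 'd) utuple = "'a ^ ('d::finite)" / same_up_to_order
  morphisms rep_utuple utuple
  by (rule same_up_to_order_equivp)

lemma utuple_eq_iff: "utuple x = utuple y \<longleftrightarrow> same_up_to_order x y"
  by (rule utuple.abs_eq_iff)

lemma utuple_permute_vec: "\<sigma> permutes UNIV \<Longrightarrow> utuple (permute_vec \<sigma> x) = utuple x"
  by (metis utuple_eq_iff same_up_to_order_def)

lemma dist_permute_vec:
  fixes x y :: "'a::metric_space ^ 'd::finite"
  assumes "\<sigma> permutes UNIV"
  shows "dist (permute_vec \<sigma> x) (permute_vec \<sigma> y) = dist x y"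
proof -
  have "(\<Sum>j\<in>UNIV. (dist (x $ \<sigma> j) (y $ \<sigma> j))\<^sup>2) = (\<Sum>j\<in>UNIV. (dist (x $ j) (y $ j))\<^sup>2)"
    using sum.permute[OF assms, of "\<lambda>j. (dist (x $ j) (y $ j))\<^sup>2"] by (simp add: o_def)
  then show ?thesis
    by (simp add: dist_vec_def L2_set_def permute_vec_def)
qed

definition min_dist :: "'a::metric_space ^ 'd::finite \<Rightarrow> 'a ^ 'd \<Rightarrow> real" where
  "min_dist x y = Min ((\<lambda>\<sigma>. dist x (permute_vec \<sigma> y)) ` {\<sigma>. \<sigma> permutes UNIV})"

lemma min_dist_le: "\<sigma> permutes UNIV \<Longrightarrow> min_dist x y \<le> dist x (permute_vec \<sigma> y)"
  unfolding min_dist_def by (rule Min_le) auto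

lemma min_dist_attained:
  obtains \<sigma> where "\<sigma> permutes UNIV" "min_dist x y = dist x (permute_vec \<sigma> y)"
proof -
  have "min_dist x y \<in> (\<lambda>\<sigma>. dist x (permute_vec \<sigma> y)) ` {\<sigma>. \<sigma> permutes UNIV}"
    unfolding min_dist_def
  proof (rule Min_in)
    show "(\<lambda>\<sigma>. dist x (permute_vec \<sigma> y)) ` {\<sigma>. \<sigma> permutes UNIV} \<noteq> {}"
      using permutes_id[of UNIV] by blast
  qed simp
  then show ?thesis using that by auto
qed

lemma min_dist_commute: "min_dist x y = min_dist y x"
proof -
  have le: "min_dist x y \<le> min_dist y x" for x y :: "'a ^ 'b"
  proof -
    obtain \<sigma> where \<sigma>: "\<sigma> permutes UNIV" "min_dist y x = dist y (permute_vec \<sigma> x)"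
      by (rule min_dist_attained)
    have "min_dist x y \<le> dist x (permute_vec (inv \<sigma>) y)"
      by (rule min_dist_le[OF permutes_inv[OF \<sigma>(1)]])
    also have "\<dots> = dist (permute_vec \<sigma> x) (permute_vec \<sigma> (permute_vec (inv \<sigma>) y))"
      by (rule dist_permute_vec[OF \<sigma>(1), symmetric])
    also have "\<dots> = dist y (permute_vec \<sigma> x)"
      using \<sigma>(1) by (simp add: permutes_inv_o dist_commute)
    finally show ?thesis using \<sigma>(2) by simp
  qed
  show ?thesis by (rule antisym) (rule le)+
qed

lemma min_dist_triangle: "min_dist x z \<le> min_dist x y + min_dist y z"
proof -
  obtain \<sigma> where \<sigma>: "\<sigma> permutes UNIV" "min_dist x y = dist x (permute_vec \<sigma> y)"
    by (rule min_dist_attained)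
  obtain \<tau> where \<tau>: "\<tau> permutes UNIV" "min_dist y z = dist y (permute_vec \<tau> z)"
    by (rule min_dist_attained)
  have "min_dist x z \<le> dist x (permute_vec (\<tau> \<circ> \<sigma>) z)"
    by (rule min_dist_le[OF permutes_compose[OF \<sigma>(1) \<tau>(1)]])
  also have "\<dots> \<le> dist x (permute_vec \<sigma> y) + dist (permute_vec \<sigma> y) (permute_vec (\<tau> \<circ> \<sigma>) z)"
    by (rule dist_triangle)
  also have "dist (permute_vec \<sigma> y) (permute_vec (\<tau> \<circ> \<sigma>) z) = dist y (permute_vec \<tau> z)"
    using dist_permute_vec[OF \<sigma>(1), of y "permute_vec \<tau> z"] by simp
  finally show ?thesis using \<sigma>(2) \<tau>(2) by simp
qed

lemma min_dist_eq_0_iff: "min_dist x y = 0 \<longleftrightarrow> same_up_to_order x y"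
proof
  assume "min_dist x y = 0"
  moreover obtain \<sigma> where "\<sigma> permutes UNIV" "min_dist x y = dist x (permute_vec \<sigma> y)"
    by (rule min_dist_attained)
  ultimately have "same_up_to_order y x"
    unfolding same_up_to_order_def by (metis dist_eq_0_iff)
  then show "same_up_to_order x y"
    by (metis utuple_eq_iff)
next
  assume "same_up_to_order x y"
  then have "same_up_to_order y x" by (metis utuple_eq_iff)
  then obtain \<sigma> where \<sigma>: "\<sigma> permutes UNIV" "x = permute_vec \<sigma> y"
    by (auto simp: same_up_to_order_def)
  have "min_dist x y \<le> 0" using min_dist_le[OF \<sigma>(1), of x y] \<sigma>(2) by simp
  moreover have "min_dist x y \<ge> 0" by (metis min_dist_attained zero_le_dist)
  ultimately show "min_dist x y = 0" by simp
qed

lemma min_dist_cong: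
  assumes "same_up_to_order x x'" "same_up_to_order y y'"
  shows "min_dist x y = min_dist x' y'"
proof -
  have "min_dist x x' = 0" "min_dist x' x = 0" "min_dist y y' = 0" "min_dist y' y = 0"
    using assms by (metis min_dist_eq_0_iff min_dist_commute)+
  then show ?thesis
    using min_dist_triangle[of x y x'] min_dist_triangle[of x' y y']
      min_dist_triangle[of x' y' x] min_dist_triangle[of x y' y] by linarith
qed

instantiation utuple :: (metric_space, finite) metric_space
begin

lift_definition dist_utuple :: "('a, 'b) utuple \<Rightarrow> ('a, 'b) utuple \<Rightarrow> real" is min_dist
  by (rule min_dist_cong)

definition uniformity_utuple :: "(('a, 'b) utuple \<times> ('a, 'b) utuple) filter" where
  "uniformity_utuple = (INF e\<in>{0 <..}. principal {(x, y). dist x y < e})"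

definition open_utuple :: "('a, 'b) utuple set \<Rightarrow> bool" where
  "open_utuple U \<longleftrightarrow> (\<forall>x\<in>U. eventually (\<lambda>(x', y). x' = x \<longrightarrow> y \<in> U) uniformity)"

instance
proof
  fix x y z :: "('a, 'b) utuple"
  show "dist x y = 0 \<longleftrightarrow> x = y"
    by transfer (rule min_dist_eq_0_iff)
  show "dist x y \<le> dist x z + dist y z"
    by transfer (metis min_dist_commute min_dist_triangle)
qed (simp_all add: uniformity_utuple_def open_utuple_def)

end

lemma dist_utuple:
  "dist (utuple x) (utuple y) = (MIN \<sigma>\<in>{\<sigma>. \<sigma> permutes UNIV}. dist x (permute_vec \<sigma> y))"
  by (simp add: dist_utuple.abs_eq min_dist_def)

lemma dist_utuple_real_vec:
  fixes x y :: "(real ^ 'n) ^ 'd"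
  shows "dist (utuple x) (utuple y) =
    (MIN \<sigma>\<in>{\<sigma>. \<sigma> permutes UNIV}. sqrt (\<Sum>j\<in>UNIV. (norm (x $ j - y $ \<sigma> j))\<^sup>2))"
proof -
  have "dist x (permute_vec \<sigma> y) = sqrt (\<Sum>j\<in>UNIV. (norm (x $ j - y $ \<sigma> j))\<^sup>2)" for \<sigma>
    unfolding dist_vec_def[of x] L2_set_def by (simp add: permute_vec_def dist_norm)
  then show ?thesis by (simp add: dist_utuple)
qed

section \<open>Differential forms\<close>

text \<open>A \<open>k\<close>-form on a space \<open>'a\<close> has type \<open>'a \<Rightarrow> 'a list \<Rightarrow> real\<close>: it takes a point and the list
  of its \<open>k\<close> tangent vectors. Its values on lists of any other length carry no meaning.\<close>

type_synonym 'a form = "'a \<Rightarrow> 'a list \<Rightarrow> real"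

definition alternating_form :: "nat \<Rightarrow> ('a::real_vector list \<Rightarrow> real) \<Rightarrow> bool" where
  "alternating_form k \<phi> \<longleftrightarrow>
     (\<forall>v i. length v = k \<longrightarrow> i < k \<longrightarrow> linear (\<lambda>a. \<phi> (v[i := a]))) \<and>
     (\<forall>v i j. length v = k \<longrightarrow> i < j \<longrightarrow> j < k \<longrightarrow> v ! i = v ! j \<longrightarrow> \<phi> v = 0)"

primrec times_cont_differentiable ::
    "nat \<Rightarrow> ('a::real_normed_vector \<Rightarrow> 'b::real_normed_vector) \<Rightarrow> bool" where
  "times_cont_differentiable 0 g \<longleftrightarrow> continuous_on UNIV g"
| "times_cont_differentiable (Suc r) g \<longleftrightarrow>
     (\<forall>x. g differentiable at x) \<and>
     (\<forall>u. times_cont_differentiable r (\<lambda>x. frechet_derivative g (at x) u))"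

definition smooth :: "('a::real_normed_vector \<Rightarrow> 'b::real_normed_vector) \<Rightarrow> bool" where
  "smooth g \<longleftrightarrow> (\<forall>r. times_cont_differentiable r g)"

definition smooth_form :: "nat \<Rightarrow> 'a::real_normed_vector form \<Rightarrow> bool" where
  "smooth_form k \<omega> \<longleftrightarrow>
     (\<forall>x. alternating_form k (\<omega> x)) \<and> (\<forall>v. length v = k \<longrightarrow> smooth (\<lambda>x. \<omega> x v))"

text \<open>The vectors in \<open>v\<close> are constant vector fields, whose Lie brackets vanish, so only the
  derivative terms of the invariant formula for \<open>d\<omega>\<close> remain.\<close>

definition ext_deriv :: "'a::real_normed_vector form \<Rightarrow> 'a form" where
  "ext_deriv \<omega> x v =
     (\<Sum>i<length v. (- 1) ^ i *
        frechet_derivative (\<lambda>y. \<omega> y (take i v @ drop (Suc i) v)) (at x) (v ! i))"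

text \<open>Normalised so that \<open>dx\<^sub>1 \<and> \<dots> \<and> dx\<^sub>m\<close> takes the value \<open>1\<close> on the standard basis.\<close>

definition wedge :: "nat \<Rightarrow> nat \<Rightarrow> 'a form \<Rightarrow> 'a form \<Rightarrow> 'a form" where
  "wedge p q \<beta> \<alpha> x v =
     (\<Sum>\<sigma> | \<sigma> permutes {..<p + q}. of_int (sign \<sigma>) *
        \<beta> x (take p (permute_list \<sigma> v)) * \<alpha> x (drop p (permute_list \<sigma> v))) / (fact p * fact q)"

text \<open>\<open>\<Omega>\<^sup>k\<close> of the space of unordered tuples. Permuting the factors is linear, hence equal to its
  own derivative.\<close>

definition invariant_form :: "nat \<Rightarrow> ((real ^ 'n) ^ 'd) form \<Rightarrow> bool" where
  "invariant_form k \<omega> \<longleftrightarrow>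
     smooth_form k \<omega> \<and>
     (\<forall>\<sigma> x v. \<sigma> permutes UNIV \<longrightarrow> length v = k \<longrightarrow>
        \<omega> (permute_vec \<sigma> x) (map (permute_vec \<sigma>) v) = \<omega> x v)"

section \<open>Integration of forms, weak exterior derivatives and flat forms\<close>

text \<open>The standard basis in the order of the index type, which fixes the orientation.\<close>

definition std_basis :: "(real ^ 'm::{finite, wellorder}) list" where
  "std_basis = map (\<lambda>i. axis i 1) (sorted_list_of_set UNIV)"

definition form_integrable ::
    "(real ^ 'm::{finite, wellorder}) set \<Rightarrow> (real ^ 'm::{finite, wellorder}) form \<Rightarrow> bool" where
  "form_integrable U \<beta> \<longleftrightarrow> integrable (lebesgue_on U) (\<lambda>x. \<beta> x std_basis)"

definition form_integral ::
    "(real ^ 'm::{finite, wellorder}) set \<Rightarrow> (real ^ 'm::{finite, wellorder}) form \<Rightarrow> real" where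
  "form_integral U \<beta> = integral\<^sup>L (lebesgue_on U) (\<lambda>x. \<beta> x std_basis)"

text \<open>A compactly supported form on \<open>U\<close> is represented by its extension by zero.\<close>

definition test_form :: "(real ^ 'm) set \<Rightarrow> nat \<Rightarrow> (real ^ 'm) form \<Rightarrow> bool" where
  "test_form U l \<alpha> \<longleftrightarrow>
     smooth_form l \<alpha> \<and>
     (\<exists>K. compact K \<and> K \<subseteq> U \<and> (\<forall>x v. x \<notin> K \<longrightarrow> length v = l \<longrightarrow> \<alpha> x v = 0))"

text \<open>\<open>\<gamma> = d\<beta>\<close> weakly on \<open>U\<close>, for a \<open>k\<close>-form \<open>\<beta>\<close> and a \<open>(k + 1)\<close>-form \<open>\<gamma>\<close>. The degree
  \<open>l = m - k - 1\<close> is introduced by an equation to avoid truncated subtraction: for \<open>k \<ge> m\<close> there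
  are no test forms. Integrability is required because the integral of a non-integrable function
  is \<open>0\<close> by convention.\<close>

definition weak_ext_deriv ::
    "(real ^ 'm::{finite, wellorder}) set \<Rightarrow> nat \<Rightarrow> (real ^ 'm::{finite, wellorder}) form \<Rightarrow>
     (real ^ 'm::{finite, wellorder}) form \<Rightarrow> bool" where
  "weak_ext_deriv U k \<beta> \<gamma> \<longleftrightarrow>
     (\<forall>l \<alpha>. k + 1 + l = CARD('m) \<longrightarrow> test_form U l \<alpha> \<longrightarrow>
        form_integrable U (wedge (k + 1) l \<gamma> \<alpha>) \<and>
        form_integrable U (wedge k (l + 1) \<beta> (ext_deriv \<alpha>)) \<and>
        form_integral U (wedge (k + 1) l \<gamma> \<alpha>) =
          (- 1) ^ (k + 1) * form_integral U (wedge k (l + 1) \<beta> (ext_deriv \<alpha>)))"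

definition Linfty_form :: "(real ^ 'm) set \<Rightarrow> nat \<Rightarrow> (real ^ 'm) form \<Rightarrow> bool" where
  "Linfty_form U k \<beta> \<longleftrightarrow>
     (AE x in lebesgue_on U. alternating_form k (\<beta> x)) \<and>
     (\<forall>v. length v = k \<longrightarrow> (\<lambda>x. \<beta> x v) \<in> borel_measurable (lebesgue_on U)) \<and>
     (\<exists>C. AE x in lebesgue_on U. \<forall>v. length v = k \<longrightarrow> \<bar>\<beta> x v\<bar> \<le> C * (\<Prod>i<k. norm (v ! i)))"

definition flat_form ::
    "(real ^ 'm::{finite, wellorder}) set \<Rightarrow> nat \<Rightarrow> (real ^ 'm::{finite, wellorder}) form \<Rightarrow> bool" where
  "flat_form U k \<beta> \<longleftrightarrow>
     Linfty_form U k \<beta> \<and> (\<exists>\<gamma>. Linfty_form U (k + 1) \<gamma> \<and> weak_ext_deriv U k \<beta> \<gamma>)"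

definition bounded_form_on :: "'a::real_normed_vector set \<Rightarrow> nat \<Rightarrow> 'a form \<Rightarrow> bool" where
  "bounded_form_on Y k \<omega> \<longleftrightarrow>
     (\<exists>C. \<forall>y\<in>Y. \<forall>v. length v = k \<longrightarrow> \<bar>\<omega> y v\<bar> \<le> C * (\<Prod>i<k. norm (v ! i)))"

section \<open>Pull-back along maps into unordered tuples\<close>

text \<open>\<open>y\<close> is a labeling of \<open>f x\<^sub>0\<close>, and \<open>L\<close> combines the linear maps \<open>L\<^sub>j = (\<lambda>v. L v $ j)\<close>.\<close>

definition has_utuple_derivative ::
    "(real ^ 'm \<Rightarrow> (real ^ 'n, 'd) utuple) \<Rightarrow> (real ^ 'n) ^ 'd \<Rightarrow>
     (real ^ 'm \<Rightarrow> (real ^ 'n) ^ 'd) \<Rightarrow> real ^ 'm \<Rightarrow> bool" where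
  "has_utuple_derivative f y L x\<^sub>0 \<longleftrightarrow>
     f x\<^sub>0 = utuple y \<and> linear L \<and>
     (\<forall>i j. y $ i = y $ j \<longrightarrow> (\<forall>v. L v $ i = L v $ j)) \<and>
     ((\<lambda>x. dist (f x) (utuple (y + L (x - x\<^sub>0))) / norm (x - x\<^sub>0)) \<longlongrightarrow> 0) (at x\<^sub>0)"

text \<open>For invariant \<open>\<omega>\<close> the value does not depend on the labeling and derivative that are chosen.
  The value \<open>0\<close> where \<open>f\<close> is not differentiable is a convention on a null set if \<open>f\<close> is
  Lipschitz.\<close>

definition pullback_utuple ::
    "(real ^ 'm \<Rightarrow> (real ^ 'n, 'd) utuple) \<Rightarrow> ((real ^ 'n) ^ 'd) form \<Rightarrow> (real ^ 'm) form" where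
  "pullback_utuple f \<omega> x v =
     (if \<exists>y L. has_utuple_derivative f y L x
      then let (y, L) = (SOME (y, L). has_utuple_derivative f y L x) in \<omega> y (map L v)
      else 0)"

end

theory Submission
  imports Defs
begin

text \<open>
  A map into unordered tuples is a map \<open>y\<close> into \<open>(\<real>\<^sup>n)\<^sup>d\<close> that is Lipschitz only modulo the
  permutations of the factors: the distance from \<open>y x\<close> to some permutation of \<open>y x'\<close> is at most
  \<open>C * dist x x'\<close>. Of the permutations, the proof uses only that they form a finite group \<open>G\<close> of
  linear isometries of a Euclidean space. This generality makes an induction on the order of \<open>G\<close>
  possible. Near a point where \<open>y\<close> is not fixed by all of \<open>G\<close>, the values of \<open>y\<close> can be
  chosen anew within their orbits so that \<open>y\<close> becomes Lipschitz modulo the stabiliser of one value,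
  a proper subgroup of \<open>G\<close> (\<open>local_reselection\<close>). What remains is the set \<open>D\<close> where the value
  of \<open>y\<close> is fixed by \<open>G\<close>, for unordered tuples the set where all entries coincide.

  Two single-valued Lipschitz functions control \<open>y\<close> there: the average \<open>c\<close> of \<open>y\<close> over \<open>G\<close>, and
  \<open>\<rho> = norm (y - c)\<close>, which is nonnegative and vanishes exactly on \<open>D\<close>. By Rademacher's theorem
  both are differentiable at almost every point of \<open>D\<close>, and the derivative of \<open>\<rho>\<close> at a zero is
  \<open>0\<close> because a zero is a minimum. So \<open>y\<close> has the derivative of \<open>c\<close> there
  (\<open>AE_differentiable_where_fixed\<close>). The induction then shows that \<open>y\<close> is differentiable almost
  everywhere modulo \<open>G\<close> and that the pull-backs of invariant forms are measurable.

  For the weak identity, \<open>y\<close> is pushed towards its average: \<open>y\<^sub>\<epsilon> = c + \<theta> (\<rho> / \<epsilon>) (y - c)\<close> with a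
  cut-off \<open>\<theta>\<close> that is \<open>0\<close> up to \<open>1\<close> and \<open>1\<close> from \<open>2\<close> on. These maps are
  Lipschitz modulo \<open>G\<close> uniformly in \<open>\<epsilon>\<close>. Near \<open>D\<close> they equal the single-valued map \<open>c\<close>, away from
  \<open>D\<close> the induction hypothesis applies to them, and a partition of unity joins the two
  cases. At almost every point the value and the derivative of \<open>y\<^sub>\<epsilon>\<close> agree with those of \<open>y\<close> once
  \<open>\<epsilon>\<close> is small; at points of \<open>D\<close> this holds because both derivatives equal that of \<open>c\<close>. Dominated
  convergence gives the identity for \<open>y\<close> (\<open>weak_stokes_orbit\<close>).

  For a single-valued map, expanding the form in coordinates turns the identity into
  \<open>\<Sum>\<pi>. sign \<pi> * (\<integral> \<partial>\<^bsub>\<pi> 0\<^esub> h\<^sub>0 * \<dots> * \<partial>\<^bsub>\<pi> k\<^esub> h\<^sub>k) = 0\<close> for Lipschitz functions \<open>h\<^sub>j\<close>, with \<open>h\<^sub>0\<close> of compact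
  support. If \<open>h\<^sub>1, \<dots>, h\<^sub>k\<close> are smooth, integration by parts moves \<open>\<partial>\<^bsub>\<pi> 0\<^esub>\<close> to the other factors,
  and the second derivatives cancel in pairs by their symmetry. The general case follows by
  mollification, since at a point of differentiability the derivatives of the mollified functions
  converge (\<open>antisymmetrized_ddir_integral_zero\<close>).

  All these identities concern an antisymmetrised derivative in which the differentiated slot comes
  first. Moving that slot to the front by a cyclic permutation brings both sides of the weak
  identity for the wedge product with a test form into this shape (\<open>wedge_ext_deriv_left\<close>,
  \<open>wedge_ext_deriv_right\<close>).
\<close>

section \<open>Lipschitz functions on the line\<close>

text \<open>Vitali's covering theorem picks disjoint intervals inside \<open>W\<close> on which \<open>F\<close> contracts by the
  factor \<open>p\<close> and which cover \<open>E\<close> up to a null set. Monotonicity keeps their images disjoint, and a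
  Lipschitz function maps null sets to null sets.\<close>

lemma lipschitz_shrinks_lebesgue_cover:
  fixes F :: "real \<Rightarrow> real"
  assumes mono: "strict_mono F" and lip: "C-lipschitz_on UNIV F" and p: "0 \<le> p"
    and E: "\<And>x d. x \<in> E \<Longrightarrow> d > 0 \<Longrightarrow>
      \<exists>u v. u < v \<and> u \<le> x \<and> x \<le> v \<and> v - u < d \<and> F v - F u \<le> p * (v - u)"
    and W: "open W" "E \<subseteq> W"
  shows "\<exists>T\<in>sets lebesgue. F ` E \<subseteq> T \<and> emeasure lebesgue T \<le> ennreal p * emeasure lebesgue W"
proof -
  (* intervals are encoded by their end points; centres and radii are what the covering theorem needs *)
  define K where "K = {(u, v). u < v \<and> {u..v} \<subseteq> W \<and> F v - F u \<le> p * (v - u)}"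
  define a :: "real \<times> real \<Rightarrow> real" where "a i = (fst i + snd i) / 2" for i
  define r :: "real \<times> real \<Rightarrow> real" where "r i = (snd i - fst i) / 2" for i
  have ball: "cball (a i) (r i) = {fst i..snd i}" for i
    by (auto simp: a_def r_def cball_eq_atLeastAtMost field_simps)
  have r: "0 < r i" if "i \<in> K" for i
    using that by (auto simp: K_def r_def)
  have S: "\<exists>i. i \<in> K \<and> x \<in> cball (a i) (r i) \<and> r i < d" if x: "x \<in> E" and d: "0 < d" for x d
  proof -
    obtain e where e: "e > 0" "ball x e \<subseteq> W"
      using W x by (meson open_contains_ball subsetD)
    obtain u v where uv: "u < v" "u \<le> x" "x \<le> v" "v - u < min d e" "F v - F u \<le> p * (v - u)"
      using E[OF x, of "min d e"] d e by auto
    have "{u..v} \<subseteq> ball x e"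
      using uv by (auto simp: dist_real_def)
    then have "(u, v) \<in> K"
      using e uv by (auto simp: K_def)
    moreover have "x \<in> cball (a (u, v)) (r (u, v))"
      unfolding ball using uv by auto
    moreover have "r (u, v) < d"
      using uv by (auto simp: r_def)
    ultimately show ?thesis by blast
  qed
  obtain I where I: "countable I" "I \<subseteq> K"
     "pairwise (\<lambda>i j. disjnt (cball (a i) (r i)) (cball (a j) (r j))) I"
     "negligible (E - (\<Union>i\<in>I. cball (a i) (r i)))"
    by (rule Vitali_covering_theorem_cballs[of K r E a, OF r S])
  define N where "N = E - (\<Union>i\<in>I. cball (a i) (r i))"
  define J where "J = (\<lambda>i. {F (fst i)..F (snd i)})"
  have negN: "negligible (F ` N)"
  proof (rule negligible_locally_Lipschitz_image)
    fix x assume "x \<in> N"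
    show "\<exists>T B. open T \<and> x \<in> T \<and> (\<forall>y\<in>N \<inter> T. norm (F y - F x) \<le> B * norm (y - x))"
      using lip by (intro exI[of _ UNIV] exI[of _ C]) (auto simp: lipschitz_on_def dist_norm)
  qed (use I in \<open>auto simp: N_def\<close>)
  have monoF: "F x \<le> F y \<longleftrightarrow> x \<le> y" "F x < F y \<longleftrightarrow> x < y" for x y
    using mono by (simp_all add: strict_mono_less_eq strict_mono_less)
  have dis: "{fst i..snd i} \<inter> {fst j..snd j} = {}" if "i \<in> I" "j \<in> I" "i \<noteq> j" for i j
    using I(3) that unfolding pairwise_def disjnt_def ball by blast
  have disJ: "disjoint_family_on J I"
  proof (unfold disjoint_family_on_def, intro ballI impI)
    fix i j assume ij: "i \<in> I" "j \<in> I" "i \<noteq> j"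
    have *: "fst i < snd i" "fst j < snd j" using ij I(2) by (auto simp: K_def)
    have "snd i < fst j \<or> snd j < fst i"
      using dis[OF ij] * by (auto simp: set_eq_iff) (metis dual_order.trans linorder_not_less nle_le order.strict_iff_order)
    then show "J i \<inter> J j = {}"
    proof
      assume "snd i < fst j"
      then have "F (snd i) < F (fst j)" by (simp add: monoF)
      then show ?thesis by (auto simp: J_def)
    next
      assume "snd j < fst i"
      then have "F (snd j) < F (fst i)" by (simp add: monoF)
      then show ?thesis by (auto simp: J_def)
    qed
  qed
  let ?T = "F ` N \<union> (\<Union>i\<in>I. J i)"
  have FE: "F ` E \<subseteq> ?T"
  proof
    fix z assume "z \<in> F ` E"
    then obtain x where x: "x \<in> E" "z = F x" by auto
    show "z \<in> ?T"
    proof (cases "x \<in> N")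
      case False
      then obtain i where "i \<in> I" "x \<in> {fst i..snd i}"
        using x by (auto simp: N_def ball)
      then have "F x \<in> J i" by (auto simp: J_def monoF)
      then show ?thesis using x \<open>i \<in> I\<close> by blast
    qed (use x in auto)
  qed
  have UJ: "(\<Union>i\<in>I. J i) \<in> sets lebesgue"
    using I(1) by (intro sets.countable_UN') (auto simp: J_def)
  have T: "?T \<in> sets lebesgue"
    using UJ negN by (auto intro: negligible_imp_sets)
  have "emeasure lebesgue ?T \<le> emeasure lebesgue (F ` N) + emeasure lebesgue (\<Union>i\<in>I. J i)"
    using UJ negN by (intro emeasure_subadditive) (auto intro: negligible_imp_sets)
  also have "emeasure lebesgue (F ` N) = 0"
    using negN by (simp add: null_setsD1 negligible_iff_null_sets)
  also have "0 + emeasure lebesgue (\<Union>i\<in>I. J i) = (\<integral>\<^sup>+i. emeasure lebesgue (J i) \<partial>count_space I)"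
    using emeasure_UN_countable[of I J lebesgue] I(1) disJ by (simp add: J_def)
  also have "\<dots> \<le> (\<integral>\<^sup>+i. ennreal p * emeasure lebesgue {fst i..snd i} \<partial>count_space I)"
  proof (rule nn_integral_mono)
    fix i assume "i \<in> space (count_space I)"
    then have i: "fst i < snd i" "F (snd i) - F (fst i) \<le> p * (snd i - fst i)"
      using I(2) by (auto simp: K_def)
    then show "emeasure lebesgue (J i) \<le> ennreal p * emeasure lebesgue {fst i..snd i}"
      using p by (simp add: J_def monoF flip: ennreal_mult)
  qed
  also have "\<dots> = ennreal p * (\<integral>\<^sup>+i. emeasure lebesgue {fst i..snd i} \<partial>count_space I)"
    by (rule nn_integral_cmult) simp
  also have "(\<integral>\<^sup>+i. emeasure lebesgue {fst i..snd i} \<partial>count_space I) =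
      emeasure lebesgue (\<Union>i\<in>I. {fst i..snd i})"
  proof (rule emeasure_UN_countable[symmetric])
    show "disjoint_family_on (\<lambda>i. {fst i..snd i}) I"
      unfolding disjoint_family_on_def using dis by blast
  qed (use I(1) in simp_all)
  also have "ennreal p * \<dots> \<le> ennreal p * emeasure lebesgue W"
  proof (rule mult_left_mono[OF emeasure_mono])
    show "(\<Union>i\<in>I. {fst i..snd i}) \<subseteq> W"
    proof (rule UN_least)
      fix i assume "i \<in> I"
      then have "i \<in> K" using I(2) by blast
      then show "{fst i..snd i} \<subseteq> W" by (auto simp: K_def)
    qed
  qed (use W(1) in auto)
  finally show ?thesis
    using T FE by (intro bexI[of _ ?T] conjI)
qed

lemma lipschitz_shrinks_lebesgue_measure:
  fixes F :: "real \<Rightarrow> real"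
  assumes "strict_mono F" "C-lipschitz_on UNIV F" "0 \<le> p"
    and "\<And>x d. x \<in> E \<Longrightarrow> d > 0 \<Longrightarrow>
      \<exists>u v. u < v \<and> u \<le> x \<and> x \<le> v \<and> v - u < d \<and> F v - F u \<le> p * (v - u)"
  shows "outer_measure_of lebesgue (F ` E) \<le> ennreal p * outer_measure_of lebesgue E"
proof -
  obtain B where B: "B \<in> sets lebesgue" "E \<subseteq> B" "outer_measure_of lebesgue E = emeasure lebesgue B"
    using outer_measure_of_attain[of E lebesgue] by auto
  have "outer_measure_of lebesgue (F ` E) \<le> ennreal p * emeasure lebesgue B + ennreal e" if "e > 0" for e
  proof -
    (* the denominator p + 1 allows p = 0 *)
    have e': "e / (p + 1) > 0" using that assms(3) by simp
    obtain W where W: "open W" "B \<subseteq> W" "W - B \<in> lmeasurable"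
        "emeasure lebesgue (W - B) < ennreal (e / (p + 1))"
      using sets_lebesgue_outer_open[OF B(1) e'] by blast
    obtain T where T: "T \<in> sets lebesgue" "F ` E \<subseteq> T"
        "emeasure lebesgue T \<le> ennreal p * emeasure lebesgue W"
      using lipschitz_shrinks_lebesgue_cover[OF assms W(1) subset_trans[OF B(2) W(2)]] by auto
    have "outer_measure_of lebesgue (F ` E) \<le> emeasure lebesgue T"
      using T outer_measure_of_mono[of "F ` E" T lebesgue] by simp
    also have "\<dots> \<le> ennreal p * emeasure lebesgue W" by fact
    also have "emeasure lebesgue W \<le> emeasure lebesgue B + emeasure lebesgue (W - B)"
      using emeasure_subadditive[of B lebesgue "W - B"] B W by (simp add: Un_absorb1 fmeasurableD)
    also have "\<dots> \<le> emeasure lebesgue B + ennreal (e / (p + 1))"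
      using W(4) by (intro add_left_mono) simp
    also have "ennreal p * (emeasure lebesgue B + ennreal (e / (p + 1))) =
        ennreal p * emeasure lebesgue B + ennreal (p * (e / (p + 1)))"
      using assms(3) that by (simp add: distrib_left flip: ennreal_mult)
    also have "p * (e / (p + 1)) \<le> e"
      using assms(3) that by (simp add: divide_simps)
    finally show ?thesis by (simp add: mult_left_mono add_left_mono ennreal_leI)
  qed
  then show ?thesis
    unfolding B(3) by (rule ennreal_le_epsilon)
qed

text \<open>Lebesgue's argument. Suppose that the slopes at all points of \<open>E\<close> oscillate across the
  gap between \<open>p\<close> and \<open>q\<close>. Then the increasing function \<open>F\<close> shrinks \<open>E\<close> by the factor \<open>p\<close>, its inverse
  shrinks the image of \<open>E\<close> by \<open>1 / q\<close>, and so the outer measure of \<open>E\<close> is at most \<open>p / q < 1\<close>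
  times itself.\<close>

lemma lipschitz_real_differentiable_AE:
  fixes g :: "real \<Rightarrow> real"
  assumes g: "C-lipschitz_on UNIV g"
  shows "AE x in lebesgue. \<exists>l. ((\<lambda>h. (g (x + h) - g x) / h) \<longlongrightarrow> l) (at 0)"
proof -
  have C: "C \<ge> 0" using g by (rule lipschitz_on_nonneg)
  have gC: "\<bar>g x - g y\<bar> \<le> C * \<bar>x - y\<bar>" for x y
    using g by (auto simp: lipschitz_on_def dist_real_def)
  (* adding a steep linear function makes g bi-Lipschitz and increasing *)
  define F where "F x = g x + (C + 1) * x" for x
  have F1: "v - u \<le> F v - F u" if "u \<le> v" for u v
    using gC[of v u] that by (auto simp: F_def algebra_simps abs_le_iff)
  have F2: "F v - F u \<le> (2 * C + 1) * (v - u)" if "u \<le> v" for u v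
    using gC[of v u] that by (auto simp: F_def algebra_simps abs_le_iff)
  have Fmono: "strict_mono F"
  proof (rule strict_monoI)
    fix x y :: real assume "x < y"
    then show "F x < F y" using F1[of x y] by linarith
  qed
  have FL: "(2 * C + 1)-lipschitz_on UNIV F"
  proof (rule lipschitz_onI)
    fix x y show "dist (F x) (F y) \<le> (2 * C + 1) * dist x y"
      using F1[of x y] F1[of y x] F2[of x y] F2[of y x] by (cases "x \<le> y") (auto simp: dist_real_def)
  qed (use C in auto)
  have contF: "continuous_on UNIV F"
    using FL by (rule lipschitz_on_continuous_on)
  have surj: "\<exists>x. F x = z" for z
  proof -
    define R where "R = \<bar>z - F 0\<bar>"
    have "F (- R) \<le> z" "z \<le> F R"
      using F1[of "-R" 0] F1[of 0 R] by (auto simp: R_def)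
    then show ?thesis
      using IVT'[of F "- R" z R] continuous_on_subset[OF contF, of "{-R..R}"] by (auto simp: R_def)
  qed
  define G where "G = inv F"
  have inj: "inj F" using Fmono by (simp add: strict_mono_imp_inj_on)
  have FG: "F (G z) = z" for z unfolding G_def using surj by (metis f_inv_into_f rangeI)
  have GF: "G (F x) = x" for x unfolding G_def using inj by simp
  have Gmono: "strict_mono G"
  proof (rule strict_monoI)
    fix x y :: real assume "x < y"
    then have "F (G x) < F (G y)" by (simp add: FG)
    then show "G x < G y" using Fmono by (simp add: strict_mono_less)
  qed
  have GL: "1-lipschitz_on UNIV G"
  proof (rule lipschitz_onI)
    fix x y show "dist (G x) (G y) \<le> 1 * dist x y"
    proof (induction x y rule: linorder_wlog)
      case (le x y)
      then have "G x \<le> G y" using Gmono by (simp add: strict_mono_less_eq)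
      then show ?case using F1[of "G x" "G y"] le by (simp add: FG dist_real_def)
    qed (simp add: dist_commute)
  qed auto
  define s where "s x h = (F (x + h) - F x) / h" for x h :: real
  have s_bd: "0 \<le> s x h \<and> s x h \<le> 2 * C + 1" if "h \<noteq> 0" for x h
  proof (cases "h > 0")
    case True
    then have "h \<le> F (x + h) - F x" "F (x + h) - F x \<le> (2 * C + 1) * h"
      using F1[of x "x + h"] F2[of x "x + h"] by simp_all
    then show ?thesis
      using True by (simp add: s_def pos_divide_le_eq)
  next
    case False
    then have h: "h < 0" using that by simp
    then have "- h \<le> F x - F (x + h)" "F x - F (x + h) \<le> (2 * C + 1) * (- h)"
      using F1[of "x + h" x] F2[of "x + h" x] by simp_all
    then show ?thesis
      using h by (simp add: s_def neg_divide_le_eq zero_le_divide_iff)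
  qed
  (* the points at which the slopes oscillate across the gap between p and q *)
  define E where "E p q n = {x \<in> {- real n..real n}.
      (\<exists>\<^sub>F h in at 0. s x h < p) \<and> (\<exists>\<^sub>F h in at 0. s x h > q)}" for p q :: real and n :: nat
  have freq: "\<exists>u v. u < v \<and> u \<le> x \<and> x \<le> v \<and> v - u < d \<and> P ((F v - F u) / (v - u))"
    if "\<exists>\<^sub>F h in at 0. P (s x h)" and d: "d > 0" for x d P
  proof -
    have "\<forall>\<^sub>F h in at 0. h \<noteq> 0 \<and> \<bar>h\<bar> < d"
      using d by (auto simp: eventually_at dist_real_def)
    with that(1) have "\<exists>\<^sub>F h in at 0. P (s x h) \<and> h \<noteq> 0 \<and> \<bar>h\<bar> < d"
      by (rule frequently_eventually_frequently)
    then obtain h where h: "P (s x h)" "h \<noteq> 0" "\<bar>h\<bar> < d"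
      by (auto dest: frequently_ex)
    show ?thesis
    proof (cases "h > 0")
      case True then show ?thesis using h
        by (intro exI[of _ x] exI[of _ "x+h"]) (auto simp: s_def)
    next
      case False
      have "(F x - F (x + h)) / (x - (x + h)) = s x h"
        by (simp add: s_def minus_divide_left[symmetric] divide_simps)
      then show ?thesis using h False
        by (intro exI[of _ "x+h"] exI[of _ x]) auto
    qed
  qed
  have null: "E p q n \<in> null_sets lebesgue" if pq: "0 \<le> p" "p < q" for p q n
  proof -
    let ?E = "E p q n" let ?m = "outer_measure_of lebesgue ?E"
    have 1: "outer_measure_of lebesgue (F ` ?E) \<le> ennreal p * ?m"
    proof (rule lipschitz_shrinks_lebesgue_measure[OF Fmono FL pq(1)])
      fix x d :: real assume "x \<in> ?E" "d > 0"
      then have "\<exists>u v. u < v \<and> u \<le> x \<and> x \<le> v \<and> v - u < d \<and> (F v - F u) / (v - u) < p"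
        by (intro freq[of "\<lambda>s. s < p"]) (simp_all add: E_def)
      then obtain u v where uv: "u < v" "u \<le> x" "x \<le> v" "v - u < d" "(F v - F u) / (v - u) < p"
        by blast
      then have "F v - F u \<le> p * (v - u)"
        by (simp add: pos_divide_less_eq)
      then show "\<exists>u v. u < v \<and> u \<le> x \<and> x \<le> v \<and> v - u < d \<and> F v - F u \<le> p * (v - u)"
        using uv by blast
    qed
    have "outer_measure_of lebesgue (G ` (F ` ?E)) \<le> ennreal (1 / q) * outer_measure_of lebesgue (F ` ?E)"
    proof (rule lipschitz_shrinks_lebesgue_measure[OF Gmono GL])
      fix z d :: real assume z: "z \<in> F ` ?E" and d: "d > 0"
      then obtain x where x: "x \<in> ?E" "z = F x" by auto
      have d': "d / (2 * C + 1) > 0" using d C by simp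
      have "\<exists>u v. u < v \<and> u \<le> x \<and> x \<le> v \<and> v - u < d / (2 * C + 1) \<and> q < (F v - F u) / (v - u)"
        using x by (intro freq[of "\<lambda>s. q < s", OF _ d']) (simp add: E_def)
      then obtain u v where uv: "u < v" "u \<le> x" "x \<le> v" "v - u < d / (2 * C + 1)"
          "q < (F v - F u) / (v - u)"
        by blast
      have "F v - F u \<le> (2 * C + 1) * (v - u)"
        using F2[of u v] uv by simp
      also have "\<dots> < d"
        using uv(4) C by (simp add: pos_less_divide_eq mult.commute)
      finally have "F v - F u < d" .
      moreover have "q * (v - u) \<le> F v - F u"
        using uv by (simp add: pos_less_divide_eq)
      then have "G (F v) - G (F u) \<le> (1/q) * (F v - F u)"
        using pq by (simp add: GF pos_le_divide_eq mult.commute)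
      moreover have "F u < F v" "F u \<le> z" "z \<le> F v"
        using uv Fmono x by (simp_all add: strict_mono_less strict_mono_less_eq)
      ultimately show "\<exists>u v. u < v \<and> u \<le> z \<and> z \<le> v \<and> v - u < d \<and> G v - G u \<le> (1/q) * (v - u)"
        by blast
    qed (use pq in auto)
    also have "G ` (F ` ?E) = ?E" by (auto simp: GF image_image)
    also have "ennreal (1 / q) * outer_measure_of lebesgue (F ` ?E) \<le> ennreal (1 / q) * (ennreal p * ?m)"
      using 1 by (rule mult_left_mono) simp
    also have "\<dots> = ennreal (p / q) * ?m"
      using pq by (simp flip: ennreal_mult mult.assoc)
    finally have m: "?m \<le> ennreal (p / q) * ?m" .
    have "?m \<le> outer_measure_of lebesgue {- real n..real n}"
      by (rule outer_measure_of_mono) (auto simp: E_def)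
    then have "?m < \<infinity>" by (simp add: order.strict_trans1)
    then obtain t where t: "?m = ennreal t" "t \<ge> 0" by (cases ?m) auto
    have "t \<le> (p / q) * t"
      using m t pq by (simp add: ennreal_mult[symmetric])
    then have "t \<le> 0"
      using pq by (simp add: field_simps) (metis less_eq_real_def linorder_not_less mult_strict_right_mono t(2))
    then have "?m = 0" using t by simp
    then obtain B where "B \<in> sets lebesgue" "?E \<subseteq> B" "emeasure lebesgue B = 0"
      using outer_measure_of_attain[of ?E lebesgue] by auto
    then show ?thesis
      by (meson null_setsI null_sets_completion_subset)
  qed
  have ex: "\<exists>l. ((\<lambda>h. s x h) \<longlongrightarrow> l) (at 0)"
    if x: "\<And>p q n. p \<in> \<rat> \<Longrightarrow> q \<in> \<rat> \<Longrightarrow> 0 \<le> p \<Longrightarrow> p < q \<Longrightarrow> x \<notin> E p q n" for x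
  proof -
    let ?l = "Liminf (at 0) (\<lambda>h. ereal (s x h))" and ?u = "Limsup (at 0) (\<lambda>h. ereal (s x h))"
    have ne: "\<forall>\<^sub>F h in at (0::real). h \<noteq> 0" by (simp add: eventually_at_filter)
    have l0: "0 \<le> ?l"
      by (rule Liminf_bounded, rule eventually_mono[OF ne]) (use s_bd in auto)
    have u1: "?u \<le> ereal (2 * C + 1)"
      by (rule Limsup_bounded, rule eventually_mono[OF ne]) (use s_bd in auto)
    have lu: "?l \<le> ?u" by (rule Liminf_le_Limsup) simp
    have "\<not> ?l < ?u"
    proof
      assume "?l < ?u"
      then obtain p0 where p0: "?l < ereal p0" "ereal p0 < ?u"
        using ereal_dense2 by blast
      then obtain q0 where q0: "ereal p0 < ereal q0" "ereal q0 < ?u"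
        using ereal_dense2 by blast
      obtain p where p: "p \<in> \<rat>" "p0 < p" "p < (p0 + q0) / 2"
        using Rats_dense_in_real[of p0 "(p0+q0)/2"] q0 by auto
      obtain q where q: "q \<in> \<rat>" "(p0 + q0) / 2 < q" "q < q0"
        using Rats_dense_in_real[of "(p0+q0)/2" q0] q0 by auto
      have "0 < ereal p0" using l0 p0(1) by (rule order.strict_trans1)
      then have "0 < p0" by simp
      then have "0 \<le> p" "p < q" using p q by linarith+
      have A: "\<exists>\<^sub>F h in at 0. s x h < p"
      proof (rule ccontr)
        assume "\<not> (\<exists>\<^sub>F h in at 0. s x h < p)"
        then have "\<forall>\<^sub>F h in at 0. ereal p \<le> ereal (s x h)"
          by (simp add: not_frequently not_less)
        then have "ereal p \<le> ?l" by (rule Liminf_bounded)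
        with p0(1) have "ereal p < ereal p0" by (rule order.strict_trans1[rotated])
        then show False using p by simp
      qed
      have B: "\<exists>\<^sub>F h in at 0. s x h > q"
      proof (rule ccontr)
        assume "\<not> (\<exists>\<^sub>F h in at 0. s x h > q)"
        then have "\<forall>\<^sub>F h in at 0. ereal (s x h) \<le> ereal q"
          by (simp add: not_frequently not_less)
        then have "?u \<le> ereal q" by (rule Limsup_bounded)
        with q0(2) have "ereal q0 < ereal q" by (rule order.strict_trans2)
        then show False using q by simp
      qed
      obtain n where "\<bar>x\<bar> \<le> real n" using real_arch_simple by blast
      then have "x \<in> E p q n" using A B by (simp add: E_def abs_le_iff)
      then show False using x[OF p(1) q(1) \<open>0 \<le> p\<close> \<open>p < q\<close>] by blast
    qed
    then have eq: "?l = ?u" using lu by simp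
    moreover have "?l \<noteq> \<infinity>" "?l \<noteq> -\<infinity>" using l0 u1 eq by auto
    ultimately obtain r where r: "?l = ereal r" "?u = ereal r" by (cases ?u) auto
    have "((\<lambda>h. ereal (s x h)) \<longlongrightarrow> ereal r) (at 0)"
      by (rule Liminf_eq_Limsup[OF _ r]) simp
    then show ?thesis by auto
  qed
  have "AE x in lebesgue. \<forall>p\<in>\<rat>. \<forall>q\<in>\<rat>. \<forall>n. 0 \<le> p \<longrightarrow> p < q \<longrightarrow> x \<notin> E p q n"
    using null by (auto simp: AE_ball_countable AE_all_countable countable_rat intro!: AE_not_in)
  then show ?thesis
  proof (rule AE_mp, intro AE_I2 impI)
    fix x assume "\<forall>p\<in>\<rat>. \<forall>q\<in>\<rat>. \<forall>n. 0 \<le> p \<longrightarrow> p < q \<longrightarrow> x \<notin> E p q n"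
    then obtain l where l: "((\<lambda>h. s x h) \<longlongrightarrow> l) (at 0)" using ex by blast
    have "((\<lambda>h. s x h - (C + 1)) \<longlongrightarrow> l - (C + 1)) (at 0)"
      by (intro tendsto_intros l)
    moreover have "\<forall>\<^sub>F h in at 0. s x h - (C + 1) = (g (x + h) - g x) / h"
      unfolding eventually_at_filter by (auto simp: s_def F_def field_simps)
    ultimately have "((\<lambda>h. (g (x + h) - g x) / h) \<longlongrightarrow> l - (C + 1)) (at 0)"
      by (rule Lim_transform_eventually)
    then show "\<exists>l. ((\<lambda>h. (g (x + h) - g x) / h) \<longlongrightarrow> l) (at 0)" by blast
  qed
qed

section \<open>Rademacher's theorem\<close>

lemma lborel_integral_translate:
  fixes g :: "'a::euclidean_space \<Rightarrow> real"
  assumes [measurable]: "g \<in> borel_measurable borel"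
  shows "(\<integral>x. g (c + x) \<partial>lborel) = (\<integral>x. g x \<partial>lborel)"
proof -
  have "(\<integral>x. g x \<partial>lborel) = (\<integral>x. g x \<partial>distr lborel borel ((+) c))"
    by (simp add: lborel_distr_plus)
  also have "\<dots> = (\<integral>x. g (c + x) \<partial>lborel)"
    by (rule integral_distr) auto
  finally show ?thesis ..
qed

lemma dominated_convergence:
  fixes s :: "nat \<Rightarrow> 'a \<Rightarrow> real"
  assumes "f \<in> borel_measurable M" "\<And>i. s i \<in> borel_measurable M" "integrable M w"
    and "AE x in M. (\<lambda>i. s i x) \<longlonglongrightarrow> f x" and "\<And>i. AE x in M. \<bar>s i x\<bar> \<le> w x"
  shows "integrable M f \<and> (\<lambda>i. \<integral>x. s i x \<partial>M) \<longlonglongrightarrow> (\<integral>x. f x \<partial>M)"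
  using integrable_dominated_convergence[of f M s w] integral_dominated_convergence[of f M s w] assms
  by simp

lemma bounded_support_imp_bounded_fun:
  fixes \<psi> :: "'a::euclidean_space \<Rightarrow> real"
  assumes "continuous_on UNIV \<psi>" "bounded {x. \<psi> x \<noteq> 0}"
  obtains B R where "0 \<le> B" "0 \<le> R" "\<And>x. \<bar>\<psi> x\<bar> \<le> B * indicator (cball 0 R) x"
proof -
  obtain R where R: "\<And>x. \<psi> x \<noteq> 0 \<Longrightarrow> norm x \<le> R"
    using assms(2) by (auto simp: bounded_iff)
  have "compact (\<psi> ` cball 0 (max R 0))"
    by (intro compact_continuous_image continuous_on_subset[OF assms(1)]) auto
  then obtain B where B: "\<And>x. norm x \<le> max R 0 \<Longrightarrow> \<bar>\<psi> x\<bar> \<le> B"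
    using compact_imp_bounded by (force simp: bounded_iff)
  have "0 \<le> B" using B[of 0] by simp
  moreover have "\<bar>\<psi> x\<bar> \<le> B * indicator (cball 0 (max R 0)) x" for x
    using B[of x] R[of x] by (cases "\<psi> x = 0") (auto simp: indicator_def \<open>0 \<le> B\<close>)
  ultimately show ?thesis using that[of B "max R 0"] by simp
qed

text \<open>A measurable function is an almost everywhere limit of continuous functions, which after
  truncation and multiplication by a cut-off are admissible for \<open>test\<close>. In the limit \<open>g\<close> is tested
  against itself.\<close>

lemma AE_zero_if_orthogonal_to_continuous:
  fixes g :: "'a::euclidean_space \<Rightarrow> real"
  assumes g[measurable]: "g \<in> borel_measurable borel" and M: "AE x in lborel. \<bar>g x\<bar> \<le> M"
    and test: "\<And>\<psi>. continuous_on UNIV \<psi> \<Longrightarrow> bounded {x. \<psi> x \<noteq> 0} \<Longrightarrow> (\<integral>x. \<psi> x * g x \<partial>lborel) = 0"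
  shows "AE x in lborel. g x = 0"
proof -
  have "g \<in> borel_measurable (lebesgue_on UNIV)" using g by (simp add: lebesgue_on_UNIV_eq measurable_completion)
  then have "g measurable_on UNIV"
    by (simp add: measurable_on_iff_borel_measurable)
  then obtain N h where N: "negligible N" and h: "\<And>n. continuous_on UNIV (h n)"
      and lim: "\<And>x. x \<notin> N \<Longrightarrow> (\<lambda>n. h n x) \<longlonglongrightarrow> g x"
    unfolding measurable_on_def by auto
  have hm[measurable]: "h n \<in> borel_measurable borel" for n
    using h by (rule borel_measurable_continuous_onI)
  have "AE x in lebesgue. x \<notin> N"
    using N by (intro AE_not_in) (simp add: negligible_iff_null_sets)
  then have AEN: "AE x in lborel. x \<notin> N" by (simp add: AE_completion_iff)
  have "AE x in lborel. max 0 (min 1 (real R - norm x)) * g x * g x = 0" for R :: nat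
  proof -
    define c where "c x = max 0 (min 1 (real R - norm x))" for x :: 'a
    have c: "0 \<le> c x" "c x \<le> indicator (cball 0 (real R)) x" for x
      by (auto simp: c_def indicator_def)
    define \<psi> where "\<psi> n x = c x * max (- \<bar>M\<bar>) (min \<bar>M\<bar> (h n x))" for n x
    have cont_c: "continuous_on UNIV c"
      unfolding c_def by (intro continuous_intros)
    then have [measurable]: "c \<in> borel_measurable borel"
      by (rule borel_measurable_continuous_onI)
    have cont: "continuous_on UNIV (\<psi> n)" for n
      unfolding \<psi>_def by (intro continuous_intros cont_c h)
    have [measurable]: "\<psi> n \<in> borel_measurable borel" for n
      using cont by (rule borel_measurable_continuous_onI)
    have "{x. \<psi> n x \<noteq> 0} \<subseteq> cball 0 (real R)" for n
      by (auto simp: \<psi>_def c_def)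
    then have "bounded {x. \<psi> n x \<noteq> 0}" for n
      using bounded_cball bounded_subset by blast
    then have zero: "(\<integral>x. \<psi> n x * g x \<partial>lborel) = 0" for n
      using test cont by blast
    have "integrable lborel (\<lambda>x. c x * g x * g x) \<and> (\<lambda>n. \<integral>x. \<psi> n x * g x \<partial>lborel) \<longlonglongrightarrow> (\<integral>x. c x * g x * g x \<partial>lborel)"
    proof (rule dominated_convergence)
      show "integrable lborel (\<lambda>x::'a. indicator (cball 0 (real R)) x * (\<bar>M\<bar> * \<bar>M\<bar>) :: real)"
        using emeasure_bounded_finite[OF bounded_cball[of "0::'a" "real R"]]
        by (intro integrable_mult_left integrable_real_indicator) auto
      show "AE x in lborel. (\<lambda>n. \<psi> n x * g x) \<longlonglongrightarrow> c x * g x * g x"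
        using M AEN
      proof eventually_elim
        case (elim x)
        have "(\<lambda>n. \<psi> n x * g x) \<longlonglongrightarrow> c x * max (- \<bar>M\<bar>) (min \<bar>M\<bar> (g x)) * g x"
          unfolding \<psi>_def by (intro tendsto_intros lim elim)
        moreover have "max (- \<bar>M\<bar>) (min \<bar>M\<bar> (g x)) = g x" using elim by auto
        ultimately show ?case by simp
      qed
      fix n
      show "AE x in lborel. \<bar>\<psi> n x * g x\<bar> \<le> indicator (cball 0 (real R)) x * (\<bar>M\<bar> * \<bar>M\<bar>)"
        using M
      proof eventually_elim
        case (elim x)
        have "\<bar>\<psi> n x * g x\<bar> = c x * (\<bar>max (- \<bar>M\<bar>) (min \<bar>M\<bar> (h n x))\<bar> * \<bar>g x\<bar>)"
          using c by (simp add: \<psi>_def abs_mult)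
        also have "\<dots> \<le> indicator (cball 0 (real R)) x * (\<bar>M\<bar> * \<bar>M\<bar>)"
          using c elim by (intro mult_mono) auto
        finally show ?case .
      qed
    qed measurable
    then have int: "integrable lborel (\<lambda>x. c x * g x * g x)" and "(\<integral>x. c x * g x * g x \<partial>lborel) = 0"
      using zero by (auto simp: LIMSEQ_const_iff)
    then have "AE x in lborel. c x * g x * g x = 0"
      using integral_nonneg_eq_0_iff_AE[OF int] c by (simp add: mult.assoc)
    then show ?thesis unfolding c_def .
  qed
  then have "AE x in lborel. \<forall>R::nat. max 0 (min 1 (real R - norm x)) * g x * g x = 0"
    unfolding AE_all_countable ..
  then show ?thesis
  proof eventually_elim
    case (elim x)
    obtain R :: nat where "norm x < real R" using reals_Archimedean2 by blast
    then have "max 0 (min 1 (real R - norm x)) \<noteq> 0" by simp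
    then show ?case using elim by (metis mult_eq_0_iff)
  qed
qed

text \<open>Cauchy's criterion over rational increments exhibits the existence of a directional derivative
  as a condition with countably many quantifiers, hence as a Borel condition.\<close>

lemma ex_limit_at_0_iff_rat:
  fixes q :: "real \<Rightarrow> real"
  assumes cont: "\<And>t. t \<noteq> 0 \<Longrightarrow> isCont q t"
  shows "(\<exists>l. (q \<longlongrightarrow> l) (at 0)) \<longleftrightarrow>
    (\<forall>n::nat. \<exists>k::nat. \<forall>s t::rat. s \<noteq> 0 \<longrightarrow> t \<noteq> 0 \<longrightarrow> \<bar>of_rat s\<bar> < 1 / real (Suc k) \<longrightarrow>
       \<bar>of_rat t\<bar> < 1 / real (Suc k) \<longrightarrow> \<bar>q (of_rat s) - q (of_rat t)\<bar> \<le> 1 / real (Suc n))"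
    (is "?L \<longleftrightarrow> ?R")
proof
  assume ?L
  then obtain l where l: "(q \<longlongrightarrow> l) (at 0)" by blast
  show ?R
  proof
    fix n :: nat
    have "1 / real (2 * Suc n) > 0" by simp
    then obtain d where d: "d > 0" "\<And>t. t \<noteq> 0 \<Longrightarrow> \<bar>t\<bar> < d \<Longrightarrow> \<bar>q t - l\<bar> < 1 / real (2 * Suc n)"
      using LIM_D[OF l, of "1 / real (2 * Suc n)"] by auto
    obtain k where k: "1 / real (Suc k) < d" using d(1) nat_approx_posE by blast
    have "\<bar>q s - q t\<bar> \<le> 1 / real (Suc n)"
      if "s \<noteq> 0" "t \<noteq> 0" "\<bar>s\<bar> < 1 / real (Suc k)" "\<bar>t\<bar> < 1 / real (Suc k)" for s t
    proof -
      have "\<bar>q s - q t\<bar> \<le> \<bar>q s - l\<bar> + \<bar>q t - l\<bar>" by linarith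
      also have "\<dots> \<le> 1 / real (2 * Suc n) + 1 / real (2 * Suc n)"
        using d(2)[of s] d(2)[of t] that k by (intro add_mono) auto
      finally show ?thesis by (simp add: field_simps)
    qed
    then show "\<exists>k::nat. \<forall>s t::rat. s \<noteq> 0 \<longrightarrow> t \<noteq> 0 \<longrightarrow> \<bar>of_rat s\<bar> < 1 / real (Suc k) \<longrightarrow>
       \<bar>of_rat t\<bar> < 1 / real (Suc k) \<longrightarrow> \<bar>q (of_rat s) - q (of_rat t)\<bar> \<le> 1 / real (Suc n)"
      by (intro exI[of _ k]) auto
  qed
next
  assume R: ?R
  have R': "\<exists>d>0. \<forall>s t. s \<noteq> 0 \<longrightarrow> t \<noteq> 0 \<longrightarrow> \<bar>s\<bar> < d \<longrightarrow> \<bar>t\<bar> < d \<longrightarrow> \<bar>q s - q t\<bar> \<le> e"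
    if e: "e > 0" for e
  proof -
    obtain n where n: "1 / real (Suc n) < e" using e nat_approx_posE by blast
    obtain k where k: "\<And>s t::rat. s \<noteq> 0 \<Longrightarrow> t \<noteq> 0 \<Longrightarrow> \<bar>of_rat s\<bar> < 1 / real (Suc k) \<Longrightarrow>
       \<bar>of_rat t\<bar> < 1 / real (Suc k) \<Longrightarrow> \<bar>q (of_rat s) - q (of_rat t)\<bar> \<le> 1 / real (Suc n)"
      using R by blast
    define d where "d = 1 / real (Suc k)"
    have approx: "\<exists>r::rat. r \<noteq> 0 \<and> \<bar>of_rat r\<bar> < d \<and> \<bar>q (of_rat r) - q s\<bar> < \<epsilon>"
      if s: "s \<noteq> 0" "\<bar>s\<bar> < d" and eps: "\<epsilon> > 0" for s \<epsilon>
    proof -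
      obtain \<delta> where \<delta>: "\<delta> > 0" "\<And>t. \<bar>t - s\<bar> < \<delta> \<Longrightarrow> \<bar>q t - q s\<bar> < \<epsilon>"
        using cont[OF s(1)] eps unfolding isCont_def LIM_eq by (metis diff_self abs_zero real_norm_def)
      let ?m = "min \<delta> (min \<bar>s\<bar> (d - \<bar>s\<bar>))"
      have "s < s + ?m" using \<delta> s by simp
      then obtain r :: rat where r: "s < of_rat r" "of_rat r < s + ?m"
        using of_rat_dense by blast
      then have r': "\<bar>of_rat r - s\<bar> < \<delta>" "\<bar>of_rat r - s\<bar> < \<bar>s\<bar>" "\<bar>of_rat r - s\<bar> < d - \<bar>s\<bar>"
        by auto
      then have "r \<noteq> 0" by auto
      moreover have "\<bar>of_rat r\<bar> < d" using r' by linarith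
      ultimately show ?thesis using \<delta>(2)[OF r'(1)] by blast
    qed
    have "\<bar>q s - q t\<bar> \<le> e" if st: "s \<noteq> 0" "t \<noteq> 0" "\<bar>s\<bar> < d" "\<bar>t\<bar> < d" for s t
    proof -
      have *: "(e - 1 / real (Suc n)) / 2 > 0" using n by simp
      obtain r1 :: rat where r1: "r1 \<noteq> 0" "\<bar>of_rat r1\<bar> < d" "\<bar>q (of_rat r1) - q s\<bar> < (e - 1 / real (Suc n)) / 2"
        using approx[OF st(1,3) *] by blast
      obtain r2 :: rat where r2: "r2 \<noteq> 0" "\<bar>of_rat r2\<bar> < d" "\<bar>q (of_rat r2) - q t\<bar> < (e - 1 / real (Suc n)) / 2"
        using approx[OF st(2,4) *] by blast
      have "\<bar>q (of_rat r1) - q (of_rat r2)\<bar> \<le> 1 / real (Suc n)"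
        using k[of r1 r2] r1 r2 by (simp add: d_def)
      then show ?thesis using r1(3) r2(3) by argo
    qed
    then show ?thesis by (intro exI[of _ d]) (auto simp: d_def)
  qed
  define \<tau> where "\<tau> n = 1 / real (Suc n)" for n
  have \<tau>: "\<tau> n \<noteq> 0" "\<tau> \<longlonglongrightarrow> 0" for n
    using LIMSEQ_inverse_real_of_nat by (simp_all add: \<tau>_def[abs_def] inverse_eq_divide)
  have ev: "\<forall>\<^sub>F n in sequentially. \<bar>\<tau> n\<bar> < d" if "d > 0" for d
    using order_tendstoD(2)[OF tendsto_rabs_zero[OF \<tau>(2)] that] .
  have "Cauchy (\<lambda>n. q (\<tau> n))"
  proof (rule metric_CauchyI)
    fix e :: real assume "e > 0"
    then obtain d where d: "d > 0" "\<And>s t. s \<noteq> 0 \<Longrightarrow> t \<noteq> 0 \<Longrightarrow> \<bar>s\<bar> < d \<Longrightarrow> \<bar>t\<bar> < d \<Longrightarrow> \<bar>q s - q t\<bar> \<le> e / 2"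
      using R'[of "e / 2"] by auto
    obtain M where M: "\<And>n. n \<ge> M \<Longrightarrow> \<bar>\<tau> n\<bar> < d"
      using ev[OF d(1)] by (auto simp: eventually_sequentially)
    have "dist (q (\<tau> m)) (q (\<tau> n)) < e" if "m \<ge> M" "n \<ge> M" for m n
    proof -
      have "\<bar>q (\<tau> m) - q (\<tau> n)\<bar> \<le> e / 2"
        by (rule d(2)[OF \<tau>(1) \<tau>(1) M[OF that(1)] M[OF that(2)]])
      then show ?thesis using \<open>e > 0\<close> by (simp add: dist_real_def)
    qed
    then show "\<exists>M. \<forall>m\<ge>M. \<forall>n\<ge>M. dist (q (\<tau> m)) (q (\<tau> n)) < e" by blast
  qed
  then obtain l where l: "(\<lambda>n. q (\<tau> n)) \<longlonglongrightarrow> l" by (auto simp: Cauchy_convergent_iff convergent_def)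
  have "(q \<longlongrightarrow> l) (at 0)"
  proof (rule LIM_I)
    fix e :: real assume "e > 0"
    then obtain d where d: "d > 0" "\<And>s t. s \<noteq> 0 \<Longrightarrow> t \<noteq> 0 \<Longrightarrow> \<bar>s\<bar> < d \<Longrightarrow> \<bar>t\<bar> < d \<Longrightarrow> \<bar>q s - q t\<bar> \<le> e / 2"
      using R'[of "e / 2"] by auto
    have "norm (q t - l) < e" if t: "t \<noteq> 0" "\<bar>t\<bar> < d" for t
    proof -
      have "(\<lambda>n. \<bar>q t - q (\<tau> n)\<bar>) \<longlonglongrightarrow> \<bar>q t - l\<bar>" by (intro tendsto_intros l)
      moreover have "\<forall>\<^sub>F n in sequentially. \<bar>q t - q (\<tau> n)\<bar> \<le> e / 2"
        using ev[OF d(1)]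
      proof eventually_elim
        case (elim n)
        then show ?case using d(2)[OF t(1) \<tau>(1) t(2)] by blast
      qed
      ultimately have "\<bar>q t - l\<bar> \<le> e / 2"
        by (rule tendsto_upperbound) simp
      then show ?thesis using \<open>e > 0\<close> by simp
    qed
    then show "\<exists>r>0. \<forall>x. x \<noteq> 0 \<and> norm (x - 0) < r \<longrightarrow> norm (q x - l) < e"
      using d(1) by (intro exI[of _ d]) auto
  qed
  then show ?L by blast
qed

text \<open>The derivative along \<open>v\<close> is defined by a sequential limit so that it is a Borel function of the
  point in any case; where the directional derivative exists, it is its value.\<close>

definition ddir :: "('a::real_normed_vector \<Rightarrow> real) \<Rightarrow> 'a \<Rightarrow> 'a \<Rightarrow> real" where
  "ddir f v x = lim (\<lambda>n. (f (x + (1 / real (Suc n)) *\<^sub>R v) - f x) / (1 / real (Suc n)))"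

definition has_ddir :: "('a::real_normed_vector \<Rightarrow> real) \<Rightarrow> 'a \<Rightarrow> 'a \<Rightarrow> real \<Rightarrow> bool" where
  "has_ddir f v x l \<longleftrightarrow> ((\<lambda>t. (f (x + t *\<^sub>R v) - f x) / t) \<longlongrightarrow> l) (at 0)"

lemma inverse_Suc_at_0: "filterlim (\<lambda>n. 1 / real (Suc n)) (at 0) sequentially"
  using LIMSEQ_inverse_real_of_nat
  by (auto simp: filterlim_at inverse_eq_divide)

lemma has_ddir_LIMSEQ:
  assumes "has_ddir f v x l"
  shows "(\<lambda>n. (f (x + (1 / real (Suc n)) *\<^sub>R v) - f x) / (1 / real (Suc n))) \<longlonglongrightarrow> l"
  using assms unfolding has_ddir_def by (rule filterlim_compose[OF _ inverse_Suc_at_0])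

lemma has_ddir_imp_ddir: "has_ddir f v x l \<Longrightarrow> ddir f v x = l"
  unfolding ddir_def by (intro limI has_ddir_LIMSEQ)

text \<open>On every line parallel to \<open>v\<close> the exceptional set \<open>N\<close> is null by the one-dimensional
  theorem. Integrating over \<open>x\<close> and over the translations \<open>x + t *\<^sub>R v\<close> with \<open>0 \<le> t \<le> 1\<close> in both orders
  yields the measure of \<open>N\<close> itself, so coordinates adapted to \<open>v\<close> are avoided.\<close>

lemma AE_has_ddir:
  fixes f :: "'a::euclidean_space \<Rightarrow> real"
  assumes f: "C-lipschitz_on UNIV f"
  shows "AE x in lborel. has_ddir f v x (ddir f v x)"
proof -
  have contf: "continuous_on UNIV f" using f by (rule lipschitz_on_continuous_on)
  then have isc: "isCont f x" for x by (simp add: continuous_on_eq_continuous_at)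
  have [measurable]: "f \<in> borel_measurable borel" using contf by (rule borel_measurable_continuous_onI)
  define N where "N = {x. \<not> (\<exists>l. has_ddir f v x l)}"
  define P where "P x \<longleftrightarrow> (\<forall>n::nat. \<exists>k::nat. \<forall>s t::rat. s \<noteq> 0 \<longrightarrow> t \<noteq> 0 \<longrightarrow> \<bar>of_rat s\<bar> < 1 / real (Suc k) \<longrightarrow>
       \<bar>of_rat t\<bar> < 1 / real (Suc k) \<longrightarrow>
       \<bar>(f (x + of_rat s *\<^sub>R v) - f x) / of_rat s - (f (x + of_rat t *\<^sub>R v) - f x) / of_rat t\<bar> \<le> 1 / real (Suc n))" for x
  have P: "(\<exists>l. has_ddir f v x l) \<longleftrightarrow> P x" for x
    unfolding has_ddir_def P_def
    by (rule ex_limit_at_0_iff_rat) (intro continuous_intros isCont_o2[OF _ isc], auto)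
  have [measurable]: "Measurable.pred borel P"
    unfolding P_def by measurable
  have N: "N \<in> sets borel" unfolding N_def P by simp
  note N[measurable]
  have inner: "(\<integral>\<^sup>+t. indicator N (x + t *\<^sub>R v) * indicator {0..1} t \<partial>lborel) = 0" for x
  proof -
    have "(C * norm v)-lipschitz_on UNIV (\<lambda>t. f (x + t *\<^sub>R v))"
    proof (rule lipschitz_onI)
      fix s t :: real
      have "dist (f (x + s *\<^sub>R v)) (f (x + t *\<^sub>R v)) \<le> C * dist (x + s *\<^sub>R v) (x + t *\<^sub>R v)"
        using f unfolding lipschitz_on_def by blast
      also have "dist (x + s *\<^sub>R v) (x + t *\<^sub>R v) = dist s t * norm v"
        by (simp add: dist_norm flip: scaleR_diff_left)
      finally show "dist (f (x + s *\<^sub>R v)) (f (x + t *\<^sub>R v)) \<le> C * norm v * dist s t"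
        by (simp add: mult_ac)
    qed (use lipschitz_on_nonneg[OF f] in auto)
    from lipschitz_real_differentiable_AE[OF this]
    have "AE t in lborel. \<exists>l. ((\<lambda>h. (f (x + (t + h) *\<^sub>R v) - f (x + t *\<^sub>R v)) / h) \<longlongrightarrow> l) (at 0)"
      by (simp add: AE_completion_iff)
    then have "AE t in lborel. x + t *\<^sub>R v \<notin> N"
      by (rule AE_mp) (auto simp: N_def has_ddir_def scaleR_add_left add.assoc)
    then have "AE t in lborel. indicator N (x + t *\<^sub>R v) * indicator {0..1} t = (0::ennreal)"
      by (rule AE_mp) auto
    then show ?thesis by (subst nn_integral_0_iff_AE) auto
  qed
  have "0 = (\<integral>\<^sup>+x. \<integral>\<^sup>+t. indicator N (x + t *\<^sub>R v) * indicator {0..1} t \<partial>lborel \<partial>lborel)"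
    unfolding inner by simp
  also have "\<dots> = (\<integral>\<^sup>+t. \<integral>\<^sup>+x. indicator N (x + t *\<^sub>R v) * indicator {0..1} t \<partial>lborel \<partial>lborel)"
    by (rule lborel_pair.Fubini'[symmetric]) measurable
  also have "\<dots> = (\<integral>\<^sup>+t. emeasure lborel N * indicator {0..1::real} t \<partial>lborel)"
  proof (rule nn_integral_cong, goal_cases)
    case (1 t)
    have "(\<integral>\<^sup>+x. indicator N (x + t *\<^sub>R v) * indicator {0..1} t \<partial>lborel) =
        (\<integral>\<^sup>+x. indicator N (t *\<^sub>R v + x) \<partial>lborel) * indicator {0..1} t"
      by (subst nn_integral_multc) (auto simp: add.commute)
    also have "(\<integral>\<^sup>+x. indicator N (t *\<^sub>R v + x) \<partial>lborel) = (\<integral>\<^sup>+x. indicator N x \<partial>distr lborel borel ((+) (t *\<^sub>R v)))"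
      by (subst nn_integral_distr) auto
    also have "\<dots> = emeasure lborel N" by (simp add: lborel_distr_plus)
    finally show ?case .
  qed
  also have "\<dots> = emeasure lborel N" by (subst nn_integral_cmult_indicator) auto
  finally have "N \<in> null_sets lborel" using N by auto
  then have "AE x in lborel. x \<notin> N" by (rule AE_not_in)
  then show ?thesis
    by (rule AE_mp) (auto simp: N_def has_ddir_imp_ddir)
qed

lemma ddir_measurable[measurable]:
  fixes f :: "'a::euclidean_space \<Rightarrow> real"
  assumes "continuous_on UNIV f"
  shows "ddir f v \<in> borel_measurable borel"
proof -
  have [measurable]: "f \<in> borel_measurable borel" using assms by (rule borel_measurable_continuous_onI)
  show ?thesis unfolding ddir_def[abs_def] by measurable
qed

lemma has_ddir_bound:
  fixes f :: "'a::euclidean_space \<Rightarrow> real"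
  assumes f: "C-lipschitz_on UNIV f" and "has_ddir f v x l"
  shows "\<bar>l\<bar> \<le> C * norm v"
proof -
  have "norm ((f (x + t *\<^sub>R v) - f x) / t) \<le> C * norm v" if "t \<noteq> 0" for t
    using lipschitz_onD[OF f, of "x + t *\<^sub>R v" x] that
    by (simp add: dist_norm field_simps)
  then have "norm l \<le> C * norm v"
    using assms(2) unfolding has_ddir_def
    by (intro Lim_norm_ubound[of "at (0::real)"]) (auto simp: eventually_at_filter)
  then show ?thesis by simp
qed

text \<open>The quotient for \<open>u + v\<close> minus that for \<open>u\<close> is the quotient for \<open>v\<close>, taken at the shifted point
  \<open>x + t *\<^sub>R u\<close>. Integrated against a continuous function of compact support, the shift can be moved
  to that function, where it disappears in the limit.\<close>

lemma AE_ddir_add: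
  fixes f :: "'a::euclidean_space \<Rightarrow> real"
  assumes f: "C-lipschitz_on UNIV f"
  shows "AE x in lborel. ddir f (u + v) x = ddir f u x + ddir f v x"
proof -
  have contf: "continuous_on UNIV f" using f by (rule lipschitz_on_continuous_on)
  have [measurable]: "f \<in> borel_measurable borel" using contf by (rule borel_measurable_continuous_onI)
  note [measurable] = ddir_measurable[OF contf]
  have C: "C \<ge> 0" using f by (rule lipschitz_on_nonneg)
  define \<tau> where "\<tau> n = 1 / real (Suc n)" for n
  have \<tau>: "\<tau> n > 0" "\<tau> n \<le> 1" "\<tau> \<longlonglongrightarrow> 0" for n
    using LIMSEQ_inverse_real_of_nat by (simp_all add: \<tau>_def[abs_def] inverse_eq_divide)
  have ae: "AE x in lborel. has_ddir f w x (ddir f w x)" for w using AE_has_ddir[OF f] .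
  have bd: "\<bar>(f (x + t *\<^sub>R w + t *\<^sub>R v) - f (x + t *\<^sub>R w)) / t\<bar> \<le> C * norm v" if "t > 0" for t x w
    using lipschitz_onD[OF f, of "x + t *\<^sub>R w + t *\<^sub>R v" "x + t *\<^sub>R w"] that
    by (simp add: dist_norm field_simps)
  define g where "g x = (ddir f (u + v) x - ddir f u x) - ddir f v x" for x
  have [measurable]: "g \<in> borel_measurable borel" unfolding g_def by measurable
  have "AE x in lborel. g x = 0"
  proof (rule AE_zero_if_orthogonal_to_continuous)
    show "AE x in lborel. \<bar>g x\<bar> \<le> C * norm (u + v) + C * norm u + C * norm v"
      using ae[of u] ae[of v] ae[of "u + v"]
    proof eventually_elim
      case (elim x)
      then show ?case using has_ddir_bound[OF f elim(1)] has_ddir_bound[OF f elim(2)] has_ddir_bound[OF f elim(3)]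
        unfolding g_def by linarith
    qed
    fix \<psi> :: "'a \<Rightarrow> real" assume \<psi>: "continuous_on UNIV \<psi>" "bounded {x. \<psi> x \<noteq> 0}"
    then have [measurable]: "\<psi> \<in> borel_measurable borel" by (intro borel_measurable_continuous_onI)
    obtain B R where BR: "0 \<le> B" "0 \<le> R" "\<And>x. \<bar>\<psi> x\<bar> \<le> B * indicator (cball 0 R) x"
      using bounded_support_imp_bounded_fun[OF \<psi>] by blast
    let ?w = "\<lambda>x::'a. indicator (cball 0 (R + norm u)) x * (B * (C * norm v)) :: real"
    have int: "integrable lborel ?w"
      using emeasure_bounded_finite[OF bounded_cball[of "0::'a" "R + norm u"]]
      by (intro integrable_mult_left integrable_real_indicator) auto
    let ?A = "\<lambda>n x. \<psi> x * ((f (x + \<tau> n *\<^sub>R u + \<tau> n *\<^sub>R v) - f (x + \<tau> n *\<^sub>R u)) / \<tau> n)"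
    let ?B = "\<lambda>n x. \<psi> (x - \<tau> n *\<^sub>R u) * ((f (x + \<tau> n *\<^sub>R v) - f x) / \<tau> n)"
    have limA: "AE x in lborel. (\<lambda>n. ?A n x) \<longlonglongrightarrow> \<psi> x * (ddir f (u + v) x - ddir f u x)"
      using ae[of "u + v"] ae[of u]
    proof eventually_elim
      case (elim x)
      have "(\<lambda>n. \<psi> x * ((f (x + \<tau> n *\<^sub>R (u + v)) - f x) / \<tau> n - (f (x + \<tau> n *\<^sub>R u) - f x) / \<tau> n))
          \<longlonglongrightarrow> \<psi> x * (ddir f (u + v) x - ddir f u x)"
        using has_ddir_LIMSEQ[OF elim(1)] has_ddir_LIMSEQ[OF elim(2)] unfolding \<tau>_def
        by (intro tendsto_intros)
      then show ?case
        by (simp add: scaleR_add_right add.assoc diff_divide_distrib[symmetric] del: times_divide_eq_right)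
    qed
    have domA: "norm (?A n x) \<le> ?w x" for n x
    proof -
      have "norm (?A n x) \<le> (B * indicator (cball 0 R) x) * (C * norm v)"
        unfolding real_norm_def abs_mult[of "\<psi> _"] using BR(3) bd[OF \<tau>(1)] BR(1) C
        by (intro mult_mono) auto
      also have "\<dots> \<le> ?w x"
      proof -
        have "cball 0 R \<subseteq> cball (0::'a) (R + norm u)" by (simp add: subset_cball)
        then show ?thesis
          using BR(1) C by (simp add: indicator_def subset_iff)
      qed
      finally show ?thesis .
    qed
    have limB: "AE x in lborel. (\<lambda>n. ?B n x) \<longlonglongrightarrow> \<psi> x * ddir f v x"
      using ae[of v]
    proof eventually_elim
      case (elim x)
      have "(\<lambda>n. x - \<tau> n *\<^sub>R u) \<longlonglongrightarrow> x - 0 *\<^sub>R u" by (intro tendsto_intros \<tau>)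
      then have "(\<lambda>n. \<psi> (x - \<tau> n *\<^sub>R u)) \<longlonglongrightarrow> \<psi> x"
        using \<psi>(1) continuous_on_tendsto_compose by fastforce
      then show ?case
        using has_ddir_LIMSEQ[OF elim(1)] unfolding \<tau>_def by (intro tendsto_mult)
    qed
    have domB: "norm (?B n x) \<le> ?w x" for n x
    proof -
      have *: "\<bar>(f (x + \<tau> n *\<^sub>R v) - f x) / \<tau> n\<bar> \<le> C * norm v"
        using bd[OF \<tau>(1)[of n], of x 0] by simp
      have "norm (?B n x) \<le> (B * indicator (cball 0 R) (x - \<tau> n *\<^sub>R u)) * (C * norm v)"
        unfolding real_norm_def abs_mult[of "\<psi> _"] using BR(3) * BR(1) C
        by (intro mult_mono) auto
      also have "\<dots> \<le> ?w x"
      proof (cases "x - \<tau> n *\<^sub>R u \<in> cball 0 R")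
        case True
        have "norm x \<le> norm (x - \<tau> n *\<^sub>R u) + norm (\<tau> n *\<^sub>R u)"
          using norm_triangle_ineq[of "x - \<tau> n *\<^sub>R u" "\<tau> n *\<^sub>R u"] by simp
        also have "norm (\<tau> n *\<^sub>R u) \<le> 1 * norm u"
          unfolding norm_scaleR using \<tau>(1)[of n] \<tau>(2)[of n] by (intro mult_right_mono) auto
        finally have "x \<in> cball 0 (R + norm u)" using True by simp
        then show ?thesis using True BR(1) C by simp
      qed (use BR(1) C in \<open>auto simp: indicator_def\<close>)
      finally show ?thesis .
    qed
    have A: "(\<lambda>n. \<integral>x. ?A n x \<partial>lborel) \<longlonglongrightarrow> (\<integral>x. \<psi> x * (ddir f (u + v) x - ddir f u x) \<partial>lborel)"
      by (rule integral_dominated_convergence[OF _ _ int limA]) (use domA in auto)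
    have A': "integrable lborel (\<lambda>x. \<psi> x * (ddir f (u + v) x - ddir f u x))"
      by (rule integrable_dominated_convergence[OF _ _ int limA]) (use domA in auto)
    have B: "(\<lambda>n. \<integral>x. ?B n x \<partial>lborel) \<longlonglongrightarrow> (\<integral>x. \<psi> x * ddir f v x \<partial>lborel)"
      by (rule integral_dominated_convergence[OF _ _ int limB]) (use domB in auto)
    have B': "integrable lborel (\<lambda>x. \<psi> x * ddir f v x)"
      by (rule integrable_dominated_convergence[OF _ _ int limB]) (use domB in auto)
    have AB: "(\<lambda>n. \<integral>x. ?A n x \<partial>lborel) = (\<lambda>n. \<integral>x. ?B n x \<partial>lborel)"
    proof
      fix n
      show "(\<integral>x. ?A n x \<partial>lborel) = (\<integral>x. ?B n x \<partial>lborel)"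
        using lborel_integral_translate[of "?B n" "\<tau> n *\<^sub>R u"] by (simp add: add.commute add.left_commute)
    qed
    have "(\<lambda>n. \<integral>x. ?A n x \<partial>lborel) \<longlonglongrightarrow> (\<integral>x. \<psi> x * ddir f v x \<partial>lborel)"
      by (subst AB) (rule B)
    from LIMSEQ_unique[OF A this]
    have "(\<integral>x. \<psi> x * (ddir f (u + v) x - ddir f u x) \<partial>lborel) = (\<integral>x. \<psi> x * ddir f v x \<partial>lborel)" .
    then show "(\<integral>x. \<psi> x * g x \<partial>lborel) = 0"
      using A' B' unfolding g_def right_diff_distrib[of "\<psi> _" "ddir f (u + v) _ - ddir f u _"] by simp
  qed simp
  then show ?thesis by (rule AE_mp) (auto simp: g_def)
qed

lemma has_ddir_scale:
  assumes "has_ddir f v x l"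
  shows "has_ddir f (c *\<^sub>R v) x (c * l)"
proof (cases "c = 0")
  case False
  have "filterlim (\<lambda>t. t * c) (at 0) (at 0)"
    using False by (auto simp: filterlim_at eventually_at_filter intro!: tendsto_eq_intros)
  from filterlim_compose[OF assms[unfolded has_ddir_def] this]
  have "((\<lambda>t. c * ((f (x + (t * c) *\<^sub>R v) - f x) / (t * c))) \<longlongrightarrow> c * l) (at 0)"
    by (intro tendsto_mult_left)
  then show ?thesis
    unfolding has_ddir_def by (rule Lim_transform_eventually) (use False in \<open>auto simp: eventually_at_filter\<close>)
qed (simp add: has_ddir_def)

lemma AE_ddir_sum:
  fixes f :: "'a::euclidean_space \<Rightarrow> real"
  assumes f: "C-lipschitz_on UNIV f" and "finite S"
  shows "AE x in lborel. ddir f (\<Sum>b\<in>S. c b *\<^sub>R b) x = (\<Sum>b\<in>S. c b * ddir f b x)"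
  using assms(2)
proof (induction S)
  case empty
  have "has_ddir f 0 x 0" for x by (simp add: has_ddir_def)
  then show ?case by (simp add: has_ddir_imp_ddir)
next
  case (insert b S)
  have "AE x in lborel. has_ddir f b x (ddir f b x)" using AE_has_ddir[OF f] .
  moreover have "AE x in lborel. ddir f (c b *\<^sub>R b + (\<Sum>b\<in>S. c b *\<^sub>R b)) x =
      ddir f (c b *\<^sub>R b) x + ddir f (\<Sum>b\<in>S. c b *\<^sub>R b) x"
    by (rule AE_ddir_add[OF f])
  ultimately show ?case using insert.IH
  proof eventually_elim
    case (elim x)
    then show ?case using insert.hyps has_ddir_imp_ddir[OF has_ddir_scale[OF elim(1)]] by simp
  qed
qed

text \<open>At almost every point the directional derivatives exist along a countable dense set of
  directions and are given there by one linear map. Compactness of the unit sphere and the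
  Lipschitz bound make the convergence uniform in the direction.\<close>

theorem rademacher_real:
  fixes f :: "'a::euclidean_space \<Rightarrow> real"
  assumes f: "C-lipschitz_on UNIV f"
  shows "AE x in lborel. f differentiable (at x)"
proof -
  have C: "C \<ge> 0" using f by (rule lipschitz_on_nonneg)
  obtain Q :: "'a set" where Q: "countable Q" "\<And>X. open X \<Longrightarrow> X \<noteq> {} \<Longrightarrow> \<exists>q\<in>Q. q \<in> X"
    using countable_dense_setE by metis
  have "AE x in lborel. has_ddir f q x (\<Sum>b\<in>Basis. (q \<bullet> b) * ddir f b x)" for q
    using AE_has_ddir[OF f, of q] AE_ddir_sum[OF f finite_Basis, of "\<lambda>b. q \<bullet> b"]
    by eventually_elim (simp add: euclidean_representation)
  then have "AE x in lborel. \<forall>q\<in>Q. has_ddir f q x (\<Sum>b\<in>Basis. (q \<bullet> b) * ddir f b x)"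
    using Q(1) by (simp add: AE_ball_countable)
  then show ?thesis
  proof eventually_elim
    case (elim x)
    define L where "L v = (\<Sum>b\<in>Basis. (v \<bullet> b) * ddir f b x)" for v
    have linL: "linear L"
      by (rule linearI) (simp_all add: L_def inner_add_left sum.distrib distrib_right sum_distrib_left mult.assoc)
    then obtain B where B: "B > 0" "\<And>v. \<bar>L v\<bar> \<le> B * norm v"
      using linear_bounded_pos by (metis real_norm_def)
    have "(f has_derivative L) (at x)"
    proof (rule has_derivativeI)
      show "bounded_linear L" using linL by (simp add: linear_conv_bounded_linear)
      show "((\<lambda>y. (f y - f x - L (y - x)) /\<^sub>R norm (y - x)) \<longlongrightarrow> 0) (at x)"
      proof (rule LIM_I)
        fix e :: real assume e: "e > 0"
        (* 1, C and B account for the three errors below, all of size at most t * \<eta> *)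
        define \<eta> where "\<eta> = e / (2 * (1 + C + B))"
        have \<eta>: "\<eta> > 0" using e C B by (simp add: \<eta>_def)
        have "compact (sphere (0::'a) 1)" by simp
        moreover have "sphere (0::'a) 1 \<subseteq> (\<Union>q\<in>Q. ball q \<eta>)"
        proof
          fix u :: 'a assume "u \<in> sphere 0 1"
          obtain q where "q \<in> Q" "q \<in> ball u \<eta>" using Q(2)[of "ball u \<eta>"] \<eta> by auto
          then show "u \<in> (\<Union>q\<in>Q. ball q \<eta>)" by (auto simp: dist_commute)
        qed
        ultimately obtain F where F: "F \<subseteq> Q" "finite F" "sphere (0::'a) 1 \<subseteq> (\<Union>q\<in>F. ball q \<eta>)"
          using compactE_image[of "sphere (0::'a) 1" Q "\<lambda>q. ball q \<eta>"] open_ball by metis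
        have "\<forall>\<^sub>F t in at 0. \<forall>q\<in>F. \<bar>(f (x + t *\<^sub>R q) - f x) / t - L q\<bar> < \<eta>"
        proof (rule eventually_ball_finite[OF F(2)], rule ballI)
          fix q assume "q \<in> F"
          then have "((\<lambda>t. (f (x + t *\<^sub>R q) - f x) / t) \<longlongrightarrow> L q) (at 0)"
            using elim F(1) unfolding has_ddir_def L_def by auto
          then show "\<forall>\<^sub>F t in at 0. \<bar>(f (x + t *\<^sub>R q) - f x) / t - L q\<bar> < \<eta>"
            using \<eta> by (auto dest: tendstoD simp: dist_real_def)
        qed
        then obtain \<delta> where \<delta>: "\<delta> > 0"
          "\<And>t q. t \<noteq> 0 \<Longrightarrow> \<bar>t\<bar> < \<delta> \<Longrightarrow> q \<in> F \<Longrightarrow> \<bar>(f (x + t *\<^sub>R q) - f x) / t - L q\<bar> < \<eta>"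
          unfolding eventually_at by (auto simp: dist_real_def)
        have "norm ((f y - f x - L (y - x)) /\<^sub>R norm (y - x)) < e" if y: "y \<noteq> x" "norm (y - x) < \<delta>" for y
        proof -
          define t where "t = norm (y - x)"
          define u where "u = (y - x) /\<^sub>R t"
          have t: "t > 0" "t < \<delta>" using y by (simp_all add: t_def)
          have yu: "y = x + t *\<^sub>R u" using t by (simp add: u_def)
          have "u \<in> sphere 0 1" using y by (simp add: u_def t_def)
          then obtain q where q: "q \<in> F" "norm (u - q) < \<eta>"
            using F(3) by (auto simp: dist_norm norm_minus_commute)
          have 1: "\<bar>(f (x + t *\<^sub>R q) - f x) - t * L q\<bar> \<le> t * \<eta>"
          proof -
            have "(f (x + t *\<^sub>R q) - f x) - t * L q = t * ((f (x + t *\<^sub>R q) - f x) / t - L q)"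
              using t by (simp add: field_simps)
            then show ?thesis using \<delta>(2)[of t q] t q by (simp add: abs_mult)
          qed
          have 2: "\<bar>f (x + t *\<^sub>R u) - f (x + t *\<^sub>R q)\<bar> \<le> C * (t * \<eta>)"
          proof -
            have "\<bar>f (x + t *\<^sub>R u) - f (x + t *\<^sub>R q)\<bar> \<le> C * norm (t *\<^sub>R (u - q))"
              using lipschitz_onD[OF f, of "x + t *\<^sub>R u" "x + t *\<^sub>R q"] by (simp add: dist_norm scaleR_diff_right)
            also have "\<dots> \<le> C * (t * \<eta>)" using C t q by (intro mult_left_mono) auto
            finally show ?thesis .
          qed
          have 3: "\<bar>t * L q - t * L u\<bar> \<le> B * (t * \<eta>)"
          proof -
            have "\<bar>t * L q - t * L u\<bar> = t * \<bar>L (u - q)\<bar>"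
              using t linear_diff[OF linL, of u q] by (simp add: abs_mult abs_minus_commute flip: right_diff_distrib)
            also have "\<dots> \<le> t * (B * \<eta>)"
            proof (rule mult_left_mono)
              have "\<bar>L (u - q)\<bar> \<le> B * norm (u - q)" by (rule B(2))
              also have "\<dots> \<le> B * \<eta>" using q B(1) by simp
              finally show "\<bar>L (u - q)\<bar> \<le> B * \<eta>" .
            qed (use t in simp)
            finally show ?thesis by (simp add: mult_ac)
          qed
          have "\<bar>f y - f x - L (y - x)\<bar> \<le> (1 + C + B) * (t * \<eta>)"
          proof -
            have "L (y - x) = t * L u" using linear_cmul[OF linL, of t u] by (simp add: yu)
            then have "\<bar>f y - f x - L (y - x)\<bar> \<le> t * \<eta> + C * (t * \<eta>) + B * (t * \<eta>)"
              using 1 2 3 unfolding yu by linarith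
            then show ?thesis by (simp add: distrib_right)
          qed
          also have "\<dots> = t * (e / 2)" using C B by (simp add: \<eta>_def field_simps)
          finally have "\<bar>f y - f x - L (y - x)\<bar> / t \<le> e / 2"
            using t by (simp add: pos_divide_le_eq mult.commute)
          moreover have "norm ((f y - f x - L (y - x)) /\<^sub>R norm (y - x)) = \<bar>f y - f x - L (y - x)\<bar> / t"
            using t by (simp add: t_def[symmetric] abs_mult divide_inverse mult.commute)
          ultimately show ?thesis using e by linarith
        qed
        then show "\<exists>s>0. \<forall>y. y \<noteq> x \<and> norm (y - x) < s \<longrightarrow>
            norm ((f y - f x - L (y - x)) /\<^sub>R norm (y - x) - 0) < e"
          using \<delta>(1) unfolding diff_zero by blast
      qed
    qed
    then show ?case by (auto simp: differentiable_def)
  qed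
qed

theorem rademacher:
  fixes f :: "'a::euclidean_space \<Rightarrow> 'b::euclidean_space"
  assumes f: "C-lipschitz_on UNIV f"
  shows "AE x in lborel. f differentiable (at x)"
proof -
  have "AE x in lborel. (\<lambda>x. f x \<bullet> b) differentiable (at x)" if "b \<in> Basis" for b
  proof (rule rademacher_real)
    show "C-lipschitz_on UNIV (\<lambda>x. f x \<bullet> b)"
    proof (rule lipschitz_onI)
      fix x y
      have "dist (f x \<bullet> b) (f y \<bullet> b) = \<bar>(f x - f y) \<bullet> b\<bar>" by (simp add: dist_real_def inner_diff_left)
      also have "\<dots> \<le> norm (f x - f y)" using that by (rule Basis_le_norm)
      also have "\<dots> \<le> C * dist x y" using lipschitz_onD[OF f, of x y] by (simp add: dist_norm)
      finally show "dist (f x \<bullet> b) (f y \<bullet> b) \<le> C * dist x y" .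
    qed (use lipschitz_on_nonneg[OF f] in auto)
  qed
  then have "AE x in lborel. \<forall>b\<in>Basis. (\<lambda>x. f x \<bullet> b) differentiable (at x)"
    by (simp add: AE_ball_countable countable_finite)
  then show ?thesis
    by eventually_elim (subst differentiable_componentwise_within, assumption)
qed

section \<open>Mollification\<close>

lemma has_ddir_iff_DERIV:
  "has_ddir f v x l \<longleftrightarrow> ((\<lambda>t. f (x + t *\<^sub>R v)) has_real_derivative l) (at 0)"
  by (simp add: has_ddir_def DERIV_def)

lemma has_ddir_imp_DERIV_line:
  assumes "has_ddir f v (x + t *\<^sub>R v) l"
  shows "((\<lambda>s. f (x + s *\<^sub>R v)) has_real_derivative l) (at t)"
  using assms by (simp add: has_ddir_def DERIV_def scaleR_add_left add.assoc)

lemma has_ddir_imp_line_bound: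
  assumes "\<And>z. has_ddir f v z (f' z)" "\<And>z. \<bar>f' z\<bar> \<le> K"
  shows "\<bar>f (x + t *\<^sub>R v) - f x\<bar> \<le> K * \<bar>t\<bar>"
proof -
  have "norm (f (x + t *\<^sub>R v) - f (x + 0 *\<^sub>R v)) \<le> K * norm (t - 0)"
    by (rule field_differentiable_bound[of UNIV "\<lambda>s. f (x + s *\<^sub>R v)" "\<lambda>s. f' (x + s *\<^sub>R v)"])
       (use assms in \<open>auto intro: has_ddir_imp_DERIV_line\<close>)
  then show ?thesis by simp
qed

lemma has_derivative_imp_has_ddir:
  assumes "(f has_derivative f') (at x)"
  shows "has_ddir f v x (f' v)"
proof -
  have l: "bounded_linear f'" using assms by (rule has_derivative_bounded_linear)
  have "((\<lambda>t::real. x + t *\<^sub>R v) has_derivative (\<lambda>t. t *\<^sub>R v)) (at 0)"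
    by (auto intro!: derivative_eq_intros)
  then have "((\<lambda>t. f (x + t *\<^sub>R v)) has_derivative (\<lambda>t. f' (t *\<^sub>R v))) (at 0)"
    by (rule has_derivative_compose) (use assms in simp)
  moreover have "(\<lambda>t. f' (t *\<^sub>R v)) = (*) (f' v)"
    using l by (auto simp: bounded_linear.linear linear_cmul)
  ultimately show ?thesis
    unfolding has_ddir_iff_DERIV has_field_derivative_def by simp
qed

lemma frechet_derivative_eq_ddir:
  "f differentiable (at x) \<Longrightarrow> frechet_derivative f (at x) v = ddir f v x"
  using has_derivative_imp_has_ddir[of f "frechet_derivative f (at x)" x v]
  by (simp add: frechet_derivative_works has_ddir_imp_ddir)

lemma integrable_continuous_bounded_support:
  fixes \<psi> :: "'a::euclidean_space \<Rightarrow> real"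
  assumes "continuous_on UNIV \<psi>" "bounded {x. \<psi> x \<noteq> 0}"
  shows "integrable lborel \<psi>"
proof -
  obtain B R where BR: "0 \<le> B" "0 \<le> R" "\<And>x. \<bar>\<psi> x\<bar> \<le> B * indicator (cball 0 R) x"
    using bounded_support_imp_bounded_fun[OF assms] by blast
  have "integrable lborel (\<lambda>x::'a. B * indicator (cball 0 R) x)"
    using emeasure_bounded_finite[OF bounded_cball[of "0::'a" R]]
    by (intro integrable_mult_right integrable_real_indicator) auto
  then show ?thesis
    by (rule Bochner_Integration.integrable_bound)
      (use BR assms(1) in \<open>auto intro: borel_measurable_continuous_onI order_trans\<close>)
qed

lemma continuous_bounded_on_cball:
  fixes h :: "'a::euclidean_space \<Rightarrow> real"
  assumes "continuous_on UNIV h"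
  obtains B where "0 \<le> B" "\<And>z. norm z \<le> R \<Longrightarrow> \<bar>h z\<bar> \<le> B"
proof -
  have "compact (h ` cball 0 R)"
    by (intro compact_continuous_image continuous_on_subset[OF assms]) auto
  then obtain B where "\<And>z. norm z \<le> R \<Longrightarrow> \<bar>h z\<bar> \<le> B"
    using compact_imp_bounded by (force simp: bounded_iff)
  then show ?thesis
    using that[of "max B 0"] by (simp add: le_max_iff_disj)
qed

text \<open>The average of \<open>h\<close> around \<open>x\<close> on the scale \<open>\<epsilon>\<close>. The weight is not normalised, and also its
  directional derivatives are used as weights.\<close>

definition mollify :: "('a \<Rightarrow> real) \<Rightarrow> real \<Rightarrow> ('a \<Rightarrow> real) \<Rightarrow> 'a::euclidean_space \<Rightarrow> real" where
  "mollify \<psi> \<epsilon> h x = (\<integral>z. \<psi> z * h (x + \<epsilon> *\<^sub>R z) \<partial>lborel)"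

lemma mollify_integrable:
  fixes \<psi> h :: "'a::euclidean_space \<Rightarrow> real"
  assumes "continuous_on UNIV \<psi>" "bounded {x. \<psi> x \<noteq> 0}" "continuous_on UNIV h"
  shows "integrable lborel (\<lambda>z. \<psi> z * h (x + \<epsilon> *\<^sub>R z))"
proof (rule integrable_continuous_bounded_support)
  show "continuous_on UNIV (\<lambda>z. \<psi> z * h (x + \<epsilon> *\<^sub>R z))"
    by (intro continuous_intros assms continuous_on_compose2[OF assms(3)]) auto
  show "bounded {z. \<psi> z * h (x + \<epsilon> *\<^sub>R z) \<noteq> 0}"
    by (rule bounded_subset[OF assms(2)]) auto
qed

lemma mollify_lipschitz:
  assumes "continuous_on UNIV \<psi>" "bounded {x. \<psi> x \<noteq> 0}" "C-lipschitz_on UNIV h"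
  shows "(C * (\<integral>z. \<bar>\<psi> z\<bar> \<partial>lborel))-lipschitz_on UNIV (mollify \<psi> \<epsilon> h)"
proof (rule lipschitz_onI)
  fix x y
  have conth: "continuous_on UNIV h" using assms(3) by (rule lipschitz_on_continuous_on)
  have int\<psi>: "integrable lborel \<psi>" using assms(1,2) by (rule integrable_continuous_bounded_support)
  note int = mollify_integrable[OF assms(1,2) conth, of _ \<epsilon>]
  have "mollify \<psi> \<epsilon> h x - mollify \<psi> \<epsilon> h y =
      (\<integral>z. \<psi> z * (h (x + \<epsilon> *\<^sub>R z) - h (y + \<epsilon> *\<^sub>R z)) \<partial>lborel)"
    unfolding mollify_def by (subst Bochner_Integration.integral_diff[symmetric]) (auto simp: int algebra_simps)
  also have "\<bar>\<dots>\<bar> \<le> (\<integral>z. C * dist x y * \<bar>\<psi> z\<bar> \<partial>lborel)"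
  proof (rule integral_abs_bound[THEN order_trans], rule integral_mono)
    have "integrable lborel (\<lambda>z. \<psi> z * h (x + \<epsilon> *\<^sub>R z) - \<psi> z * h (y + \<epsilon> *\<^sub>R z))"
      using int by (intro Bochner_Integration.integrable_diff)
    then show "integrable lborel (\<lambda>z. \<bar>\<psi> z * (h (x + \<epsilon> *\<^sub>R z) - h (y + \<epsilon> *\<^sub>R z))\<bar>)"
      by (simp add: right_diff_distrib)
    show "integrable lborel (\<lambda>z. C * dist x y * \<bar>\<psi> z\<bar>)" using int\<psi> by simp
    fix z
    have "\<bar>h (x + \<epsilon> *\<^sub>R z) - h (y + \<epsilon> *\<^sub>R z)\<bar> \<le> C * dist x y"
      using lipschitz_onD[OF assms(3), of "x + \<epsilon> *\<^sub>R z" "y + \<epsilon> *\<^sub>R z"] by (simp add: dist_real_def)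
    then have "\<bar>\<psi> z\<bar> * \<bar>h (x + \<epsilon> *\<^sub>R z) - h (y + \<epsilon> *\<^sub>R z)\<bar> \<le> \<bar>\<psi> z\<bar> * (C * dist x y)"
      by (rule mult_left_mono) simp
    then show "\<bar>\<psi> z * (h (x + \<epsilon> *\<^sub>R z) - h (y + \<epsilon> *\<^sub>R z))\<bar> \<le> C * dist x y * \<bar>\<psi> z\<bar>"
      by (simp add: abs_mult mult_ac)
  qed
  also have "\<dots> = C * (\<integral>z. \<bar>\<psi> z\<bar> \<partial>lborel) * dist x y"
    by simp
  finally show "dist (mollify \<psi> \<epsilon> h x) (mollify \<psi> \<epsilon> h y) \<le> C * (\<integral>z. \<bar>\<psi> z\<bar> \<partial>lborel) * dist x y"
    by (simp add: dist_real_def)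
qed (use lipschitz_on_nonneg[OF assms(3)] in auto)

text \<open>After a translation of the variable, the difference quotient falls on the weight, with the
  increment rescaled by \<open>- (1 / \<epsilon>)\<close>.\<close>

lemma has_ddir_mollify:
  fixes \<psi> :: "'a::euclidean_space \<Rightarrow> real"
  assumes \<psi>: "continuous_on UNIV \<psi>" "bounded {x. \<psi> x \<noteq> 0}"
    and d\<psi>: "\<And>z. has_ddir \<psi> w z (\<psi>' z)" and \<psi>': "continuous_on UNIV \<psi>'" "bounded {x. \<psi>' x \<noteq> 0}"
    and h: "continuous_on UNIV h" and \<epsilon>: "\<epsilon> > 0"
  shows "has_ddir (mollify \<psi> \<epsilon> h) w x (- (1 / \<epsilon>) * mollify \<psi>' \<epsilon> h x)"
proof -
  obtain K R1 where K: "0 \<le> K" "\<And>z. \<bar>\<psi>' z\<bar> \<le> K * indicator (cball 0 R1) z"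
    using bounded_support_imp_bounded_fun[OF \<psi>'] by metis
  have K': "\<bar>\<psi>' z\<bar> \<le> K" for z
    using K(2)[of z] K(1) by (cases "z \<in> cball 0 R1") auto
  obtain B R where R: "0 \<le> R" "\<And>z. \<bar>\<psi> z\<bar> \<le> B * indicator (cball 0 R) z"
    using bounded_support_imp_bounded_fun[OF \<psi>] by metis
  have R0: "\<psi> z = 0" if "norm z > R" for z
    using R(2)[of z] that by simp
  have ms: "(\<lambda>z. \<psi> (c + z)) \<in> borel_measurable borel" "(\<lambda>z. h (c + \<epsilon> *\<^sub>R z)) \<in> borel_measurable borel"
      "\<psi>' \<in> borel_measurable borel" "\<psi> \<in> borel_measurable borel" for c
    by (intro borel_measurable_continuous_onI continuous_on_compose2[OF \<psi>(1)] continuous_on_compose2[OF h]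
        \<psi> \<psi>' continuous_intros; simp)+
  have shift: "(mollify \<psi> \<epsilon> h (x + t *\<^sub>R w) - mollify \<psi> \<epsilon> h x) / t =
      (\<integral>z. (\<psi> (z + t *\<^sub>R ((- (1 / \<epsilon>)) *\<^sub>R w)) - \<psi> z) / t * h (x + \<epsilon> *\<^sub>R z) \<partial>lborel)" for t
  proof -
    let ?u = "t *\<^sub>R ((- (1 / \<epsilon>)) *\<^sub>R w)"
    let ?G = "\<lambda>z. \<psi> (z + ?u) * h (x + \<epsilon> *\<^sub>R z)"
    have [simp]: "\<epsilon> *\<^sub>R ?u = - (t *\<^sub>R w)" using \<epsilon> by simp
    have Gm: "?G \<in> borel_measurable borel"
      using ms(1)[of ?u] ms(2)[of x] by (simp add: add.commute)
    have eq: "?G (- ?u + z) = \<psi> z * h (x + t *\<^sub>R w + \<epsilon> *\<^sub>R z)" for z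
      using \<epsilon> by (simp add: scaleR_add_right add.assoc)
    have 1: "mollify \<psi> \<epsilon> h (x + t *\<^sub>R w) = (\<integral>z. ?G z \<partial>lborel)"
      using lborel_integral_translate[OF Gm, of "- ?u"] unfolding mollify_def eq by simp
    have "bounded ((\<lambda>z. z - ?u) ` {x. \<psi> x \<noteq> 0})"
      using \<psi>(2) by (rule bounded_translation_minus)
    moreover have "(\<lambda>z. z - ?u) ` {x. \<psi> x \<noteq> 0} = {z. \<psi> (z + ?u) \<noteq> 0}"
      by (auto simp: image_iff intro!: exI[of _ "_ + ?u"])
    ultimately have bs: "bounded {z. \<psi> (z + ?u) \<noteq> 0}" by simp
    have "integrable lborel ?G"
      by (rule mollify_integrable[OF _ bs h]) (intro continuous_intros continuous_on_compose2[OF \<psi>(1)]; simp)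
    with mollify_integrable[OF \<psi> h, of x \<epsilon>]
    have "(\<integral>z. ?G z \<partial>lborel) - mollify \<psi> \<epsilon> h x = (\<integral>z. (\<psi> (z + ?u) - \<psi> z) * h (x + \<epsilon> *\<^sub>R z) \<partial>lborel)"
      unfolding mollify_def by (subst Bochner_Integration.integral_diff[symmetric]) (auto simp: left_diff_distrib)
    then show ?thesis unfolding 1 by simp
  qed
  show ?thesis
    unfolding has_ddir_def shift tendsto_at_iff_sequentially
  proof (intro allI impI)
    fix X :: "nat \<Rightarrow> real" assume X: "\<forall>i. X i \<in> UNIV - {0}" "X \<longlonglongrightarrow> 0"
    have X0: "X i \<noteq> 0" for i using X by auto
    obtain T where T: "T \<ge> 0" "\<And>i. \<bar>X i\<bar> \<le> T"
    proof -
      have "Bseq X" using X(2) by (rule convergent_imp_Bseq[OF convergentI])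
      then obtain T where "T > 0" "\<And>i. norm (X i) \<le> T" by (auto simp: Bseq_def)
      then show ?thesis using that[of T] by auto
    qed
    define R' where "R' = R + T * norm w / \<epsilon>"
    obtain H where H: "0 \<le> H" "\<And>z. norm z \<le> R' \<Longrightarrow> \<bar>h (x + \<epsilon> *\<^sub>R z)\<bar> \<le> H"
    proof (rule continuous_bounded_on_cball[of "\<lambda>z. h (x + \<epsilon> *\<^sub>R z)" R'])
      show "continuous_on UNIV (\<lambda>z. h (x + \<epsilon> *\<^sub>R z))"
        by (intro continuous_intros continuous_on_compose2[OF h]; simp)
    qed (use that in auto)
    let ?s = "\<lambda>i z. (\<psi> (z + X i *\<^sub>R ((- (1 / \<epsilon>)) *\<^sub>R w)) - \<psi> z) / X i * h (x + \<epsilon> *\<^sub>R z)"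
    have "(\<lambda>i. \<integral>z. ?s i z \<partial>lborel) \<longlonglongrightarrow> (\<integral>z. (- (1 / \<epsilon>) * \<psi>' z) * h (x + \<epsilon> *\<^sub>R z) \<partial>lborel)"
    proof (rule dominated_convergence[THEN conjunct2])
      show "(\<lambda>z. (- (1 / \<epsilon>) * \<psi>' z) * h (x + \<epsilon> *\<^sub>R z)) \<in> borel_measurable lborel"
        using ms by measurable
      show "?s i \<in> borel_measurable lborel" for i
        using ms(1)[of "X i *\<^sub>R ((- (1 / \<epsilon>)) *\<^sub>R w)"] ms(2,4)
        by (simp add: add.commute) measurable
      show "integrable lborel (\<lambda>z::'a. indicator (cball 0 R') z * (K / \<epsilon> * H))"
        using emeasure_bounded_finite[OF bounded_cball[of "0::'a" R']]
        by (intro integrable_mult_left integrable_real_indicator) auto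
      show "AE z in lborel. (\<lambda>i. ?s i z) \<longlonglongrightarrow> (- (1 / \<epsilon>) * \<psi>' z) * h (x + \<epsilon> *\<^sub>R z)"
      proof (rule AE_I2)
        fix z
        have "has_ddir \<psi> ((- (1 / \<epsilon>)) *\<^sub>R w) z (- (1 / \<epsilon>) * \<psi>' z)"
          by (rule has_ddir_scale[OF d\<psi>])
        moreover have "filterlim X (at 0) sequentially"
          using X by (simp add: filterlim_at)
        ultimately have "(\<lambda>i. (\<psi> (z + X i *\<^sub>R ((- (1 / \<epsilon>)) *\<^sub>R w)) - \<psi> z) / X i) \<longlonglongrightarrow> - (1 / \<epsilon>) * \<psi>' z"
          unfolding has_ddir_def by (rule filterlim_compose)
        then show "(\<lambda>i. ?s i z) \<longlonglongrightarrow> (- (1 / \<epsilon>) * \<psi>' z) * h (x + \<epsilon> *\<^sub>R z)"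
          by (rule tendsto_mult_right)
      qed
      show "AE z in lborel. \<bar>?s i z\<bar> \<le> indicator (cball 0 R') z * (K / \<epsilon> * H)" for i
      proof (rule AE_I2)
        fix z
        let ?u = "X i *\<^sub>R ((- (1 / \<epsilon>)) *\<^sub>R w)"
        have u: "norm ?u \<le> T * norm w / \<epsilon>"
          using T \<epsilon> by (simp add: divide_right_mono mult_right_mono)
        show "\<bar>?s i z\<bar> \<le> indicator (cball 0 R') z * (K / \<epsilon> * H)"
        proof (cases "norm z \<le> R'")
          case True
          have "\<psi> (z + ?u) = \<psi> (z + (X i * (- (1 / \<epsilon>))) *\<^sub>R w)" by simp
          then have "\<bar>\<psi> (z + ?u) - \<psi> z\<bar> \<le> K * \<bar>X i * (- (1 / \<epsilon>))\<bar>"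
            using has_ddir_imp_line_bound[OF d\<psi> K', of z "X i * (- (1 / \<epsilon>))"] by simp
          also have "\<dots> = K / \<epsilon> * \<bar>X i\<bar>" using \<epsilon> by (simp add: abs_mult)
          finally have "\<bar>(\<psi> (z + ?u) - \<psi> z) / X i\<bar> \<le> K / \<epsilon>"
            using X0[of i] by (simp add: pos_divide_le_eq)
          then have "\<bar>(\<psi> (z + ?u) - \<psi> z) / X i\<bar> * \<bar>h (x + \<epsilon> *\<^sub>R z)\<bar> \<le> K / \<epsilon> * H"
            using H(2)[OF True] K(1) \<epsilon> by (intro mult_mono) auto
          then show ?thesis using True by (simp only: abs_mult) simp
        next
          case False
          have "norm z \<le> norm (z + ?u) + norm ?u"
            using norm_triangle_ineq[of "z + ?u" "- ?u"] by simp
          then have "norm (z + ?u) > R" using False u by (simp add: R'_def)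
          moreover have "norm z > R"
            using False T(1) \<epsilon> by (simp add: R'_def) (smt (verit, best) divide_nonneg_pos mult_nonneg_nonneg norm_ge_zero)
          ultimately show ?thesis using R0 False by simp
        qed
      qed
    qed
    then have "(\<lambda>i. \<integral>z. ?s i z \<partial>lborel) \<longlonglongrightarrow> - (1 / \<epsilon>) * mollify \<psi>' \<epsilon> h x"
      unfolding mollify_def mult.assoc by simp
    then show "((\<lambda>t. \<integral>z. (\<psi> (z + t *\<^sub>R ((- (1 / \<epsilon>)) *\<^sub>R w)) - \<psi> z) / t * h (x + \<epsilon> *\<^sub>R z) \<partial>lborel) \<circ> X)
        \<longlonglongrightarrow> - (1 / \<epsilon>) * mollify \<psi>' \<epsilon> h x"
      by (simp only: o_def)
  qed
qed

lemma DERIV_max_power: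
  "((\<lambda>s::real. max 0 s ^ Suc (Suc n)) has_real_derivative real (Suc (Suc n)) * max 0 s ^ Suc n) (at s)"
proof (rule linorder_cases[of s 0])
  assume s: "s < 0"
  have "((\<lambda>s::real. 0) has_real_derivative 0) (at s)" by simp
  moreover have "\<forall>\<^sub>F t in nhds s. max 0 t ^ Suc (Suc n) = 0"
    using eventually_nhds_in_open[of "{..<0}" s] s by (auto elim!: eventually_mono)
  ultimately show ?thesis
    using s DERIV_cong_ev[of s s "\<lambda>t. max 0 t ^ Suc (Suc n)" "\<lambda>t. 0" 0 0] by simp
next
  assume s: "0 < s"
  have "((\<lambda>s::real. s ^ Suc (Suc n)) has_real_derivative real (Suc (Suc n)) * s ^ Suc n) (at s)"
    using DERIV_pow[of "Suc (Suc n)" s] by simp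
  moreover have "\<forall>\<^sub>F t in nhds s. max 0 t ^ Suc (Suc n) = t ^ Suc (Suc n)"
    using eventually_nhds_in_open[of "{0<..}" s] s by (auto elim!: eventually_mono)
  ultimately show ?thesis
    using s DERIV_cong_ev[of s s "\<lambda>t. max 0 t ^ Suc (Suc n)" "\<lambda>t. t ^ Suc (Suc n)"
        "real (Suc (Suc n)) * s ^ Suc n" "real (Suc (Suc n)) * s ^ Suc n"] by simp
next
  assume s: "s = 0"
  have "((\<lambda>h::real. max 0 h ^ Suc n) \<longlongrightarrow> max 0 0 ^ Suc n) (at 0)"
    by (intro tendsto_intros)
  moreover have "\<forall>\<^sub>F h in at (0::real). max 0 h ^ Suc n = (max 0 (0 + h) ^ Suc (Suc n) - max 0 0 ^ Suc (Suc n)) / h"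
    using eventually_neq_at_within[of "0::real" 0 UNIV]
  proof eventually_elim
    case (elim h)
    then show ?case by (cases "h > 0") simp_all
  qed
  ultimately have "((\<lambda>h::real. (max 0 (0 + h) ^ Suc (Suc n) - max 0 0 ^ Suc (Suc n)) / h) \<longlongrightarrow> max 0 0 ^ Suc n) (at 0)"
    by (rule Lim_transform_eventually)
  then show ?thesis using s by (simp add: DERIV_def)
qed

text \<open>The third power makes the truncated paraboloid twice continuously differentiable, with explicit
  derivatives \<open>bump'\<close> and \<open>bump''\<close>.\<close>

definition bump :: "'a::euclidean_space \<Rightarrow> real" where
  "bump z = max 0 (1 - z \<bullet> z) ^ 3"

definition bump' :: "'a::euclidean_space \<Rightarrow> 'a \<Rightarrow> real" where
  "bump' w z = - 6 * max 0 (1 - z \<bullet> z) ^ 2 * (z \<bullet> w)"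

definition bump'' :: "'a::euclidean_space \<Rightarrow> 'a \<Rightarrow> 'a \<Rightarrow> real" where
  "bump'' w v z = 24 * max 0 (1 - z \<bullet> z) * (z \<bullet> w) * (z \<bullet> v) - 6 * max 0 (1 - z \<bullet> z) ^ 2 * (w \<bullet> v)"

lemma DERIV_max_quadratic:
  fixes z v :: "'a::euclidean_space"
  shows "((\<lambda>t. max 0 (1 - (z + t *\<^sub>R v) \<bullet> (z + t *\<^sub>R v)) ^ Suc (Suc n)) has_real_derivative
    real (Suc (Suc n)) * max 0 (1 - z \<bullet> z) ^ Suc n * (- 2 * (z \<bullet> v))) (at 0)"
proof -
  have "((\<lambda>t. 1 - (z \<bullet> z + 2 * t * (z \<bullet> v) + t ^ 2 * (v \<bullet> v))) has_real_derivative - 2 * (z \<bullet> v)) (at 0)"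
    by (auto intro!: derivative_eq_intros)
  moreover have "1 - (z + t *\<^sub>R v) \<bullet> (z + t *\<^sub>R v) = 1 - (z \<bullet> z + 2 * t * (z \<bullet> v) + t ^ 2 * (v \<bullet> v))" for t
    by (simp add: inner_add_left inner_add_right inner_commute power2_eq_square)
  ultimately have d: "((\<lambda>t. 1 - (z + t *\<^sub>R v) \<bullet> (z + t *\<^sub>R v)) has_real_derivative - 2 * (z \<bullet> v)) (at 0)"
    by presburger
  have "((\<lambda>s::real. max 0 s ^ Suc (Suc n)) has_real_derivative real (Suc (Suc n)) * max 0 (1 - z \<bullet> z) ^ Suc n)
      (at (1 - (z + 0 *\<^sub>R v) \<bullet> (z + 0 *\<^sub>R v)))"
    using DERIV_max_power[of n "1 - z \<bullet> z"] by simp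
  from DERIV_chain2[OF this d] show ?thesis .
qed

lemma has_ddir_bump: "has_ddir bump w z (bump' w z)"
  using DERIV_max_quadratic[of z w 1]
  unfolding has_ddir_iff_DERIV bump_def bump'_def by (simp add: numeral_3_eq_3 power2_eq_square mult_ac)

lemma has_ddir_bump': "has_ddir (bump' w) v z (bump'' w v z)"
proof -
  have "((\<lambda>t. - 6 * max 0 (1 - (z + t *\<^sub>R v) \<bullet> (z + t *\<^sub>R v)) ^ Suc (Suc 0)) has_real_derivative
      - 6 * (real (Suc (Suc 0)) * max 0 (1 - z \<bullet> z) ^ Suc 0 * (- 2 * (z \<bullet> v)))) (at 0)"
    by (intro DERIV_cmult DERIV_max_quadratic)
  moreover have "((\<lambda>t. (z + t *\<^sub>R v) \<bullet> w) has_real_derivative v \<bullet> w) (at 0)"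
    by (auto intro!: derivative_eq_intros simp: inner_add_left)
  ultimately have "((\<lambda>t. - 6 * max 0 (1 - (z + t *\<^sub>R v) \<bullet> (z + t *\<^sub>R v)) ^ Suc (Suc 0) * ((z + t *\<^sub>R v) \<bullet> w)) has_real_derivative
     - 6 * (real (Suc (Suc 0)) * max 0 (1 - z \<bullet> z) ^ Suc 0 * (- 2 * (z \<bullet> v))) * ((z + 0 *\<^sub>R v) \<bullet> w)
     + (v \<bullet> w) * (- 6 * max 0 (1 - (z + 0 *\<^sub>R v) \<bullet> (z + 0 *\<^sub>R v)) ^ Suc (Suc 0))) (at 0)"
    by (rule DERIV_mult)
  then show ?thesis
    unfolding has_ddir_iff_DERIV bump'_def bump''_def
    by (simp add: numeral_2_eq_2 inner_commute mult_ac)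
qed

lemma bump_continuous:
  "continuous_on UNIV bump" "continuous_on UNIV (bump' w)" "continuous_on UNIV (bump'' w v)"
  unfolding bump_def[abs_def] bump'_def[abs_def] bump''_def[abs_def] by (intro continuous_intros)+

lemma bump_support:
  fixes w v :: "'a::euclidean_space"
  shows "bounded {z::'a. bump z \<noteq> 0}" "bounded {z. bump' w z \<noteq> 0}" "bounded {z. bump'' w v z \<noteq> 0}"
proof -
  have "max 0 (1 - z \<bullet> z) = 0" if "z \<notin> cball 0 1" for z :: 'a
  proof -
    have "1 < norm z" using that by simp
    then have "1 < norm z ^ 2" by (simp add: power2_eq_square less_1_mult)
    then show ?thesis by (simp add: power2_norm_eq_inner)
  qed
  then have "{z::'a. bump z \<noteq> 0} \<subseteq> cball 0 1" "{z. bump' w z \<noteq> 0} \<subseteq> cball 0 1" "{z. bump'' w v z \<noteq> 0} \<subseteq> cball 0 1"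
    unfolding bump_def bump'_def bump''_def by fastforce+
  then show "bounded {z::'a. bump z \<noteq> 0}" "bounded {z. bump' w z \<noteq> 0}" "bounded {z. bump'' w v z \<noteq> 0}"
    using bounded_cball bounded_subset by blast+
qed

lemma bump''_commute: "bump'' w v = bump'' v w"
  by (rule ext) (simp add: bump''_def inner_commute mult_ac)

lemma bump_nonneg: "bump z \<ge> 0" by (simp add: bump_def)

lemma integral_bump_pos: "(\<integral>z. bump (z :: 'a::euclidean_space) \<partial>lborel) > 0"
proof (rule ccontr)
  have int: "integrable lborel (bump :: 'a \<Rightarrow> real)"
    by (rule integrable_continuous_bounded_support[OF bump_continuous(1) bump_support(1)])
  assume "\<not> ?thesis"
  moreover have "(\<integral>(z::'a). bump z \<partial>lborel) \<ge> 0" by (simp add: bump_nonneg)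
  ultimately have "(\<integral>(z::'a). bump z \<partial>lborel) = 0" by simp
  then have "AE z::'a in lborel. bump z = 0"
    using integral_nonneg_eq_0_iff_AE[OF int] AE_I2[of lborel "\<lambda>z. 0 \<le> bump z", OF bump_nonneg] by simp
  moreover have "bump z \<noteq> 0" if "z \<in> ball 0 1" for z :: 'a
  proof -
    have "norm z ^ 2 < 1" using that by (simp add: power_less_one_iff)
    then show ?thesis by (simp add: bump_def power2_norm_eq_inner)
  qed
  ultimately have "AE z::'a in lborel. z \<notin> ball 0 1" by (auto elim!: eventually_mono)
  then have "ball (0::'a) 1 \<in> null_sets lborel"
    by (simp add: AE_iff_null_sets)
  then have "emeasure lborel (ball (0::'a) 1) = 0" by (rule null_setsD1)
  moreover have "measure lborel (ball (0::'a) 1) > 0" by (rule content_ball_pos) simp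
  ultimately show False by (simp add: measure_def)
qed

definition mol_deriv :: "real \<Rightarrow> ('a \<Rightarrow> real) \<Rightarrow> 'a \<Rightarrow> 'a::euclidean_space \<Rightarrow> real" where
  "mol_deriv \<epsilon> h w x = - (1 / \<epsilon>) * mollify (bump' w) \<epsilon> h x"

definition mol_deriv2 :: "real \<Rightarrow> ('a \<Rightarrow> real) \<Rightarrow> 'a \<Rightarrow> 'a \<Rightarrow> 'a::euclidean_space \<Rightarrow> real" where
  "mol_deriv2 \<epsilon> h w v x = (1 / \<epsilon>) ^ 2 * mollify (bump'' w v) \<epsilon> h x"

lemma mol_deriv2_commute: "mol_deriv2 \<epsilon> h w v = mol_deriv2 \<epsilon> h v w"
  by (rule ext) (simp add: mol_deriv2_def bump''_commute[of w v])

lemma has_ddir_mollify_bump: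
  assumes "continuous_on UNIV h" "\<epsilon> > 0"
  shows "has_ddir (mollify bump \<epsilon> h) w x (mol_deriv \<epsilon> h w x)"
  unfolding mol_deriv_def
  by (intro has_ddir_mollify bump_continuous bump_support has_ddir_bump assms)

lemma has_ddir_cmult: "has_ddir f v x l \<Longrightarrow> has_ddir (\<lambda>x. c * f x) v x (c * l)"
  unfolding has_ddir_iff_DERIV by (rule DERIV_cmult)

lemma has_ddir_mol_deriv:
  assumes "continuous_on UNIV h" "\<epsilon> > 0"
  shows "has_ddir (mol_deriv \<epsilon> h w) v x (mol_deriv2 \<epsilon> h w v x)"
proof -
  have "has_ddir (\<lambda>x. - (1 / \<epsilon>) * mollify (bump' w) \<epsilon> h x) v x
      (- (1 / \<epsilon>) * (- (1 / \<epsilon>) * mollify (bump'' w v) \<epsilon> h x))"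
    by (intro has_ddir_cmult has_ddir_mollify bump_continuous bump_support has_ddir_bump' assms)
  then show ?thesis
    unfolding mol_deriv_def[abs_def] mol_deriv2_def by (simp add: power2_eq_square)
qed

abbreviation bump_mass :: "'a::euclidean_space itself \<Rightarrow> real" where
  "bump_mass T \<equiv> (\<integral>z. bump (z::'a) \<partial>lborel)"

lemma mol_deriv_bound:
  fixes h :: "'a::euclidean_space \<Rightarrow> real"
  assumes "C-lipschitz_on UNIV h" "\<epsilon> > 0"
  shows "\<bar>mol_deriv \<epsilon> h w x\<bar> \<le> C * bump_mass TYPE('a) * norm w"
proof -
  have "(C * (\<integral>z. \<bar>bump (z::'a)\<bar> \<partial>lborel))-lipschitz_on UNIV (mollify bump \<epsilon> h)"
    by (rule mollify_lipschitz[OF bump_continuous(1) bump_support(1) assms(1)])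
  then have "(C * bump_mass TYPE('a))-lipschitz_on UNIV (mollify bump \<epsilon> h)"
    by (simp add: bump_nonneg)
  then show ?thesis
    using has_ddir_mollify_bump[OF lipschitz_on_continuous_on[OF assms(1)] assms(2)]
    by (rule has_ddir_bound)
qed

lemma mol_deriv_lipschitz:
  fixes h :: "'a::euclidean_space \<Rightarrow> real"
  assumes "C-lipschitz_on UNIV h" "\<epsilon> > 0"
  shows "\<exists>C. C-lipschitz_on UNIV (mol_deriv \<epsilon> h w)"
  unfolding mol_deriv_def[abs_def]
  using lipschitz_on_cmult_real[OF mollify_lipschitz[OF bump_continuous(2) bump_support(2) assms(1), of w \<epsilon>]]
  by blast

text \<open>Both integrals are derivatives of a mollification, of a constant and of a linear function.\<close>

lemma integral_bump':
  fixes w :: "'a::euclidean_space"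
  shows "(\<integral>z. bump' w z \<partial>lborel) = 0"
    and "linear lf \<Longrightarrow> (\<integral>z. bump' w z * lf z \<partial>lborel) = - bump_mass TYPE('a) * lf w"
proof -
  have "has_ddir (mollify bump 1 (\<lambda>x::'a. 1)) w 0 (- (1 / 1) * mollify (bump' w) 1 (\<lambda>x. 1) 0)"
    by (intro has_ddir_mollify bump_continuous bump_support has_ddir_bump) auto
  moreover have "has_ddir (mollify bump 1 (\<lambda>x::'a. 1)) w 0 0"
    by (simp add: has_ddir_def mollify_def)
  ultimately have "- (1 / 1) * mollify (bump' w) 1 (\<lambda>x. 1) 0 = 0"
    by (metis has_ddir_imp_ddir)
  then show "(\<integral>z. bump' w z \<partial>lborel) = 0"
    by (simp add: mollify_def)
next
  assume l: "linear lf"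
  then have cont: "continuous_on UNIV lf" by (simp add: linear_continuous_on linear_conv_bounded_linear)
  have "has_ddir (mollify bump 1 lf) w 0 (- (1 / 1) * mollify (bump' w) 1 lf 0)"
    by (intro has_ddir_mollify bump_continuous bump_support has_ddir_bump cont) auto
  moreover have "has_ddir (mollify bump 1 lf) w 0 (bump_mass TYPE('a) * lf w)"
  proof -
    have int: "integrable lborel (bump :: 'a \<Rightarrow> real)"
      by (rule integrable_continuous_bounded_support[OF bump_continuous(1) bump_support(1)])
    have int2: "integrable lborel (\<lambda>z. bump z * lf z)"
      using mollify_integrable[OF bump_continuous(1) bump_support(1) cont, of 0 1] by simp
    have "mollify bump 1 lf (0 + t *\<^sub>R w) = t * (bump_mass TYPE('a) * lf w) + (\<integral>z. bump z * lf z \<partial>lborel)" for t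
    proof -
      have "mollify bump 1 lf (0 + t *\<^sub>R w) = (\<integral>z. bump z * (t * lf w) + bump z * lf z \<partial>lborel)"
        unfolding mollify_def by (simp add: linear_add[OF l] linear_cmul[OF l] distrib_left)
      also have "\<dots> = (\<integral>(z::'a). bump z * (t * lf w) \<partial>lborel) + (\<integral>z. bump z * lf z \<partial>lborel)"
        using int int2 by simp
      finally show ?thesis by simp
    qed
    then show ?thesis
      unfolding has_ddir_iff_DERIV by (auto intro!: derivative_eq_intros)
  qed
  ultimately have "- (1 / 1) * mollify (bump' w) 1 lf 0 = bump_mass TYPE('a) * lf w"
    by (metis has_ddir_imp_ddir)
  then show "(\<integral>z. bump' w z * lf z \<partial>lborel) = - bump_mass TYPE('a) * lf w"
    by (simp add: mollify_def)
qed

text \<open>The two integrals of \<open>bump'\<close> show that the formula for the derivative is exact, up to the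
  factor \<open>bump_mass\<close>, for the affine approximation of \<open>h\<close> at \<open>x\<close>. The remainder is of smaller
  order than \<open>\<epsilon>\<close> on the support of the weight, and it is divided by \<open>\<epsilon>\<close>.\<close>

lemma mol_deriv_tendsto:
  fixes h :: "'a::euclidean_space \<Rightarrow> real"
  assumes h: "continuous_on UNIV h" and d: "h differentiable (at x)"
  shows "(\<lambda>n. mol_deriv (1 / real (Suc n)) h w x) \<longlonglongrightarrow> bump_mass TYPE('a) * ddir h w x"
proof -
  define lf where "lf = frechet_derivative h (at x)"
  have hd: "(h has_derivative lf) (at x)" using d by (simp add: lf_def frechet_derivative_works)
  then have lin: "linear lf" by (meson has_derivative_bounded_linear bounded_linear.linear)
  then have contl: "continuous_on UNIV lf" by (simp add: linear_continuous_on linear_conv_bounded_linear)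
  have lw: "ddir h w x = lf w" unfolding lf_def using frechet_derivative_eq_ddir[OF d] by simp
  let ?b = "bump' w"
  let ?I = "\<integral>z. \<bar>?b z\<bar> \<partial>lborel"
  have intb: "integrable lborel ?b"
    by (rule integrable_continuous_bounded_support[OF bump_continuous(2) bump_support(2)])
  have intl: "integrable lborel (\<lambda>z. ?b z * lf z)"
    using mollify_integrable[OF bump_continuous(2) bump_support(2) contl, of w 0 1] by simp
  have b0: "?b z = 0" if "norm z > 1" for z
  proof -
    have "1 < norm z ^ 2" using that by (simp add: power2_eq_square less_1_mult)
    then show ?thesis by (simp add: bump'_def power2_norm_eq_inner)
  qed
  show ?thesis
  proof (rule LIMSEQ_I)
    fix e :: real assume e: "e > 0"
    define \<eta> where "\<eta> = e / (2 * (?I + 1))"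
    have I0: "?I \<ge> 0" by simp
    have \<eta>: "\<eta> > 0" unfolding \<eta>_def
      using e add_nonneg_pos[OF I0 zero_less_one] by (intro divide_pos_pos mult_pos_pos) simp_all
    obtain \<delta> where \<delta>: "\<delta> > 0" "\<And>y. norm (y - x) < \<delta> \<Longrightarrow> \<bar>h y - h x - lf (y - x)\<bar> \<le> \<eta> * norm (y - x)"
      using hd \<eta> unfolding has_derivative_at_alt by (metis real_norm_def)
    obtain N where N: "1 / real (Suc N) < \<delta>" using nat_approx_posE[OF \<delta>(1)] by blast
    have "norm (mol_deriv (1 / real (Suc n)) h w x - bump_mass TYPE('a) * ddir h w x) < e" if n: "n \<ge> N" for n
    proof -
      define \<epsilon> where "\<epsilon> = 1 / real (Suc n)"
      have "\<epsilon> \<le> 1 / real (Suc N)" using n by (simp add: \<epsilon>_def frac_le)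
      then have \<epsilon>: "\<epsilon> > 0" "\<epsilon> < \<delta>" using N by (auto simp: \<epsilon>_def)
      have int: "integrable lborel (\<lambda>z. ?b z * h (x + \<epsilon> *\<^sub>R z))"
        by (rule mollify_integrable[OF bump_continuous(2) bump_support(2) h])
      let ?r = "\<lambda>z. h (x + \<epsilon> *\<^sub>R z) - h x - \<epsilon> * lf z"
      have eq: "?b z * ?r z = ?b z * h (x + \<epsilon> *\<^sub>R z) - ?b z * h x - \<epsilon> * (?b z * lf z)" for z
        by (simp add: algebra_simps)
      have intr: "integrable lborel (\<lambda>z. ?b z * ?r z)"
        unfolding eq using int intb intl by simp
      have "(\<integral>z. ?b z * ?r z \<partial>lborel) = mollify ?b \<epsilon> h x - (\<integral>z. ?b z \<partial>lborel) * h x - \<epsilon> * (\<integral>z. ?b z * lf z \<partial>lborel)"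
        unfolding eq mollify_def using int intb intl by simp
      also have "\<dots> = mollify ?b \<epsilon> h x + \<epsilon> * (bump_mass TYPE('a) * lf w)"
        unfolding integral_bump'(1) integral_bump'(2)[OF lin] by simp
      finally have m: "mollify ?b \<epsilon> h x = (\<integral>z. ?b z * ?r z \<partial>lborel) - \<epsilon> * (bump_mass TYPE('a) * lf w)" by simp
      have "mol_deriv \<epsilon> h w x - bump_mass TYPE('a) * lf w = - (1 / \<epsilon>) * (\<integral>z. ?b z * ?r z \<partial>lborel)"
        unfolding mol_deriv_def m using \<epsilon> by (simp add: field_simps)
      also have "\<bar>\<dots>\<bar> = (1 / \<epsilon>) * \<bar>\<integral>z. ?b z * ?r z \<partial>lborel\<bar>" using \<epsilon> by (simp add: abs_mult)
      also have "\<bar>\<integral>z. ?b z * ?r z \<partial>lborel\<bar> \<le> (\<integral>z. \<bar>?b z\<bar> * (\<eta> * \<epsilon>) \<partial>lborel)"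
      proof (rule integral_abs_bound[THEN order_trans], rule integral_mono)
        show "integrable lborel (\<lambda>z. \<bar>?b z * ?r z\<bar>)" using intr by simp
        show "integrable lborel (\<lambda>z. \<bar>?b z\<bar> * (\<eta> * \<epsilon>))" using intb by simp
        fix z
        show "\<bar>?b z * ?r z\<bar> \<le> \<bar>?b z\<bar> * (\<eta> * \<epsilon>)"
        proof (cases "norm z \<le> 1")
          case True
          then have nz: "norm (\<epsilon> *\<^sub>R z) \<le> \<epsilon>" using \<epsilon> by (simp add: mult_left_le)
          then have "\<bar>?r z\<bar> \<le> \<eta> * norm (\<epsilon> *\<^sub>R z)"
            using \<delta>(2)[of "x + \<epsilon> *\<^sub>R z"] order.strict_trans1[OF nz \<epsilon>(2)]
            by (simp add: linear_cmul[OF lin])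
          also have "\<dots> \<le> \<eta> * \<epsilon>" using nz \<eta> by simp
          finally show ?thesis unfolding abs_mult by (rule mult_left_mono) simp
        qed (use b0 in simp)
      qed
      also have "\<dots> = ?I * \<eta> * \<epsilon>" by simp
      finally have "\<bar>mol_deriv \<epsilon> h w x - bump_mass TYPE('a) * lf w\<bar> \<le> (1 / \<epsilon>) * (?I * \<eta> * \<epsilon>)"
        using \<epsilon> by (simp add: divide_right_mono)
      also have "\<dots> = ?I * \<eta>" using \<epsilon> by simp
      also have "\<dots> \<le> (?I + 1) * \<eta>" using \<eta> by (intro mult_right_mono) auto
      also have "\<dots> = e / 2"
      proof -
        have "J * (e / (2 * J)) = e / 2" if "J > 0" for J :: real
          using that by simp
        from this[OF add_nonneg_pos[OF I0 zero_less_one]] show ?thesis unfolding \<eta>_def .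
      qed
      also have "\<dots> < e" using e by simp
      finally show ?thesis by (simp add: \<epsilon>_def lw)
    qed
    then show "\<exists>N. \<forall>n\<ge>N. norm (mol_deriv (1 / real (Suc n)) h w x - bump_mass TYPE('a) * ddir h w x) < e"
      by blast
  qed
qed

lemma lipschitz_bounded_support_bound:
  fixes h :: "'a::euclidean_space \<Rightarrow> real"
  assumes "C-lipschitz_on UNIV h" "bounded {x. h x \<noteq> 0}"
  obtains R where "0 \<le> R" "\<And>x. R < norm x \<Longrightarrow> h x = 0" "\<And>x w. R < norm x \<Longrightarrow> ddir h w x = 0"
proof -
  obtain B R where BR: "0 \<le> B" "0 \<le> R" "\<And>x. \<bar>h x\<bar> \<le> B * indicator (cball 0 R) x"
    using bounded_support_imp_bounded_fun[OF lipschitz_on_continuous_on[OF assms(1)] assms(2)] by blast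
  have z: "h x = 0" if "R < norm x" for x
    using BR(3)[of x] that by simp
  have "has_ddir h w x 0" if x: "R < norm x" for x w
  proof -
    have "open {y::'a. R < norm y}" by (intro open_Collect_less continuous_intros)
    then have "(h has_derivative (\<lambda>v. 0)) (at x)"
      by (rule has_derivative_transform_within_open[OF has_derivative_const[of 0]]) (use z x in auto)
    then show ?thesis by (rule has_derivative_imp_has_ddir)
  qed
  then show ?thesis using that[of R] BR(2) z by (auto simp: has_ddir_imp_ddir)
qed

text \<open>The discrete version, for difference quotients, is a translation of the variable.\<close>

lemma integral_by_parts_ddir:
  fixes h G :: "'a::euclidean_space \<Rightarrow> real"
  assumes h: "C-lipschitz_on UNIV h" "bounded {x. h x \<noteq> 0}"
    and G: "D-lipschitz_on UNIV G" "\<And>x. \<bar>G x\<bar> \<le> B" and dG: "\<And>x. has_ddir G w x (G' x)"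
  shows "integrable lborel (\<lambda>x. ddir h w x * G x)" "integrable lborel (\<lambda>x. h x * G' x)"
    and "(\<integral>x. ddir h w x * G x \<partial>lborel) = - (\<integral>x. h x * G' x \<partial>lborel)"
proof -
  obtain R where R: "0 \<le> R" "\<And>x. R < norm x \<Longrightarrow> h x = 0" "\<And>x w. R < norm x \<Longrightarrow> ddir h w x = 0"
    using lipschitz_bounded_support_bound[OF h] by blast
  have conth: "continuous_on UNIV h" and contG: "continuous_on UNIV G"
    using h(1) G(1) lipschitz_on_continuous_on by blast+
  have [measurable]: "h \<in> borel_measurable borel" "G \<in> borel_measurable borel"
    using conth contG by (auto intro: borel_measurable_continuous_onI)
  note [measurable] = ddir_measurable[OF conth] ddir_measurable[OF contG]
  have G'eq: "G' = ddir G w" using has_ddir_imp_ddir[OF dG] by auto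
  have C: "C \<ge> 0" and D: "D \<ge> 0" using h(1) G(1) lipschitz_on_nonneg by blast+
  have B: "B \<ge> 0" using G(2)[of 0] by linarith
  obtain H R1 where H: "0 \<le> H" "\<And>x. \<bar>h x\<bar> \<le> H * indicator (cball 0 R1) x"
    using bounded_support_imp_bounded_fun[OF conth h(2)] by metis
  have H': "\<bar>h x\<bar> \<le> H" for x using H(1) H(2)[of x] by (cases "x \<in> cball 0 R1") auto
  define \<tau> where "\<tau> n = 1 / real (Suc n)" for n
  have \<tau>: "\<tau> n > 0" "\<tau> n \<le> 1" for n by (auto simp: \<tau>_def)
  let ?A = "\<lambda>n x. (h (x + \<tau> n *\<^sub>R w) - h x) / \<tau> n * G x"
  let ?B = "\<lambda>n x. h x * ((G (x + \<tau> n *\<^sub>R ((- 1) *\<^sub>R w)) - G x) / \<tau> n)"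
  let ?S = "\<lambda>c x::'a. indicator (cball 0 (R + norm w)) x * c :: real"
  have intS: "integrable lborel (?S c)" for c
    using emeasure_bounded_finite[OF bounded_cball[of "0::'a" "R + norm w"]]
    by (intro integrable_mult_left integrable_real_indicator) auto
  have A: "integrable lborel (\<lambda>x. ddir h w x * G x) \<and> (\<lambda>n. \<integral>x. ?A n x \<partial>lborel) \<longlonglongrightarrow> (\<integral>x. ddir h w x * G x \<partial>lborel)"
  proof (rule dominated_convergence[OF _ _ intS[of "C * norm w * B"]])
    show "AE x in lborel. (\<lambda>n. ?A n x) \<longlonglongrightarrow> ddir h w x * G x"
      using AE_has_ddir[OF h(1), of w]
    proof eventually_elim
      case (elim x)
      show ?case using has_ddir_LIMSEQ[OF elim] unfolding \<tau>_def by (rule tendsto_mult_right)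
    qed
    show "AE x in lborel. \<bar>?A n x\<bar> \<le> ?S (C * norm w * B) x" for n
    proof (rule AE_I2)
      fix x
      show "\<bar>?A n x\<bar> \<le> ?S (C * norm w * B) x"
      proof (cases "norm x \<le> R + norm w")
        case True
        have "\<bar>(h (x + \<tau> n *\<^sub>R w) - h x) / \<tau> n\<bar> \<le> C * norm w"
          using lipschitz_onD[OF h(1), of "x + \<tau> n *\<^sub>R w" x] \<tau>(1)[of n]
          by (simp add: dist_norm pos_divide_le_eq mult.assoc mult.commute mult.left_commute)
        then have "\<bar>(h (x + \<tau> n *\<^sub>R w) - h x) / \<tau> n\<bar> * \<bar>G x\<bar> \<le> C * norm w * B"
          using G(2)[of x] C by (intro mult_mono) auto
        then show ?thesis using True by (simp only: abs_mult) simp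
      next
        case False
        have "norm (\<tau> n *\<^sub>R w) \<le> norm w" using \<tau>[of n] by (simp add: mult_left_le_one_le)
        moreover have "norm x \<le> norm (x + \<tau> n *\<^sub>R w) + norm (\<tau> n *\<^sub>R w)"
          using norm_triangle_ineq4[of "x + \<tau> n *\<^sub>R w" "\<tau> n *\<^sub>R w"] by simp
        ultimately have "R < norm (x + \<tau> n *\<^sub>R w)" "R < norm x"
          using False norm_ge_zero[of w] by linarith+
        then show ?thesis using False R(2) by simp
      qed
    qed
  qed measurable
  have B: "integrable lborel (\<lambda>x. h x * - G' x) \<and> (\<lambda>n. \<integral>x. ?B n x \<partial>lborel) \<longlonglongrightarrow> (\<integral>x. h x * - G' x \<partial>lborel)"
  proof (rule dominated_convergence[OF _ _ intS[of "H * (D * norm w)"]])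
    show "AE x in lborel. (\<lambda>n. ?B n x) \<longlonglongrightarrow> h x * - G' x"
    proof (rule AE_I2)
      fix x
      have "has_ddir G ((- 1) *\<^sub>R w) x (- 1 * G' x)" by (rule has_ddir_scale[OF dG])
      from has_ddir_LIMSEQ[OF this] show "(\<lambda>n. ?B n x) \<longlonglongrightarrow> h x * - G' x"
        unfolding \<tau>_def by (intro tendsto_mult_left) simp
    qed
    show "AE x in lborel. \<bar>?B n x\<bar> \<le> ?S (H * (D * norm w)) x" for n
    proof (rule AE_I2)
      fix x
      show "\<bar>?B n x\<bar> \<le> ?S (H * (D * norm w)) x"
      proof (cases "norm x \<le> R + norm w")
        case True
        have "\<bar>(G (x + \<tau> n *\<^sub>R ((- 1) *\<^sub>R w)) - G x) / \<tau> n\<bar> \<le> D * norm w"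
          using lipschitz_onD[OF G(1), of "x + \<tau> n *\<^sub>R ((- 1) *\<^sub>R w)" x] \<tau>(1)[of n]
          by (simp add: dist_norm pos_divide_le_eq mult.assoc mult.commute mult.left_commute)
        then have "\<bar>h x\<bar> * \<bar>(G (x + \<tau> n *\<^sub>R ((- 1) *\<^sub>R w)) - G x) / \<tau> n\<bar> \<le> H * (D * norm w)"
          using H' H(1) by (intro mult_mono) auto
        then show ?thesis using True by (simp only: abs_mult) simp
      next
        case False
        then have "R < norm x" using norm_ge_zero[of w] by linarith
        then show ?thesis using False R(2) by simp
      qed
    qed
  qed (simp_all add: G'eq)
  have AB: "(\<lambda>n. \<integral>x. ?A n x \<partial>lborel) = (\<lambda>n. \<integral>x. ?B n x \<partial>lborel)"
  proof
    fix n
    let ?u = "\<tau> n *\<^sub>R w"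
    have i0: "integrable lborel (\<lambda>x. h x * G x)"
      by (rule integrable_continuous_bounded_support)
        (auto intro!: continuous_intros conth contG intro: bounded_subset[OF h(2)])
    have i2: "integrable lborel (\<lambda>x. h x * G (x - ?u))"
      by (rule integrable_continuous_bounded_support)
        (auto intro!: continuous_intros conth continuous_on_compose2[OF contG] intro: bounded_subset[OF h(2)])
    have bs: "bounded {x. h (x + ?u) \<noteq> 0}"
    proof -
      have "bounded ((\<lambda>z. z - ?u) ` {x. h x \<noteq> 0})" using h(2) by (rule bounded_translation_minus)
      moreover have "(\<lambda>z. z - ?u) ` {x. h x \<noteq> 0} = {z. h (z + ?u) \<noteq> 0}"
        by (auto simp: image_iff intro!: exI[of _ "_ + ?u"])
      ultimately show ?thesis by simp
    qed
    have i1: "integrable lborel (\<lambda>x. h (x + ?u) * G x)"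
      by (rule integrable_continuous_bounded_support)
        (auto intro!: continuous_intros continuous_on_compose2[OF conth] contG intro: bounded_subset[OF bs])
    have tr: "(\<integral>x. h (x + ?u) * G x \<partial>lborel) = (\<integral>x. h x * G (x - ?u) \<partial>lborel)"
      using lborel_integral_translate[of "\<lambda>x. h x * G (x - ?u)" ?u] by (simp add: add.commute)
    have "(\<integral>x. ?A n x \<partial>lborel) = ((\<integral>x. h (x + ?u) * G x \<partial>lborel) - (\<integral>x. h x * G x \<partial>lborel)) / \<tau> n"
      using i0 i1 by (simp add: left_diff_distrib)
    also have "\<dots> = (\<integral>x. ?B n x \<partial>lborel)"
      unfolding tr using i0 i2 by (simp add: right_diff_distrib)
    finally show "(\<integral>x. ?A n x \<partial>lborel) = (\<integral>x. ?B n x \<partial>lborel)" .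
  qed
  show "integrable lborel (\<lambda>x. ddir h w x * G x)" using A by simp
  show "integrable lborel (\<lambda>x. h x * G' x)" using B by simp
  have "(\<lambda>n. \<integral>x. ?A n x \<partial>lborel) \<longlonglongrightarrow> (\<integral>x. h x * - G' x \<partial>lborel)"
    by (subst AB) (use B in blast)
  with A show "(\<integral>x. ddir h w x * G x \<partial>lborel) = - (\<integral>x. h x * G' x \<partial>lborel)"
    using LIMSEQ_unique by fastforce
qed

lemma sum_sign_symmetric_eq_0:
  fixes F :: "('i \<Rightarrow> 'i) \<Rightarrow> real"
  assumes S: "finite S" "a \<in> S" "b \<in> S" "a \<noteq> b"
    and F: "\<And>\<pi>. \<pi> permutes S \<Longrightarrow> F (\<pi> \<circ> Transposition.transpose a b) = F \<pi>"
  shows "(\<Sum>\<pi> | \<pi> permutes S. of_int (sign \<pi>) * F \<pi>) = 0"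
proof -
  have t: "Transposition.transpose a b permutes S" using S by (intro permutes_swap_id)
  let ?X = "\<Sum>\<pi> | \<pi> permutes S. of_int (sign \<pi>) * F \<pi>"
  have "?X = (\<Sum>\<pi> | \<pi> permutes S. of_int (sign (\<pi> \<circ> Transposition.transpose a b)) * F (\<pi> \<circ> Transposition.transpose a b))"
    by (rule sum_permutations_compose_right[OF t])
  also have "\<dots> = (\<Sum>\<pi> | \<pi> permutes S. - (of_int (sign \<pi>) * F \<pi>))"
  proof (rule sum.cong[OF refl])
    fix \<pi> assume "\<pi> \<in> {\<pi>. \<pi> permutes S}"
    then have p: "\<pi> permutes S" by simp
    have "sign (\<pi> \<circ> Transposition.transpose a b) = sign \<pi> * sign (Transposition.transpose a b)"
      using p t S(1) by (intro sign_compose permutes_imp_permutation[OF S(1)])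
    then show "of_int (sign (\<pi> \<circ> Transposition.transpose a b)) * F (\<pi> \<circ> Transposition.transpose a b) = - (of_int (sign \<pi>) * F \<pi>)"
      using F[OF p] S(4) by (simp add: sign_swap_id)
  qed
  also have "\<dots> = - ?X" by (simp add: sum_negf)
  finally show ?thesis by simp
qed

section \<open>Antisymmetrised products of derivatives\<close>

lemma lipschitz_on_mult_bounded:
  fixes f g :: "'a::metric_space \<Rightarrow> real"
  assumes "C-lipschitz_on S f" "D-lipschitz_on S g" "\<And>x. x \<in> S \<Longrightarrow> \<bar>f x\<bar> \<le> A" "\<And>x. x \<in> S \<Longrightarrow> \<bar>g x\<bar> \<le> B"
    and "0 \<le> A" "0 \<le> B"
  shows "(C * B + A * D)-lipschitz_on S (\<lambda>x. f x * g x)"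
proof (rule lipschitz_onI)
  fix x y assume xy: "x \<in> S" "y \<in> S"
  have "\<bar>f x * g x - f y * g y\<bar> = \<bar>(f x - f y) * g x + f y * (g x - g y)\<bar>" by (simp add: algebra_simps)
  also have "\<dots> \<le> \<bar>f x - f y\<bar> * \<bar>g x\<bar> + \<bar>f y\<bar> * \<bar>g x - g y\<bar>"
    by (rule order_trans[OF abs_triangle_ineq]) (simp add: abs_mult)
  also have "\<dots> \<le> (C * dist x y) * B + A * (D * dist x y)"
    using lipschitz_onD[OF assms(1) xy] lipschitz_onD[OF assms(2) xy] assms(3-6) xy
      lipschitz_on_nonneg[OF assms(1)]
    by (intro add_mono mult_mono) (auto simp: dist_real_def)
  finally show "dist (f x * g x) (f y * g y) \<le> (C * B + A * D) * dist x y"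
    by (simp add: dist_real_def algebra_simps)
qed (use assms lipschitz_on_nonneg[OF assms(1)] lipschitz_on_nonneg[OF assms(2)] in simp)

lemma lipschitz_on_prod_bounded:
  fixes f :: "'i \<Rightarrow> 'a::metric_space \<Rightarrow> real"
  assumes "finite I" "\<And>i. i \<in> I \<Longrightarrow> \<exists>C. C-lipschitz_on S (f i)"
    and "\<And>i x. i \<in> I \<Longrightarrow> x \<in> S \<Longrightarrow> \<bar>f i x\<bar> \<le> B i" "\<And>i. i \<in> I \<Longrightarrow> 0 \<le> B i"
  shows "\<exists>C. C-lipschitz_on S (\<lambda>x. \<Prod>i\<in>I. f i x)"
  using assms
proof (induction I)
  case empty
  then show ?case by (auto intro: lipschitz_on_constant)
next
  case (insert i I)
  obtain C where C: "C-lipschitz_on S (\<lambda>x. \<Prod>i\<in>I. f i x)" using insert by auto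
  obtain D where D: "D-lipschitz_on S (f i)" using insert.prems(1) by auto
  have b: "\<bar>\<Prod>i\<in>I. f i x\<bar> \<le> (\<Prod>i\<in>I. B i)" if "x \<in> S" for x
    unfolding abs_prod using insert.prems that by (intro prod_mono) auto
  have "0 \<le> (\<Prod>i\<in>I. B i)" using insert.prems by (intro prod_nonneg) auto
  then show ?case
    using lipschitz_on_mult_bounded[OF D C, of "B i" "\<Prod>i\<in>I. B i"] b insert by auto
qed

text \<open>Here \<open>h\<^sub>1, \<dots>, h\<^sub>k\<close> are mollified. After integration by parts, the product rule produces terms
  with one second derivative, in the directions \<open>w (\<pi> 0)\<close> and \<open>w (\<pi> i)\<close>. Composing \<open>\<pi>\<close> with the
  transposition of \<open>0\<close> and \<open>i\<close> leaves such a term unchanged and reverses its sign in the sum.\<close>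

lemma antisymmetrized_ddir_integral_zero:
  fixes h :: "nat \<Rightarrow> 'a::euclidean_space \<Rightarrow> real" and w :: "nat \<Rightarrow> 'a"
  assumes h: "\<And>j. j \<le> k \<Longrightarrow> C-lipschitz_on UNIV (h j)" and supp: "bounded {x. h 0 x \<noteq> 0}"
  shows "has_bochner_integral lborel
    (\<lambda>x. \<Sum>\<pi> | \<pi> permutes {..k}. of_int (sign \<pi>) *
       (ddir (h 0) (w (\<pi> 0)) x * (\<Prod>j\<in>{1..k}. ddir (h j) (w (\<pi> j)) x))) 0"
proof -
  let ?P = "{\<pi>. \<pi> permutes {..k}}"
  have finP: "finite ?P" by (rule finite_permutations) simp
  define m where "m = bump_mass TYPE('a)"
  have m: "m > 0" unfolding m_def by (rule integral_bump_pos)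
  have C: "C \<ge> 0" using h[of 0] lipschitz_on_nonneg by blast
  have cont: "continuous_on UNIV (h j)" if "j \<le> k" for j
    using h[OF that] by (rule lipschitz_on_continuous_on)
  have [measurable]: "ddir (h j) v \<in> borel_measurable borel" if "j \<le> k" for j v
    using cont[OF that] by (rule ddir_measurable)
  define \<epsilon> where "\<epsilon> n = 1 / real (Suc n)" for n
  have \<epsilon>: "\<epsilon> n > 0" for n by (simp add: \<epsilon>_def)
  define T where "T n j v x = mol_deriv (\<epsilon> n) (h j) v x" for n j v x
  define S where "S n j v u x = mol_deriv2 (\<epsilon> n) (h j) v u x" for n j v u x
  have S_comm: "S n j v u x = S n j u v x" for n j v u x
    unfolding S_def using mol_deriv2_commute[of "\<epsilon> n" "h j" v u] by simp
  define B where "B \<pi> j = C * m * norm (w (\<pi> j))" for \<pi> :: "nat \<Rightarrow> nat" and j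
  have B0: "B \<pi> j \<ge> 0" for \<pi> j using C m by (simp add: B_def)
  have TB: "\<bar>T n j (w (\<pi> j)) x\<bar> \<le> B \<pi> j" if "j \<le> k" for n j \<pi> x
    unfolding T_def B_def m_def by (rule mol_deriv_bound[OF h[OF that] \<epsilon>])
  define G where "G \<pi> n x = (\<Prod>j\<in>{1..k}. T n j (w (\<pi> j)) x)" for \<pi> :: "nat \<Rightarrow> nat" and n x
  define G' where "G' \<pi> n x = (\<Sum>i\<in>{1..k}. S n i (w (\<pi> i)) (w (\<pi> 0)) x *
      (\<Prod>j\<in>{1..k} - {i}. T n j (w (\<pi> j)) x))" for \<pi> :: "nat \<Rightarrow> nat" and n x
  have Tlip: "\<exists>D. D-lipschitz_on UNIV (T n j v)" if "j \<le> k" for n j v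
    unfolding T_def by (rule mol_deriv_lipschitz[OF h[OF that] \<epsilon>])
  have GB: "\<bar>G \<pi> n x\<bar> \<le> (\<Prod>j\<in>{1..k}. B \<pi> j)" for \<pi> n x
    unfolding G_def abs_prod using TB by (intro prod_mono) auto
  have Glip: "\<exists>D. D-lipschitz_on UNIV (G \<pi> n)" for \<pi> n
    unfolding G_def using Tlip TB B0 by (intro lipschitz_on_prod_bounded[where B="B \<pi>"]) auto
  have dT: "has_ddir (T n j v) u x (S n j v u x)" if "j \<le> k" for n j v u x
    unfolding T_def S_def by (rule has_ddir_mol_deriv[OF cont[OF that] \<epsilon>])
  have dG: "has_ddir (G \<pi> n) (w (\<pi> 0)) x (G' \<pi> n x)" for \<pi> n x
  proof -
    have "((\<lambda>t. \<Prod>j\<in>{1..k}. T n j (w (\<pi> j)) (x + t *\<^sub>R w (\<pi> 0))) has_real_derivative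
        (\<Sum>i\<in>{1..k}. S n i (w (\<pi> i)) (w (\<pi> 0)) x *
          (\<Prod>j\<in>{1..k} - {i}. T n j (w (\<pi> j)) (x + 0 *\<^sub>R w (\<pi> 0))))) (at 0)"
      by (rule has_field_derivative_prod) (use dT in \<open>simp add: has_ddir_iff_DERIV\<close>)
    then show ?thesis unfolding has_ddir_iff_DERIV G_def G'_def by simp
  qed
  have ibp: "integrable lborel (\<lambda>x. ddir (h 0) (w (\<pi> 0)) x * G \<pi> n x)"
      "integrable lborel (\<lambda>x. h 0 x * G' \<pi> n x)"
      "(\<integral>x. ddir (h 0) (w (\<pi> 0)) x * G \<pi> n x \<partial>lborel) = - (\<integral>x. h 0 x * G' \<pi> n x \<partial>lborel)" for \<pi> n
  proof -
    obtain D where D: "D-lipschitz_on UNIV (G \<pi> n)" using Glip by blast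
    note * = integral_by_parts_ddir[OF h[of 0] supp D GB dG, simplified]
    show "integrable lborel (\<lambda>x. ddir (h 0) (w (\<pi> 0)) x * G \<pi> n x)"
      "integrable lborel (\<lambda>x. h 0 x * G' \<pi> n x)"
      "(\<integral>x. ddir (h 0) (w (\<pi> 0)) x * G \<pi> n x \<partial>lborel) = - (\<integral>x. h 0 x * G' \<pi> n x \<partial>lborel)"
      by (rule *)+
  qed
  (* the symmetry of second derivatives *)
  have cancel: "(\<Sum>\<pi>\<in>?P. of_int (sign \<pi>) * G' \<pi> n x) = 0" for n x
  proof -
    let ?F = "\<lambda>i \<pi>. S n i (w (\<pi> i)) (w (\<pi> 0)) x * (\<Prod>j\<in>{1..k} - {i}. T n j (w (\<pi> j)) x)"
    have "(\<Sum>\<pi>\<in>?P. of_int (sign \<pi>) * ?F i \<pi>) = 0" if i: "i \<in> {1..k}" for i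
    proof (rule sum_sign_symmetric_eq_0[of "{..k}" 0 i])
      fix \<pi> :: "nat \<Rightarrow> nat"
      have "(\<Prod>j\<in>{1..k} - {i}. T n j (w ((\<pi> \<circ> Transposition.transpose 0 i) j)) x) =
          (\<Prod>j\<in>{1..k} - {i}. T n j (w (\<pi> j)) x)"
        by (rule prod.cong[OF refl]) (auto simp: transpose_def)
      moreover have "S n i (w ((\<pi> \<circ> Transposition.transpose 0 i) i)) (w ((\<pi> \<circ> Transposition.transpose 0 i) 0)) x =
          S n i (w (\<pi> i)) (w (\<pi> 0)) x"
        using i S_comm[of n i "w (\<pi> 0)" "w (\<pi> i)" x] by simp
      ultimately show "?F i (\<pi> \<circ> Transposition.transpose 0 i) = ?F i \<pi>" by simp
    qed (use i in auto)
    then have "(\<Sum>i\<in>{1..k}. \<Sum>\<pi>\<in>?P. of_int (sign \<pi>) * ?F i \<pi>) = 0" by (intro sum.neutral) blast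
    also have "(\<Sum>i\<in>{1..k}. \<Sum>\<pi>\<in>?P. of_int (sign \<pi>) * ?F i \<pi>) = (\<Sum>\<pi>\<in>?P. of_int (sign \<pi>) * G' \<pi> n x)"
      unfolding G'_def sum_distrib_left by (rule sum.swap)
    finally show ?thesis .
  qed
  define J where "J n x = (\<Sum>\<pi>\<in>?P. of_int (sign \<pi>) * (ddir (h 0) (w (\<pi> 0)) x * G \<pi> n x))" for n x
  define J' where "J' x = (\<Sum>\<pi>\<in>?P. of_int (sign \<pi>) *
      (ddir (h 0) (w (\<pi> 0)) x * (\<Prod>j\<in>{1..k}. ddir (h j) (w (\<pi> j)) x)))" for x
  have J0: "(\<integral>x. J n x \<partial>lborel) = 0" for n
  proof -
    have "(\<integral>x. J n x \<partial>lborel) = (\<Sum>\<pi>\<in>?P. of_int (sign \<pi>) * (\<integral>x. ddir (h 0) (w (\<pi> 0)) x * G \<pi> n x \<partial>lborel))"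
      unfolding J_def using ibp(1) by (subst Bochner_Integration.integral_sum) auto
    also have "\<dots> = - (\<Sum>\<pi>\<in>?P. of_int (sign \<pi>) * (\<integral>x. h 0 x * G' \<pi> n x \<partial>lborel))"
      unfolding ibp(3) by (simp add: sum_negf)
    also have "(\<Sum>\<pi>\<in>?P. of_int (sign \<pi>) * (\<integral>x. h 0 x * G' \<pi> n x \<partial>lborel)) =
        (\<integral>x. (\<Sum>\<pi>\<in>?P. of_int (sign \<pi>) * (h 0 x * G' \<pi> n x)) \<partial>lborel)"
      using ibp(2) by (subst Bochner_Integration.integral_sum) auto
    also have "\<dots> = (\<integral>x. h 0 x * (\<Sum>\<pi>\<in>?P. of_int (sign \<pi>) * G' \<pi> n x) \<partial>lborel)"
      by (intro Bochner_Integration.integral_cong refl) (simp add: sum_distrib_left mult.left_commute)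
    finally show ?thesis unfolding cancel by simp
  qed
  obtain R where R: "0 \<le> R" "\<And>x. R < norm x \<Longrightarrow> h 0 x = 0" "\<And>x w. R < norm x \<Longrightarrow> ddir (h 0) w x = 0"
    using lipschitz_bounded_support_bound[OF h[of 0] supp] by blast
  define K where "K = (\<Sum>\<pi>\<in>?P. C * norm (w (\<pi> 0)) * (\<Prod>j\<in>{1..k}. B \<pi> j))"
  have lim: "integrable lborel (\<lambda>x. m ^ k * J' x) \<and> (\<lambda>n. \<integral>x. J n x \<partial>lborel) \<longlonglongrightarrow> (\<integral>x. m ^ k * J' x \<partial>lborel)"
  proof (rule dominated_convergence)
    show "(\<lambda>x. m ^ k * J' x) \<in> borel_measurable lborel"
      unfolding J'_def by measurable (auto intro: cont)
    have [measurable]: "G \<pi> n \<in> borel_measurable borel" for \<pi> n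
      using Glip[of \<pi> n] by (auto intro: borel_measurable_continuous_onI lipschitz_on_continuous_on)
    show "J n \<in> borel_measurable lborel" for n
      unfolding J_def[abs_def] by measurable (auto intro: cont)
    show "integrable lborel (\<lambda>x::'a. indicator (cball 0 R) x * K)"
      using emeasure_bounded_finite[OF bounded_cball[of "0::'a" R]]
      by (intro integrable_mult_left integrable_real_indicator) auto
    have "AE x in lborel. \<forall>j\<in>{1..k}. h j differentiable (at x)"
      using rademacher_real[OF h] by (intro AE_finite_allI) auto
    then show "AE x in lborel. (\<lambda>n. J n x) \<longlonglongrightarrow> m ^ k * J' x"
    proof eventually_elim
      case (elim x)
      have "(\<lambda>n. G \<pi> n x) \<longlonglongrightarrow> (\<Prod>j\<in>{1..k}. m * ddir (h j) (w (\<pi> j)) x)" for \<pi>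
        unfolding G_def
      proof (rule tendsto_prod)
        fix j assume j: "j \<in> {1..k}"
        then show "(\<lambda>n. T n j (w (\<pi> j)) x) \<longlonglongrightarrow> m * ddir (h j) (w (\<pi> j)) x"
          unfolding T_def \<epsilon>_def m_def using elim by (intro mol_deriv_tendsto cont) auto
      qed
      then have "(\<lambda>n. J n x) \<longlonglongrightarrow> (\<Sum>\<pi>\<in>?P. of_int (sign \<pi>) *
          (ddir (h 0) (w (\<pi> 0)) x * (\<Prod>j\<in>{1..k}. m * ddir (h j) (w (\<pi> j)) x)))"
        unfolding J_def by (intro tendsto_sum tendsto_mult tendsto_const)
      also have "(\<Sum>\<pi>\<in>?P. of_int (sign \<pi>) *
          (ddir (h 0) (w (\<pi> 0)) x * (\<Prod>j\<in>{1..k}. m * ddir (h j) (w (\<pi> j)) x))) = m ^ k * J' x"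
        unfolding J'_def prod.distrib by (simp add: sum_distrib_left mult_ac)
      finally show ?case .
    qed
    have "AE x in lborel. \<forall>\<pi>\<in>?P. has_ddir (h 0) (w (\<pi> 0)) x (ddir (h 0) (w (\<pi> 0)) x)"
      using AE_has_ddir[OF h] finP by (intro AE_finite_allI) auto
    then show "AE x in lborel. \<bar>J n x\<bar> \<le> indicator (cball 0 R) x * K" for n
    proof eventually_elim
      case (elim x)
      show ?case
      proof (cases "R < norm x")
        case True
        then show ?thesis by (simp add: J_def R(3))
      next
        case False
        have "\<bar>J n x\<bar> \<le> (\<Sum>\<pi>\<in>?P. \<bar>of_int (sign \<pi>) * (ddir (h 0) (w (\<pi> 0)) x * G \<pi> n x)\<bar>)"
          unfolding J_def by (rule sum_abs)
        also have "\<dots> \<le> K"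
          unfolding K_def
        proof (rule sum_mono)
          fix \<pi> assume p: "\<pi> \<in> ?P"
          have "\<bar>ddir (h 0) (w (\<pi> 0)) x\<bar> * \<bar>G \<pi> n x\<bar> \<le> C * norm (w (\<pi> 0)) * (\<Prod>j\<in>{1..k}. B \<pi> j)"
            using has_ddir_bound[OF h[of 0]] elim p GB C by (intro mult_mono) auto
          moreover have "\<bar>of_int (sign \<pi>) :: real\<bar> = 1"
            by (simp add: sign_def)
          ultimately show "\<bar>of_int (sign \<pi>) * (ddir (h 0) (w (\<pi> 0)) x * G \<pi> n x)\<bar> \<le> C * norm (w (\<pi> 0)) * (\<Prod>j\<in>{1..k}. B \<pi> j)"
            by (simp add: abs_mult)
        qed
        finally show ?thesis using False by simp
      qed
    qed
  qed
  then have "integrable lborel (\<lambda>x. m ^ k * J' x)" "(\<integral>x. m ^ k * J' x \<partial>lborel) = 0"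
    unfolding J0 by (auto simp: LIMSEQ_const_iff)
  then have "has_bochner_integral lborel (\<lambda>x. (1 / m ^ k) * (m ^ k * J' x)) ((1 / m ^ k) * 0)"
    by (intro has_bochner_integral_mult_right) (auto simp: has_bochner_integral_iff)
  then have "has_bochner_integral lborel J' 0" using m by simp
  then show ?thesis unfolding J'_def .
qed

section \<open>Extension of Lipschitz functions\<close>

text \<open>McShane's extension, the infimum of the cones above the graph.\<close>

lemma lipschitz_extension_real:
  fixes f :: "'a::metric_space \<Rightarrow> real"
  assumes "C-lipschitz_on S f"
  obtains g where "C-lipschitz_on UNIV g" "\<And>x. x \<in> S \<Longrightarrow> g x = f x"
proof (cases "S = {}")
  case True
  then show ?thesis using that[of "\<lambda>_. 0"] assms lipschitz_on_nonneg lipschitz_on_constant lipschitz_on_le by (metis empty_iff)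
next
  case False
  have C: "C \<ge> 0" using assms by (rule lipschitz_on_nonneg)
  have fC: "f y \<le> f z + C * dist y z" if "y \<in> S" "z \<in> S" for y z
    using lipschitz_onD[OF assms that] by (simp add: dist_real_def abs_le_iff)
  define g where "g x = (INF y\<in>S. f y + C * dist x y)" for x
  have tri: "C * dist y z \<le> C * dist x y + C * dist x z" for x y z
    using mult_left_mono[OF dist_triangle3[of y z x] C] by (simp add: distrib_left)
  have bdd: "bdd_below ((\<lambda>y. f y + C * dist x y) ` S)" for x
  proof -
    obtain y0 where y0: "y0 \<in> S" using False by blast
    have "f y0 - C * dist x y0 \<le> f y + C * dist x y" if "y \<in> S" for y
      using fC[OF y0 that] tri[of y0 y x] by linarith
    then show ?thesis by (intro bdd_belowI2) auto
  qed
  have le: "g x \<le> g x' + C * dist x x'" for x x'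
  proof -
    have "g x - C * dist x x' \<le> f y + C * dist x' y" if "y \<in> S" for y
    proof -
      have "g x \<le> f y + C * dist x y" unfolding g_def by (rule cINF_lower[OF bdd that])
      then show ?thesis using tri[of x y x'] by (simp add: dist_commute)
    qed
    then have "g x - C * dist x x' \<le> g x'" unfolding g_def[of x'] by (intro cINF_greatest False)
    then show ?thesis by simp
  qed
  show ?thesis
  proof (rule that[of g])
    show "C-lipschitz_on UNIV g"
    proof (rule lipschitz_onI[OF _ C])
      fix x y show "dist (g x) (g y) \<le> C * dist x y"
        using le[of x y] le[of y x] by (simp add: dist_real_def abs_le_iff dist_commute)
    qed
    fix x assume x: "x \<in> S"
    have "g x \<le> f x + C * dist x x" unfolding g_def by (rule cINF_lower[OF bdd x])
    moreover have "f x \<le> g x" unfolding g_def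
      using fC[OF x] by (intro cINF_greatest False)
    ultimately show "g x = f x" by simp
  qed
qed

lemma lipschitz_extension:
  fixes f :: "'a::metric_space \<Rightarrow> 'b::euclidean_space"
  assumes "C-lipschitz_on S f"
  obtains D g where "D-lipschitz_on UNIV g" "\<And>x. x \<in> S \<Longrightarrow> g x = f x"
proof -
  have C: "C \<ge> 0" using assms by (rule lipschitz_on_nonneg)
  have "\<exists>g. C-lipschitz_on UNIV g \<and> (\<forall>x\<in>S. g x = f x \<bullet> b)" if b: "b \<in> Basis" for b
  proof -
    have "C-lipschitz_on S (\<lambda>x. f x \<bullet> b)"
    proof (rule lipschitz_onI[OF _ C])
      fix x y assume xy: "x \<in> S" "y \<in> S"
      have "\<bar>(f x - f y) \<bullet> b\<bar> \<le> norm (f x - f y)" using b by (rule Basis_le_norm)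
      then show "dist (f x \<bullet> b) (f y \<bullet> b) \<le> C * dist x y"
        using lipschitz_onD[OF assms xy] by (simp add: dist_real_def dist_norm inner_diff_left)
    qed
    then show ?thesis by (rule lipschitz_extension_real) blast
  qed
  then obtain G where G: "\<And>b. b \<in> Basis \<Longrightarrow> C-lipschitz_on UNIV (G b)"
      "\<And>b x. b \<in> Basis \<Longrightarrow> x \<in> S \<Longrightarrow> G b x = f x \<bullet> b" by metis
  define g where "g x = (\<Sum>b\<in>Basis. G b x *\<^sub>R b)" for x
  show ?thesis
  proof (rule that[of "real DIM('b) * C" g])
    show "(real DIM('b) * C)-lipschitz_on UNIV g"
    proof (rule lipschitz_onI)
      fix x y
      have "dist (g x) (g y) = norm (\<Sum>b\<in>Basis. (G b x - G b y) *\<^sub>R b)"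
        by (simp add: g_def dist_norm sum_subtractf scaleR_diff_left)
      also have "\<dots> \<le> (\<Sum>b\<in>(Basis::'b set). C * dist x y)"
        using lipschitz_onD[OF G(1)] by (intro sum_norm_le) (auto simp: dist_real_def)
      finally show "dist (g x) (g y) \<le> real DIM('b) * C * dist x y" by simp
    qed (use C in simp)
    show "g x = f x" if "x \<in> S" for x
      unfolding g_def using G(2) that by (simp add: euclidean_representation)
  qed
qed

section \<open>The weak identity for single-valued maps\<close>

definition multilinear_list :: "nat \<Rightarrow> ('b::real_vector list \<Rightarrow> real) \<Rightarrow> bool" where
  "multilinear_list k \<phi> \<longleftrightarrow> (\<forall>v i. length v = k \<longrightarrow> i < k \<longrightarrow> linear (\<lambda>a. \<phi> (v[i := a])))"

definition basis_lists :: "nat \<Rightarrow> 'b::euclidean_space list set" where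
  "basis_lists k = {bs. set bs \<subseteq> Basis \<and> length bs = k}"

lemma finite_basis_lists [simp]: "finite (basis_lists k)"
  unfolding basis_lists_def by (rule finite_lists_length_eq) simp

lemma basis_lists_nth: "bs \<in> basis_lists k \<Longrightarrow> i < k \<Longrightarrow> bs ! i \<in> Basis"
  by (auto simp: basis_lists_def)

lemma length_basis_lists: "bs \<in> basis_lists k \<Longrightarrow> length bs = k"
  by (simp add: basis_lists_def)

text \<open>The arguments are expanded one after the other, from the left.\<close>

lemma multilinear_list_expand:
  fixes v :: "'b::euclidean_space list"
  assumes \<phi>: "multilinear_list k \<phi>" and v: "length v = k"
  shows "\<phi> v = (\<Sum>bs\<in>basis_lists k. (\<Prod>i<k. v ! i \<bullet> bs ! i) * \<phi> bs)"
proof -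
  have "\<phi> v = (\<Sum>bs\<in>basis_lists j. (\<Prod>i<j. v ! i \<bullet> bs ! i) * \<phi> (bs @ drop j v))" if "j \<le> k" for j
    using that
  proof (induction j)
    case 0
    have "basis_lists 0 = {[]::'b list}" by (auto simp: basis_lists_def)
    then show ?case by simp
  next
    case (Suc j)
    have step: "\<phi> (bs @ drop j v) = (\<Sum>b\<in>Basis. (v ! j \<bullet> b) * \<phi> (bs @ b # drop (Suc j) v))"
      if bs: "bs \<in> basis_lists j" for bs
    proof -
      let ?u = "bs @ drop j v"
      have len: "length ?u = k" using bs Suc.prems v by (simp add: length_basis_lists)
      have upd: "?u[j := a] = bs @ a # drop (Suc j) v" for a
      proof -
        have "drop j v = v ! j # drop (Suc j) v" using Suc.prems v by (simp add: Cons_nth_drop_Suc)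
        then show ?thesis using bs by (simp add: list_update_append length_basis_lists)
      qed
      have u: "?u[j := v ! j] = ?u" unfolding upd using Suc.prems v by (simp add: Cons_nth_drop_Suc)
      have lin: "linear (\<lambda>a. \<phi> (?u[j := a]))"
        using \<phi> len Suc.prems unfolding multilinear_list_def by simp
      have "\<phi> ?u = \<phi> (?u[j := (\<Sum>b\<in>Basis. (v ! j \<bullet> b) *\<^sub>R b)])"
        unfolding euclidean_representation u ..
      also have "\<dots> = (\<Sum>b\<in>Basis. \<phi> (?u[j := (v ! j \<bullet> b) *\<^sub>R b]))"
        by (rule linear_sum[OF lin])
      also have "\<dots> = (\<Sum>b\<in>Basis. (v ! j \<bullet> b) * \<phi> (?u[j := b]))"
        using linear_cmul[OF lin] by simp
      finally show ?thesis unfolding upd .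
    qed
    have "\<phi> v = (\<Sum>bs\<in>basis_lists j. \<Sum>b\<in>Basis. (\<Prod>i<j. v ! i \<bullet> bs ! i) * ((v ! j \<bullet> b) * \<phi> (bs @ b # drop (Suc j) v)))"
      using Suc by (simp add: step sum_distrib_left)
    also have "\<dots> = (\<Sum>(bs, b)\<in>basis_lists j \<times> Basis. (\<Prod>i<j. v ! i \<bullet> bs ! i) * ((v ! j \<bullet> b) * \<phi> (bs @ b # drop (Suc j) v)))"
      by (rule sum.cartesian_product)
    also have "\<dots> = (\<Sum>cs\<in>basis_lists (Suc j). (\<Prod>i<Suc j. v ! i \<bullet> cs ! i) * \<phi> (cs @ drop (Suc j) v))"
    proof (rule sum.reindex_bij_witness[of _ "\<lambda>cs. (butlast cs, last cs)" "\<lambda>(bs, b). bs @ [b]"])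
      fix a :: "'b list \<times> 'b" assume a: "a \<in> basis_lists j \<times> Basis"
      obtain bs b where ab: "a = (bs, b)" by (cases a)
      then have len: "length bs = j" using a by (simp add: length_basis_lists)
      show "(\<lambda>cs. (butlast cs, last cs)) (case a of (bs, b) \<Rightarrow> bs @ [b]) = a" using ab by simp
      show "(case a of (bs, b) \<Rightarrow> bs @ [b]) \<in> basis_lists (Suc j)"
        using a ab by (simp add: basis_lists_def)
      show "(\<Prod>i<Suc j. v ! i \<bullet> (case a of (bs, b) \<Rightarrow> bs @ [b]) ! i) * \<phi> ((case a of (bs, b) \<Rightarrow> bs @ [b]) @ drop (Suc j) v)
        = (case a of (bs, b) \<Rightarrow> (\<Prod>i<j. v ! i \<bullet> bs ! i) * ((v ! j \<bullet> b) * \<phi> (bs @ b # drop (Suc j) v)))"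
        using len by (simp add: ab nth_append mult.assoc)
    next
      fix cs :: "'b list" assume cs: "cs \<in> basis_lists (Suc j)"
      then have ne: "cs \<noteq> []" by (auto simp: basis_lists_def)
      show "(case (butlast cs, last cs) of (bs, b) \<Rightarrow> bs @ [b]) = cs" using ne by simp
      have "set (butlast cs) \<subseteq> set cs" by (auto dest: in_set_butlastD)
      moreover have "last cs \<in> set cs" using ne by simp
      ultimately show "(butlast cs, last cs) \<in> basis_lists j \<times> Basis"
        using cs by (auto simp: basis_lists_def)
    qed
    finally show ?case .
  qed
  from this[of k] v show ?thesis by simp
qed

text \<open>The derivative of the coefficients of \<open>\<omega>\<close> in the direction \<open>u\<close>: the exterior derivative before
  it is antisymmetrised.\<close>

definition dcoef :: "'b::real_normed_vector form \<Rightarrow> 'b \<Rightarrow> 'b \<Rightarrow> 'b list \<Rightarrow> real" where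
  "dcoef \<omega> z u v = frechet_derivative (\<lambda>y. \<omega> y v) (at z) u"

definition C1_form :: "nat \<Rightarrow> 'b::real_normed_vector form \<Rightarrow> bool" where
  "C1_form k \<omega> \<longleftrightarrow> (\<forall>z. multilinear_list k (\<omega> z)) \<and>
    (\<forall>v. length v = k \<longrightarrow> (\<forall>z. (\<lambda>y. \<omega> y v) differentiable (at z)) \<and>
      (\<forall>u. continuous_on UNIV (\<lambda>z. dcoef \<omega> z u v)))"

lemma C1_form_has_derivative:
  assumes "C1_form k \<omega>" "length v = k"
  shows "((\<lambda>y. \<omega> y v) has_derivative (\<lambda>u. dcoef \<omega> z u v)) (at z)"
  using assms unfolding C1_form_def dcoef_def by (simp add: frechet_derivative_works)

lemma C1_form_multilinear: "C1_form k \<omega> \<Longrightarrow> multilinear_list k (\<omega> z)"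
  by (simp add: C1_form_def)

lemma C1_form_continuous:
  assumes "C1_form k \<omega>" "length v = k"
  shows "continuous_on UNIV (\<lambda>y. \<omega> y v)"
  using has_derivative_continuous[OF C1_form_has_derivative[OF assms]]
  by (simp add: continuous_on_eq_continuous_at)

lemma dcoef_multilinear:
  assumes \<omega>: "C1_form k \<omega>"
  shows "multilinear_list k (dcoef \<omega> z u)"
  unfolding multilinear_list_def
proof (intro allI impI)
  fix v :: "'a list" and i assume v: "length v = k" and i: "i < k"
  have lin: "linear (\<lambda>a. \<omega> y (v[i := a]))" for y
    using C1_form_multilinear[OF \<omega>] v i unfolding multilinear_list_def by blast
  have d: "((\<lambda>y. \<omega> y (v[i := a])) has_derivative (\<lambda>u. dcoef \<omega> z u (v[i := a]))) (at z)" for a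
    using v by (intro C1_form_has_derivative[OF \<omega>]) simp
  show "linear (\<lambda>a. dcoef \<omega> z u (v[i := a]))"
  proof (rule linearI)
    fix a b
    have "((\<lambda>y. \<omega> y (v[i := a]) + \<omega> y (v[i := b])) has_derivative
        (\<lambda>u. dcoef \<omega> z u (v[i := a]) + dcoef \<omega> z u (v[i := b]))) (at z)"
      by (intro has_derivative_add d)
    then have "((\<lambda>y. \<omega> y (v[i := a + b])) has_derivative
        (\<lambda>u. dcoef \<omega> z u (v[i := a]) + dcoef \<omega> z u (v[i := b]))) (at z)"
      by (simp add: linear_add[OF lin])
    from has_derivative_unique[OF d this]
    show "dcoef \<omega> z u (v[i := a + b]) = dcoef \<omega> z u (v[i := a]) + dcoef \<omega> z u (v[i := b])"
      by (rule fun_cong)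
  next
    fix r :: real and a
    have "((\<lambda>y. r * \<omega> y (v[i := a])) has_derivative (\<lambda>u. r * dcoef \<omega> z u (v[i := a]))) (at z)"
      by (intro has_derivative_mult_right d)
    then have "((\<lambda>y. \<omega> y (v[i := r *\<^sub>R a])) has_derivative (\<lambda>u. r * dcoef \<omega> z u (v[i := a]))) (at z)"
      by (simp add: linear_cmul[OF lin])
    from has_derivative_unique[OF d this]
    show "dcoef \<omega> z u (v[i := r *\<^sub>R a]) = r *\<^sub>R dcoef \<omega> z u (v[i := a])"
      by (simp add: fun_eq_iff)
  qed
qed

lemma C1_imp_lipschitz_on_cball:
  fixes q :: "'b::euclidean_space \<Rightarrow> real"
  assumes d: "\<And>z. (q has_derivative q' z) (at z)" and c: "\<And>u. continuous_on UNIV (\<lambda>z. q' z u)"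
  shows "\<exists>L. L-lipschitz_on (cball 0 R) q"
proof -
  have "\<exists>B\<ge>0. \<forall>z. norm z \<le> R \<longrightarrow> \<bar>q' z b\<bar> \<le> B" for b
    using continuous_bounded_on_cball[OF c[of b], of R] by metis
  then obtain B where B: "\<And>b. B b \<ge> 0" "\<And>b z. norm z \<le> R \<Longrightarrow> \<bar>q' z b\<bar> \<le> B b" by metis
  have lin: "bounded_linear (q' z)" for z using d has_derivative_bounded_linear by blast
  have on: "onorm (q' z) \<le> (\<Sum>b\<in>Basis. B b)" if z: "z \<in> cball 0 R" for z
  proof (rule onorm_bound)
    show "0 \<le> (\<Sum>b\<in>Basis. B b)" using B(1) by (intro sum_nonneg) auto
    fix u
    have "q' z u = q' z (\<Sum>b\<in>Basis. (u \<bullet> b) *\<^sub>R b)" by (simp add: euclidean_representation)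
    also have "\<dots> = (\<Sum>b\<in>Basis. (u \<bullet> b) * q' z b)"
      using bounded_linear.linear[OF lin] by (simp add: linear_sum linear_cmul)
    also have "norm \<dots> \<le> (\<Sum>b\<in>Basis. norm u * B b)"
    proof (rule sum_norm_le)
      fix b :: 'b assume b: "b \<in> Basis"
      show "norm ((u \<bullet> b) * q' z b) \<le> norm u * B b"
        unfolding norm_mult using Basis_le_norm[OF b, of u] B(2)[of z b] z by (intro mult_mono) auto
    qed
    finally show "norm (q' z u) \<le> (\<Sum>b\<in>Basis. B b) * norm u"
      by (simp add: sum_distrib_left mult.commute)
  qed
  have "(\<Sum>b\<in>Basis. B b)-lipschitz_on (cball 0 R) q"
  proof (rule lipschitz_onI)
    fix x y :: 'b assume "x \<in> cball 0 R" "y \<in> cball 0 R"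
    then have "norm (q x - q y) \<le> (\<Sum>b\<in>Basis. B b) * norm (x - y)"
      using has_derivative_at_withinI[OF d] on by (intro differentiable_bound[OF convex_cball, of 0 R q q']) auto
    then show "dist (q x) (q y) \<le> (\<Sum>b\<in>Basis. B b) * dist x y" by (simp add: dist_norm)
  qed (use B(1) in \<open>auto intro: sum_nonneg\<close>)
  then show ?thesis by blast
qed

text \<open>The delicate case is a pair of points of which only one lies in the support of \<open>a\<close>: there the
  difference of the products is controlled by the difference of the values of \<open>a\<close>.\<close>

lemma lipschitz_cutoff_mult:
  fixes a q :: "'a::euclidean_space \<Rightarrow> real"
  assumes a: "A-lipschitz_on UNIV a" "bounded {x. a x \<noteq> 0}"
    and q: "\<And>R. \<exists>L. L-lipschitz_on (cball 0 R) q"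
  shows "\<exists>C. C-lipschitz_on UNIV (\<lambda>x. a x * q x)"
proof -
  obtain B R where BR: "0 \<le> B" "0 \<le> R" "\<And>x. \<bar>a x\<bar> \<le> B * indicator (cball 0 R) x"
    using bounded_support_imp_bounded_fun[OF lipschitz_on_continuous_on[OF a(1)] a(2)] by blast
  have aB: "\<bar>a x\<bar> \<le> B" for x using BR(1) BR(3)[of x] by (cases "x \<in> cball 0 R") auto
  have a0: "a x = 0" if "x \<notin> cball 0 R" for x using BR(3)[of x] that by simp
  obtain L where L: "L-lipschitz_on (cball 0 R) q" using q by blast
  have "compact (q ` cball 0 R)"
    by (intro compact_continuous_image lipschitz_on_continuous_on[OF L]) auto
  then obtain Q where Q: "\<And>x. x \<in> cball 0 R \<Longrightarrow> \<bar>q x\<bar> \<le> Q"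
    using compact_imp_bounded by (force simp: bounded_iff)
  have Q0: "0 \<le> Q" using Q[of 0] BR(2) by fastforce
  have A0: "0 \<le> A" and L0: "0 \<le> L" using a(1) L lipschitz_on_nonneg by blast+
  have in_S: "(A * Q + B * L)-lipschitz_on (cball 0 R) (\<lambda>x. a x * q x)"
    using lipschitz_on_mult_bounded[OF lipschitz_on_subset[OF a(1)] L aB Q BR(1) Q0] by simp
  have mixed: "\<bar>a x * q x\<bar> \<le> (A * Q + B * L) * dist x y" if "x \<in> cball 0 R" "y \<notin> cball 0 R" for x y
  proof -
    have "\<bar>a x * q x\<bar> = \<bar>a x - a y\<bar> * \<bar>q x\<bar>" using a0[OF that(2)] by (simp add: abs_mult)
    also have "\<dots> \<le> (A * dist x y) * Q"
      using lipschitz_onD[OF a(1), of x y] Q[OF that(1)] A0 by (intro mult_mono) (auto simp: dist_real_def)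
    also have "\<dots> \<le> (A * Q + B * L) * dist x y"
      using BR(1) L0 by (simp add: algebra_simps)
    finally show ?thesis .
  qed
  have "(A * Q + B * L)-lipschitz_on UNIV (\<lambda>x. a x * q x)"
  proof (rule lipschitz_onI)
    fix x y :: 'a
    consider "x \<in> cball 0 R" "y \<in> cball 0 R" | "x \<in> cball 0 R" "y \<notin> cball 0 R"
      | "x \<notin> cball 0 R" "y \<in> cball 0 R" | "x \<notin> cball 0 R" "y \<notin> cball 0 R" by blast
    then show "dist (a x * q x) (a y * q y) \<le> (A * Q + B * L) * dist x y"
    proof cases
      case 1 then show ?thesis by (rule lipschitz_onD[OF in_S])
    next
      case 2 then show ?thesis using mixed[of x y] a0[of y] by (simp add: dist_real_def)
    next
      case 3 then show ?thesis using mixed[of y x] a0[of x] by (simp add: dist_real_def dist_commute)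
    next
      case 4 then show ?thesis using a0[of x] a0[of y] A0 Q0 BR(1) L0 by simp
    qed
  qed (use A0 Q0 BR(1) L0 in simp)
  then show ?thesis by blast
qed

lemma borel_measurable_lebesgue_AE_eq:
  fixes F J :: "'a::euclidean_space \<Rightarrow> real"
  assumes J: "J \<in> borel_measurable lebesgue" and ae: "AE x in lebesgue. F x = J x"
  shows "F \<in> borel_measurable lebesgue"
proof (rule measurableI)
  obtain N where N: "{x. F x \<noteq> J x} \<subseteq> N" "N \<in> null_sets lebesgue"
    using ae by (auto elim!: AE_E simp: null_setsI)
  fix A :: "real set" assume A: "A \<in> sets borel"
  have "J -` A \<in> sets lebesgue"
    using measurable_sets[OF J A] by simp
  moreover have "F -` A \<inter> N \<in> sets lebesgue"
    using N(2) by (meson null_sets_completion_subset null_setsD2 inf_le2)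
  moreover have "F -` A = (J -` A - N) \<union> (F -` A \<inter> N)" using N(1) by auto
  ultimately have "F -` A \<in> sets lebesgue"
    using null_setsD2[OF N(2)] by (metis sets.Diff sets.Un)
  then show "F -` A \<inter> space lebesgue \<in> sets lebesgue" by simp
qed simp

lemma has_bochner_integral_lebesgue_AE_eq:
  fixes F J :: "'a::euclidean_space \<Rightarrow> real"
  assumes J: "has_bochner_integral lebesgue J r" and ae: "AE x in lebesgue. F x = J x"
  shows "has_bochner_integral lebesgue F r"
proof -
  have Jm: "J \<in> borel_measurable lebesgue" using J by (rule borel_measurable_has_bochner_integral)
  then have "F \<in> borel_measurable lebesgue" using ae by (rule borel_measurable_lebesgue_AE_eq)
  then show ?thesis using J Jm ae by (subst has_bochner_integral_cong_AE) auto
qed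

lemma has_bochner_integral_lebesgue_if_lborel:
  fixes J :: "'a::euclidean_space \<Rightarrow> real"
  assumes "has_bochner_integral lborel J r"
  shows "has_bochner_integral lebesgue J r"
  using assms borel_measurable_has_bochner_integral[OF assms]
  by (simp add: has_bochner_integral_iff integrable_completion integral_completion)

text \<open>For alternating \<open>\<omega>\<close> and up to the factor \<open>fact k\<close> this is the value of \<open>d (a \<omega>)\<close>, pulled back along a map with value \<open>z\<close> and
  derivative \<open>L\<close>, on the vectors \<open>w 0, \<dots>, w k\<close>; \<open>a\<close> and \<open>a'\<close> stand for the value and the derivative
  of a test function. The value and the derivative enter as parameters so that the expression also makes
  sense for maps that are differentiable only modulo a group.\<close>

definition stokes_integrand ::
    "nat \<Rightarrow> 'b::real_normed_vector form \<Rightarrow> (nat \<Rightarrow> 'a) \<Rightarrow> 'b \<Rightarrow> ('a \<Rightarrow> 'b) \<Rightarrow> real \<Rightarrow> ('a \<Rightarrow> real) \<Rightarrow> real" where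
  "stokes_integrand k \<omega> w z L a a' = (\<Sum>\<pi> | \<pi> permutes {..k}. of_int (sign \<pi>) *
     (a * dcoef \<omega> z (L (w (\<pi> 0))) (map (\<lambda>i. L (w (\<pi> (Suc i)))) [0..<k]) +
      a' (w (\<pi> 0)) * \<omega> z (map (\<lambda>i. L (w (\<pi> (Suc i)))) [0..<k])))"

text \<open>For each choice \<open>bs\<close> of basis vectors, the coefficient of the expanded integrand is an
  antisymmetrised product of the derivatives of \<open>a x * \<omega> (c x) bs\<close> and of the components of \<open>c\<close>.\<close>

theorem weak_stokes_single_valued:
  fixes c :: "'a::euclidean_space \<Rightarrow> 'b::euclidean_space" and a :: "'a \<Rightarrow> real"
  assumes c: "C-lipschitz_on UNIV c" and \<omega>: "C1_form k \<omega>"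
    and a: "A-lipschitz_on UNIV a" "bounded {x. a x \<noteq> 0}"
  shows "has_bochner_integral lebesgue
    (\<lambda>x. stokes_integrand k \<omega> w (c x) (frechet_derivative c (at x)) (a x) (frechet_derivative a (at x))) 0"
proof -
  (* index 0 carries the test function, index j + 1 the j-th selected component of c *)
  define h where "h bs j x = (if j = 0 then a x * \<omega> (c x) bs else c x \<bullet> bs ! (j - 1))" for bs j x
  define J where "J bs x = (\<Sum>\<pi> | \<pi> permutes {..k}. of_int (sign \<pi>) *
       (ddir (h bs 0) (w (\<pi> 0)) x * (\<Prod>j\<in>{1..k}. ddir (h bs j) (w (\<pi> j)) x)))" for bs x
  have J: "has_bochner_integral lborel (J bs) 0" if bs: "bs \<in> basis_lists k" for bs
  proof -
    have len: "length bs = k" using bs by (rule length_basis_lists)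
    have "\<exists>L. L-lipschitz_on (cball 0 R) (\<lambda>x. \<omega> (c x) bs)" for R
    proof -
      have "bounded (c ` cball 0 R)"
        by (intro compact_imp_bounded compact_continuous_image
            continuous_on_subset[OF lipschitz_on_continuous_on[OF c]]) auto
      from bounded_subset_ballD[OF this, of 0]
      obtain R' where R': "c ` cball 0 R \<subseteq> cball 0 R'"
        using ball_subset_cball by blast
      obtain L where L: "L-lipschitz_on (cball 0 R') (\<lambda>z. \<omega> z bs)"
        using C1_imp_lipschitz_on_cball[OF C1_form_has_derivative[OF \<omega> len]] \<omega> len
        unfolding C1_form_def by metis
      show ?thesis
        using lipschitz_on_compose2[OF lipschitz_on_subset[OF c, of "cball 0 R"] lipschitz_on_subset[OF L R']] by blast
    qed
    then obtain D where D: "D-lipschitz_on UNIV (\<lambda>x. a x * \<omega> (c x) bs)"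
      using lipschitz_cutoff_mult[OF a] by blast
    have hl: "(max D C)-lipschitz_on UNIV (h bs j)" if j: "j \<le> k" for j
    proof (cases "j = 0")
      case True
      then have "h bs j = (\<lambda>x. a x * \<omega> (c x) bs)" by (auto simp: h_def)
      then show ?thesis using lipschitz_on_mono[OF D] by simp
    next
      case False
      then have b: "bs ! (j - 1) \<in> Basis" using basis_lists_nth[OF bs] j by simp
      have "C-lipschitz_on UNIV (h bs j)"
      proof (rule lipschitz_onI)
        fix x y
        have "\<bar>(c x - c y) \<bullet> bs ! (j - 1)\<bar> \<le> norm (c x - c y)" using b by (rule Basis_le_norm)
        then show "dist (h bs j x) (h bs j y) \<le> C * dist x y"
          using lipschitz_onD[OF c, of x y] False by (simp add: h_def dist_real_def dist_norm inner_diff_left)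
      qed (use lipschitz_on_nonneg[OF c] in simp)
      then show ?thesis by (rule lipschitz_on_mono) auto
    qed
    have "bounded {x. h bs 0 x \<noteq> 0}" by (rule bounded_subset[OF a(2)]) (auto simp: h_def)
    from antisymmetrized_ddir_integral_zero[where h="h bs" and w=w, OF hl this]
    show ?thesis unfolding J_def[abs_def] .
  qed
  have "has_bochner_integral lborel (\<lambda>x. \<Sum>bs\<in>basis_lists k. J bs x) (\<Sum>bs\<in>(basis_lists k::'b list set). 0)"
    by (intro has_bochner_integral_sum J)
  then have Jsum: "has_bochner_integral lborel (\<lambda>x. \<Sum>bs\<in>basis_lists k. J bs x) 0" by simp
  show ?thesis
  proof (rule has_bochner_integral_lebesgue_AE_eq[OF has_bochner_integral_lebesgue_if_lborel[OF Jsum]])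
    have "AE x in lborel. stokes_integrand k \<omega> w (c x) (frechet_derivative c (at x)) (a x) (frechet_derivative a (at x))
        = (\<Sum>bs\<in>basis_lists k. J bs x)"
      using rademacher[OF c] rademacher_real[OF a(1)]
    proof eventually_elim
      case (elim x)
      define L where "L = frechet_derivative c (at x)"
      define a' where "a' = frechet_derivative a (at x)"
      have dc: "(c has_derivative L) (at x)" and da: "(a has_derivative a') (at x)"
        using elim by (auto simp: L_def a'_def frechet_derivative_works)
      have d0: "ddir (h bs 0) v x = a x * dcoef \<omega> (c x) (L v) bs + a' v * \<omega> (c x) bs" if "bs \<in> basis_lists k" for bs v
      proof -
        have "((\<lambda>x. \<omega> (c x) bs) has_derivative (\<lambda>v. dcoef \<omega> (c x) (L v) bs)) (at x)"
          by (rule has_derivative_compose[OF dc C1_form_has_derivative[OF \<omega> length_basis_lists[OF that]]])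
        from has_derivative_mult[OF da this]
        have "(h bs 0 has_derivative (\<lambda>v. a x * dcoef \<omega> (c x) (L v) bs + a' v * \<omega> (c x) bs)) (at x)"
          unfolding h_def by simp
        then show ?thesis by (intro has_ddir_imp_ddir has_derivative_imp_has_ddir)
      qed
      have d1: "ddir (h bs (Suc i)) v x = L v \<bullet> bs ! i" for bs i v
      proof -
        have "(h bs (Suc i) has_derivative (\<lambda>v. L v \<bullet> bs ! i)) (at x)"
          unfolding h_def by (auto intro!: derivative_eq_intros dc)
        then show ?thesis by (intro has_ddir_imp_ddir has_derivative_imp_has_ddir)
      qed
      let ?V = "\<lambda>\<pi>. map (\<lambda>i. L (w (\<pi> (Suc i)))) [0..<k]"
      have trm: "a x * dcoef \<omega> (c x) (L (w (\<pi> 0))) (?V \<pi>) + a' (w (\<pi> 0)) * \<omega> (c x) (?V \<pi>) =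
          (\<Sum>bs\<in>basis_lists k. ddir (h bs 0) (w (\<pi> 0)) x * (\<Prod>j\<in>{1..k}. ddir (h bs j) (w (\<pi> j)) x))" for \<pi> :: "nat \<Rightarrow> nat"
      proof -
        let ?Q = "\<lambda>bs. \<Prod>i<k. L (w (\<pi> (Suc i))) \<bullet> bs ! i"
        have Q: "(\<Prod>i<k. ?V \<pi> ! i \<bullet> bs ! i) = ?Q bs" for bs by (rule prod.cong) auto
        have e: "\<omega> (c x) (?V \<pi>) = (\<Sum>bs\<in>basis_lists k. ?Q bs * \<omega> (c x) bs)"
            "dcoef \<omega> (c x) u (?V \<pi>) = (\<Sum>bs\<in>basis_lists k. ?Q bs * dcoef \<omega> (c x) u bs)" for u
          using multilinear_list_expand[OF C1_form_multilinear[OF \<omega>], of "?V \<pi>"]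
            multilinear_list_expand[OF dcoef_multilinear[OF \<omega>], of "?V \<pi>"] unfolding Q by simp_all
        have P: "(\<Prod>j\<in>{1..k}. ddir (h bs j) (w (\<pi> j)) x) = ?Q bs" for bs
          by (simp add: prod.atLeast1_atMost_eq d1)
        show ?thesis
          unfolding e P sum_distrib_left sum.distrib[symmetric]
          by (rule sum.cong[OF refl]) (simp add: d0 algebra_simps)
      qed
      show ?case
        unfolding stokes_integrand_def L_def[symmetric] a'_def[symmetric] trm J_def sum_distrib_left
        by (rule sum.swap)
    qed
    then show "AE x in lebesgue. stokes_integrand k \<omega> w (c x) (frechet_derivative c (at x)) (a x) (frechet_derivative a (at x))
        = (\<Sum>bs\<in>basis_lists k. J bs x)" by (simp add: AE_completion_iff)
  qed
qed

section \<open>Finite groups of linear isometries\<close>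

lemma eventually_at_right_0_less: "0 < c \<Longrightarrow> \<forall>\<^sub>F t in at_right (0::real). t < c"
  by (rule eventually_at_right_real[THEN eventually_mono]) auto

text \<open>The group is a set of maps and not an action of an abstract group, so that a subgroup is simply a
  subset.\<close>

locale isometry_group =
  fixes G :: "('b::euclidean_space \<Rightarrow> 'b) set"
  assumes finite_G: "finite G" and id_G: "id \<in> G"
    and comp_G: "g \<in> G \<Longrightarrow> h \<in> G \<Longrightarrow> g \<circ> h \<in> G"
    and inverse_G: "g \<in> G \<Longrightarrow> \<exists>h\<in>G. h \<circ> g = id \<and> g \<circ> h = id"
    and linear_G: "g \<in> G \<Longrightarrow> linear g"
    and norm_G: "g \<in> G \<Longrightarrow> norm (g z) = norm z"
begin

lemma dist_G: "g \<in> G \<Longrightarrow> dist (g z) (g z') = dist z z'"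
  using norm_G[of g "z - z'"] linear_diff[OF linear_G] by (simp add: dist_norm)

lemma inverseE:
  assumes "g \<in> G"
  obtains h where "h \<in> G" "\<And>z. h (g z) = z" "\<And>z. g (h z) = z"
  using inverse_G[OF assms] by (auto simp: fun_eq_iff)

lemma fixed_if_close: "\<exists>\<delta>>0. \<forall>g\<in>G. dist z (g z) < \<delta> \<longrightarrow> g z = z"
proof -
  have "\<exists>\<delta>>0. \<forall>g\<in>F. dist z (g z) < \<delta> \<longrightarrow> g z = z" if "finite F" for F :: "('b \<Rightarrow> 'b) set"
    using that
  proof (induction F)
    case empty
    then show ?case by (auto intro: exI[of _ 1])
  next
    case (insert g F)
    then obtain \<delta> where \<delta>: "\<delta> > 0" "\<forall>g\<in>F. dist z (g z) < \<delta> \<longrightarrow> g z = z" by blast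
    show ?case
    proof (cases "g z = z")
      case True
      then show ?thesis using \<delta> by auto
    next
      case False
      then have "0 < min \<delta> (dist z (g z))" using \<delta> by auto
      then show ?thesis using \<delta> by (intro exI[of _ "min \<delta> (dist z (g z))"]) auto
    qed
  qed
  then show ?thesis using finite_G by blast
qed

definition avg :: "'b \<Rightarrow> 'b" where
  "avg z = (1 / real (card G)) *\<^sub>R (\<Sum>g\<in>G. g z)"

lemma card_G_pos: "card G > 0"
  using finite_G id_G card_gt_0_iff by blast

lemma linear_avg: "linear avg"
  unfolding avg_def[abs_def]
  by (intro linear_compose_scale_right linear_compose_sum) (auto intro: linear_G)

lemma avg_G: "g \<in> G \<Longrightarrow> avg (g z) = avg z"
proof -
  assume g: "g \<in> G"
  obtain h where h: "h \<in> G" "\<And>z. h (g z) = z" "\<And>z. g (h z) = z" using inverseE[OF g] by metis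
  have "(\<Sum>f\<in>G. f (g z)) = (\<Sum>f\<in>G. f z)"
    by (rule sum.reindex_bij_witness[of _ "\<lambda>f. f \<circ> h" "\<lambda>f. f \<circ> g"])
      (use g h comp_G in \<open>auto simp: fun_eq_iff\<close>)
  then show ?thesis by (simp add: avg_def)
qed

lemma G_avg: "g \<in> G \<Longrightarrow> g (avg z) = avg z"
proof -
  assume g: "g \<in> G"
  obtain h where h: "h \<in> G" "\<And>z. h (g z) = z" "\<And>z. g (h z) = z" using inverseE[OF g] by metis
  have "(\<Sum>f\<in>G. g (f z)) = (\<Sum>f\<in>G. f z)"
    by (rule sum.reindex_bij_witness[of _ "\<lambda>f. h \<circ> f" "\<lambda>f. g \<circ> f"])
      (use g h comp_G in \<open>auto simp: fun_eq_iff\<close>)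
  moreover have "g (avg z) = (1 / real (card G)) *\<^sub>R (\<Sum>f\<in>G. g (f z))"
    unfolding avg_def linear_cmul[OF linear_G[OF g]] linear_sum[OF linear_G[OF g]] ..
  ultimately show ?thesis by (simp add: avg_def)
qed

lemma norm_avg: "norm (avg z) \<le> norm z"
proof -
  have "norm (\<Sum>g\<in>G. g z) \<le> (\<Sum>g\<in>G. norm z)"
    using norm_G by (intro sum_norm_le) simp
  then have "norm (\<Sum>g\<in>G. g z) \<le> real (card G) * norm z" by simp
  then show ?thesis
    using card_G_pos by (simp add: avg_def divide_le_eq mult.commute)
qed

lemma dist_avg: "dist (avg z) (avg z') \<le> dist z z'"
  using norm_avg[of "z - z'"] linear_diff[OF linear_avg] by (simp add: dist_norm)

lemma avg_fixed: "(\<And>g. g \<in> G \<Longrightarrow> g z = z) \<Longrightarrow> avg z = z"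
proof -
  assume "\<And>g. g \<in> G \<Longrightarrow> g z = z"
  then have "(\<Sum>g\<in>G. g z) = (\<Sum>g\<in>G. z)" by (intro sum.cong refl)
  then show ?thesis using card_G_pos by (simp add: avg_def sum_constant_scaleR)
qed

lemma fixed_iff: "(\<forall>g\<in>G. g z = z) \<longleftrightarrow> avg z = z"
  using avg_fixed G_avg by metis

text \<open>It vanishes exactly at the points that are fixed by the group.\<close>

definition dev :: "'b \<Rightarrow> real" where
  "dev z = norm (z - avg z)"

lemma dev_G: "g \<in> G \<Longrightarrow> dev (g z) = dev z"
  using norm_G[of g "z - avg z"] by (simp add: dev_def avg_G linear_diff[OF linear_G] G_avg)

lemma dev_lipschitz: "\<bar>dev z - dev z'\<bar> \<le> 2 * dist z z'"
proof -
  have "\<bar>dev z - dev z'\<bar> \<le> norm ((z - avg z) - (z' - avg z'))"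
    unfolding dev_def by (rule norm_triangle_ineq3)
  also have "\<dots> = norm ((z - z') - (avg z - avg z'))" by (simp add: algebra_simps)
  also have "\<dots> \<le> norm (z - z') + norm (avg z - avg z')" by (rule norm_triangle_ineq4)
  also have "\<dots> \<le> 2 * dist z z'" using dist_avg[of z z'] by (simp add: dist_norm)
  finally show ?thesis .
qed

lemma dev_nonneg: "dev z \<ge> 0" by (simp add: dev_def)

lemma dev_eq_0_iff: "dev z = 0 \<longleftrightarrow> avg z = z"
  by (auto simp: dev_def)

text \<open>Points at distance at most \<open>\<epsilon>\<close> from their average are moved to the average, and points at
  distance at least \<open>2 * \<epsilon>\<close> do not move.\<close>

definition collapse :: "real \<Rightarrow> 'b \<Rightarrow> 'b" where
  "collapse \<epsilon> z = avg z + max 0 (min 1 (dev z / \<epsilon> - 1)) *\<^sub>R (z - avg z)"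

lemma avg_collapse: "avg (collapse \<epsilon> z) = avg z"
proof -
  have "avg (avg z) = avg z" by (rule avg_fixed) (rule G_avg)
  then show ?thesis
    by (simp add: collapse_def linear_add[OF linear_avg] linear_cmul[OF linear_avg] linear_diff[OF linear_avg])
qed

lemma collapse_G: "g \<in> G \<Longrightarrow> collapse \<epsilon> (g z) = g (collapse \<epsilon> z)"
  by (simp add: collapse_def avg_G dev_G linear_add[OF linear_G] linear_cmul[OF linear_G] linear_diff[OF linear_G] G_avg)

lemma collapse_eq_avg: "\<epsilon> > 0 \<Longrightarrow> dev z \<le> \<epsilon> \<Longrightarrow> collapse \<epsilon> z = avg z"
  by (simp add: collapse_def max_def)

lemma collapse_eq_id: "\<epsilon> > 0 \<Longrightarrow> 2 * \<epsilon> \<le> dev z \<Longrightarrow> collapse \<epsilon> z = z"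
proof -
  assume "\<epsilon> > 0" "2 * \<epsilon> \<le> dev z"
  then have "1 \<le> dev z / \<epsilon> - 1" by (simp add: le_diff_eq pos_le_divide_eq)
  then show ?thesis by (simp add: collapse_def)
qed

lemma norm_collapse: "norm (collapse \<epsilon> z) \<le> 3 * norm z"
proof -
  have "norm (collapse \<epsilon> z) \<le> norm (avg z) + \<bar>max 0 (min 1 (dev z / \<epsilon> - 1))\<bar> * norm (z - avg z)"
    unfolding collapse_def by (rule order_trans[OF norm_triangle_ineq]) simp
  also have "\<dots> \<le> norm (avg z) + 1 * norm (z - avg z)"
    by (intro add_left_mono mult_right_mono) auto
  also have "\<dots> \<le> 3 * norm z"
    using norm_avg[of z] norm_triangle_ineq4[of z "avg z"] by linarith
  finally show ?thesis .
qed

text \<open>Unless a point is collapsed completely, collapsing does not enlarge its stabiliser.\<close>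

lemma collapse_fixed:
  assumes "\<epsilon> > 0" "g \<in> G" "g (collapse \<epsilon> z) = collapse \<epsilon> z"
  shows "g z = z \<or> avg (collapse \<epsilon> z) = collapse \<epsilon> z"
proof (cases "max 0 (min 1 (dev z / \<epsilon> - 1)) = 0")
  case True
  then have "collapse \<epsilon> z = avg z" by (simp add: collapse_def)
  then show ?thesis using avg_collapse[of \<epsilon> z] by simp
next
  case False
  define t where "t = max 0 (min 1 (dev z / \<epsilon> - 1))"
  have t: "t \<noteq> 0" using False by (simp add: t_def)
  have "avg z + t *\<^sub>R g (z - avg z) = avg z + t *\<^sub>R (z - avg z)"
    using assms(3) unfolding collapse_def t_def[symmetric] by (simp add: linear_add[OF linear_G[OF assms(2)]]
        linear_cmul[OF linear_G[OF assms(2)]] G_avg[OF assms(2)])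
  then have "g (z - avg z) = z - avg z" using t by simp
  then show ?thesis by (simp add: linear_diff[OF linear_G[OF assms(2)]] G_avg[OF assms(2)])
qed

text \<open>The Lipschitz constant is independent of \<open>\<epsilon>\<close>: the cut-off has slope \<open>1 / \<epsilon>\<close>, but it varies only
  where the deviation from the average is at most \<open>2 * \<epsilon>\<close>.\<close>

lemma collapse_lipschitz:
  assumes \<epsilon>: "\<epsilon> > 0"
  shows "dist (collapse \<epsilon> z) (collapse \<epsilon> z') \<le> 7 * dist z z'"
proof -
  define \<theta> where "\<theta> r = max 0 (min 1 (r / \<epsilon> - 1))" for r :: real
  have \<theta>: "0 \<le> \<theta> r" "\<theta> r \<le> 1" "r \<ge> 2 * \<epsilon> \<Longrightarrow> \<theta> r = 1" for r
    using \<epsilon> by (auto simp: \<theta>_def le_diff_eq pos_le_divide_eq)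
  have \<theta>L: "\<bar>\<theta> r - \<theta> s\<bar> \<le> \<bar>r - s\<bar> / \<epsilon>" for r s
  proof -
    have "\<bar>\<theta> r - \<theta> s\<bar> \<le> \<bar>r / \<epsilon> - s / \<epsilon>\<bar>" by (auto simp: \<theta>_def max_def min_def)
    also have "\<dots> = \<bar>r - s\<bar> / \<epsilon>" using \<epsilon> by (simp add: diff_divide_distrib[symmetric])
    finally show ?thesis .
  qed
  have shrink: "norm (\<theta> (norm u) *\<^sub>R u - \<theta> (norm v) *\<^sub>R v) \<le> 3 * norm (u - v)" if uv: "norm v \<le> norm u" for u v :: 'b
  proof -
    have "\<theta> (norm u) *\<^sub>R u - \<theta> (norm v) *\<^sub>R v = \<theta> (norm u) *\<^sub>R (u - v) + (\<theta> (norm u) - \<theta> (norm v)) *\<^sub>R v"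
      by (simp add: algebra_simps)
    also have "norm \<dots> \<le> \<theta> (norm u) * norm (u - v) + \<bar>\<theta> (norm u) - \<theta> (norm v)\<bar> * norm v"
      by (rule order_trans[OF norm_triangle_ineq]) (simp add: \<theta>)
    also have "\<dots> \<le> 1 * norm (u - v) + 2 * norm (u - v)"
    proof (intro add_mono mult_right_mono)
      show "\<bar>\<theta> (norm u) - \<theta> (norm v)\<bar> * norm v \<le> 2 * norm (u - v)"
      proof (cases "norm v \<ge> 2 * \<epsilon>")
        case True
        then show ?thesis using uv \<theta>(3)[of "norm u"] \<theta>(3)[of "norm v"] by simp
      next
        case False
        have "\<bar>\<theta> (norm u) - \<theta> (norm v)\<bar> * norm v \<le> (\<bar>norm u - norm v\<bar> / \<epsilon>) * (2 * \<epsilon>)"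
          using False \<theta>L \<epsilon> by (intro mult_mono) auto
        also have "\<dots> = 2 * \<bar>norm u - norm v\<bar>" using \<epsilon> by simp
        also have "\<dots> \<le> 2 * norm (u - v)" using norm_triangle_ineq3[of u v] by simp
        finally show ?thesis .
      qed
    qed (use \<theta> in auto)
    finally show ?thesis by simp
  qed
  have shrink': "norm (\<theta> (norm u) *\<^sub>R u - \<theta> (norm v) *\<^sub>R v) \<le> 3 * norm (u - v)" for u v :: 'b
    using shrink[of u v] shrink[of v u] by (cases "norm v \<le> norm u") (auto simp: norm_minus_commute)
  have "dist (collapse \<epsilon> z) (collapse \<epsilon> z') = norm ((avg z - avg z') +
      (\<theta> (norm (z - avg z)) *\<^sub>R (z - avg z) - \<theta> (norm (z' - avg z')) *\<^sub>R (z' - avg z')))"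
    by (simp add: collapse_def \<theta>_def dev_def dist_norm algebra_simps)
  also have "\<dots> \<le> norm (avg z - avg z') + 3 * norm ((z - avg z) - (z' - avg z'))"
    by (rule order_trans[OF norm_triangle_ineq]) (intro add_left_mono shrink')
  also have "norm ((z - avg z) - (z' - avg z')) \<le> norm (z - z') + norm (avg z - avg z')"
    using norm_triangle_ineq4[of "z - z'" "avg z - avg z'"] by (simp add: algebra_simps)
  finally show ?thesis using dist_avg[of z z'] by (simp add: dist_norm)
qed

end

section \<open>Maps that are Lipschitz modulo a group\<close>

definition orbit_lipschitz :: "('b \<Rightarrow> 'b) set \<Rightarrow> real \<Rightarrow> 'a::metric_space set \<Rightarrow> ('a \<Rightarrow> 'b::metric_space) \<Rightarrow> bool" where
  "orbit_lipschitz G C U y \<longleftrightarrow> (\<forall>x\<in>U. \<forall>x'\<in>U. \<exists>g\<in>G. dist (y x) (g (y x')) \<le> C * dist x x')"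

lemma orbit_lipschitzE:
  assumes "orbit_lipschitz G C U y" "x \<in> U" "x' \<in> U"
  obtains g where "g \<in> G" "dist (y x) (g (y x')) \<le> C * dist x x'"
  using assms unfolding orbit_lipschitz_def by blast

lemma orbit_lipschitz_mono_group:
  "orbit_lipschitz H C U y \<Longrightarrow> H \<subseteq> G \<Longrightarrow> orbit_lipschitz G C U y"
  unfolding orbit_lipschitz_def by blast

lemma orbit_lipschitz_compose:
  assumes "orbit_lipschitz G C U y" and "\<And>g z. g \<in> G \<Longrightarrow> F (g z) = g (F z)"
    and "\<And>z z'. dist (F z) (F z') \<le> K * dist z z'" "0 \<le> K"
  shows "orbit_lipschitz G (K * C) U (\<lambda>x. F (y x))"
  unfolding orbit_lipschitz_def
proof (intro ballI)
  fix x x' assume "x \<in> U" "x' \<in> U"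
  then obtain g where g: "g \<in> G" "dist (y x) (g (y x')) \<le> C * dist x x'"
    by (rule orbit_lipschitzE[OF assms(1)])
  have "dist (F (y x)) (g (F (y x'))) \<le> K * dist (y x) (g (y x'))"
    using assms(2)[OF g(1)] assms(3) by metis
  also have "\<dots> \<le> K * (C * dist x x')" using g(2) assms(4) by (rule mult_left_mono)
  finally show "\<exists>g\<in>G. dist (F (y x)) (g (F (y x'))) \<le> K * C * dist x x'"
    using g(1) by (auto simp: mult.assoc)
qed

lemma orbit_lipschitz_invariant:
  fixes F :: "'b::metric_space \<Rightarrow> 'c::metric_space"
  assumes "orbit_lipschitz G C U y" and "\<And>g z. g \<in> G \<Longrightarrow> F (g z) = F z"
    and "\<And>z z'. dist (F z) (F z') \<le> K * dist z z'" "0 \<le> K" "0 \<le> C"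
  shows "(K * C)-lipschitz_on U (\<lambda>x. F (y x))"
proof (rule lipschitz_onI)
  fix x x' assume "x \<in> U" "x' \<in> U"
  then obtain g where g: "g \<in> G" "dist (y x) (g (y x')) \<le> C * dist x x'"
    by (rule orbit_lipschitzE[OF assms(1)])
  have "dist (F (y x)) (F (y x')) \<le> K * dist (y x) (g (y x'))"
    using assms(2)[OF g(1)] assms(3) by metis
  also have "\<dots> \<le> K * (C * dist x x')" using g(2) assms(4) by (rule mult_left_mono)
  finally show "dist (F (y x)) (F (y x')) \<le> K * C * dist x x'" by (simp add: mult.assoc)
qed (use assms in simp)

text \<open>Invariance of \<open>L\<close> under the stabiliser of \<open>y x\<^sub>0\<close> makes \<open>L\<close> unique. For permutations it says that
  equal entries have equal derivatives.\<close>

definition has_orbit_derivative ::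
    "('b \<Rightarrow> 'b) set \<Rightarrow> ('a::real_normed_vector \<Rightarrow> 'b::real_normed_vector) \<Rightarrow> 'a \<Rightarrow> ('a \<Rightarrow> 'b) \<Rightarrow> bool" where
  "has_orbit_derivative G y x\<^sub>0 L \<longleftrightarrow> linear L \<and> (\<forall>g\<in>G. g (y x\<^sub>0) = y x\<^sub>0 \<longrightarrow> (\<forall>v. g (L v) = L v)) \<and>
     (\<forall>e>0. \<exists>r>0. \<forall>x. dist x x\<^sub>0 < r \<longrightarrow> (\<exists>g\<in>G. dist (y x) (g (y x\<^sub>0 + L (x - x\<^sub>0))) \<le> e * dist x x\<^sub>0))"

definition orbit_derivative ::
    "('b \<Rightarrow> 'b) set \<Rightarrow> ('a::real_normed_vector \<Rightarrow> 'b::real_normed_vector) \<Rightarrow> 'a \<Rightarrow> 'a \<Rightarrow> 'b" where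
  "orbit_derivative G y x = (SOME L. has_orbit_derivative G y x L)"

lemma has_orbit_derivative_transform:
  assumes "has_orbit_derivative G y x L" "open S" "x \<in> S" "\<And>x'. x' \<in> S \<Longrightarrow> y x' = y' x'"
  shows "has_orbit_derivative G y' x L"
proof -
  obtain s where s: "s > 0" "ball x s \<subseteq> S" using assms(2,3) open_contains_ball by blast
  have eq: "y x' = y' x'" if "dist x' x < s" for x'
    using s(2) that assms(4) by (auto simp: subset_iff dist_commute)
  have eqx: "y' x = y x" using eq[of x] s(1) by simp
  have "\<exists>r>0. \<forall>x'. dist x' x < r \<longrightarrow> (\<exists>g\<in>G. dist (y' x') (g (y x + L (x' - x))) \<le> e * dist x' x)" if e: "e > 0" for e
  proof -
    obtain r where r: "r > 0" "\<And>x'. dist x' x < r \<Longrightarrow> \<exists>g\<in>G. dist (y x') (g (y x + L (x' - x))) \<le> e * dist x' x"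
      using assms(1) e unfolding has_orbit_derivative_def by blast
    have "\<exists>g\<in>G. dist (y' x') (g (y x + L (x' - x))) \<le> e * dist x' x" if "dist x' x < min r s" for x'
      using r(2)[of x'] eq[of x'] that by simp
    then show ?thesis using r(1) s(1) by (intro exI[of _ "min r s"]) auto
  qed
  then show ?thesis using assms(1) unfolding has_orbit_derivative_def eqx by blast
qed

lemma orbit_derivative_transform:
  assumes "open S" "x \<in> S" "\<And>x'. x' \<in> S \<Longrightarrow> y x' = y' x'"
  shows "orbit_derivative G y x = orbit_derivative G y' x"
proof -
  have "has_orbit_derivative G y x L \<longleftrightarrow> has_orbit_derivative G y' x L" for L
    using has_orbit_derivative_transform[of G y x L S y'] has_orbit_derivative_transform[of G y' x L S y] assms by auto
  then have "has_orbit_derivative G y x = has_orbit_derivative G y' x" by (rule ext)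
  then show ?thesis unfolding orbit_derivative_def by simp
qed

context isometry_group
begin

lemma has_orbit_derivative_near:
  assumes L: "has_orbit_derivative G y x L" and e: "e > 0" and v: "v \<noteq> 0"
  shows "\<forall>\<^sub>F t in at_right 0. \<exists>g\<in>G. dist (y (x + t *\<^sub>R v)) (g (y x + t *\<^sub>R L v)) \<le> e * (t * norm v)"
proof -
  obtain r where r: "r > 0" "\<And>x'. dist x' x < r \<Longrightarrow> \<exists>g\<in>G. dist (y x') (g (y x + L (x' - x))) \<le> e * dist x' x"
    using L e unfolding has_orbit_derivative_def by blast
  have lin: "linear L" using L unfolding has_orbit_derivative_def by blast
  have "\<forall>\<^sub>F t in at_right 0. t < r / norm v"
    using r(1) v by (intro eventually_at_right_0_less) simp
  then show ?thesis
    using eventually_at_right_less[of "0::real"]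
  proof eventually_elim
    case (elim t)
    then have "dist (x + t *\<^sub>R v) x < r" using v by (simp add: dist_norm pos_less_divide_eq)
    from r(2)[OF this] show ?case
      using elim by (simp add: dist_norm linear_cmul[OF lin])
  qed
qed

text \<open>Close to \<open>z\<close>, an element of \<open>G\<close> that moves \<open>z\<close> moves it by a definite amount. So the group elements
  that occur for small \<open>t\<close> fix \<open>z\<close>, and the first-order terms can be compared.\<close>

lemma orbit_close_imp_fixed_close:
  assumes "\<forall>\<^sub>F t in at_right (0::real). \<exists>g\<in>G. dist (z + t *\<^sub>R a) (g (z + t *\<^sub>R b)) \<le> c * t"
  shows "\<exists>g\<in>G. g z = z \<and> dist a (g b) \<le> c"
proof -
  obtain \<delta> where \<delta>: "\<delta> > 0" "\<And>g. g \<in> G \<Longrightarrow> dist z (g z) < \<delta> \<Longrightarrow> g z = z"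
    using fixed_if_close[of z] by blast
  define M where "M = norm a + norm b + \<bar>c\<bar> + 1"
  have M: "M > 0" unfolding M_def by (smt (verit) norm_ge_zero)
  have "\<forall>\<^sub>F t in at_right 0. t < \<delta> / M"
    using \<delta>(1) M by (intro eventually_at_right_0_less) simp
  with assms eventually_at_right_less[of "0::real"]
  have "\<forall>\<^sub>F t in at_right (0::real). \<exists>g\<in>G. g z = z \<and> dist a (g b) \<le> c"
  proof eventually_elim
    case (elim t)
    then obtain g where g: "g \<in> G" "dist (z + t *\<^sub>R a) (g (z + t *\<^sub>R b)) \<le> c * t" by blast
    note lin = linear_G[OF g(1)]
    have eq: "g (z + t *\<^sub>R b) = g z + t *\<^sub>R g b" by (simp add: linear_add[OF lin] linear_cmul[OF lin])
    have d: "norm ((z - g z) + t *\<^sub>R (a - g b)) \<le> c * t"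
      using g(2) unfolding eq by (simp add: dist_norm algebra_simps)
    have "norm (z - g z) \<le> norm ((z - g z) + t *\<^sub>R (a - g b)) + norm (t *\<^sub>R (a - g b))"
      using norm_triangle_ineq4[of "(z - g z) + t *\<^sub>R (a - g b)" "t *\<^sub>R (a - g b)"] by simp
    also have "\<dots> \<le> c * t + t * (norm a + norm b)"
    proof (intro add_mono d)
      have "norm (a - g b) \<le> norm a + norm b"
        using norm_triangle_ineq4[of a "g b"] norm_G[OF g(1)] by simp
      then show "norm (t *\<^sub>R (a - g b)) \<le> t * (norm a + norm b)"
        using elim by (simp add: mult_left_mono)
    qed
    also have "\<dots> \<le> t * M"
    proof -
      have "c * t \<le> \<bar>c\<bar> * t" using elim by (intro mult_right_mono) auto
      moreover have "t * M = t * (norm a + norm b) + \<bar>c\<bar> * t + t" by (simp add: M_def algebra_simps)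
      ultimately show ?thesis using elim by linarith
    qed
    also have "\<dots> < \<delta>" using elim M by (simp add: pos_less_divide_eq)
    finally have fixz: "g z = z" using \<delta>(2)[OF g(1)] by (simp add: dist_norm)
    have "t * norm (a - g b) \<le> t * c" using d elim unfolding fixz by (simp add: mult.commute)
    then have "dist a (g b) \<le> c" using elim by (simp add: dist_norm)
    then show ?case using g(1) fixz by blast
  qed
  then show ?thesis by (simp add: eventually_const_iff)
qed

lemma has_orbit_derivative_unique:
  assumes L: "has_orbit_derivative G y x L" and L': "has_orbit_derivative G y x L'"
  shows "L = L'"
proof
  fix v
  show "L v = L' v"
  proof (cases "v = 0")
    case True
    then show ?thesis using L L' unfolding has_orbit_derivative_def by (simp add: linear_0)
  next
    case False
    have bd: "dist (L v) (L' v) \<le> 2 * e * norm v" if e: "e > 0" for e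
    proof -
      have "\<forall>\<^sub>F t in at_right (0::real). \<exists>g\<in>G. dist (y x + t *\<^sub>R L v) (g (y x + t *\<^sub>R L' v)) \<le> (2 * e * norm v) * t"
        using has_orbit_derivative_near[OF L e False] has_orbit_derivative_near[OF L' e False]
      proof eventually_elim
        case (elim t)
        obtain g where g: "g \<in> G" "dist (y (x + t *\<^sub>R v)) (g (y x + t *\<^sub>R L v)) \<le> e * (t * norm v)"
          using elim(1) by blast
        obtain g' where g': "g' \<in> G" "dist (y (x + t *\<^sub>R v)) (g' (y x + t *\<^sub>R L' v)) \<le> e * (t * norm v)"
          using elim(2) by blast
        obtain h where h: "h \<in> G" "\<And>z. h (g z) = z" "\<And>z. g (h z) = z" using inverseE[OF g(1)] by metis
        have "dist (y x + t *\<^sub>R L v) (h (g' (y x + t *\<^sub>R L' v))) = dist (g (y x + t *\<^sub>R L v)) (g' (y x + t *\<^sub>R L' v))"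
          using dist_G[OF g(1), of "y x + t *\<^sub>R L v" "h (g' (y x + t *\<^sub>R L' v))"] by (simp add: h)
        also have "\<dots> \<le> e * (t * norm v) + e * (t * norm v)"
          using dist_triangle3[of "g (y x + t *\<^sub>R L v)" "g' (y x + t *\<^sub>R L' v)" "y (x + t *\<^sub>R v)"] g(2) g'(2) by linarith
        finally have "dist (y x + t *\<^sub>R L v) ((h \<circ> g') (y x + t *\<^sub>R L' v)) \<le> (2 * e * norm v) * t"
          by (simp add: mult_ac)
        then show ?case using comp_G[OF h(1) g'(1)] by blast
      qed
      from orbit_close_imp_fixed_close[OF this]
      obtain g where "g \<in> G" "g (y x) = y x" "dist (L v) (g (L' v)) \<le> 2 * e * norm v" by blast
      then show ?thesis using L' unfolding has_orbit_derivative_def by metis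
    qed
    have "dist (L v) (L' v) \<le> 0 + e" if "e > 0" for e
      using bd[of "e / (2 * norm v)"] that False by simp
    then have "dist (L v) (L' v) \<le> 0" by (rule field_le_epsilon)
    then show ?thesis by simp
  qed
qed

lemma orbit_derivative_eq: "has_orbit_derivative G y x L \<Longrightarrow> orbit_derivative G y x = L"
  unfolding orbit_derivative_def by (intro some_equality has_orbit_derivative_unique)

lemma has_orbit_derivative_bound:
  assumes L: "has_orbit_derivative G y x L" and y: "orbit_lipschitz G C U y" and U: "open U" "x \<in> U"
  shows "norm (L v) \<le> C * norm v"
proof (cases "v = 0")
  case True
  then show ?thesis using L unfolding has_orbit_derivative_def by (simp add: linear_0)
next
  case False
  obtain s where s: "s > 0" "ball x s \<subseteq> U" using U open_contains_ball by blast
  have "norm (L v) \<le> C * norm v + e" if e: "e > 0" for e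
  proof -
    define e' where "e' = e / norm v"
    have e': "e' > 0" using e False by (simp add: e'_def)
    have "\<forall>\<^sub>F t in at_right 0. t < s / norm v"
      using s(1) False by (intro eventually_at_right_0_less) simp
    then have "\<forall>\<^sub>F t in at_right (0::real). \<exists>g\<in>G. dist (y x + t *\<^sub>R L v) (g (y x + t *\<^sub>R 0)) \<le> (C * norm v + e) * t"
      using has_orbit_derivative_near[OF L e' False] eventually_at_right_less[of "0::real"]
    proof eventually_elim
      case (elim t)
      have "x + t *\<^sub>R v \<in> ball x s" using elim False by (simp add: dist_norm pos_less_divide_eq)
      then have "x + t *\<^sub>R v \<in> U" using s by blast
      then obtain g' where g': "g' \<in> G" "dist (y (x + t *\<^sub>R v)) (g' (y x)) \<le> C * dist (x + t *\<^sub>R v) x"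
        using orbit_lipschitzE[OF y _ U(2)] by blast
      obtain g where g: "g \<in> G" "dist (y (x + t *\<^sub>R v)) (g (y x + t *\<^sub>R L v)) \<le> e' * (t * norm v)"
        using elim(2) by blast
      obtain h where h: "h \<in> G" "\<And>z. h (g z) = z" "\<And>z. g (h z) = z" using inverseE[OF g(1)] by metis
      have "dist (y x + t *\<^sub>R L v) (h (g' (y x))) = dist (g (y x + t *\<^sub>R L v)) (g' (y x))"
        using dist_G[OF g(1), of "y x + t *\<^sub>R L v" "h (g' (y x))"] by (simp add: h)
      also have "\<dots> \<le> e' * (t * norm v) + C * dist (x + t *\<^sub>R v) x"
        using dist_triangle3[of "g (y x + t *\<^sub>R L v)" "g' (y x)" "y (x + t *\<^sub>R v)"] g(2) g'(2) by linarith
      also have "\<dots> = (C * norm v + e) * t"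
        using elim False by (simp add: e'_def dist_norm algebra_simps)
      finally have "dist (y x + t *\<^sub>R L v) ((h \<circ> g') (y x + t *\<^sub>R 0)) \<le> (C * norm v + e) * t" by simp
      then show ?case using comp_G[OF h(1) g'(1)] by blast
    qed
    from orbit_close_imp_fixed_close[OF this]
    obtain g where "g \<in> G" "dist (L v) (g 0) \<le> C * norm v + e" by blast
    then show ?thesis using linear_0[OF linear_G[of g]] by (simp add: dist_norm)
  qed
  then show ?thesis by (rule field_le_epsilon)
qed

text \<open>The elements \<open>\<gamma> x'\<close> may depend on the point in an arbitrary way, because only orbits are
  compared.\<close>

lemma has_orbit_derivative_reselect:
  assumes L: "has_orbit_derivative G y x L" and S: "open S" "x \<in> S" and \<gamma>: "\<And>x'. x' \<in> S \<Longrightarrow> \<gamma> x' \<in> G"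
  shows "has_orbit_derivative G (\<lambda>x. \<gamma> x (y x)) x (\<lambda>v. \<gamma> x (L v))"
  unfolding has_orbit_derivative_def
proof (intro conjI ballI impI allI)
  have lin\<gamma>: "linear (\<gamma> x)" using \<gamma> S linear_G by blast
  have lin: "linear L" using L unfolding has_orbit_derivative_def by blast
  obtain k where k: "k \<in> G" "\<And>z. k (\<gamma> x z) = z" "\<And>z. \<gamma> x (k z) = z" using inverseE[OF \<gamma>[OF S(2)]] by blast
  show "linear (\<lambda>v. \<gamma> x (L v))" using linear_compose[OF lin lin\<gamma>] by (simp add: o_def)
  show "g (\<gamma> x (L v)) = \<gamma> x (L v)" if g: "g \<in> G" "g (\<gamma> x (y x)) = \<gamma> x (y x)" for g v
  proof -
    have "k \<circ> (g \<circ> \<gamma> x) \<in> G" using k(1) g(1) \<gamma>[OF S(2)] comp_G by blast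
    moreover have "(k \<circ> (g \<circ> \<gamma> x)) (y x) = y x" using g(2) k by simp
    ultimately have "(k \<circ> (g \<circ> \<gamma> x)) (L v) = L v" using L unfolding has_orbit_derivative_def by blast
    then show ?thesis using k(3) by (metis comp_apply)
  qed
  fix e :: real assume "e > 0"
  then obtain r where r: "r > 0" "\<And>x'. dist x' x < r \<Longrightarrow> \<exists>g\<in>G. dist (y x') (g (y x + L (x' - x))) \<le> e * dist x' x"
    using L unfolding has_orbit_derivative_def by blast
  obtain s where s: "s > 0" "ball x s \<subseteq> S" using S open_contains_ball by blast
  have "\<exists>g\<in>G. dist (\<gamma> x' (y x')) (g (\<gamma> x (y x) + \<gamma> x (L (x' - x)))) \<le> e * dist x' x" if d: "dist x' x < min r s" for x'
  proof -
    have "x' \<in> ball x s" using d by (simp add: dist_commute)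
    then have x': "\<gamma> x' \<in> G" using s \<gamma> by blast
    obtain g where g: "g \<in> G" "dist (y x') (g (y x + L (x' - x))) \<le> e * dist x' x" using r(2)[of x'] d by auto
    have "dist (\<gamma> x' (y x')) ((\<gamma> x' \<circ> (g \<circ> k)) (\<gamma> x (y x) + \<gamma> x (L (x' - x)))) = dist (y x') (g (y x + L (x' - x)))"
      using dist_G[OF x'] k(2) by (simp add: linear_add[OF lin\<gamma>, symmetric])
    then show ?thesis using g(2) comp_G[OF x' comp_G[OF g(1) k(1)]] by (intro bexI) auto
  qed
  then show "\<exists>r>0. \<forall>x'. dist x' x < r \<longrightarrow> (\<exists>g\<in>G. dist (\<gamma> x' (y x')) (g (\<gamma> x (y x) + \<gamma> x (L (x' - x)))) \<le> e * dist x' x)"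
    using r(1) s(1) by (intro exI[of _ "min r s"]) auto
qed

lemma has_derivative_imp_has_orbit_derivative:
  assumes d: "(y has_derivative L) (at x)" and inv: "\<And>g v. g \<in> G \<Longrightarrow> g (y x) = y x \<Longrightarrow> g (L v) = L v"
  shows "has_orbit_derivative G y x L"
  unfolding has_orbit_derivative_def
proof (intro conjI ballI impI allI)
  show "linear L" using d has_derivative_bounded_linear bounded_linear.linear by blast
  show "g (L v) = L v" if "g \<in> G" "g (y x) = y x" for g v using inv that .
  fix e :: real assume "e > 0"
  then obtain r where "r > 0" "\<And>x'. norm (x' - x) < r \<Longrightarrow> norm (y x' - y x - L (x' - x)) \<le> e * norm (x' - x)"
    using d unfolding has_derivative_at_alt by blast
  then show "\<exists>r>0. \<forall>x'. dist x' x < r \<longrightarrow> (\<exists>g\<in>G. dist (y x') (g (y x + L (x' - x))) \<le> e * dist x' x)"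
    using id_G by (intro exI[of _ r]) (auto simp: dist_norm diff_diff_eq intro!: bexI[of _ id])
qed

text \<open>Each value near \<open>x\<^sub>0\<close> is replaced by the point of its orbit that is close to \<open>z = y x\<^sub>0\<close>.
  A group element that brings two such points close to each other moves \<open>z\<close> only a little, hence
  fixes it. In the same way, the stabilisers of the new values are contained in that of \<open>z\<close>.\<close>

lemma local_reselection:
  assumes y: "orbit_lipschitz G C U y" and C: "0 \<le> C" and U: "open U" "x\<^sub>0 \<in> U" and nf: "avg (y x\<^sub>0) \<noteq> y x\<^sub>0"
  obtains B H \<gamma> where "open B" "x\<^sub>0 \<in> B" "B \<subseteq> U" "isometry_group H" "H \<subseteq> G" "card H < card G"
    "\<And>x. \<gamma> x \<in> G" "orbit_lipschitz H C B (\<lambda>x. \<gamma> x (y x))"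
    "\<And>x g. x \<in> B \<Longrightarrow> g \<in> G \<Longrightarrow> g (\<gamma> x (y x)) = \<gamma> x (y x) \<Longrightarrow> g \<in> H"
proof -
  define z where "z = y x\<^sub>0"
  define H where "H = {g \<in> G. g z = z}"
  have HG: "H \<subseteq> G" by (auto simp: H_def)
  have "\<exists>g\<in>G. g z \<noteq> z" using nf fixed_iff[of z] by (auto simp: z_def)
  then have "H \<subset> G" by (auto simp: H_def)
  then have card: "card H < card G" using finite_G by (rule psubset_card_mono[rotated])
  have grpH: "isometry_group H"
  proof (rule isometry_group.intro)
    fix g assume g: "g \<in> H"
    then obtain h where h: "h \<in> G" "h \<circ> g = id" "g \<circ> h = id" using inverse_G HG by blast
    have "h z = z" using g h(2) by (auto simp: H_def fun_eq_iff) metis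
    then show "\<exists>h\<in>H. h \<circ> g = id \<and> g \<circ> h = id" using h by (auto simp: H_def)
  next
    show "finite H" using finite_G by (simp add: H_def)
    show "id \<in> H" using id_G by (simp add: H_def)
    show "g \<circ> h \<in> H" if "g \<in> H" "h \<in> H" for g h using comp_G that by (simp add: H_def)
    show "linear g" if "g \<in> H" for g using linear_G that HG by blast
    show "norm (g z) = norm z" if "g \<in> H" for g z using norm_G that HG by blast
  qed
  obtain \<delta> where \<delta>: "\<delta> > 0" "\<And>g. g \<in> G \<Longrightarrow> dist z (g z) < \<delta> \<Longrightarrow> g z = z"
    using fixed_if_close[of z] by blast
  obtain s where s: "s > 0" "ball x\<^sub>0 s \<subseteq> U" using U open_contains_ball by blast
  (* new values stay within \<delta> / 8 of z, so that a group element which brings two of them within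
     \<delta> / 4 of each other moves z by at most \<delta> / 2 *)
  define r where "r = min s (\<delta> / (8 * (C + 1)))"
  have r: "r > 0" "r \<le> s" "C * r \<le> \<delta> / 8"
  proof -
    show "r > 0" "r \<le> s" using s \<delta> C by (auto simp: r_def)
    have "C * r \<le> C * (\<delta> / (8 * (C + 1)))" using C by (intro mult_left_mono) (auto simp: r_def)
    also have "\<dots> \<le> \<delta> / 8" using C \<delta> by (simp add: field_simps)
    finally show "C * r \<le> \<delta> / 8" .
  qed
  have "\<exists>g\<in>G. x \<in> ball x\<^sub>0 r \<longrightarrow> dist (g (y x)) z \<le> \<delta> / 8" for x
  proof (cases "x \<in> ball x\<^sub>0 r")
    case True
    then have "x \<in> U" using s r by auto
    then obtain g where g: "g \<in> G" "dist (y x) (g z) \<le> C * dist x x\<^sub>0"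
      using orbit_lipschitzE[OF y _ U(2)] unfolding z_def by blast
    obtain h where h: "h \<in> G" "\<And>z. h (g z) = z" "\<And>z. g (h z) = z" using inverseE[OF g(1)] by metis
    have "dist (h (y x)) z = dist (y x) (g z)" using dist_G[OF g(1), of "h (y x)" z] h(3) by simp
    also have "\<dots> \<le> C * dist x x\<^sub>0" by fact
    also have "\<dots> \<le> C * r" using True C by (intro mult_left_mono) (auto simp: dist_commute)
    finally have "dist (h (y x)) z \<le> \<delta> / 8" using r(3) by simp
    then show ?thesis using h(1) by blast
  qed (use id_G in blast)
  then obtain \<gamma> where \<gamma>: "\<And>x. \<gamma> x \<in> G" "\<And>x. x \<in> ball x\<^sub>0 r \<Longrightarrow> dist (\<gamma> x (y x)) z \<le> \<delta> / 8" by metis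
  have inH: "g \<in> H" if g: "g \<in> G" and x: "x \<in> ball x\<^sub>0 r" "x' \<in> ball x\<^sub>0 r"
      and d: "dist (\<gamma> x (y x)) (g (\<gamma> x' (y x'))) \<le> \<delta> / 4" for g x x'
  proof -
    have "dist z (g z) \<le> dist z (\<gamma> x (y x)) + dist (\<gamma> x (y x)) (g (\<gamma> x' (y x'))) + dist (g (\<gamma> x' (y x'))) (g z)"
      using dist_triangle[of z "g z" "\<gamma> x (y x)"] dist_triangle[of "\<gamma> x (y x)" "g z" "g (\<gamma> x' (y x'))"] by linarith
    also have "\<dots> \<le> \<delta> / 8 + \<delta> / 4 + \<delta> / 8"
      using \<gamma>(2)[OF x(1)] \<gamma>(2)[OF x(2)] d dist_G[OF g] by (intro add_mono) (auto simp: dist_commute)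
    also have "\<dots> < \<delta>" using \<delta>(1) by simp
    finally have "g z = z" by (rule \<delta>(2)[OF g])
    then show ?thesis using g by (simp add: H_def)
  qed
  have lipH: "orbit_lipschitz H C (ball x\<^sub>0 r) (\<lambda>x. \<gamma> x (y x))"
    unfolding orbit_lipschitz_def
  proof (intro ballI)
    fix x x' assume x: "x \<in> ball x\<^sub>0 r" "x' \<in> ball x\<^sub>0 r"
    then have "x \<in> U" "x' \<in> U" using s r by auto
    then obtain g where g: "g \<in> G" "dist (y x) (g (y x')) \<le> C * dist x x'" by (rule orbit_lipschitzE[OF y])
    obtain h where h: "h \<in> G" "\<And>z. h (\<gamma> x' z) = z" using inverseE[OF \<gamma>(1)[of x']] by metis
    define f where "f = \<gamma> x \<circ> (g \<circ> h)"
    have f: "f \<in> G" unfolding f_def by (intro comp_G \<gamma> g h)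
    have d: "dist (\<gamma> x (y x)) (f (\<gamma> x' (y x'))) = dist (y x) (g (y x'))"
      using dist_G[OF \<gamma>(1), of x "y x" "g (y x')"] h(2)[of "y x'"] by (simp add: f_def)
    have "dist x x' \<le> 2 * r" using x dist_triangle3[of x x' x\<^sub>0] by simp
    then have "C * dist x x' \<le> C * (2 * r)" using C by (rule mult_left_mono)
    also have "\<dots> \<le> \<delta> / 4" using r(3) by simp
    finally have "dist (\<gamma> x (y x)) (f (\<gamma> x' (y x'))) \<le> \<delta> / 4" unfolding d using g(2) by linarith
    then have "f \<in> H" by (rule inH[OF f x])
    moreover have "dist (\<gamma> x (y x)) (f (\<gamma> x' (y x'))) \<le> C * dist x x'" unfolding d by (rule g(2))
    ultimately show "\<exists>g\<in>H. dist (\<gamma> x (y x)) (g (\<gamma> x' (y x'))) \<le> C * dist x x'" by blast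
  qed
  show ?thesis
  proof (rule that[OF open_ball _ _ grpH HG card \<gamma>(1) lipH])
    show "x\<^sub>0 \<in> ball x\<^sub>0 r" using r by simp
    show "ball x\<^sub>0 r \<subseteq> U" using s r by auto
    show "g \<in> H" if "x \<in> ball x\<^sub>0 r" "g \<in> G" "g (\<gamma> x (y x)) = \<gamma> x (y x)" for x g
      using inH[OF that(2,1,1)] that(3) \<delta>(1) by simp
  qed
qed

end

section \<open>Almost everywhere differentiability and measurable pull-backs\<close>

definition cont_tensor :: "nat \<Rightarrow> ('b::euclidean_space \<Rightarrow> 'b list \<Rightarrow> real) \<Rightarrow> bool" where
  "cont_tensor n q \<longleftrightarrow> (\<forall>z. multilinear_list n (q z)) \<and>
     (\<forall>v. length v = n \<longrightarrow> continuous_on UNIV (\<lambda>z. q z v))"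

text \<open>This is the invariance for which the pull-back depends only on the orbit of the point.\<close>

definition invariant_tensor :: "('b \<Rightarrow> 'b) set \<Rightarrow> nat \<Rightarrow> ('b::euclidean_space \<Rightarrow> 'b list \<Rightarrow> real) \<Rightarrow> bool" where
  "invariant_tensor G n q \<longleftrightarrow> (\<forall>g\<in>G. \<forall>z v. length v = n \<longrightarrow> q (g z) (map g v) = q z v)"

definition orbit_pullback ::
    "('b \<Rightarrow> 'b) set \<Rightarrow> ('a::real_normed_vector \<Rightarrow> 'b::euclidean_space) \<Rightarrow> ('b \<Rightarrow> 'b list \<Rightarrow> real) \<Rightarrow> 'a \<Rightarrow> 'a list \<Rightarrow> real" where
  "orbit_pullback G y q x v = q (y x) (map (orbit_derivative G y x) v)"

lemma cont_tensor_bound_prod: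
  assumes q: "cont_tensor n q"
  obtains M where "0 \<le> M" "\<And>z v. norm z \<le> Z \<Longrightarrow> length v = n \<Longrightarrow> \<bar>q z v\<bar> \<le> M * (\<Prod>i<n. norm (v ! i))"
proof -
  have "\<exists>B\<ge>0. \<forall>z. norm z \<le> Z \<longrightarrow> \<bar>q z bs\<bar> \<le> B" if "bs \<in> basis_lists n" for bs
    using continuous_bounded_on_cball[of "\<lambda>z. q z bs" Z] q length_basis_lists[OF that]
    unfolding cont_tensor_def by metis
  then obtain B where B: "\<And>bs. bs \<in> basis_lists n \<Longrightarrow> B bs \<ge> 0"
      "\<And>bs z. bs \<in> basis_lists n \<Longrightarrow> norm z \<le> Z \<Longrightarrow> \<bar>q z bs\<bar> \<le> B bs" by metis
  show ?thesis
  proof (rule that[of "\<Sum>bs\<in>basis_lists n. B bs"])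
    show "0 \<le> (\<Sum>bs\<in>basis_lists n. B bs)" using B(1) by (intro sum_nonneg)
    fix z :: 'a and v :: "'a list" assume z: "norm z \<le> Z" and v: "length v = n"
    have "\<bar>q z v\<bar> = \<bar>\<Sum>bs\<in>basis_lists n. (\<Prod>i<n. v ! i \<bullet> bs ! i) * q z bs\<bar>"
      using multilinear_list_expand[of n "q z" v] q v unfolding cont_tensor_def by simp
    also have "\<dots> \<le> (\<Sum>bs\<in>basis_lists n. \<bar>(\<Prod>i<n. v ! i \<bullet> bs ! i) * q z bs\<bar>)" by (rule sum_abs)
    also have "\<dots> \<le> (\<Sum>bs\<in>basis_lists n. B bs * (\<Prod>i<n. norm (v ! i)))"
    proof (rule sum_mono)
      fix bs :: "'a list" assume bs: "bs \<in> basis_lists n"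
      have "\<bar>\<Prod>i<n. v ! i \<bullet> bs ! i\<bar> \<le> (\<Prod>i<n. norm (v ! i))"
        unfolding abs_prod
      proof (rule prod_mono)
        fix i assume i: "i \<in> {..<n}"
        show "0 \<le> \<bar>v ! i \<bullet> bs ! i\<bar> \<and> \<bar>v ! i \<bullet> bs ! i\<bar> \<le> norm (v ! i)"
          using basis_lists_nth[OF bs] i by (intro conjI Basis_le_norm) auto
      qed
      then have "\<bar>\<Prod>i<n. v ! i \<bullet> bs ! i\<bar> * \<bar>q z bs\<bar> \<le> (\<Prod>i<n. norm (v ! i)) * B bs"
        using B(2)[OF bs z] by (intro mult_mono prod_nonneg) auto
      then show "\<bar>(\<Prod>i<n. v ! i \<bullet> bs ! i) * q z bs\<bar> \<le> B bs * (\<Prod>i<n. norm (v ! i))"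
        by (simp add: abs_mult mult.commute)
    qed
    finally show "\<bar>q z v\<bar> \<le> (\<Sum>bs\<in>basis_lists n. B bs) * (\<Prod>i<n. norm (v ! i))"
      by (simp add: sum_distrib_right)
  qed
qed

lemma cont_tensor_bound:
  assumes q: "cont_tensor n q" and N: "0 \<le> N"
  obtains M where "\<And>z v. norm z \<le> Z \<Longrightarrow> length v = n \<Longrightarrow> (\<And>i. i < n \<Longrightarrow> norm (v ! i) \<le> N) \<Longrightarrow> \<bar>q z v\<bar> \<le> M"
proof -
  obtain M where M: "0 \<le> M" "\<And>z v. norm z \<le> Z \<Longrightarrow> length v = n \<Longrightarrow> \<bar>q z v\<bar> \<le> M * (\<Prod>i<n. norm (v ! i))"
    by (rule cont_tensor_bound_prod[OF q, of Z], rule that)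
  show ?thesis
  proof (rule that[of "M * N ^ n"])
    fix z :: 'a and v :: "'a list" assume z: "norm z \<le> Z" and v: "length v = n" "\<And>i. i < n \<Longrightarrow> norm (v ! i) \<le> N"
    have "(\<Prod>i<n. norm (v ! i)) \<le> (\<Prod>i<n. N)" using v(2) by (intro prod_mono) auto
    then have "M * (\<Prod>i<n. norm (v ! i)) \<le> M * N ^ n" using M(1) by (simp add: mult_left_mono)
    then show "\<bar>q z v\<bar> \<le> M * N ^ n" using M(2)[OF z v(1)] by simp
  qed
qed

lemma C1_form_cont_tensor: "C1_form k \<omega> \<Longrightarrow> cont_tensor k \<omega>"
  unfolding cont_tensor_def using C1_form_multilinear C1_form_continuous by blast

lemma linear_dcoef: "C1_form k \<omega> \<Longrightarrow> length v = k \<Longrightarrow> linear (\<lambda>u. dcoef \<omega> z u v)"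
  using C1_form_has_derivative has_derivative_bounded_linear bounded_linear.linear by blast

text \<open>The direction of differentiation becomes the first argument.\<close>

definition dtensor :: "'b::real_normed_vector form \<Rightarrow> 'b form" where
  "dtensor \<omega> z v = dcoef \<omega> z (hd v) (tl v)"

lemma dtensor_cont_tensor:
  assumes \<omega>: "C1_form k \<omega>"
  shows "cont_tensor (Suc k) (dtensor \<omega>)"
  unfolding cont_tensor_def
proof (intro conjI allI impI)
  fix z
  show "multilinear_list (Suc k) (dtensor \<omega> z)"
    unfolding multilinear_list_def
  proof (intro allI impI)
    fix v :: "'a list" and i assume v: "length v = Suc k" and i: "i < Suc k"
    then obtain u us where u: "v = u # us" "length us = k" by (cases v) auto
    show "linear (\<lambda>a. dtensor \<omega> z (v[i := a]))"
    proof (cases i)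
      case 0
      then show ?thesis using linear_dcoef[OF \<omega> u(2)] by (simp add: dtensor_def u)
    next
      case (Suc j)
      then show ?thesis using dcoef_multilinear[OF \<omega>, of z u] u i
        unfolding multilinear_list_def by (simp add: dtensor_def)
    qed
  qed
next
  fix v :: "'a list" assume "length v = Suc k"
  then show "continuous_on UNIV (\<lambda>z. dtensor \<omega> z v)"
    using \<omega> unfolding C1_form_def dtensor_def by simp
qed

lemma dcoef_invariant:
  assumes \<omega>: "C1_form k \<omega>" and inv: "invariant_tensor G k \<omega>" and g: "g \<in> G" "linear g" and v: "length v = k"
  shows "dcoef \<omega> (g z) (g u) (map g v) = dcoef \<omega> z u v"
proof -
  have "(g has_derivative g) (at z)"
    using g(2) by (simp add: bounded_linear_imp_has_derivative linear_conv_bounded_linear)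
  then have "((\<lambda>z. \<omega> (g z) (map g v)) has_derivative (\<lambda>u. dcoef \<omega> (g z) (g u) (map g v))) (at z)"
    by (rule has_derivative_compose) (use C1_form_has_derivative[OF \<omega>, of "map g v"] v in simp)
  moreover have "(\<lambda>z. \<omega> (g z) (map g v)) = (\<lambda>z. \<omega> z v)"
    using inv g(1) v unfolding invariant_tensor_def by blast
  ultimately have "((\<lambda>z. \<omega> z v) has_derivative (\<lambda>u. dcoef \<omega> (g z) (g u) (map g v))) (at z)" by simp
  from has_derivative_unique[OF this C1_form_has_derivative[OF \<omega> v]]
  show ?thesis by (rule fun_cong)
qed

lemma has_orbit_derivative_supergroup:
  assumes "has_orbit_derivative H y x L" "H \<subseteq> G" "\<And>g. g \<in> G \<Longrightarrow> g (y x) = y x \<Longrightarrow> g \<in> H"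
  shows "has_orbit_derivative G y x L"
  unfolding has_orbit_derivative_def
proof (intro conjI ballI impI allI)
  show "linear L" using assms(1) unfolding has_orbit_derivative_def by blast
  show "g (L v) = L v" if "g \<in> G" "g (y x) = y x" for g v
    using assms(1) assms(3)[OF that] that(2) unfolding has_orbit_derivative_def by blast
  show "\<exists>r>0. \<forall>x'. dist x' x < r \<longrightarrow> (\<exists>g\<in>G. dist (y x') (g (y x + L (x' - x))) \<le> e * dist x' x)" if "e > 0" for e
  proof -
    have "\<exists>r>0. \<forall>x'. dist x' x < r \<longrightarrow> (\<exists>g\<in>H. dist (y x') (g (y x + L (x' - x))) \<le> e * dist x' x)"
      using assms(1) that unfolding has_orbit_derivative_def by simp
    then show ?thesis using assms(2) by (meson subsetD)
  qed
qed

context isometry_group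
begin

lemma avg_extension:
  fixes y :: "'a::metric_space \<Rightarrow> 'b"
  assumes "orbit_lipschitz G C U y" "0 \<le> C"
  obtains D c where "D-lipschitz_on UNIV c" "\<forall>x\<in>U. c x = avg (y x)"
proof -
  have "(1 * C)-lipschitz_on U (\<lambda>x. avg (y x))"
    by (rule orbit_lipschitz_invariant[OF assms(1)]) (use avg_G dist_avg assms in auto)
  then show ?thesis by (rule lipschitz_extension) (use that in blast)
qed

lemma dev_extension:
  fixes y :: "'a::metric_space \<Rightarrow> 'b"
  assumes "orbit_lipschitz G C U y" "0 \<le> C"
  obtains D \<rho> where "D-lipschitz_on UNIV \<rho>" "\<And>x. x \<in> U \<Longrightarrow> \<rho> x = dev (y x)"
proof -
  have "(2 * C)-lipschitz_on U (\<lambda>x. dev (y x))"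
  proof (rule orbit_lipschitz_invariant[OF assms(1)])
    show "dist (dev z) (dev z') \<le> 2 * dist z z'" for z z'
      using dev_lipschitz[of z z'] by (simp add: dist_real_def)
  qed (use dev_G assms in auto)
  then show ?thesis by (rule lipschitz_extension_real) (use that in blast)
qed

text \<open>The distance \<open>\<rho>\<close> of \<open>y\<close> from its average is a single-valued Lipschitz function with minimum \<open>0\<close> at
  the points in question. Where it is differentiable, its derivative therefore vanishes, and \<open>y\<close> has
  the same first-order behaviour as \<open>c\<close>. Outside of these points \<open>y\<close> can be discontinuous, but at
  them it is differentiable in the ordinary sense.\<close>

lemma AE_differentiable_where_fixed:
  fixes y :: "'a::euclidean_space \<Rightarrow> 'b"
  assumes y: "orbit_lipschitz G C U y" and C: "0 \<le> C" and U: "open U"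
    and c: "D-lipschitz_on UNIV c" "\<forall>x\<in>U. c x = avg (y x)"
  shows "AE x in lborel. x \<in> U \<longrightarrow> avg (y x) = y x \<longrightarrow>
    (y has_derivative frechet_derivative c (at x)) (at x) \<and>
    (\<forall>g\<in>G. \<forall>v. g (frechet_derivative c (at x) v) = frechet_derivative c (at x) v)"
proof -
  obtain D' \<rho> where \<rho>: "D'-lipschitz_on UNIV \<rho>" "\<And>x. x \<in> U \<Longrightarrow> \<rho> x = dev (y x)"
    using dev_extension[OF y C] by blast
  show ?thesis
    using rademacher[OF c(1)] rademacher_real[OF \<rho>(1)]
  proof eventually_elim
    case (elim x)
    show ?case
    proof (intro impI)
      assume x: "x \<in> U" and fx: "avg (y x) = y x"
      define L where "L = frechet_derivative c (at x)"
      have dc: "(c has_derivative L) (at x)" using elim(1) by (simp add: L_def frechet_derivative_works)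
      obtain r' where r': "(\<rho> has_derivative r') (at x)" using elim(2) by (auto simp: differentiable_def)
      have \<rho>x: "\<rho> x = 0" using \<rho>(2)[OF x] fx by (simp add: dev_eq_0_iff)
      have "r' = (\<lambda>v. 0)"
        by (rule differential_zero_maxmin[OF x U r']) (use \<rho>(2) \<rho>x dev_nonneg in auto)
      then have d\<rho>: "(\<rho> has_derivative (\<lambda>v. 0)) (at x)" using r' by simp
      obtain s where s: "s > 0" "ball x s \<subseteq> U" using U x open_contains_ball by blast
      have "(y has_derivative L) (at x)"
        unfolding has_derivative_at_alt
      proof (intro conjI allI impI)
        show "bounded_linear L" using dc by (rule has_derivative_bounded_linear)
        fix e :: real assume "e > 0"
        then have e2: "e / 2 > 0" by simp
        obtain d1 where d1: "d1 > 0" "\<And>x'. norm (x' - x) < d1 \<Longrightarrow> norm (c x' - c x - L (x' - x)) \<le> e / 2 * norm (x' - x)"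
          using dc e2 unfolding has_derivative_at_alt by blast
        obtain d2 where d2: "d2 > 0" "\<And>x'. norm (x' - x) < d2 \<Longrightarrow> norm (\<rho> x' - \<rho> x - 0) \<le> e / 2 * norm (x' - x)"
          using d\<rho> e2 unfolding has_derivative_at_alt by blast
        have "norm (y x' - y x - L (x' - x)) \<le> e * norm (x' - x)" if n: "norm (x' - x) < min s (min d1 d2)" for x'
        proof -
          have x': "x' \<in> U" using s n by (auto simp: dist_norm norm_minus_commute)
          have "norm (y x' - c x') = \<rho> x'" using \<rho>(2)[OF x'] bspec[OF c(2) x'] by (simp add: dev_def)
          moreover have "y x' - y x - L (x' - x) = (c x' - c x - L (x' - x)) + (y x' - c x')"
            using bspec[OF c(2) x] fx by simp
          ultimately have "norm (y x' - y x - L (x' - x)) \<le> norm (c x' - c x - L (x' - x)) + \<rho> x'"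
            by (metis norm_triangle_ineq)
          also have "\<dots> \<le> e / 2 * norm (x' - x) + e / 2 * norm (x' - x)"
            using d1(2)[of x'] d2(2)[of x'] n \<rho>x by (intro add_mono) auto
          finally show ?thesis by simp
        qed
        then show "\<exists>d>0. \<forall>x'. norm (x' - x) < d \<longrightarrow> norm (y x' - y x - L (x' - x)) \<le> e * norm (x' - x)"
          using s(1) d1(1) d2(1) by (intro exI[of _ "min s (min d1 d2)"]) auto
      qed
      moreover have "g (L v) = L v" if g: "g \<in> G" for g v
      proof -
        have "bounded_linear g" using linear_G[OF g] by (simp add: linear_conv_bounded_linear)
        then have "((\<lambda>x. g (c x)) has_derivative (\<lambda>v. g (L v))) (at x)"
          using dc by (rule bounded_linear.has_derivative)
        then have "(c has_derivative (\<lambda>v. g (L v))) (at x)"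
          by (rule has_derivative_transform_within_open[OF _ U x]) (use c(2) G_avg[OF g] in simp)
        from has_derivative_unique[OF this dc] show ?thesis by (rule fun_cong)
      qed
      ultimately show "(y has_derivative frechet_derivative c (at x)) (at x) \<and>
          (\<forall>g\<in>G. \<forall>v. g (frechet_derivative c (at x) v) = frechet_derivative c (at x) v)"
        unfolding L_def by blast
    qed
  qed
qed

lemma pullback_reselect:
  assumes L: "has_orbit_derivative G (\<lambda>x. \<gamma> x (y x)) x L" and S: "open S" "x \<in> S" and \<gamma>: "\<And>x. \<gamma> x \<in> G"
  shows "\<exists>L'. has_orbit_derivative G y x L' \<and> L = (\<lambda>v. \<gamma> x (L' v))"
proof -
  obtain \<kappa> where \<kappa>: "\<And>x. \<kappa> x \<in> G" "\<And>x z. \<kappa> x (\<gamma> x z) = z" "\<And>x z. \<gamma> x (\<kappa> x z) = z"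
  proof -
    have "\<forall>x. \<exists>h. h \<in> G \<and> (\<forall>z. h (\<gamma> x z) = z) \<and> (\<forall>z. \<gamma> x (h z) = z)"
    proof
      fix x
      show "\<exists>h. h \<in> G \<and> (\<forall>z. h (\<gamma> x z) = z) \<and> (\<forall>z. \<gamma> x (h z) = z)"
        using inverseE[OF \<gamma>[of x]] by metis
    qed
    from choice[OF this] show ?thesis using that by blast
  qed
  have "has_orbit_derivative G (\<lambda>x. \<kappa> x (\<gamma> x (y x))) x (\<lambda>v. \<kappa> x (L v))"
    using has_orbit_derivative_reselect[OF L S, of \<kappa>] \<kappa>(1) by blast
  then show ?thesis using \<kappa>(2,3) by (intro exI[of _ "\<lambda>v. \<kappa> x (L v)"]) simp
qed

end

text \<open>Points with a non-fixed value have a neighbourhood to which the induction hypothesis applies;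
  countably many such neighbourhoods suffice.\<close>

theorem AE_has_orbit_derivative:
  fixes y :: "'a::euclidean_space \<Rightarrow> 'b::euclidean_space"
  assumes "isometry_group G" "open U" "0 \<le> C" "orbit_lipschitz G C U y"
  shows "AE x in lborel. x \<in> U \<longrightarrow> (\<exists>L. has_orbit_derivative G y x L)"
  using assms
proof (induction "card G" arbitrary: G U y rule: less_induct)
  case less
  interpret isometry_group G by fact
  obtain D c where c: "D-lipschitz_on UNIV c" "\<forall>x\<in>U. c x = avg (y x)"
    using avg_extension[OF less.prems(4,3)] by blast
  define \<B> where "\<B> = {B. open B \<and> (AE x in lborel. x \<in> B \<longrightarrow> (\<exists>L. has_orbit_derivative G y x L))}"
  obtain \<B>' where \<B>': "\<B>' \<subseteq> \<B>" "countable \<B>'" "\<Union>\<B>' = \<Union>\<B>"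
    by (rule Lindelof[of \<B>]) (auto simp: \<B>_def)
  have "AE x in lborel. \<forall>B\<in>\<B>'. x \<in> B \<longrightarrow> (\<exists>L. has_orbit_derivative G y x L)"
    using \<B>' by (subst AE_ball_countable) (auto simp: \<B>_def)
  then show ?case
    using AE_differentiable_where_fixed[OF less.prems(4,3,2) c]
  proof eventually_elim
    case (elim x)
    show ?case
    proof
      assume x: "x \<in> U"
      show "\<exists>L. has_orbit_derivative G y x L"
      proof (cases "avg (y x) = y x")
        case True
        then show ?thesis using elim(2) x has_derivative_imp_has_orbit_derivative by blast
      next
        case False
        obtain B H \<gamma> where B: "open B" "x \<in> B" "B \<subseteq> U" and H: "isometry_group H" "H \<subseteq> G" "card H < card G"
          and \<gamma>: "\<And>x. \<gamma> x \<in> G" "orbit_lipschitz H C B (\<lambda>x. \<gamma> x (y x))"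
            "\<And>x g. x \<in> B \<Longrightarrow> g \<in> G \<Longrightarrow> g (\<gamma> x (y x)) = \<gamma> x (y x) \<Longrightarrow> g \<in> H"
          by (rule local_reselection[OF less.prems(4,3,2) x False], rule that)
        have "AE x in lborel. x \<in> B \<longrightarrow> (\<exists>L. has_orbit_derivative H (\<lambda>x. \<gamma> x (y x)) x L)"
          by (rule less.hyps[OF H(3,1) B(1) less.prems(3) \<gamma>(2)])
        then have "AE x in lborel. x \<in> B \<longrightarrow> (\<exists>L. has_orbit_derivative G y x L)"
        proof eventually_elim
          case (elim x')
          show ?case
          proof
            assume x': "x' \<in> B"
            then obtain L where "has_orbit_derivative H (\<lambda>x. \<gamma> x (y x)) x' L" using elim by blast
            then have "has_orbit_derivative G (\<lambda>x. \<gamma> x (y x)) x' L"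
              by (rule has_orbit_derivative_supergroup[OF _ H(2) \<gamma>(3)[OF x']])
            then show "\<exists>L. has_orbit_derivative G y x' L"
              using pullback_reselect[where \<gamma>=\<gamma> and y=y, OF _ B(1) x' \<gamma>(1)] by blast
          qed
        qed
        then have "B \<in> \<B>" using B by (simp add: \<B>_def)
        then have "x \<in> \<Union>\<B>'" using B(2) \<B>'(3) by blast
        then show ?thesis using elim(1) by blast
      qed
    qed
  qed
qed

lemma single_valued_pullback_measurable:
  fixes c :: "'a::euclidean_space \<Rightarrow> 'b::euclidean_space"
  assumes c: "D-lipschitz_on UNIV c" and q: "cont_tensor n q" and v: "length v = n"
  shows "(\<lambda>x. q (c x) (map (frechet_derivative c (at x)) v)) \<in> borel_measurable lebesgue"
proof -
  have contc: "continuous_on UNIV c" using c by (rule lipschitz_on_continuous_on)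
  have contb: "continuous_on UNIV (\<lambda>x. c x \<bullet> b)" for b by (intro continuous_intros contc)
  define J where "J x = (\<Sum>bs\<in>basis_lists n. (\<Prod>i<n. ddir (\<lambda>x. c x \<bullet> bs ! i) (v ! i) x) * q (c x) bs)" for x
  have "(\<lambda>x. q (c x) bs) \<in> borel_measurable borel" if "bs \<in> basis_lists n" for bs
    using q length_basis_lists[OF that] contc unfolding cont_tensor_def
    by (intro borel_measurable_continuous_onI continuous_on_compose2[of UNIV "\<lambda>z. q z bs" UNIV c]) auto
  then have "J \<in> borel_measurable borel"
    unfolding J_def[abs_def]
    by (intro borel_measurable_sum borel_measurable_times borel_measurable_prod ddir_measurable contb)
  then have Jm: "J \<in> borel_measurable lebesgue" by (simp add: measurable_completion)
  have "AE x in lborel. q (c x) (map (frechet_derivative c (at x)) v) = J x"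
    using rademacher[OF c]
  proof eventually_elim
    case (elim x)
    define L where "L = frechet_derivative c (at x)"
    have dc: "(c has_derivative L) (at x)" using elim by (simp add: L_def frechet_derivative_works)
    have d: "ddir (\<lambda>x. c x \<bullet> b) u x = L u \<bullet> b" for b u
    proof -
      have "((\<lambda>x. c x \<bullet> b) has_derivative (\<lambda>u. L u \<bullet> b)) (at x)"
        by (auto intro!: derivative_eq_intros dc)
      then show ?thesis by (intro has_ddir_imp_ddir has_derivative_imp_has_ddir)
    qed
    have "multilinear_list n (q (c x))" using q unfolding cont_tensor_def by blast
    from multilinear_list_expand[OF this, of "map L v"] v
    show ?case unfolding J_def d L_def[symmetric] by simp
  qed
  then have "AE x in lebesgue. q (c x) (map (frechet_derivative c (at x)) v) = J x" by (simp add: AE_completion_iff)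
  with Jm show ?thesis by (rule borel_measurable_lebesgue_AE_eq)
qed

lemma borel_measurable_lebesgue_on_AE_eq:
  fixes F J :: "'a::euclidean_space \<Rightarrow> real"
  assumes S: "S \<in> sets lebesgue" and J: "J \<in> borel_measurable (lebesgue_on S)"
    and ae: "AE x in lebesgue. x \<in> S \<longrightarrow> F x = J x"
  shows "F \<in> borel_measurable (lebesgue_on S)"
proof -
  have "(\<lambda>x. if x \<in> S then J x else 0) \<in> borel_measurable lebesgue"
    using J borel_measurable_if[OF S, of J] by simp
  then have "(\<lambda>x. if x \<in> S then F x else 0) \<in> borel_measurable lebesgue"
    by (rule borel_measurable_lebesgue_AE_eq) (use ae in \<open>auto elim!: eventually_mono\<close>)
  then show ?thesis using borel_measurable_if[OF S, of F] by simp
qed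

text \<open>The domain is split into countably many open sets on which the pull-back agrees with one along a
  map that is Lipschitz modulo a smaller group, and a remainder \<open>F\<close> on which it is a pull-back along
  the average.\<close>

theorem orbit_pullback_measurable:
  fixes y :: "'a::euclidean_space \<Rightarrow> 'b::euclidean_space"
  assumes "isometry_group G" "open U" "0 \<le> C" "orbit_lipschitz G C U y"
    and "invariant_tensor G n q" and q: "cont_tensor n q" and v: "length v = n"
  shows "(\<lambda>x. orbit_pullback G y q x v) \<in> borel_measurable (lebesgue_on U)"
  using assms(1-5)
proof (induction "card G" arbitrary: G U y rule: less_induct)
  case less
  interpret isometry_group G by fact
  note U = less.prems(2)
  let ?P = "\<lambda>x. orbit_pullback G y q x v"
  obtain D c where c: "D-lipschitz_on UNIV c" "\<forall>x\<in>U. c x = avg (y x)"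
    using avg_extension[OF less.prems(4,3)] by blast
  define \<B> where "\<B> = {B. open B \<and> B \<subseteq> U \<and> ?P \<in> borel_measurable (lebesgue_on B)}"
  obtain \<B>' where \<B>': "\<B>' \<subseteq> \<B>" "countable \<B>'" "\<Union>\<B>' = \<Union>\<B>"
    by (rule Lindelof[of \<B>]) (auto simp: \<B>_def)
  have off: "x \<in> \<Union>\<B>" if x: "x \<in> U" and nf: "avg (y x) \<noteq> y x" for x
  proof -
    obtain B H \<gamma> where B: "open B" "x \<in> B" "B \<subseteq> U" and H: "isometry_group H" "H \<subseteq> G" "card H < card G"
      and \<gamma>: "\<And>x. \<gamma> x \<in> G" "orbit_lipschitz H C B (\<lambda>x. \<gamma> x (y x))"
        "\<And>x g. x \<in> B \<Longrightarrow> g \<in> G \<Longrightarrow> g (\<gamma> x (y x)) = \<gamma> x (y x) \<Longrightarrow> g \<in> H"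
      by (rule local_reselection[OF less.prems(4,3,2) x nf], rule that)
    interpret H: isometry_group H by fact
    let ?y = "\<lambda>x. \<gamma> x (y x)"
    have "invariant_tensor H n q" using less.prems(5) H(2) unfolding invariant_tensor_def by blast
    then have m: "(\<lambda>x. orbit_pullback H ?y q x v) \<in> borel_measurable (lebesgue_on B)"
      by (intro less.hyps[OF H(3,1) B(1) less.prems(3) \<gamma>(2)])
    have "AE x in lborel. x \<in> B \<longrightarrow> ?P x = orbit_pullback H ?y q x v"
      using AE_has_orbit_derivative[OF H(1) B(1) less.prems(3) \<gamma>(2)]
    proof eventually_elim
      case (elim x')
      show ?case
      proof
        assume x': "x' \<in> B"
        then obtain L where L: "has_orbit_derivative H ?y x' L" using elim by blast
        then have "has_orbit_derivative G ?y x' L"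
          by (rule has_orbit_derivative_supergroup[OF _ H(2) \<gamma>(3)[OF x']])
        then obtain L' where L': "has_orbit_derivative G y x' L'" "L = (\<lambda>v. \<gamma> x' (L' v))"
          using pullback_reselect[where \<gamma>=\<gamma> and y=y, OF _ B(1) x' \<gamma>(1)] by blast
        have "orbit_pullback H ?y q x' v = q (\<gamma> x' (y x')) (map (\<gamma> x') (map L' v))"
          unfolding orbit_pullback_def H.orbit_derivative_eq[OF L] L'(2) by (simp add: o_def)
        also have "\<dots> = q (y x') (map L' v)"
          using less.prems(5) \<gamma>(1) v unfolding invariant_tensor_def by (simp del: map_map)
        also have "\<dots> = ?P x'" unfolding orbit_pullback_def orbit_derivative_eq[OF L'(1)] ..
        finally show "?P x' = orbit_pullback H ?y q x' v" ..
      qed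
    qed
    then have "AE x in lebesgue. x \<in> B \<longrightarrow> ?P x = orbit_pullback H ?y q x v" by (simp add: AE_completion_iff)
    then have "?P \<in> borel_measurable (lebesgue_on B)"
      using B(1) m by (intro borel_measurable_lebesgue_on_AE_eq[OF _ m]) auto
    then have "B \<in> \<B>" using B by (simp add: \<B>_def)
    then show ?thesis using B(2) by blast
  qed
  define F where "F = U - \<Union>\<B>'"
  have openB: "open (\<Union>\<B>')" using \<B>'(1) by (auto simp: \<B>_def)
  have Fs: "F \<in> sets lebesgue" unfolding F_def using U openB by auto
  have PF: "?P \<in> borel_measurable (lebesgue_on F)"
  proof (rule borel_measurable_lebesgue_on_AE_eq[OF Fs])
    show "(\<lambda>x. q (c x) (map (frechet_derivative c (at x)) v)) \<in> borel_measurable (lebesgue_on F)"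
      using single_valued_pullback_measurable[OF c(1) q v] by (rule measurable_restrict_space1)
    have "AE x in lborel. x \<in> F \<longrightarrow> ?P x = q (c x) (map (frechet_derivative c (at x)) v)"
      using AE_differentiable_where_fixed[OF less.prems(4,3,2) c]
    proof eventually_elim
      case (elim x)
      show ?case
      proof
        assume "x \<in> F"
        then have x: "x \<in> U" and f: "avg (y x) = y x" using off \<B>'(3) by (auto simp: F_def)
        then have "has_orbit_derivative G y x (frechet_derivative c (at x))"
          using elim has_derivative_imp_has_orbit_derivative by blast
        then show "?P x = q (c x) (map (frechet_derivative c (at x)) v)"
          unfolding orbit_pullback_def by (simp add: orbit_derivative_eq bspec[OF c(2) x] f)
      qed
    qed
    then show "AE x in lebesgue. x \<in> F \<longrightarrow> ?P x = q (c x) (map (frechet_derivative c (at x)) v)"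
      by (simp add: AE_completion_iff)
  qed
  show ?case
  proof (rule measurable_piecewise_restrict[of "insert F \<B>'"])
    show "countable (insert F \<B>')" using \<B>'(2) by simp
    show "space (lebesgue_on U) \<subseteq> \<Union> (insert F \<B>')" by (auto simp: F_def)
    fix \<Omega> assume \<Omega>: "\<Omega> \<in> insert F \<B>'"
    then have sub: "\<Omega> \<subseteq> U" and s: "\<Omega> \<in> sets lebesgue" and m: "?P \<in> borel_measurable (lebesgue_on \<Omega>)"
      using \<B>'(1) Fs PF by (auto simp: F_def \<B>_def)
    show "\<Omega> \<inter> space (lebesgue_on U) \<in> sets (lebesgue_on U)"
      using sub s U by (auto simp: sets_restrict_space)
    have "restrict_space (lebesgue_on U) \<Omega> = lebesgue_on \<Omega>"
      using sub U s by (subst restrict_restrict_space) (auto simp: Int_absorb1)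
    then show "?P \<in> borel_measurable (restrict_space (lebesgue_on U) \<Omega>)" using m by simp
  qed
qed

section \<open>Test functions and partitions of unity\<close>

definition lip_test :: "'a::euclidean_space set \<Rightarrow> ('a \<Rightarrow> real) \<Rightarrow> bool" where
  "lip_test U a \<longleftrightarrow> (\<exists>A. A-lipschitz_on UNIV a) \<and> (\<exists>K. compact K \<and> K \<subseteq> U \<and> (\<forall>x. x \<notin> K \<longrightarrow> a x = 0))"

lemma lip_test_mono: "lip_test U a \<Longrightarrow> U \<subseteq> V \<Longrightarrow> lip_test V a"
  unfolding lip_test_def by blast

lemma lip_test_bounded_support: "lip_test U a \<Longrightarrow> bounded {x. a x \<noteq> 0}"
proof -
  assume "lip_test U a"
  then obtain K where "compact K" "\<forall>x. x \<notin> K \<longrightarrow> a x = 0" unfolding lip_test_def by blast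
  then show ?thesis by (intro bounded_subset[OF compact_imp_bounded]) auto
qed

lemma infdist_lipschitz: "1-lipschitz_on UNIV (\<lambda>x. infdist x S)"
  by (rule lipschitz_onI) (use infdist_triangle_abs in \<open>auto simp: dist_real_def\<close>)

lemma clamp_lipschitz: "1-lipschitz_on UNIV (\<lambda>r::real. max 0 (min 1 (2 - r)))"
  by (rule lipschitz_onI) (auto simp: dist_real_def max_def min_def)

text \<open>The cut-off is \<open>1\<close> near the part of the support that is not covered by \<open>V2\<close>, and it vanishes
  outside a compact neighbourhood of this part inside \<open>V1\<close>.\<close>

lemma lip_test_Un:
  fixes P :: "('a::euclidean_space \<Rightarrow> real) \<Rightarrow> bool"
  assumes add: "\<And>a b. lip_test UNIV a \<Longrightarrow> lip_test UNIV b \<Longrightarrow> P a \<Longrightarrow> P b \<Longrightarrow> P (\<lambda>x. a x + b x)"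
    and V: "open V1" "open V2" and P1: "\<And>a. lip_test V1 a \<Longrightarrow> P a" and P2: "\<And>a. lip_test V2 a \<Longrightarrow> P a"
    and a: "lip_test (V1 \<union> V2) a"
  shows "P a"
proof -
  obtain A K where A: "A-lipschitz_on UNIV a" and K: "compact K" "K \<subseteq> V1 \<union> V2" "\<And>x. x \<notin> K \<Longrightarrow> a x = 0"
    using a unfolding lip_test_def by blast
  define K1 where "K1 = K - V2"
  have K1: "compact K1" "K1 \<subseteq> V1" using K V by (auto simp: K1_def intro: compact_diff)
  show ?thesis
  proof (cases "K1 = {}")
    case True
    then have "K \<subseteq> V2" by (auto simp: K1_def)
    then have "lip_test V2 a" using A K unfolding lip_test_def by blast
    then show ?thesis by (rule P2)
  next
    case False
    obtain \<delta> where \<delta>: "\<delta> > 0" "(\<Union>x\<in>K1. cball x \<delta>) \<subseteq> V1"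
      using compact_subset_open_imp_cball_epsilon_subset[OF K1(1) V(1) K1(2)] by blast
    define \<eta> where "\<eta> = \<delta> / 2"
    have \<eta>: "\<eta> > 0" using \<delta> by (simp add: \<eta>_def)
    define \<psi> where "\<psi> x = max 0 (min 1 (2 - infdist x K1 / \<eta>))" for x
    have \<psi>L: "(1 * (1 / \<eta> * 1))-lipschitz_on UNIV \<psi>"
      unfolding \<psi>_def[abs_def]
    proof (rule lipschitz_on_compose2[of _ _ "\<lambda>x. infdist x K1 / \<eta>" _ "\<lambda>r. max 0 (min 1 (2 - r))"])
      show "(1 / \<eta> * 1)-lipschitz_on UNIV (\<lambda>x. infdist x K1 / \<eta>)"
        using lipschitz_on_cmult_real[OF infdist_lipschitz[of K1], of "1 / \<eta>"] \<eta> by simp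
      show "1-lipschitz_on (range (\<lambda>x. infdist x K1 / \<eta>)) (\<lambda>r. max 0 (min 1 (2 - r)))"
        using clamp_lipschitz by (rule lipschitz_on_subset) simp
    qed
    have \<psi>1: "\<psi> x = 1" if "infdist x K1 \<le> \<eta>" for x using that \<eta> by (simp add: \<psi>_def)
    have \<psi>0: "\<psi> x = 0" if "infdist x K1 \<ge> 2 * \<eta>" for x
    proof -
      have "2 - infdist x K1 / \<eta> \<le> 0" using that \<eta> by (simp add: pos_le_divide_eq)
      then show ?thesis by (simp add: \<psi>_def)
    qed
    have cinf: "continuous_on UNIV (\<lambda>x. infdist x K1)" by (intro continuous_intros)
    define a1 where "a1 x = a x * \<psi> x" for x
    define a2 where "a2 x = a x * (1 - \<psi> x)" for x
    have bs: "bounded {x. a x \<noteq> 0}" using a by (rule lip_test_bounded_support)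
    have L1: "\<exists>C. C-lipschitz_on UNIV a1"
      unfolding a1_def[abs_def] using lipschitz_cutoff_mult[OF A bs] lipschitz_on_subset[OF \<psi>L subset_UNIV] by blast
    have L2: "\<exists>C. C-lipschitz_on UNIV a2"
      unfolding a2_def[abs_def]
    proof (rule lipschitz_cutoff_mult[OF A bs])
      fix R
      have "(0 + 1 * (1 / \<eta> * 1))-lipschitz_on UNIV (\<lambda>x. 1 - \<psi> x)"
        by (rule lipschitz_on_diff) (use \<psi>L in \<open>auto intro: lipschitz_on_constant\<close>)
      then show "\<exists>L. L-lipschitz_on (cball 0 R) (\<lambda>x. 1 - \<psi> x)" using lipschitz_on_subset by blast
    qed
    have T1: "lip_test V1 a1"
      unfolding lip_test_def
    proof (intro conjI L1 exI)
      let ?K = "K \<inter> {x. infdist x K1 \<le> 2 * \<eta>}"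
      show "compact ?K" using K(1) by (intro compact_Int_closed closed_Collect_le cinf continuous_on_const)
      show "?K \<subseteq> V1"
      proof
        fix x assume "x \<in> ?K"
        moreover obtain z where "z \<in> K1" "infdist x K1 = dist x z"
          using infdist_attains_inf[of K1 x] K1(1) False compact_imp_closed by blast
        ultimately have "x \<in> cball z \<delta>" by (simp add: \<eta>_def dist_commute)
        then show "x \<in> V1" using \<delta>(2) \<open>z \<in> K1\<close> by blast
      qed
      show "\<forall>x. x \<notin> ?K \<longrightarrow> a1 x = 0" using K(3) \<psi>0 by (auto simp: a1_def)
    qed
    have T2: "lip_test V2 a2"
      unfolding lip_test_def
    proof (intro conjI L2 exI)
      let ?K = "K \<inter> {x. \<eta> \<le> infdist x K1}"
      show "compact ?K" using K(1) by (intro compact_Int_closed closed_Collect_le cinf continuous_on_const)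
      show "?K \<subseteq> V2"
      proof
        fix x assume x: "x \<in> ?K"
        then have "x \<notin> K1" using \<eta> by auto
        then show "x \<in> V2" using x by (auto simp: K1_def)
      qed
      show "\<forall>x. x \<notin> ?K \<longrightarrow> a2 x = 0" using K(3) \<psi>1 by (auto simp: a2_def)
    qed
    have "a = (\<lambda>x. a1 x + a2 x)" by (rule ext) (simp add: a1_def a2_def algebra_simps)
    then show ?thesis
      using add[OF lip_test_mono[OF T1 subset_UNIV] lip_test_mono[OF T2 subset_UNIV] P1[OF T1] P2[OF T2]] by simp
  qed
qed

lemma lip_test_local:
  fixes P :: "('a::euclidean_space \<Rightarrow> real) \<Rightarrow> bool"
  assumes add: "\<And>a b. lip_test UNIV a \<Longrightarrow> lip_test UNIV b \<Longrightarrow> P a \<Longrightarrow> P b \<Longrightarrow> P (\<lambda>x. a x + b x)"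
    and zero: "P (\<lambda>x. 0)"
    and loc: "\<And>x. x \<in> U \<Longrightarrow> \<exists>B. open B \<and> x \<in> B \<and> (\<forall>a. lip_test B a \<longrightarrow> P a)"
    and a: "lip_test U a"
  shows "P a"
proof -
  define \<B> where "\<B> = {B. open B \<and> (\<forall>a. lip_test B a \<longrightarrow> P a)}"
  have fin: "\<forall>a. lip_test (\<Union>F) a \<longrightarrow> P a" if "finite F" "F \<subseteq> \<B>" for F
    using that
  proof (induction F)
    case empty
    then show ?case using zero by (auto simp: lip_test_def fun_eq_iff[symmetric])
  next
    case (insert B F)
    show ?case
    proof (intro allI impI)
      fix a assume "lip_test (\<Union>(insert B F)) a"
      then have t: "lip_test (B \<union> \<Union>F) a" by simp
      show "P a"
      proof (rule lip_test_Un[where P=P and ?V1.0=B and ?V2.0="\<Union>F" and a=a])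
        show "P (\<lambda>x. a x + b x)" if "lip_test UNIV a" "lip_test UNIV b" "P a" "P b" for a b
          using that by (rule add)
        show "lip_test (B \<union> \<Union>F) a" by (rule t)
        show "open B" "open (\<Union>F)" using insert by (auto simp: \<B>_def)
        show "P b" if "lip_test B b" for b using that insert by (auto simp: \<B>_def)
        show "P b" if "lip_test (\<Union>F) b" for b using that insert by auto
      qed
    qed
  qed
  obtain A K where A: "A-lipschitz_on UNIV a" and K: "compact K" "K \<subseteq> U" "\<And>x. x \<notin> K \<Longrightarrow> a x = 0"
    using a unfolding lip_test_def by blast
  have "K \<subseteq> \<Union>\<B>" using loc K(2) unfolding \<B>_def by blast
  then obtain F where F: "F \<subseteq> \<B>" "finite F" "K \<subseteq> \<Union>F"
  proof (rule compactE[OF K(1)])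
    show "open B" if "B \<in> \<B>" for B using that by (simp add: \<B>_def)
  qed (use that in blast)
  then have "lip_test (\<Union>F) a" using A K unfolding lip_test_def by blast
  then show ?thesis using fin F by blast
qed

section \<open>The weak identity for maps that are Lipschitz modulo a group\<close>

lemma stokes_integrand_zero: "stokes_integrand k \<omega> w z L 0 (\<lambda>v. 0) = 0"
  by (simp add: stokes_integrand_def)

lemma frechet_derivative_eq_0_outside:
  fixes a :: "'a::euclidean_space \<Rightarrow> real"
  assumes "closed K" "\<And>x. x \<notin> K \<Longrightarrow> a x = 0" "x \<notin> K"
  shows "frechet_derivative a (at x) = (\<lambda>v. 0)"
proof -
  have "((\<lambda>x. 0) has_derivative (\<lambda>v. 0)) (at x)" by simp
  then have "(a has_derivative (\<lambda>v. 0)) (at x)"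
    by (rule has_derivative_transform_within_open[of _ _ _ _ "- K"]) (use assms in auto)
  then show ?thesis by (metis frechet_derivative_at)
qed

lemma stokes_integrand_add:
  "stokes_integrand k \<omega> w z L (a + b) (\<lambda>v. a' v + b' v) =
     stokes_integrand k \<omega> w z L a a' + stokes_integrand k \<omega> w z L b b'"
  unfolding stokes_integrand_def sum.distrib[symmetric] by (rule sum.cong) (simp_all add: algebra_simps)

definition weak_stokes ::
    "('b \<Rightarrow> 'b) set \<Rightarrow> ('a::euclidean_space \<Rightarrow> 'b::euclidean_space) \<Rightarrow> nat \<Rightarrow> 'b form \<Rightarrow> (nat \<Rightarrow> 'a) \<Rightarrow> ('a \<Rightarrow> real) \<Rightarrow> bool" where
  "weak_stokes G y k \<omega> w a \<longleftrightarrow> has_bochner_integral lebesgue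
     (\<lambda>x. stokes_integrand k \<omega> w (y x) (orbit_derivative G y x) (a x) (frechet_derivative a (at x))) 0"

lemma weak_stokes_zero: "weak_stokes G y k \<omega> w (\<lambda>x. 0)"
proof -
  have "frechet_derivative (\<lambda>x::'a. 0::real) (at x) = (\<lambda>v. 0)" for x
    by (metis frechet_derivative_at has_derivative_const)
  then show ?thesis unfolding weak_stokes_def by (simp add: stokes_integrand_zero has_bochner_integral_zero)
qed

lemma weak_stokes_add:
  assumes a: "A-lipschitz_on UNIV a" and b: "B-lipschitz_on UNIV b"
    and W: "weak_stokes G y k \<omega> w a" "weak_stokes G y k \<omega> w b"
  shows "weak_stokes G y k \<omega> w (\<lambda>x. a x + b x)"
  unfolding weak_stokes_def
proof (rule has_bochner_integral_lebesgue_AE_eq)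
  show "has_bochner_integral lebesgue (\<lambda>x.
      stokes_integrand k \<omega> w (y x) (orbit_derivative G y x) (a x) (frechet_derivative a (at x)) +
      stokes_integrand k \<omega> w (y x) (orbit_derivative G y x) (b x) (frechet_derivative b (at x))) 0"
    using has_bochner_integral_add[OF W[unfolded weak_stokes_def]] by simp
  have "AE x in lborel. frechet_derivative (\<lambda>x. a x + b x) (at x) =
      (\<lambda>v. frechet_derivative a (at x) v + frechet_derivative b (at x) v)"
    using rademacher_real[OF a] rademacher_real[OF b]
  proof eventually_elim
    case (elim x)
    then have "((\<lambda>x. a x + b x) has_derivative (\<lambda>v. frechet_derivative a (at x) v + frechet_derivative b (at x) v)) (at x)"
      by (intro has_derivative_add) (simp_all add: frechet_derivative_works)
    then show ?case by (metis frechet_derivative_at)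
  qed
  then have "AE x in lebesgue. frechet_derivative (\<lambda>x. a x + b x) (at x) =
      (\<lambda>v. frechet_derivative a (at x) v + frechet_derivative b (at x) v)" by (simp add: AE_completion_iff)
  then show "AE x in lebesgue. stokes_integrand k \<omega> w (y x) (orbit_derivative G y x) (a x + b x)
        (frechet_derivative (\<lambda>x. a x + b x) (at x)) =
      stokes_integrand k \<omega> w (y x) (orbit_derivative G y x) (a x) (frechet_derivative a (at x)) +
      stokes_integrand k \<omega> w (y x) (orbit_derivative G y x) (b x) (frechet_derivative b (at x))"
    by (rule AE_mp) (simp add: stokes_integrand_add)
qed

text \<open>Only points of \<open>B\<close> matter, since the test function and its derivative vanish elsewhere.\<close>

lemma weak_stokes_cong:
  assumes a: "lip_test B a" and W: "has_bochner_integral lebesgue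
      (\<lambda>x. stokes_integrand k \<omega> w (z x) (L x) (a x) (frechet_derivative a (at x))) 0"
    and eq: "AE x in lborel. x \<in> B \<longrightarrow> (\<forall>r r'. stokes_integrand k \<omega> w (y x) (orbit_derivative G y x) r r' =
      stokes_integrand k \<omega> w (z x) (L x) r r')"
  shows "weak_stokes G y k \<omega> w a"
  unfolding weak_stokes_def
proof (rule has_bochner_integral_lebesgue_AE_eq[OF W])
  obtain K where K: "compact K" "K \<subseteq> B" "\<And>x. x \<notin> K \<Longrightarrow> a x = 0"
    using a unfolding lip_test_def by blast
  have "AE x in lborel. stokes_integrand k \<omega> w (y x) (orbit_derivative G y x) (a x) (frechet_derivative a (at x)) =
      stokes_integrand k \<omega> w (z x) (L x) (a x) (frechet_derivative a (at x))"
    using eq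
  proof eventually_elim
    case (elim x)
    show ?case
    proof (cases "x \<in> K")
      case True then show ?thesis using elim K(2) by blast
    next
      case False
      then show ?thesis
        using K frechet_derivative_eq_0_outside[OF compact_imp_closed[OF K(1)] K(3) False]
        by (simp add: stokes_integrand_zero)
    qed
  qed
  then show "AE x in lebesgue. stokes_integrand k \<omega> w (y x) (orbit_derivative G y x) (a x) (frechet_derivative a (at x)) =
      stokes_integrand k \<omega> w (z x) (L x) (a x) (frechet_derivative a (at x))"
    by (simp add: AE_completion_iff)
qed

lemma stokes_integrand_invariant:
  assumes \<omega>: "C1_form k \<omega>" and inv: "invariant_tensor G k \<omega>" and g: "g \<in> G" "linear g"
  shows "stokes_integrand k \<omega> w (g z) (\<lambda>v. g (L v)) r r' = stokes_integrand k \<omega> w z L r r'"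
proof -
  have *: "map (\<lambda>i. g (L (w (\<pi> (Suc i))))) [0..<k] = map g (map (\<lambda>i. L (w (\<pi> (Suc i)))) [0..<k])" for \<pi> :: "nat \<Rightarrow> nat"
    by simp
  show ?thesis
    unfolding stokes_integrand_def * using inv g(1)
    by (intro sum.cong refl) (simp add: dcoef_invariant[OF \<omega> inv g] invariant_tensor_def del: map_map)
qed

lemma stokes_integrand_bound:
  fixes \<omega> :: "'b::euclidean_space form" and w :: "nat \<Rightarrow> 'a::euclidean_space"
  assumes \<omega>: "C1_form k \<omega>" and N: "0 \<le> N" and A: "0 \<le> A" and M: "0 \<le> M"
  obtains T where "\<And>z L r r'. norm z \<le> Z \<Longrightarrow> (\<And>v. norm (L v) \<le> N * norm v) \<Longrightarrow> \<bar>r\<bar> \<le> M \<Longrightarrow>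
    (\<And>v. \<bar>r' v\<bar> \<le> A * norm v) \<Longrightarrow> \<bar>stokes_integrand k \<omega> w z L r r'\<bar> \<le> T"
proof -
  define W where "W = (\<Sum>i\<le>k. norm (w i))"
  have W: "norm (w (\<pi> i)) \<le> W" if "\<pi> permutes {..k}" "i \<le> k" for \<pi> i
  proof -
    have "\<pi> i \<in> {..k}" using that permutes_in_image by fastforce
    then show ?thesis unfolding W_def by (intro member_le_sum) auto
  qed
  have W0: "0 \<le> W" unfolding W_def by (intro sum_nonneg) auto
  obtain T1 where T1: "\<And>z v. norm z \<le> Z \<Longrightarrow> length v = k \<Longrightarrow> (\<And>i. i < k \<Longrightarrow> norm (v ! i) \<le> N * W) \<Longrightarrow> \<bar>\<omega> z v\<bar> \<le> T1"
    using cont_tensor_bound[OF C1_form_cont_tensor[OF \<omega>], of "N * W" Z] N W0 by (metis mult_nonneg_nonneg)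
  obtain T2 where T2: "\<And>z v. norm z \<le> Z \<Longrightarrow> length v = Suc k \<Longrightarrow> (\<And>i. i < Suc k \<Longrightarrow> norm (v ! i) \<le> N * W) \<Longrightarrow> \<bar>dtensor \<omega> z v\<bar> \<le> T2"
    using cont_tensor_bound[OF dtensor_cont_tensor[OF \<omega>], of "N * W" Z] N W0 by (metis mult_nonneg_nonneg)
  let ?P = "{\<pi>. \<pi> permutes {..k}}"
  show ?thesis
  proof (rule that[of "\<Sum>\<pi>\<in>?P. M * T2 + (A * W) * T1"])
    fix z :: 'b and L :: "'a \<Rightarrow> 'b" and r :: real and r' :: "'a \<Rightarrow> real"
    assume z: "norm z \<le> Z" and L: "\<And>v. norm (L v) \<le> N * norm v" and r: "\<bar>r\<bar> \<le> M" "\<And>v. \<bar>r' v\<bar> \<le> A * norm v"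
    show "\<bar>stokes_integrand k \<omega> w z L r r'\<bar> \<le> (\<Sum>\<pi>\<in>?P. M * T2 + (A * W) * T1)"
      unfolding stokes_integrand_def
    proof (rule sum_abs[THEN order_trans], rule sum_mono)
      fix \<pi> assume "\<pi> \<in> ?P"
      then have p: "\<pi> permutes {..k}" by simp
      let ?v = "map (\<lambda>i. L (w (\<pi> (Suc i)))) [0..<k]"
      have LW: "norm (L (w (\<pi> i))) \<le> N * W" if "i \<le> k" for i
        using order_trans[OF L mult_left_mono[OF W[OF p that] N]] .
      have t1: "\<bar>\<omega> z ?v\<bar> \<le> T1" by (rule T1[OF z]) (use LW in auto)
      have "\<bar>dtensor \<omega> z (L (w (\<pi> 0)) # ?v)\<bar> \<le> T2"
      proof (rule T2[OF z])
        fix i assume i: "i < Suc k"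
        show "norm ((L (w (\<pi> 0)) # ?v) ! i) \<le> N * W"
        proof (cases i)
          case 0 then show ?thesis using LW[of 0] by simp
        next
          case (Suc j) then show ?thesis using LW[of i] i by simp
        qed
      qed simp
      then have t2: "\<bar>dcoef \<omega> z (L (w (\<pi> 0))) ?v\<bar> \<le> T2" by (simp add: dtensor_def)
      have r'W: "\<bar>r' (w (\<pi> 0))\<bar> \<le> A * W"
        using order_trans[OF r(2) mult_left_mono[OF W[OF p] A]] by simp
      have "\<bar>r * dcoef \<omega> z (L (w (\<pi> 0))) ?v + r' (w (\<pi> 0)) * \<omega> z ?v\<bar> \<le>
          \<bar>r\<bar> * \<bar>dcoef \<omega> z (L (w (\<pi> 0))) ?v\<bar> + \<bar>r' (w (\<pi> 0))\<bar> * \<bar>\<omega> z ?v\<bar>"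
        by (rule order_trans[OF abs_triangle_ineq]) (simp add: abs_mult)
      also have "\<dots> \<le> M * T2 + (A * W) * T1"
        using r(1) t1 t2 r'W A W0 M by (intro add_mono mult_mono) auto
      finally show "\<bar>of_int (sign \<pi>) * (r * dcoef \<omega> z (L (w (\<pi> 0))) ?v + r' (w (\<pi> 0)) * \<omega> z ?v)\<bar> \<le> M * T2 + (A * W) * T1"
        by (simp add: abs_mult sign_def)
    qed
  qed
qed

text \<open>The parameters \<open>U\<close>, \<open>y\<close> and \<open>C\<close> vary in the induction because the hypothesis is applied to the
  collapsed maps on small open sets. A point with a non-fixed value can be collapsed completely, and then
  the stabiliser of the collapsed value in \<open>G\<close> exceeds \<open>H\<close>; at almost every such point the
  collapsed map is differentiable in the ordinary sense, with an invariant derivative, so that the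
  derivatives modulo \<open>H\<close> and modulo \<open>G\<close> still agree.\<close>

theorem weak_stokes_orbit:
  fixes y :: "'a::euclidean_space \<Rightarrow> 'b::euclidean_space"
  assumes "isometry_group G" "open U" "0 \<le> C" "orbit_lipschitz G C U y"
    and "invariant_tensor G k \<omega>" and "lip_test U a" and \<omega>: "C1_form k \<omega>"
  shows "weak_stokes G y k \<omega> w a"
  using assms(1-6)
proof (induction "card G" arbitrary: G U C y a rule: less_induct)
  case less
  interpret isometry_group G by fact
  note U = less.prems(2) and C = less.prems(3) and y = less.prems(4) and inv = less.prems(5)
  obtain D c where c: "D-lipschitz_on UNIV c" "\<forall>x\<in>U. c x = avg (y x)"
    using avg_extension[OF y C] by blast
  obtain D' \<rho> where \<rho>: "D'-lipschitz_on UNIV \<rho>" "\<And>x. x \<in> U \<Longrightarrow> \<rho> x = dev (y x)"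
    using dev_extension[OF y C] by blast
  have cont\<rho>: "continuous_on UNIV \<rho>" using \<rho>(1) by (rule lipschitz_on_continuous_on)
  have ylip: "orbit_lipschitz G (7 * C) U (\<lambda>x. collapse \<epsilon> (y x))" if "\<epsilon> > 0" for \<epsilon>
    by (rule orbit_lipschitz_compose[OF y]) (use collapse_G collapse_lipschitz[OF that] in auto)
  have C7: "0 \<le> 7 * C" using C by simp
  (* almost everywhere the collapsed selection is differentiable where it is fixed *)
  have fixpt: "AE x in lborel. x \<in> U \<longrightarrow> avg (collapse \<epsilon> (y x)) = collapse \<epsilon> (y x) \<longrightarrow>
      ((\<lambda>x. collapse \<epsilon> (y x)) has_derivative frechet_derivative c (at x)) (at x) \<and>
      (\<forall>g\<in>G. \<forall>v. g (frechet_derivative c (at x) v) = frechet_derivative c (at x) v)" if "\<epsilon> > 0" for \<epsilon>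
    by (rule AE_differentiable_where_fixed[OF ylip[OF that] C7 U c(1)]) (use c(2) avg_collapse in simp)
  have collapsed: "weak_stokes G (\<lambda>x. collapse \<epsilon> (y x)) k \<omega> w a" if e: "\<epsilon> > 0" for \<epsilon>
  proof (rule lip_test_local[of "weak_stokes G (\<lambda>x. collapse \<epsilon> (y x)) k \<omega> w", OF _ weak_stokes_zero _ less.prems(6)])
    let ?y = "\<lambda>x. collapse \<epsilon> (y x)"
    fix x assume x: "x \<in> U"
    show "\<exists>B. open B \<and> x \<in> B \<and> (\<forall>a. lip_test B a \<longrightarrow> weak_stokes G ?y k \<omega> w a)"
    proof (cases "avg (y x) = y x")
      case True
      (* near x the collapsed map is the average *)
      define B where "B = U \<inter> {x. \<rho> x < \<epsilon>}"
      have "open B" unfolding B_def by (intro open_Int U open_Collect_less cont\<rho> continuous_on_const)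
      moreover have "x \<in> B" using x True e by (simp add: B_def \<rho>(2) dev_eq_0_iff[THEN iffD2])
      moreover have "weak_stokes G ?y k \<omega> w b" if b: "lip_test B b" for b
      proof (rule weak_stokes_cong[OF b])
        obtain A where "A-lipschitz_on UNIV b" using b unfolding lip_test_def by blast
        then show "has_bochner_integral lebesgue (\<lambda>x. stokes_integrand k \<omega> w (c x) (frechet_derivative c (at x)) (b x) (frechet_derivative b (at x))) 0"
          by (rule weak_stokes_single_valued[OF c(1) \<omega> _ lip_test_bounded_support[OF b]])
        show "AE x in lborel. x \<in> B \<longrightarrow> (\<forall>r r'. stokes_integrand k \<omega> w (?y x) (orbit_derivative G ?y x) r r' =
            stokes_integrand k \<omega> w (c x) (frechet_derivative c (at x)) r r')"
          using fixpt[OF e]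
        proof eventually_elim
          case (elim x)
          show ?case
          proof
            assume "x \<in> B"
            then have xU: "x \<in> U" and "dev (y x) \<le> \<epsilon>" by (auto simp: B_def \<rho>(2))
            then have yx: "?y x = c x" using collapse_eq_avg[OF e] c(2) by simp
            have "avg (?y x) = ?y x" using avg_collapse[of \<epsilon> "y x"] yx c(2) xU by metis
            then have "has_orbit_derivative G ?y x (frechet_derivative c (at x))"
              using elim xU by (intro has_derivative_imp_has_orbit_derivative) auto
            then show "\<forall>r r'. stokes_integrand k \<omega> w (?y x) (orbit_derivative G ?y x) r r' =
                stokes_integrand k \<omega> w (c x) (frechet_derivative c (at x)) r r'"
              using yx by (simp add: orbit_derivative_eq)
          qed
        qed
      qed
      ultimately show ?thesis by blast
    next
      case False
      obtain B H \<gamma> where B: "open B" "x \<in> B" "B \<subseteq> U" and H: "isometry_group H" "H \<subseteq> G" "card H < card G"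
        and \<gamma>: "\<And>x. \<gamma> x \<in> G" "orbit_lipschitz H C B (\<lambda>x. \<gamma> x (y x))"
          "\<And>x g. x \<in> B \<Longrightarrow> g \<in> G \<Longrightarrow> g (\<gamma> x (y x)) = \<gamma> x (y x) \<Longrightarrow> g \<in> H"
        by (rule local_reselection[OF y C U x False], rule that)
      interpret H: isometry_group H by fact
      let ?y' = "\<lambda>x. \<gamma> x (?y x)"
      have eq: "?y' = (\<lambda>x. collapse \<epsilon> (\<gamma> x (y x)))" using collapse_G[OF \<gamma>(1)] by simp
      have lipH: "orbit_lipschitz H (7 * C) B ?y'"
        unfolding eq by (rule orbit_lipschitz_compose[OF \<gamma>(2)]) (use collapse_G H(2) collapse_lipschitz[OF e] in auto)
      have lipG: "orbit_lipschitz G (7 * C) B ?y'" using lipH H(2) by (rule orbit_lipschitz_mono_group)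
      have "\<forall>x\<in>B. c x = avg (?y' x)"
        using c(2) B(3) by (auto simp: avg_G[OF \<gamma>(1)] avg_collapse)
      note fix' = AE_differentiable_where_fixed[OF lipG C7 B(1) c(1) this]
      have invH: "invariant_tensor H k \<omega>" using inv H(2) unfolding invariant_tensor_def by blast
      have "weak_stokes G ?y k \<omega> w b" if b: "lip_test B b" for b
      proof (rule weak_stokes_cong[OF b])
        have "weak_stokes H ?y' k \<omega> w b"
          by (rule less.hyps[OF H(3,1) B(1) C7 lipH invH b])
        then show "has_bochner_integral lebesgue (\<lambda>x. stokes_integrand k \<omega> w (?y' x) (orbit_derivative H ?y' x) (b x) (frechet_derivative b (at x))) 0"
          unfolding weak_stokes_def .
        show "AE x in lborel. x \<in> B \<longrightarrow> (\<forall>r r'. stokes_integrand k \<omega> w (?y x) (orbit_derivative G ?y x) r r' =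
            stokes_integrand k \<omega> w (?y' x) (orbit_derivative H ?y' x) r r')"
          using fix' AE_has_orbit_derivative[OF H(1) B(1) C7 lipH]
        proof eventually_elim
          case (elim x')
          show ?case
          proof
            assume x': "x' \<in> B"
            obtain L where L: "has_orbit_derivative H ?y' x' L" "has_orbit_derivative G ?y' x' L"
            proof (cases "avg (?y' x') = ?y' x'")
              case True
              then have d: "(?y' has_derivative frechet_derivative c (at x')) (at x')"
                  "\<forall>g\<in>G. \<forall>v. g (frechet_derivative c (at x') v) = frechet_derivative c (at x') v"
                using elim(1) x' by blast+
              show ?thesis
              proof (rule that)
                show "has_orbit_derivative H ?y' x' (frechet_derivative c (at x'))"
                  using d H(2) by (intro H.has_derivative_imp_has_orbit_derivative) auto
                show "has_orbit_derivative G ?y' x' (frechet_derivative c (at x'))"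
                  using d by (intro has_derivative_imp_has_orbit_derivative) auto
              qed
            next
              case False
              obtain L where L: "has_orbit_derivative H ?y' x' L" using elim(2) x' by blast
              have "g \<in> H" if g: "g \<in> G" "g (?y' x') = ?y' x'" for g
              proof -
                have "g (collapse \<epsilon> (\<gamma> x' (y x'))) = collapse \<epsilon> (\<gamma> x' (y x'))"
                  using g(2) collapse_G[OF \<gamma>(1)] by simp
                then have "g (\<gamma> x' (y x')) = \<gamma> x' (y x')"
                  using collapse_fixed[OF e g(1)] False collapse_G[OF \<gamma>(1)] by metis
                then show ?thesis using \<gamma>(3)[OF x' g(1)] by blast
              qed
              then have "has_orbit_derivative G ?y' x' L"
                using has_orbit_derivative_supergroup[OF L H(2)] by blast
              then show ?thesis using that L by blast
            qed
            obtain L' where L': "has_orbit_derivative G ?y x' L'" "L = (\<lambda>v. \<gamma> x' (L' v))"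
              using pullback_reselect[where \<gamma>=\<gamma> and y="?y", OF L(2) B(1) x' \<gamma>(1)] by blast
            have si: "stokes_integrand k \<omega> w (\<gamma> x' (?y x')) (\<lambda>v. \<gamma> x' (L' v)) r r' =
                stokes_integrand k \<omega> w (?y x') L' r r'" for r r'
              by (rule stokes_integrand_invariant[OF \<omega> inv \<gamma>(1) linear_G[OF \<gamma>(1)]])
            show "\<forall>r r'. stokes_integrand k \<omega> w (?y x') (orbit_derivative G ?y x') r r' =
                stokes_integrand k \<omega> w (?y' x') (orbit_derivative H ?y' x') r r'"
              unfolding H.orbit_derivative_eq[OF L(1)] orbit_derivative_eq[OF L'(1)] L'(2)
              unfolding si by simp
          qed
        qed
      qed
      then show ?thesis using B by blast
    qed
  qed (use weak_stokes_add in \<open>auto simp: lip_test_def\<close>)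
  (* let the collapse parameter tend to 0 *)
  obtain A K where A: "A-lipschitz_on UNIV a" and K: "compact K" "K \<subseteq> U" "\<And>x. x \<notin> K \<Longrightarrow> a x = 0"
    using less.prems(6) unfolding lip_test_def by blast
  have A0: "0 \<le> A" using A by (rule lipschitz_on_nonneg)
  define \<epsilon> where "\<epsilon> n = 1 / real (Suc n)" for n
  have \<epsilon>: "\<epsilon> n > 0" for n by (simp add: \<epsilon>_def)
  let ?y = "\<lambda>n x. collapse (\<epsilon> n) (y x)"
  let ?I = "\<lambda>n x. stokes_integrand k \<omega> w (?y n x) (orbit_derivative G (?y n) x) (a x) (frechet_derivative a (at x))"
  let ?J = "\<lambda>x. stokes_integrand k \<omega> w (y x) (orbit_derivative G y x) (a x) (frechet_derivative a (at x))"
  have I: "has_bochner_integral lebesgue (?I n) 0" for n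
    using collapsed[OF \<epsilon>] unfolding weak_stokes_def .
  have off: "?I n x = 0" "?J x = 0" if "x \<notin> K" for n x
    using K(3)[OF that] frechet_derivative_eq_0_outside[OF compact_imp_closed[OF K(1)] K(3) that]
    by (simp_all add: stokes_integrand_zero)
  have "AE x in lborel. \<forall>n. x \<in> U \<longrightarrow> avg (?y n x) = ?y n x \<longrightarrow>
      ((?y n) has_derivative frechet_derivative c (at x)) (at x) \<and>
      (\<forall>g\<in>G. \<forall>v. g (frechet_derivative c (at x) v) = frechet_derivative c (at x) v)"
    using fixpt[OF \<epsilon>] by (subst AE_all_countable) blast
  then have "AE x in lborel. (\<lambda>n. ?I n x) \<longlonglongrightarrow> ?J x"
    using AE_differentiable_where_fixed[OF y C U c]
  proof eventually_elim
    case (elim x)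
    have "\<forall>\<^sub>F n in sequentially. ?I n x = ?J x"
    proof (cases "x \<in> K")
      case False
      then show ?thesis using off by simp
    next
      case True
      then have x: "x \<in> U" using K by blast
      show ?thesis
      proof (cases "avg (y x) = y x")
        case f: True
        have yn: "?y n x = y x" for n
          using collapse_eq_avg[OF \<epsilon>, of "y x" n] f \<epsilon>[of n] by (simp add: dev_eq_0_iff[THEN iffD2])
        have "has_orbit_derivative G y x (frechet_derivative c (at x))"
          using elim(2) x f has_derivative_imp_has_orbit_derivative by blast
        moreover have "has_orbit_derivative G (?y n) x (frechet_derivative c (at x))" for n
        proof -
          have "avg (?y n x) = ?y n x" unfolding yn by (rule f)
          then show ?thesis using elim(1) x by (intro has_derivative_imp_has_orbit_derivative) blast+
        qed
        ultimately have "orbit_derivative G (?y n) x = orbit_derivative G y x" for n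
          using orbit_derivative_eq by metis
        then show ?thesis by (simp add: yn)
      next
        case False
        then have \<rho>x: "\<rho> x > 0" using \<rho>(2)[OF x] dev_nonneg[of "y x"] dev_eq_0_iff[of "y x"] by linarith
        have "\<epsilon> \<longlonglongrightarrow> 0" unfolding \<epsilon>_def[abs_def] using LIMSEQ_inverse_real_of_nat by (simp add: inverse_eq_divide)
        then have "\<forall>\<^sub>F n in sequentially. \<epsilon> n < \<rho> x / 2" using \<rho>x by (intro order_tendstoD(2)) auto
        then show ?thesis
        proof eventually_elim
          case (elim n)
          define S where "S = U \<inter> {x. 2 * \<epsilon> n < \<rho> x}"
          have S: "open S" unfolding S_def by (intro open_Int U open_Collect_less cont\<rho> continuous_on_const)
          have xS: "x \<in> S" using x elim by (simp add: S_def)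
          have eq: "?y n x' = y x'" if "x' \<in> S" for x'
          proof -
            have "2 * \<epsilon> n \<le> dev (y x')" using that \<rho>(2)[of x'] by (simp add: S_def)
            then show ?thesis by (rule collapse_eq_id[OF \<epsilon>])
          qed
          have "orbit_derivative G (?y n) x = orbit_derivative G y x"
            by (rule orbit_derivative_transform[OF S xS eq])
          then show ?case using eq[OF xS] by simp
        qed
      qed
    qed
    then show ?case by (rule tendsto_eventually)
  qed
  then have limAE: "AE x in lebesgue. (\<lambda>n. ?I n x) \<longlonglongrightarrow> ?J x" by (simp add: AE_completion_iff)
  have Im: "?I n \<in> borel_measurable lebesgue" for n using I by (rule borel_measurable_has_bochner_integral)
  have "(\<lambda>x. lim (\<lambda>n. ?I n x)) \<in> borel_measurable lebesgue" using Im by (rule borel_measurable_lim_metric)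
  then have Jm: "?J \<in> borel_measurable lebesgue"
    by (rule borel_measurable_lebesgue_AE_eq) (use limAE in \<open>auto elim!: eventually_mono simp: limI\<close>)
  have "(1 * C)-lipschitz_on U (\<lambda>x. norm (y x))"
    by (rule orbit_lipschitz_invariant[OF y]) (use norm_G C norm_triangle_ineq3 in \<open>auto simp: dist_real_def dist_norm\<close>)
  then have "compact ((\<lambda>x. norm (y x)) ` K)"
    using K by (intro compact_continuous_image continuous_on_subset[OF lipschitz_on_continuous_on]) auto
  then obtain Z where Z: "\<And>x. x \<in> K \<Longrightarrow> norm (y x) \<le> Z"
    using compact_imp_bounded by (force simp: bounded_iff)
  obtain M R where M: "0 \<le> M" "\<And>x. \<bar>a x\<bar> \<le> M * indicator (cball 0 R) x"
    using bounded_support_imp_bounded_fun[OF lipschitz_on_continuous_on[OF A] lip_test_bounded_support[OF less.prems(6)]] by metis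
  have aM: "\<bar>a x\<bar> \<le> M" for x using M(1) M(2)[of x] by (cases "x \<in> cball 0 R") auto
  obtain T where T: "\<And>z L r r'. norm z \<le> 3 * Z \<Longrightarrow> (\<And>v. norm (L v) \<le> (7 * C) * norm v) \<Longrightarrow> \<bar>r\<bar> \<le> M \<Longrightarrow>
    (\<And>v. \<bar>r' v\<bar> \<le> A * norm v) \<Longrightarrow> \<bar>stokes_integrand k \<omega> w z L r r'\<bar> \<le> T"
    using stokes_integrand_bound[OF \<omega> C7 A0 M(1)] by metis
  have bound: "AE x in lebesgue. \<bar>?I n x\<bar> \<le> indicator K x * T" for n
  proof -
    have "AE x in lborel. \<bar>?I n x\<bar> \<le> indicator K x * T"
      using AE_has_orbit_derivative[OF less.prems(1) U C7 ylip[OF \<epsilon>[of n]]] rademacher_real[OF A]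
    proof eventually_elim
      case (elim x)
      show ?case
      proof (cases "x \<in> K")
        case True
        then have x: "x \<in> U" using K by blast
        then obtain L where L: "has_orbit_derivative G (?y n) x L" using elim by blast
        have "norm (?y n x) \<le> 3 * Z" using norm_collapse[of "\<epsilon> n" "y x"] Z[OF True] by linarith
        moreover have "norm (L v) \<le> (7 * C) * norm v" for v
          by (rule has_orbit_derivative_bound[OF L ylip[OF \<epsilon>] U x])
        moreover have "\<bar>frechet_derivative a (at x) v\<bar> \<le> A * norm v" for v
          using has_ddir_bound[OF A has_derivative_imp_has_ddir] elim(2) by (simp add: frechet_derivative_works)
        ultimately show ?thesis
          using T[of "?y n x" L "a x" "frechet_derivative a (at x)"] aM True by (simp add: orbit_derivative_eq[OF L])
      qed (use off in simp)
    qed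
    then show ?thesis by (simp add: AE_completion_iff)
  qed
  have "emeasure lebesgue K < \<infinity>" using lmeasurable_compact[OF K(1)] unfolding fmeasurable_def by blast
  then have "integrable lebesgue (\<lambda>x. indicator K x * T)"
    using fmeasurableD[OF lmeasurable_compact[OF K(1)]]
    by (intro integrable_mult_left integrable_real_indicator) auto
  from dominated_convergence[OF Jm Im this limAE bound]
  have "integrable lebesgue ?J" "(\<lambda>n. integral\<^sup>L lebesgue (?I n)) \<longlonglongrightarrow> integral\<^sup>L lebesgue ?J" by auto
  moreover have "integral\<^sup>L lebesgue (?I n) = 0" for n using I by (rule has_bochner_integral_integral_eq)
  ultimately show ?case
    unfolding weak_stokes_def has_bochner_integral_iff by (auto simp: LIMSEQ_const_iff)
qed

section \<open>Sums over permutations and the exterior derivative\<close>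

text \<open>Composing with this cycle moves the entry at position \<open>n\<close> of a list to the front.\<close>

definition cyc :: "nat \<Rightarrow> nat \<Rightarrow> nat" where
  "cyc n j = (if j = 0 then n else if j \<le> n then j - 1 else j)"

lemma cyc_Suc: "cyc (Suc n) = Transposition.transpose n (Suc n) \<circ> cyc n"
proof
  fix j
  consider "j = 0" | "j \<noteq> 0" "j \<le> n" | "j = Suc n" | "j > Suc n" by linarith
  then show "cyc (Suc n) j = (Transposition.transpose n (Suc n) \<circ> cyc n) j"
    by cases (auto simp: cyc_def transpose_def)
qed

lemma cyc_permutes_sign: "cyc n permutes {..n} \<and> sign (cyc n) = (- 1) ^ n"
proof (induction n)
  case 0
  have "cyc 0 = id" by (rule ext) (simp add: cyc_def)
  then show ?case by (intro conjI) (simp only: permutes_id, simp)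
next
  case (Suc n)
  have t: "Transposition.transpose n (Suc n) permutes {..Suc n}" by (rule permutes_swap_id) auto
  have c: "cyc n permutes {..Suc n}" using Suc by (auto intro: permutes_subset)
  have "sign (cyc (Suc n)) = sign (Transposition.transpose n (Suc n)) * sign (cyc n)"
    unfolding cyc_Suc using t c by (intro sign_compose) (auto intro: permutes_imp_permutation[of "{..Suc n}"])
  then have "sign (cyc (Suc n)) = (- 1) ^ Suc n" using Suc by (simp add: sign_swap_id)
  moreover have "cyc (Suc n) permutes {..Suc n}" unfolding cyc_Suc by (rule permutes_compose[OF c t])
  ultimately show ?case by blast
qed

lemma sum_sign_compose_right:
  fixes Y :: "(nat \<Rightarrow> nat) \<Rightarrow> real"
  assumes p: "\<pi> permutes {..<m}"
  shows "(\<Sum>\<sigma> | \<sigma> permutes {..<m}. of_int (sign \<sigma>) * Y (\<sigma> \<circ> \<pi>)) =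
    of_int (sign \<pi>) * (\<Sum>\<sigma> | \<sigma> permutes {..<m}. of_int (sign \<sigma>) * Y \<sigma>)"
proof -
  have "(\<Sum>\<sigma> | \<sigma> permutes {..<m}. of_int (sign \<sigma>) * Y \<sigma>) =
      (\<Sum>\<sigma> | \<sigma> permutes {..<m}. of_int (sign (\<sigma> \<circ> \<pi>)) * Y (\<sigma> \<circ> \<pi>))"
    by (rule sum_permutations_compose_right[OF p])
  also have "\<dots> = (\<Sum>\<sigma> | \<sigma> permutes {..<m}. of_int (sign \<pi>) * (of_int (sign \<sigma>) * Y (\<sigma> \<circ> \<pi>)))"
  proof (rule sum.cong[OF refl])
    fix \<sigma> assume "\<sigma> \<in> {\<sigma>. \<sigma> permutes {..<m}}"
    then have "sign (\<sigma> \<circ> \<pi>) = sign \<sigma> * sign \<pi>"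
      using p by (intro sign_compose) (auto intro: permutes_imp_permutation[of "{..<m}"])
    then show "of_int (sign (\<sigma> \<circ> \<pi>)) * Y (\<sigma> \<circ> \<pi>) = of_int (sign \<pi>) * (of_int (sign \<sigma>) * Y (\<sigma> \<circ> \<pi>))"
      by simp
  qed
  also have "\<dots> = of_int (sign \<pi>) * (\<Sum>\<sigma> | \<sigma> permutes {..<m}. of_int (sign \<sigma>) * Y (\<sigma> \<circ> \<pi>))"
    by (simp add: sum_distrib_left)
  finally have "of_int (sign \<pi>) * (\<Sum>\<sigma> | \<sigma> permutes {..<m}. of_int (sign \<sigma>) * Y \<sigma>) =
      (of_int (sign \<pi>) * of_int (sign \<pi>)) * (\<Sum>\<sigma> | \<sigma> permutes {..<m}. of_int (sign \<sigma>) * Y (\<sigma> \<circ> \<pi>))"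
    by (simp add: mult.assoc)
  moreover have "(of_int (sign \<pi>) * of_int (sign \<pi>) :: real) = 1" by (simp add: sign_def)
  ultimately show ?thesis by simp
qed

text \<open>The sign of the cycle is \<open>(- 1) ^ (k + i)\<close>. Against the sign \<open>(- 1) ^ i\<close> of the \<open>i\<close>-th term only
  \<open>(- 1) ^ k\<close> is left, so all \<open>n\<close> terms contribute equally.\<close>

lemma sum_sign_alternating_cycles:
  fixes Y :: "(nat \<Rightarrow> nat) \<Rightarrow> real"
  assumes n: "k + n \<le> m" and X: "\<And>i \<sigma>. i < n \<Longrightarrow> \<sigma> permutes {..<m} \<Longrightarrow> X i \<sigma> = Y (\<sigma> \<circ> cyc (k + i))"
  shows "(\<Sum>\<sigma> | \<sigma> permutes {..<m}. of_int (sign \<sigma>) * (\<Sum>i<n. (- 1) ^ i * X i \<sigma>)) =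
    real n * (- 1) ^ k * (\<Sum>\<sigma> | \<sigma> permutes {..<m}. of_int (sign \<sigma>) * Y \<sigma>)"
proof -
  let ?P = "{\<sigma>. \<sigma> permutes {..<m}}"
  let ?S = "\<Sum>\<sigma>\<in>?P. of_int (sign \<sigma>) * Y \<sigma>"
  have "(\<Sum>\<sigma>\<in>?P. of_int (sign \<sigma>) * (\<Sum>i<n. (- 1) ^ i * X i \<sigma>)) =
      (\<Sum>i<n. \<Sum>\<sigma>\<in>?P. of_int (sign \<sigma>) * ((- 1) ^ i * X i \<sigma>))"
    unfolding sum_distrib_left by (rule sum.swap)
  also have "\<dots> = (\<Sum>i<n. (- 1) ^ k * ?S)"
  proof (rule sum.cong[OF refl])
    fix i assume i: "i \<in> {..<n}"
    have c: "cyc (k + i) permutes {..<m}"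
      using cyc_permutes_sign[of "k + i"] i n by (auto intro: permutes_subset)
    have "(\<Sum>\<sigma>\<in>?P. of_int (sign \<sigma>) * ((- 1) ^ i * X i \<sigma>)) =
        (- 1) ^ i * (\<Sum>\<sigma>\<in>?P. of_int (sign \<sigma>) * Y (\<sigma> \<circ> cyc (k + i)))"
      unfolding sum_distrib_left using i X by (intro sum.cong) auto
    also have "\<dots> = (- 1) ^ i * ((- 1) ^ (k + i) * ?S)"
      unfolding sum_sign_compose_right[OF c] using cyc_permutes_sign[of "k + i"] by simp
    also have "\<dots> = (- 1) ^ k * ?S"
      by (simp add: power_add mult.assoc[symmetric] power_mult_distrib[symmetric])
    finally show "(\<Sum>\<sigma>\<in>?P. of_int (sign \<sigma>) * ((- 1) ^ i * X i \<sigma>)) = (- 1) ^ k * ?S" .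
  qed
  finally show ?thesis by simp
qed

lemma sum_sign_average_prefix:
  fixes Y :: "(nat \<Rightarrow> nat) \<Rightarrow> real"
  assumes k: "k < m"
  shows "fact (Suc k) * (\<Sum>\<sigma> | \<sigma> permutes {..<m}. of_int (sign \<sigma>) * Y \<sigma>) =
    (\<Sum>\<sigma> | \<sigma> permutes {..<m}. of_int (sign \<sigma>) * (\<Sum>\<pi> | \<pi> permutes {..k}. of_int (sign \<pi>) * Y (\<sigma> \<circ> \<pi>)))"
proof -
  let ?P = "{\<sigma>. \<sigma> permutes {..<m}}" and ?Q = "{\<pi>. \<pi> permutes {..k}}"
  let ?S = "\<Sum>\<sigma>\<in>?P. of_int (sign \<sigma>) * Y \<sigma>"
  have "(\<Sum>\<sigma>\<in>?P. of_int (sign \<sigma>) * (\<Sum>\<pi>\<in>?Q. of_int (sign \<pi>) * Y (\<sigma> \<circ> \<pi>))) =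
      (\<Sum>\<pi>\<in>?Q. \<Sum>\<sigma>\<in>?P. of_int (sign \<sigma>) * (of_int (sign \<pi>) * Y (\<sigma> \<circ> \<pi>)))"
    unfolding sum_distrib_left by (rule sum.swap)
  also have "\<dots> = (\<Sum>\<pi>\<in>?Q. ?S)"
  proof (rule sum.cong[OF refl])
    fix \<pi> assume "\<pi> \<in> ?Q"
    then have p: "\<pi> permutes {..<m}" using k by (auto intro: permutes_subset)
    have "(\<Sum>\<sigma>\<in>?P. of_int (sign \<sigma>) * (of_int (sign \<pi>) * Y (\<sigma> \<circ> \<pi>))) =
        of_int (sign \<pi>) * (\<Sum>\<sigma>\<in>?P. of_int (sign \<sigma>) * Y (\<sigma> \<circ> \<pi>))"
      unfolding sum_distrib_left by (intro sum.cong) auto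
    also have "\<dots> = ?S"
      unfolding sum_sign_compose_right[OF p] by (simp add: sign_def)
    finally show "(\<Sum>\<sigma>\<in>?P. of_int (sign \<sigma>) * (of_int (sign \<pi>) * Y (\<sigma> \<circ> \<pi>))) = ?S" .
  qed
  also have "\<dots> = real (card ?Q) * ?S" by simp
  also have "card ?Q = fact (Suc k)" by (rule card_permutations) auto
  finally show ?thesis by (simp only: of_nat_fact)
qed

lemma map_cyc_eq_remove:
  assumes "i \<le> n"
  shows "map (\<lambda>j. F ((\<sigma> \<circ> cyc i) (Suc j))) [0..<n] =
    take i (map (\<lambda>j. F (\<sigma> j)) [0..<Suc n]) @ drop (Suc i) (map (\<lambda>j. F (\<sigma> j)) [0..<Suc n])"
proof (rule nth_equalityI)
  show "length (map (\<lambda>j. F ((\<sigma> \<circ> cyc i) (Suc j))) [0..<n]) =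
    length (take i (map (\<lambda>j. F (\<sigma> j)) [0..<Suc n]) @ drop (Suc i) (map (\<lambda>j. F (\<sigma> j)) [0..<Suc n]))"
    using assms by simp
  fix j assume "j < length (map (\<lambda>j. F ((\<sigma> \<circ> cyc i) (Suc j))) [0..<n])"
  then show "map (\<lambda>j. F ((\<sigma> \<circ> cyc i) (Suc j))) [0..<n] ! j =
    (take i (map (\<lambda>j. F (\<sigma> j)) [0..<Suc n]) @ drop (Suc i) (map (\<lambda>j. F (\<sigma> j)) [0..<Suc n])) ! j"
    using assms by (auto simp: nth_append cyc_def nth_upt simp del: upt_Suc)
qed

lemma alternating_form_multilinear: "alternating_form k \<phi> \<Longrightarrow> multilinear_list k \<phi>"
  unfolding alternating_form_def multilinear_list_def by blast

lemma alternating_form_linear: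
  "alternating_form k \<phi> \<Longrightarrow> length v = k \<Longrightarrow> i < k \<Longrightarrow> linear (\<lambda>a. \<phi> (v[i := a]))"
  unfolding alternating_form_def by blast

lemma alternating_form_swap:
  assumes \<phi>: "alternating_form k \<phi>" and len: "length (A @ u # b # D) = k"
  shows "\<phi> (A @ u # b # D) = - \<phi> (A @ b # u # D)"
proof -
  let ?n = "length A"
  define \<psi> where "\<psi> p q = \<phi> (A @ p # q # D)" for p q
  have l1: "linear (\<lambda>p. \<psi> p q)" for q
  proof -
    have "linear (\<lambda>p. \<phi> ((A @ u # q # D)[?n := p]))"
      using len by (intro alternating_form_linear[OF \<phi>]) auto
    then show ?thesis by (simp add: \<psi>_def)
  qed
  have l2: "linear (\<lambda>q. \<psi> p q)" for p
  proof -
    have "linear (\<lambda>q. \<phi> ((A @ p # b # D)[Suc ?n := q]))"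
      using len by (intro alternating_form_linear[OF \<phi>]) auto
    then show ?thesis by (simp add: \<psi>_def list_update_append)
  qed
  have z: "\<psi> p p = 0" for p
  proof -
    have "(A @ p # p # D) ! ?n = (A @ p # p # D) ! Suc ?n" by (simp add: nth_append)
    moreover have "length (A @ p # p # D) = k" "Suc ?n < k" using len by auto
    ultimately show ?thesis using \<phi> unfolding alternating_form_def \<psi>_def by blast
  qed
  have "\<psi> (u + b) (u + b) = \<psi> u u + \<psi> u b + (\<psi> b u + \<psi> b b)"
    using linear_add[OF l1] linear_add[OF l2] by simp
  then have "\<psi> u b = - \<psi> b u" using z by simp
  then show ?thesis by (simp add: \<psi>_def)
qed

lemma alternating_form_move:
  assumes \<phi>: "alternating_form k \<phi>"
  shows "length (A @ u # B @ D) = k \<Longrightarrow> \<phi> (A @ u # B @ D) = (- 1) ^ length B * \<phi> (A @ B @ u # D)"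
proof (induction B arbitrary: A)
  case (Cons b B)
  have "\<phi> (A @ u # (b # B) @ D) = - \<phi> (A @ b # u # B @ D)"
    using alternating_form_swap[OF \<phi>, of A u b "B @ D"] Cons.prems by simp
  also have "\<phi> (A @ b # u # B @ D) = (- 1) ^ length B * \<phi> ((A @ [b]) @ B @ u # D)"
    using Cons.IH[of "A @ [b]"] Cons.prems by simp
  finally show ?case by simp
qed simp

lemma dcoef_alternating:
  assumes \<omega>: "C1_form k \<omega>" and alt: "\<And>z. alternating_form k (\<omega> z)"
  shows "alternating_form k (dcoef \<omega> z u)"
  unfolding alternating_form_def
proof (intro conjI allI impI)
  show "linear (\<lambda>a. dcoef \<omega> z u (v[i := a]))" if "length v = k" "i < k" for v i
    using dcoef_multilinear[OF \<omega>] that unfolding multilinear_list_def by blast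
  fix v :: "'a list" and i j assume "length v = k" "i < j" "j < k" "v ! i = v ! j"
  then have "(\<lambda>y. \<omega> y v) = (\<lambda>y. 0)" using alt unfolding alternating_form_def by blast
  then have "((\<lambda>y. \<omega> y v) has_derivative (\<lambda>u. 0)) (at z)" by simp
  from has_derivative_unique[OF C1_form_has_derivative[OF \<omega> \<open>length v = k\<close>] this]
  show "dcoef \<omega> z u v = 0" by (rule fun_cong)
qed

lemma ext_deriv_eq_dcoef:
  "ext_deriv \<omega> z v = (\<Sum>i<length v. (- 1) ^ i * dcoef \<omega> z (v ! i) (take i v @ drop (Suc i) v))"
  unfolding ext_deriv_def dcoef_def ..

lemma ext_deriv_multilinear:
  assumes \<omega>: "C1_form k \<omega>"
  shows "multilinear_list (Suc k) (ext_deriv \<omega> z)"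
  unfolding multilinear_list_def
proof (intro allI impI)
  fix v :: "'a list" and j assume v: "length v = Suc k" and j: "j < Suc k"
  have "linear (\<lambda>a. dcoef \<omega> z (v[j := a] ! i) (take i (v[j := a]) @ drop (Suc i) (v[j := a])))" if i: "i < Suc k" for i
  proof -
    let ?u = "take i v @ drop (Suc i) v"
    have len: "length ?u = k" using v i by simp
    consider "i = j" | "j < i" | "i < j" by linarith
    then show ?thesis
    proof cases
      case 1
      have "(\<lambda>a. dcoef \<omega> z (v[j := a] ! i) (take i (v[j := a]) @ drop (Suc i) (v[j := a]))) = (\<lambda>a. dcoef \<omega> z a ?u)"
        unfolding 1 using v j drop_update_cancel[of j "Suc j" v] by simp
      then show ?thesis using linear_dcoef[OF \<omega> len] by simp
    next
      case 2
      have "take i (v[j := a]) @ drop (Suc i) (v[j := a]) = ?u[j := a]" for a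
        using 2 v i by (simp add: take_update_swap drop_update_cancel list_update_append)
      moreover have "v[j := a] ! i = v ! i" for a using 2 by simp
      moreover have "linear (\<lambda>a. dcoef \<omega> z (v ! i) (?u[j := a]))"
        using dcoef_multilinear[OF \<omega>] len 2 i unfolding multilinear_list_def by simp
      ultimately show ?thesis by simp
    next
      case 3
      have "take i (v[j := a]) @ drop (Suc i) (v[j := a]) = ?u[j - 1 := a]" for a
      proof -
        obtain j' where j': "j = Suc j'" "i \<le> j'" using 3 by (cases j) auto
        then show ?thesis using v i j by (simp add: drop_update_swap list_update_append)
      qed
      moreover have "v[j := a] ! i = v ! i" for a using 3 by simp
      moreover have "linear (\<lambda>a. dcoef \<omega> z (v ! i) (?u[j - 1 := a]))"
        using dcoef_multilinear[OF \<omega>] len 3 j unfolding multilinear_list_def by simp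
      ultimately show ?thesis by simp
    qed
  qed
  then have "linear (\<lambda>a. \<Sum>i<Suc k. (- 1) ^ i *\<^sub>R dcoef \<omega> z (v[j := a] ! i) (take i (v[j := a]) @ drop (Suc i) (v[j := a])))"
    by (intro linear_compose_sum ballI linear_compose_scale_right) auto
  then show "linear (\<lambda>a. ext_deriv \<omega> z (v[j := a]))"
    unfolding ext_deriv_eq_dcoef length_list_update v real_scaleR_def .
qed

lemma ext_deriv_cont_tensor:
  assumes \<omega>: "C1_form k \<omega>"
  shows "cont_tensor (Suc k) (ext_deriv \<omega>)"
  unfolding cont_tensor_def
proof (intro conjI allI impI ext_deriv_multilinear[OF \<omega>])
  fix v :: "'a list" assume v: "length v = Suc k"
  show "continuous_on UNIV (\<lambda>z. ext_deriv \<omega> z v)"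
    unfolding ext_deriv_eq_dcoef
  proof (intro continuous_intros)
    fix i assume "i \<in> {..<length v}"
    then have "length (take i v @ drop (Suc i) v) = k" using v by simp
    then show "continuous_on UNIV (\<lambda>z. dcoef \<omega> z (v ! i) (take i v @ drop (Suc i) v))"
      using \<omega> unfolding C1_form_def by blast
  qed
qed

lemma ext_deriv_invariant:
  assumes "C1_form k \<omega>" "invariant_tensor G k \<omega>" "\<And>g. g \<in> G \<Longrightarrow> linear g"
  shows "invariant_tensor G (Suc k) (ext_deriv \<omega>)"
  unfolding invariant_tensor_def
proof (intro ballI allI impI)
  fix g z and v :: "'a list" assume g: "g \<in> G" and v: "length v = Suc k"
  show "ext_deriv \<omega> (g z) (map g v) = ext_deriv \<omega> z v"
    unfolding ext_deriv_eq_dcoef length_map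
  proof (rule sum.cong[OF refl])
    fix i assume i: "i \<in> {..<length v}"
    have "dcoef \<omega> (g z) (g (v ! i)) (map g (take i v @ drop (Suc i) v)) = dcoef \<omega> z (v ! i) (take i v @ drop (Suc i) v)"
      using i v by (intro dcoef_invariant[OF assms(1,2) g assms(3)[OF g]]) simp
    then show "(- 1) ^ i * dcoef \<omega> (g z) (map g v ! i) (take i (map g v) @ drop (Suc i) (map g v)) =
        (- 1) ^ i * dcoef \<omega> z (v ! i) (take i v @ drop (Suc i) v)"
      using i by (simp add: take_map drop_map)
  qed
qed

text \<open>If \<open>v ! p = v ! q\<close>, then all terms with \<open>i\<close> different from \<open>p\<close> and \<open>q\<close> contain both equal entries
  and vanish. The two remaining terms differ by moving one entry across \<open>q - p - 1\<close> others, and they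
  cancel.\<close>

lemma ext_deriv_alternating:
  assumes \<omega>: "C1_form k \<omega>" and alt: "\<And>z. alternating_form k (\<omega> z)"
  shows "alternating_form (Suc k) (ext_deriv \<omega> z)"
  unfolding alternating_form_def
proof (intro conjI allI impI)
  show "linear (\<lambda>a. ext_deriv \<omega> z (v[i := a]))" if "length v = Suc k" "i < Suc k" for v i
    using ext_deriv_multilinear[OF \<omega>] that unfolding multilinear_list_def by blast
  fix v :: "'a list" and p q
  assume v: "length v = Suc k" and pq: "p < q" "q < Suc k" and eq: "v ! p = v ! q"
  note altd = dcoef_alternating[OF \<omega> alt]
  let ?t = "\<lambda>i. (- 1) ^ i * dcoef \<omega> z (v ! i) (take i v @ drop (Suc i) v)"
  have other: "?t i = 0" if i: "i < Suc k" "i \<noteq> p" "i \<noteq> q" for i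
  proof -
    let ?u = "take i v @ drop (Suc i) v"
    (* the position of the entry j after entry i has been removed *)
    define s where "s j = (if j < i then j else j - 1)" for j
    have nth: "?u ! s j = v ! j" if "j < Suc k" "j \<noteq> i" for j
      using that i v by (auto simp: s_def nth_append)
    have "?u ! s p = ?u ! s q" using nth pq i eq by simp
    moreover have "length ?u = k" using v i by simp
    moreover have "s p < s q" "s q < k" using pq i by (auto simp: s_def)
    ultimately have "dcoef \<omega> z (v ! i) ?u = 0"
      using altd unfolding alternating_form_def by blast
    then show ?thesis by simp
  qed
  define A where "A = take p v"
  define B where "B = take (q - Suc p) (drop (Suc p) v)"
  define D where "D = drop (Suc q) v"
  define u where "u = v ! q"
  have vq: "drop q v = u # D" using pq v by (simp add: D_def u_def Cons_nth_drop_Suc)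
  have dq: "drop (q - Suc p) (drop (Suc p) v) = drop q v" using pq by simp
  have vp: "drop (Suc p) v = B @ u # D"
    using append_take_drop_id[of "q - Suc p" "drop (Suc p) v"] unfolding dq vq B_def by simp
  have vsplit: "v = A @ u # B @ u # D"
  proof -
    have "drop p v = v ! p # drop (Suc p) v" using pq v by (simp add: Cons_nth_drop_Suc)
    then have "drop p v = u # B @ u # D" using vp eq by (simp add: u_def)
    then show ?thesis using append_take_drop_id[of p v] by (simp add: A_def)
  qed
  have lA: "length A = p" and lB: "length B = q - Suc p" using pq v by (simp_all add: A_def B_def)
  have rp: "take p v @ drop (Suc p) v = A @ B @ u # D" unfolding vp A_def by simp
  have rq: "take q v @ drop (Suc q) v = A @ u # B @ D"
  proof -
    have "take q v = A @ u # B" using lA lB pq by (subst vsplit) (simp add: take_Cons')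
    then show ?thesis by (simp add: D_def)
  qed
  have "length (A @ u # B @ D) = k" using v pq unfolding rq[symmetric] by simp
  from alternating_form_move[OF altd this]
  have m: "dcoef \<omega> z u (A @ u # B @ D) = (- 1) ^ (q - Suc p) * dcoef \<omega> z u (A @ B @ u # D)" unfolding lB .
  have "ext_deriv \<omega> z v = (\<Sum>i<Suc k. ?t i)" unfolding ext_deriv_eq_dcoef v ..
  also have "\<dots> = (\<Sum>i\<in>{p, q}. ?t i)"
    using pq other by (intro sum.mono_neutral_right) auto
  also have "\<dots> = ?t p + ?t q" using pq by simp
  also have "\<dots> = (- 1) ^ p * dcoef \<omega> z u (A @ B @ u # D) + (- 1) ^ q * dcoef \<omega> z u (A @ u # B @ D)"
    unfolding rp rq using eq by (simp add: u_def)
  also have "\<dots> = 0"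
  proof -
    obtain d where d: "q = Suc (p + d)" using pq(1) less_iff_Suc_add by auto
    show ?thesis unfolding m by (simp add: d power_add mult.assoc[symmetric] power_mult_distrib[symmetric])
  qed
  finally show "ext_deriv \<omega> z v = 0" .
qed

section \<open>Maps into unordered tuples\<close>

lemma smooth_form_C1:
  assumes "smooth_form k \<omega>"
  shows "C1_form k \<omega>" and "\<And>z. alternating_form k (\<omega> z)"
proof -
  show alt: "alternating_form k (\<omega> z)" for z using assms unfolding smooth_form_def by blast
  have "times_cont_differentiable (Suc 0) (\<lambda>x. \<omega> x v)" if "length v = k" for v
    using assms that unfolding smooth_form_def smooth_def by blast
  then show "C1_form k \<omega>"
    unfolding C1_form_def dcoef_def using alternating_form_multilinear[OF alt] by simp
qed

lemma lip_test_C1: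
  fixes q :: "'a::euclidean_space \<Rightarrow> real"
  assumes d: "\<And>x. (q has_derivative q' x) (at x)" and c: "\<And>u. continuous_on UNIV (\<lambda>x. q' x u)"
    and K: "compact K" "K \<subseteq> U" "\<And>x. x \<notin> K \<Longrightarrow> q x = 0"
  shows "lip_test U q"
proof -
  obtain R where R: "\<And>x. x \<in> K \<Longrightarrow> norm x \<le> R"
    using compact_imp_bounded[OF K(1)] by (auto simp: bounded_iff)
  (* a cut-off that is 1 on K turns local into global Lipschitz continuity *)
  define a :: "'a \<Rightarrow> real" where "a x = max 0 (min 1 (R + 1 - norm x))" for x
  have "1-lipschitz_on UNIV a"
  proof (rule lipschitz_onI)
    fix x y
    have "\<bar>a x - a y\<bar> \<le> \<bar>norm x - norm y\<bar>" by (auto simp: a_def max_def min_def)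
    also have "\<dots> \<le> norm (x - y)" by (rule norm_triangle_ineq3)
    finally show "dist (a x) (a y) \<le> 1 * dist x y" by (simp add: dist_real_def dist_norm)
  qed simp
  moreover have "bounded {x. a x \<noteq> 0}"
    by (rule bounded_subset[OF bounded_cball[of 0 "R + 1"]]) (auto simp: a_def max_def split: if_splits)
  ultimately have "\<exists>C. C-lipschitz_on UNIV (\<lambda>x. a x * q x)"
    using C1_imp_lipschitz_on_cball[OF d c] by (rule lipschitz_cutoff_mult)
  moreover have "(\<lambda>x. a x * q x) = q"
  proof
    fix x
    show "a x * q x = q x" using K(3)[of x] R[of x] by (cases "x \<in> K") (auto simp: a_def)
  qed
  ultimately show ?thesis using K unfolding lip_test_def by metis
qed

definition perm_group :: "((real ^ 'n) ^ 'd::finite \<Rightarrow> (real ^ 'n) ^ 'd) set" where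
  "perm_group = permute_vec ` {\<sigma>. \<sigma> permutes UNIV}"

lemma linear_permute_vec: "linear (permute_vec \<sigma> :: (real ^ 'n) ^ 'd \<Rightarrow> (real ^ 'n) ^ 'd::finite)"
  by (rule linearI) (simp_all add: permute_vec_def vec_eq_iff)

lemma isometry_group_perm_group: "isometry_group (perm_group :: ((real ^ 'n) ^ 'd::finite \<Rightarrow> (real ^ 'n) ^ 'd) set)"
proof (rule isometry_group.intro)
  let ?G = "perm_group :: ((real ^ 'n) ^ 'd \<Rightarrow> (real ^ 'n) ^ 'd) set"
  show "finite ?G" by (simp add: perm_group_def)
  show "id \<in> ?G" unfolding perm_group_def
    by (rule image_eqI[of _ _ id]) (auto simp: permutes_id fun_eq_iff)
  show "g \<circ> h \<in> ?G" if gh: "g \<in> ?G" "h \<in> ?G" for g h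
  proof -
    obtain \<sigma> where s: "\<sigma> permutes UNIV" "g = permute_vec \<sigma>"
      using gh(1) unfolding perm_group_def by blast
    obtain \<tau> where t: "\<tau> permutes UNIV" "h = permute_vec \<tau>"
      using gh(2) unfolding perm_group_def by blast
    have "g \<circ> h = permute_vec (\<tau> \<circ> \<sigma>)" by (rule ext) (simp add: s t)
    then show ?thesis unfolding perm_group_def using permutes_compose[OF s(1) t(1)] by blast
  qed
  show "\<exists>h\<in>?G. h \<circ> g = id \<and> g \<circ> h = id" if gG: "g \<in> ?G" for g
  proof -
    obtain \<sigma> where s: "\<sigma> permutes UNIV" "g = permute_vec \<sigma>" using gG unfolding perm_group_def by blast
    have "permute_vec (inv \<sigma>) \<in> ?G" unfolding perm_group_def using permutes_inv[OF s(1)] by blast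
    moreover have "permute_vec (inv \<sigma>) \<circ> g = id" "g \<circ> permute_vec (inv \<sigma>) = id"
      using s by (auto simp: fun_eq_iff permutes_inv_o)
    ultimately show ?thesis by blast
  qed
  show "linear g" if "g \<in> ?G" for g using that linear_permute_vec unfolding perm_group_def by blast
  show "norm (g z) = norm z" if gG: "g \<in> ?G" for g z
  proof -
    obtain \<sigma> where s: "\<sigma> permutes UNIV" "g = permute_vec \<sigma>" using gG unfolding perm_group_def by blast
    have "permute_vec \<sigma> 0 = (0 :: (real ^ 'n) ^ 'd)" by (rule linear_0[OF linear_permute_vec])
    then show ?thesis using dist_permute_vec[OF s(1), of z 0] by (simp add: s(2))
  qed
qed

interpretation perm_group: isometry_group "perm_group :: ((real ^ 'n) ^ 'd::finite \<Rightarrow> (real ^ 'n) ^ 'd) set"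
  by (rule isometry_group_perm_group)

lemma utuple_rep_utuple: "utuple (rep_utuple u) = u"
  by (rule Quotient3_abs_rep[OF Quotient3_utuple])

lemma dist_utuple_le_iff:
  fixes a b :: "(real ^ 'n) ^ 'd::finite"
  shows "dist (utuple a) (utuple b) \<le> r \<longleftrightarrow> (\<exists>g\<in>perm_group. dist a (g b) \<le> r)"
proof
  assume "dist (utuple a) (utuple b) \<le> r"
  moreover obtain \<sigma> where "\<sigma> permutes UNIV" "min_dist a b = dist a (permute_vec \<sigma> b)"
    by (rule min_dist_attained)
  ultimately show "\<exists>g\<in>perm_group. dist a (g b) \<le> r"
    unfolding perm_group_def by (auto simp: dist_utuple.abs_eq)
next
  assume "\<exists>g\<in>perm_group. dist a (g b) \<le> r"
  then show "dist (utuple a) (utuple b) \<le> r"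
    unfolding perm_group_def dist_utuple.abs_eq using min_dist_le order_trans by blast
qed

lemma utuple_eq_imp_perm_group:
  fixes a b :: "(real ^ 'n) ^ 'd::finite"
  assumes "utuple a = utuple b"
  obtains g where "g \<in> perm_group" "b = g a"
  using assms unfolding utuple_eq_iff same_up_to_order_def perm_group_def by blast

lemma rep_orbit_lipschitz:
  fixes f :: "'a::metric_space \<Rightarrow> (real ^ 'n, 'd::finite) utuple"
  assumes "C-lipschitz_on U f"
  shows "orbit_lipschitz perm_group C U (\<lambda>x. rep_utuple (f x))"
  unfolding orbit_lipschitz_def
  using lipschitz_onD[OF assms] by (simp add: dist_utuple_le_iff[symmetric] utuple_rep_utuple)

text \<open>From left to right, it suffices to use the transposition of \<open>i\<close> and \<open>j\<close>.\<close>

lemma perm_group_fixes_iff: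
  fixes z :: "(real ^ 'n) ^ 'd::finite" and L :: "'a \<Rightarrow> (real ^ 'n) ^ 'd"
  shows "(\<forall>g\<in>perm_group. g z = z \<longrightarrow> (\<forall>v. g (L v) = L v)) \<longleftrightarrow>
    (\<forall>i j. z $ i = z $ j \<longrightarrow> (\<forall>v. L v $ i = L v $ j))"
proof (intro iffI allI impI ballI)
  fix i j v assume *: "\<forall>g\<in>perm_group. g z = z \<longrightarrow> (\<forall>v. g (L v) = L v)" and ij: "z $ i = z $ j"
  let ?t = "Transposition.transpose i j"
  have "permute_vec ?t \<in> perm_group" unfolding perm_group_def using permutes_swap_id[of i UNIV j] by blast
  moreover have "z $ ?t k = z $ k" for k using ij by (cases "k = i"; cases "k = j") auto
  then have "permute_vec ?t z = z" by (simp add: permute_vec_def)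
  ultimately have "permute_vec ?t (L v) = L v" using * by blast
  then have "permute_vec ?t (L v) $ i = L v $ i" by simp
  then show "L v $ i = L v $ j" by (simp add: permute_vec_def)
next
  fix g v assume *: "\<forall>i j. z $ i = z $ j \<longrightarrow> (\<forall>v. L v $ i = L v $ j)" and g: "g \<in> perm_group" "g z = z"
  obtain \<sigma> where s: "\<sigma> permutes UNIV" "g = permute_vec \<sigma>" using g(1) unfolding perm_group_def by blast
  have "z $ \<sigma> j = z $ j" for j using g(2) s(2) by (simp add: permute_vec_def vec_eq_iff)
  then have "L v $ \<sigma> j = L v $ j" for j using * by blast
  then show "g (L v) = L v" by (simp add: s(2) permute_vec_def vec_eq_iff)
qed

lemma has_orbit_derivative_imp_utuple:
  fixes f :: "real ^ 'm \<Rightarrow> (real ^ 'n, 'd::finite) utuple"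
  assumes L: "has_orbit_derivative perm_group (\<lambda>x. rep_utuple (f x)) x L"
  shows "has_utuple_derivative f (rep_utuple (f x)) L x"
  unfolding has_utuple_derivative_def perm_group_fixes_iff[symmetric]
proof (intro conjI)
  show "f x = utuple (rep_utuple (f x))" by (simp add: utuple_rep_utuple)
  show "linear L" "\<forall>g\<in>perm_group. g (rep_utuple (f x)) = rep_utuple (f x) \<longrightarrow> (\<forall>v. g (L v) = L v)"
    using L unfolding has_orbit_derivative_def by blast+
  show "((\<lambda>x'. dist (f x') (utuple (rep_utuple (f x) + L (x' - x))) / norm (x' - x)) \<longlongrightarrow> 0) (at x)"
  proof (rule LIM_I)
    fix e :: real assume e: "e > 0"
    then have "e / 2 > 0" by simp
    then obtain r where r: "r > 0" "\<And>x'. dist x' x < r \<Longrightarrow>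
        \<exists>g\<in>perm_group. dist (rep_utuple (f x')) (g (rep_utuple (f x) + L (x' - x))) \<le> e / 2 * dist x' x"
      using L unfolding has_orbit_derivative_def by blast
    have "norm (dist (f x') (utuple (rep_utuple (f x) + L (x' - x))) / norm (x' - x) - 0) < e"
      if x': "x' \<noteq> x" "norm (x' - x) < r" for x'
    proof -
      have "dist (utuple (rep_utuple (f x'))) (utuple (rep_utuple (f x) + L (x' - x))) \<le> e / 2 * dist x' x"
        unfolding dist_utuple_le_iff using x'(2) by (intro r(2)) (simp add: dist_norm)
      then have "dist (f x') (utuple (rep_utuple (f x) + L (x' - x))) \<le> e / 2 * norm (x' - x)"
        unfolding utuple_rep_utuple dist_norm[of x' x] .
      then have "dist (f x') (utuple (rep_utuple (f x) + L (x' - x))) / norm (x' - x) \<le> e / 2"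
        using x'(1) by (simp add: pos_divide_le_eq)
      then have "dist (f x') (utuple (rep_utuple (f x) + L (x' - x))) / norm (x' - x) < e"
        using e by linarith
      then show ?thesis by simp
    qed
    then show "\<exists>s>0. \<forall>x'. x' \<noteq> x \<and> norm (x' - x) < s \<longrightarrow>
        norm (dist (f x') (utuple (rep_utuple (f x) + L (x' - x))) / norm (x' - x) - 0) < e"
      using r(1) by blast
  qed
qed

lemma has_utuple_derivative_imp_orbit:
  fixes f :: "real ^ 'm \<Rightarrow> (real ^ 'n, 'd::finite) utuple"
  assumes D: "has_utuple_derivative f y\<^sub>0 L\<^sub>0 x"
  shows "\<exists>g\<in>perm_group. \<exists>L. has_orbit_derivative perm_group (\<lambda>x. rep_utuple (f x)) x L \<and>
    y\<^sub>0 = g (rep_utuple (f x)) \<and> L\<^sub>0 = (\<lambda>v. g (L v))"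
proof -
  let ?z = "rep_utuple (f x)"
  have "utuple ?z = utuple y\<^sub>0" using D unfolding has_utuple_derivative_def by (simp add: utuple_rep_utuple)
  then obtain g where g: "g \<in> perm_group" "y\<^sub>0 = g ?z" by (rule utuple_eq_imp_perm_group)
  obtain h where h: "h \<in> perm_group" "\<And>z. h (g z) = z" "\<And>z. g (h z) = z"
    using perm_group.inverseE[OF g(1)] by metis
  note ling = perm_group.linear_G[OF g(1)] and linh = perm_group.linear_G[OF h(1)]
  have linL: "linear L\<^sub>0" using D unfolding has_utuple_derivative_def by blast
  have fixL: "k (L\<^sub>0 v) = L\<^sub>0 v" if "k \<in> perm_group" "k y\<^sub>0 = y\<^sub>0" for k v
    using D that unfolding has_utuple_derivative_def perm_group_fixes_iff[symmetric] by blast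
  have lim: "((\<lambda>x'. dist (f x') (utuple (y\<^sub>0 + L\<^sub>0 (x' - x))) / norm (x' - x)) \<longlongrightarrow> 0) (at x)"
    using D unfolding has_utuple_derivative_def by blast
  have fx: "f x = utuple y\<^sub>0" using D unfolding has_utuple_derivative_def by blast
  have "has_orbit_derivative perm_group (\<lambda>x. rep_utuple (f x)) x (\<lambda>v. h (L\<^sub>0 v))"
    unfolding has_orbit_derivative_def
  proof (intro conjI ballI impI allI)
    show "linear (\<lambda>v. h (L\<^sub>0 v))" using linear_compose[OF linL linh] by (simp add: o_def)
    show "k (h (L\<^sub>0 v)) = h (L\<^sub>0 v)" if k: "k \<in> perm_group" "k ?z = ?z" for k v
    proof -
      have "(g \<circ> (k \<circ> h)) \<in> perm_group" by (intro perm_group.comp_G g h k)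
      moreover have "(g \<circ> (k \<circ> h)) y\<^sub>0 = y\<^sub>0" using g(2) h(2) k(2) by simp
      ultimately have "(g \<circ> (k \<circ> h)) (L\<^sub>0 v) = L\<^sub>0 v" by (rule fixL)
      then show ?thesis using h(2) by (metis comp_apply)
    qed
    fix e :: real assume e: "e > 0"
    obtain r where r: "r > 0" "\<And>x'. x' \<noteq> x \<Longrightarrow> norm (x' - x) < r \<Longrightarrow>
        norm (dist (f x') (utuple (y\<^sub>0 + L\<^sub>0 (x' - x))) / norm (x' - x) - 0) < e"
      using LIM_D[OF lim e] by blast
    have "\<exists>k\<in>perm_group. dist (rep_utuple (f x')) (k (?z + h (L\<^sub>0 (x' - x)))) \<le> e * dist x' x"
      if x': "dist x' x < r" for x'
    proof -
      have "dist (f x') (utuple (y\<^sub>0 + L\<^sub>0 (x' - x))) \<le> e * norm (x' - x)"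
      proof (cases "x' = x")
        case True
        then show ?thesis by (simp add: linear_0[OF linL] fx)
      next
        case False
        then have "dist (f x') (utuple (y\<^sub>0 + L\<^sub>0 (x' - x))) / norm (x' - x) < e"
          using r(2)[OF False] x' by (simp add: dist_norm)
        then show ?thesis using False by (simp add: pos_divide_less_eq less_imp_le)
      qed
      then have "dist (utuple (rep_utuple (f x'))) (utuple (y\<^sub>0 + L\<^sub>0 (x' - x))) \<le> e * dist x' x"
        by (simp add: utuple_rep_utuple dist_norm)
      then obtain k where k: "k \<in> perm_group" "dist (rep_utuple (f x')) (k (y\<^sub>0 + L\<^sub>0 (x' - x))) \<le> e * dist x' x"
        unfolding dist_utuple_le_iff by blast
      have "k (y\<^sub>0 + L\<^sub>0 (x' - x)) = (k \<circ> g) (?z + h (L\<^sub>0 (x' - x)))"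
        by (simp add: g(2) linear_add[OF ling] h(3))
      then show ?thesis using k perm_group.comp_G[OF k(1) g(1)] by metis
    qed
    then show "\<exists>r>0. \<forall>x'. dist x' x < r \<longrightarrow>
        (\<exists>k\<in>perm_group. dist (rep_utuple (f x')) (k (?z + h (L\<^sub>0 (x' - x)))) \<le> e * dist x' x)"
      using r(1) by blast
  qed
  then show ?thesis using g h(3) by (intro bexI[of _ g] exI[of _ "\<lambda>v. h (L\<^sub>0 v)"]) auto
qed

text \<open>Any labeling and derivative that may be chosen in the definition of the pull-back arise from those on
  the right-hand side by one permutation, and \<open>q\<close> is invariant.\<close>

lemma pullback_utuple_eq:
  fixes f :: "real ^ 'm \<Rightarrow> (real ^ 'n, 'd::finite) utuple"
  assumes L: "has_orbit_derivative perm_group (\<lambda>x. rep_utuple (f x)) x L"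
    and q: "invariant_tensor perm_group n q" and v: "length v = n"
  shows "pullback_utuple f q x v = q (rep_utuple (f x)) (map L v)"
proof -
  have ex: "has_utuple_derivative f (rep_utuple (f x)) L x" using L by (rule has_orbit_derivative_imp_utuple)
  obtain y\<^sub>0 L\<^sub>0 where s: "(SOME (y, L). has_utuple_derivative f y L x) = (y\<^sub>0, L\<^sub>0)" by fastforce
  have "case (SOME (y, L). has_utuple_derivative f y L x) of (y, L) \<Rightarrow> has_utuple_derivative f y L x"
    by (rule someI_ex) (use ex in auto)
  then have "has_utuple_derivative f y\<^sub>0 L\<^sub>0 x" unfolding s by simp
  then obtain g L' where g: "g \<in> perm_group" "y\<^sub>0 = g (rep_utuple (f x))" "L\<^sub>0 = (\<lambda>v. g (L' v))"
    and L': "has_orbit_derivative perm_group (\<lambda>x. rep_utuple (f x)) x L'"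
    using has_utuple_derivative_imp_orbit by blast
  have "L' = L" by (rule perm_group.has_orbit_derivative_unique[OF L' L])
  have "pullback_utuple f q x v = q y\<^sub>0 (map L\<^sub>0 v)"
    unfolding pullback_utuple_def s using ex by auto
  also have "\<dots> = q (g (rep_utuple (f x))) (map g (map L v))"
    unfolding g(2,3) \<open>L' = L\<close> by (simp add: o_def)
  also have "\<dots> = q (rep_utuple (f x)) (map L v)"
    using q g(1) v unfolding invariant_tensor_def by (simp del: map_map)
  finally show ?thesis .
qed

lemma AE_pullback_utuple:
  fixes f :: "real ^ 'm \<Rightarrow> (real ^ 'n, 'd::finite) utuple"
  assumes f: "C-lipschitz_on U f" and U: "open U"
  shows "AE x in lebesgue_on U. has_orbit_derivative perm_group (\<lambda>x. rep_utuple (f x)) x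
      (orbit_derivative perm_group (\<lambda>x. rep_utuple (f x)) x) \<and>
    (\<forall>v. norm (orbit_derivative perm_group (\<lambda>x. rep_utuple (f x)) x v) \<le> C * norm v)"
proof -
  let ?y = "\<lambda>x. rep_utuple (f x)"
  have C: "0 \<le> C" using f by (rule lipschitz_on_nonneg)
  note y = rep_orbit_lipschitz[OF f]
  have "AE x in lborel. x \<in> U \<longrightarrow> (\<exists>L. has_orbit_derivative perm_group ?y x L)"
    by (rule AE_has_orbit_derivative[OF isometry_group_perm_group U C y])
  then have "AE x in lborel. x \<in> U \<longrightarrow> has_orbit_derivative perm_group ?y x (orbit_derivative perm_group ?y x) \<and>
    (\<forall>v. norm (orbit_derivative perm_group ?y x v) \<le> C * norm v)"
  proof eventually_elim
    case (elim x)
    show ?case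
    proof
      assume x: "x \<in> U"
      then obtain L where L: "has_orbit_derivative perm_group ?y x L" using elim by blast
      show "has_orbit_derivative perm_group ?y x (orbit_derivative perm_group ?y x) \<and>
          (\<forall>v. norm (orbit_derivative perm_group ?y x v) \<le> C * norm v)"
        unfolding perm_group.orbit_derivative_eq[OF L]
        using L perm_group.has_orbit_derivative_bound[OF L y U x] by blast
    qed
  qed
  then have "AE x in lebesgue. x \<in> U \<longrightarrow> has_orbit_derivative perm_group ?y x (orbit_derivative perm_group ?y x) \<and>
    (\<forall>v. norm (orbit_derivative perm_group ?y x v) \<le> C * norm v)" by (simp add: AE_completion_iff)
  then show ?thesis using U by (subst AE_restrict_space_iff) auto
qed

lemma pullback_utuple_measurable:
  fixes f :: "real ^ 'm \<Rightarrow> (real ^ 'n, 'd::finite) utuple"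
  assumes f: "C-lipschitz_on U f" and U: "open U" and q: "cont_tensor n q" "invariant_tensor perm_group n q"
    and v: "length v = n"
  shows "(\<lambda>x. pullback_utuple f q x v) \<in> borel_measurable (lebesgue_on U)"
proof (rule borel_measurable_lebesgue_on_AE_eq)
  show "U \<in> sets lebesgue" using U by auto
  show "(\<lambda>x. orbit_pullback perm_group (\<lambda>x. rep_utuple (f x)) q x v) \<in> borel_measurable (lebesgue_on U)"
    by (rule orbit_pullback_measurable[OF isometry_group_perm_group U lipschitz_on_nonneg[OF f] rep_orbit_lipschitz[OF f] q(2,1) v])
  have "AE x in lebesgue_on U. pullback_utuple f q x v = orbit_pullback perm_group (\<lambda>x. rep_utuple (f x)) q x v"
    using AE_pullback_utuple[OF f U]
    by eventually_elim (use pullback_utuple_eq[OF _ q(2) v] in \<open>simp add: orbit_pullback_def\<close>)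
  then show "AE x in lebesgue. x \<in> U \<longrightarrow> pullback_utuple f q x v = orbit_pullback perm_group (\<lambda>x. rep_utuple (f x)) q x v"
    using U by (subst (asm) AE_restrict_space_iff) auto
qed

lemma AE_pullback_bound:
  fixes f :: "real ^ 'm \<Rightarrow> (real ^ 'n, 'd::finite) utuple"
  assumes f: "C-lipschitz_on U f" and U: "open U" and q: "invariant_tensor perm_group n q"
    and M: "0 \<le> M" "\<And>x v. x \<in> S \<Longrightarrow> length v = n \<Longrightarrow> \<bar>q (rep_utuple (f x)) v\<bar> \<le> M * (\<Prod>i<n. norm (v ! i))"
  shows "AE x in lebesgue_on U. x \<in> S \<longrightarrow> (\<forall>v. length v = n \<longrightarrow>
    \<bar>pullback_utuple f q x v\<bar> \<le> (M * C ^ n) * (\<Prod>i<n. norm (v ! i)))"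
  using AE_pullback_utuple[OF f U]
proof eventually_elim
  case (elim x)
  let ?L = "orbit_derivative perm_group (\<lambda>x. rep_utuple (f x)) x"
  show ?case
  proof (intro impI allI)
    fix v :: "(real ^ 'm) list" assume x: "x \<in> S" and v: "length v = n"
    have "\<bar>pullback_utuple f q x v\<bar> = \<bar>q (rep_utuple (f x)) (map ?L v)\<bar>"
      using pullback_utuple_eq[OF conjunct1[OF elim] q v] by simp
    also have "\<dots> \<le> M * (\<Prod>i<n. norm (map ?L v ! i))" using v by (intro M(2)[OF x]) simp
    also have "(\<Prod>i<n. norm (map ?L v ! i)) \<le> (\<Prod>i<n. C * norm (v ! i))"
      using elim v by (intro prod_mono) auto
    also have "\<dots> = C ^ n * (\<Prod>i<n. norm (v ! i))" by (simp add: prod.distrib)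
    finally show "\<bar>pullback_utuple f q x v\<bar> \<le> (M * C ^ n) * (\<Prod>i<n. norm (v ! i))"
      using M(1) by (simp add: mult_left_mono mult.assoc)
  qed
qed

lemma Linfty_form_pullback_utuple:
  fixes f :: "real ^ 'm \<Rightarrow> (real ^ 'n, 'd::finite) utuple"
  assumes f: "C-lipschitz_on U f" and U: "open U" and q: "cont_tensor n q" "invariant_tensor perm_group n q"
    and alt: "\<And>z. alternating_form n (q z)"
    and M: "\<And>x v. x \<in> U \<Longrightarrow> length v = n \<Longrightarrow> \<bar>q (rep_utuple (f x)) v\<bar> \<le> M * (\<Prod>i<n. norm (v ! i))"
  shows "Linfty_form U n (pullback_utuple f q)"
  unfolding Linfty_form_def
proof (intro conjI allI impI)
  show "(\<lambda>x. pullback_utuple f q x v) \<in> borel_measurable (lebesgue_on U)" if "length v = n" for v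
    by (rule pullback_utuple_measurable[OF f U q that])
  have M': "\<bar>q (rep_utuple (f x)) v\<bar> \<le> \<bar>M\<bar> * (\<Prod>i<n. norm (v ! i))" if "x \<in> U" "length v = n" for x v
    using M[OF that] by (rule order_trans) (intro mult_right_mono prod_nonneg, auto)
  have "AE x in lebesgue_on U. x \<in> U \<longrightarrow> (\<forall>v. length v = n \<longrightarrow>
      \<bar>pullback_utuple f q x v\<bar> \<le> (\<bar>M\<bar> * C ^ n) * (\<Prod>i<n. norm (v ! i)))"
    by (rule AE_pullback_bound[OF f U q(2) abs_ge_zero M'])
  moreover have "AE x in lebesgue_on U. x \<in> U" by (rule AE_I2) (simp add: space_restrict_space)
  ultimately have "AE x in lebesgue_on U. \<forall>v. length v = n \<longrightarrow>
      \<bar>pullback_utuple f q x v\<bar> \<le> (\<bar>M\<bar> * C ^ n) * (\<Prod>i<n. norm (v ! i))"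
    by eventually_elim blast
  then show "\<exists>C. AE x in lebesgue_on U. \<forall>v. length v = n \<longrightarrow> \<bar>pullback_utuple f q x v\<bar> \<le> C * (\<Prod>i<n. norm (v ! i))"
    by blast
  show "AE x in lebesgue_on U. alternating_form n (pullback_utuple f q x)"
    using AE_pullback_utuple[OF f U]
  proof eventually_elim
    case (elim x)
    let ?L = "orbit_derivative perm_group (\<lambda>x. rep_utuple (f x)) x"
    have eq: "pullback_utuple f q x v = q (rep_utuple (f x)) (map ?L v)" if "length v = n" for v
      using pullback_utuple_eq[OF _ q(2) that] elim by blast
    have lin: "linear ?L" using elim unfolding has_orbit_derivative_def by blast
    show ?case
      unfolding alternating_form_def
    proof (intro conjI allI impI)
      fix v :: "(real ^ 'm) list" and i assume v: "length v = n" "i < n"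
      have "linear (\<lambda>a. q (rep_utuple (f x)) ((map ?L v)[i := a]))"
        using v by (intro alternating_form_linear[OF alt]) auto
      from linear_compose[OF lin this]
      show "linear (\<lambda>a. pullback_utuple f q x (v[i := a]))"
        using v by (simp add: eq map_update o_def)
    next
      fix v :: "(real ^ 'm) list" and i j assume v: "length v = n" "i < j" "j < n" "v ! i = v ! j"
      have "length (map ?L v) = n" "map ?L v ! i = map ?L v ! j" using v by auto
      then have "q (rep_utuple (f x)) (map ?L v) = 0"
        using alt[of "rep_utuple (f x)"] v unfolding alternating_form_def by blast
      then show "pullback_utuple f q x v = 0" using eq[OF v(1)] by simp
    qed
  qed
qed

lemma norm_rep_utuple:
  fixes u :: "(real ^ 'n, 'd::finite) utuple"
  shows "norm (rep_utuple u) = dist u (utuple 0)"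
proof -
  have "min_dist (rep_utuple u) (0 :: (real ^ 'n) ^ 'd) = norm (rep_utuple u)"
  proof -
    obtain \<sigma> where "\<sigma> permutes UNIV" "min_dist (rep_utuple u) 0 = dist (rep_utuple u) (permute_vec \<sigma> 0)"
      by (rule min_dist_attained)
    moreover have "permute_vec \<sigma> 0 = (0 :: (real ^ 'n) ^ 'd)" by (rule linear_0[OF linear_permute_vec])
    ultimately show ?thesis by simp
  qed
  then show ?thesis by (metis dist_utuple.abs_eq utuple_rep_utuple)
qed

lemma integrable_mult_compact_support:
  fixes a \<beta> :: "'a::euclidean_space \<Rightarrow> real"
  assumes \<beta>: "\<beta> \<in> borel_measurable (lebesgue_on U)" "AE x in lebesgue_on U. x \<in> K \<longrightarrow> \<bar>\<beta> x\<bar> \<le> T"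
    and a: "continuous_on UNIV a" "compact K" "\<And>x. x \<notin> K \<Longrightarrow> a x = 0" and U: "open U" "K \<subseteq> U"
  shows "integrable (lebesgue_on U) (\<lambda>x. \<beta> x * a x)"
proof -
  have "bounded {x. a x \<noteq> 0}" using a(3) by (intro bounded_subset[OF compact_imp_bounded[OF a(2)]]) auto
  then obtain B R where B: "0 \<le> B" "\<And>x. \<bar>a x\<bar> \<le> B * indicator (cball 0 R) x"
    using bounded_support_imp_bounded_fun[OF a(1)] by metis
  have aB: "\<bar>a x\<bar> \<le> B" for x using B(1) B(2)[of x] by (cases "x \<in> cball 0 R") auto
  have am: "a \<in> borel_measurable (lebesgue_on U)"
    using a(1) by (intro measurable_restrict_space1 measurable_completion) (auto intro: borel_measurable_continuous_onI)
  have *: "integrable lebesgue (\<lambda>x. indicator K x * (\<bar>T\<bar> * B) :: real)"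
    using lmeasurable_compact[OF a(2)] unfolding fmeasurable_def
    by (intro integrable_mult_left integrable_real_indicator) auto
  then have "integrable (lebesgue_on U) (\<lambda>x. indicator K x * (\<bar>T\<bar> * B))"
  proof -
    have "(\<lambda>x. indicator U x *\<^sub>R (indicator K x * (\<bar>T\<bar> * B))) = (\<lambda>x. indicator K x * (\<bar>T\<bar> * B) :: real)"
      using U(2) by (auto simp: indicator_def fun_eq_iff)
    with * show ?thesis using U(1) by (subst integrable_restrict_space) auto
  qed
  then show ?thesis
  proof (rule Bochner_Integration.integrable_bound)
    show "(\<lambda>x. \<beta> x * a x) \<in> borel_measurable (lebesgue_on U)" using \<beta>(1) am by measurable
    show "AE x in lebesgue_on U. norm (\<beta> x * a x) \<le> norm (indicator K x * (\<bar>T\<bar> * B))"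
      using \<beta>(2)
    proof eventually_elim
      case (elim x)
      show ?case
      proof (cases "x \<in> K")
        case True
        then have "\<bar>\<beta> x\<bar> * \<bar>a x\<bar> \<le> \<bar>T\<bar> * B" using elim aB[of x] by (intro mult_mono) auto
        then show ?thesis using True B(1) by (simp add: abs_mult)
      qed (use a(3) in simp)
    qed
  qed
qed

section \<open>The wedge product with a test form\<close>

lemma drop_map_upt: "drop p (map F [0..<p + q]) = map (\<lambda>j. F (p + j)) [0..<q]"
  by (rule nth_equalityI) auto

lemma take_map_upt: "take p (map F [0..<p + q]) = map F [0..<p]"
  by (rule nth_equalityI) auto

text \<open>In the term where slot \<open>i\<close> is differentiated, that slot is moved to the front. The \<open>k + 1\<close> equal
  terms reduce \<open>fact (k + 1)\<close> to \<open>fact k\<close>.\<close>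

lemma wedge_ext_deriv_left:
  fixes E :: "nat \<Rightarrow> 'a" and L :: "'a \<Rightarrow> 'b::real_normed_vector"
  assumes e: "e = map E [0..<Suc k + l]"
    and \<gamma>: "\<And>v. length v = Suc k \<Longrightarrow> \<gamma> x v = ext_deriv \<omega> z (map L v)"
  shows "wedge (Suc k) l \<gamma> \<alpha> x e = (1 / (fact k * fact l)) *
    (\<Sum>\<sigma> | \<sigma> permutes {..<Suc k + l}. of_int (sign \<sigma>) *
       (dcoef \<omega> z (L (E (\<sigma> 0))) (map (\<lambda>i. L (E (\<sigma> (Suc i)))) [0..<k]) *
        \<alpha> x (map (\<lambda>j. E (\<sigma> (Suc k + j))) [0..<l])))"
proof -
  let ?m = "Suc k + l"
  let ?P = "{\<sigma>. \<sigma> permutes {..<?m}}"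
  define Y where "Y \<sigma> = dcoef \<omega> z (L (E (\<sigma> 0))) (map (\<lambda>i. L (E (\<sigma> (Suc i)))) [0..<k]) *
        \<alpha> x (map (\<lambda>j. E (\<sigma> (Suc k + j))) [0..<l])" for \<sigma> :: "nat \<Rightarrow> nat"
  define X where "X i \<sigma> = dcoef \<omega> z (L (E (\<sigma> i))) (take i (map (\<lambda>j. L (E (\<sigma> j))) [0..<Suc k]) @
        drop (Suc i) (map (\<lambda>j. L (E (\<sigma> j))) [0..<Suc k])) *
        \<alpha> x (map (\<lambda>j. E (\<sigma> (Suc k + j))) [0..<l])" for i and \<sigma> :: "nat \<Rightarrow> nat"
  have XY: "X i \<sigma> = Y (\<sigma> \<circ> cyc (0 + i))" if i: "i < Suc k" for i and \<sigma> :: "nat \<Rightarrow> nat"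
  proof -
    have "map (\<lambda>i'. L (E ((\<sigma> \<circ> cyc i) (Suc i')))) [0..<k] =
        take i (map (\<lambda>j. L (E (\<sigma> j))) [0..<Suc k]) @ drop (Suc i) (map (\<lambda>j. L (E (\<sigma> j))) [0..<Suc k])"
      using i by (intro map_cyc_eq_remove[of i k "\<lambda>u. L (E u)"]) simp
    moreover have "map (\<lambda>j. E ((\<sigma> \<circ> cyc i) (Suc k + j))) [0..<l] = map (\<lambda>j. E (\<sigma> (Suc k + j))) [0..<l]"
      using i by (intro map_cong refl) (simp add: cyc_def)
    moreover have "(\<sigma> \<circ> cyc i) 0 = \<sigma> i" by (simp add: cyc_def)
    ultimately show ?thesis unfolding X_def Y_def add_0 by (simp only:)
  qed
  have term1: "\<gamma> x (take (Suc k) (permute_list \<sigma> e)) * \<alpha> x (drop (Suc k) (permute_list \<sigma> e)) =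
      (\<Sum>i<Suc k. (- 1) ^ i * X i \<sigma>)" if s: "\<sigma> permutes {..<?m}" for \<sigma>
  proof -
    have pl: "permute_list \<sigma> e = map (\<lambda>i. E (\<sigma> i)) [0..<?m]"
      unfolding permute_list_def e
    proof (rule map_cong)
      fix i assume "i \<in> set [0..<?m]"
      then have "\<sigma> i \<in> {..<?m}" using s permutes_in_image by fastforce
      then show "map E [0..<?m] ! \<sigma> i = E (\<sigma> i)" by (simp del: upt_Suc)
    qed simp
    have p: "take (Suc k) (permute_list \<sigma> e) = map (\<lambda>i. E (\<sigma> i)) [0..<Suc k]"
        "drop (Suc k) (permute_list \<sigma> e) = map (\<lambda>j. E (\<sigma> (Suc k + j))) [0..<l]"
      unfolding pl take_map_upt drop_map_upt by (rule refl)+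
    have "\<gamma> x (map (\<lambda>i. E (\<sigma> i)) [0..<Suc k]) = ext_deriv \<omega> z (map (\<lambda>i. L (E (\<sigma> i))) [0..<Suc k])"
      by (subst \<gamma>) (simp_all add: o_def del: upt_Suc)
    also have "\<dots> = (\<Sum>i<Suc k. (- 1) ^ i * dcoef \<omega> z (L (E (\<sigma> i)))
        (take i (map (\<lambda>j. L (E (\<sigma> j))) [0..<Suc k]) @ drop (Suc i) (map (\<lambda>j. L (E (\<sigma> j))) [0..<Suc k])))"
      unfolding ext_deriv_eq_dcoef by (rule sum.cong) (auto simp del: upt_Suc)
    finally show ?thesis unfolding p X_def by (simp only: sum_distrib_right mult.assoc)
  qed
  have "wedge (Suc k) l \<gamma> \<alpha> x e = (\<Sum>\<sigma>\<in>?P. of_int (sign \<sigma>) * (\<Sum>i<Suc k. (- 1) ^ i * X i \<sigma>)) / (fact (Suc k) * fact l)"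
    unfolding wedge_def
    by (rule arg_cong2[where f="(/)", OF sum.cong[OF refl] refl]) (simp only: mult.assoc term1 mem_Collect_eq)
  also have "(\<Sum>\<sigma>\<in>?P. of_int (sign \<sigma>) * (\<Sum>i<Suc k. (- 1) ^ i * X i \<sigma>)) =
      real (Suc k) * (- 1) ^ 0 * (\<Sum>\<sigma>\<in>?P. of_int (sign \<sigma>) * Y \<sigma>)"
    by (rule sum_sign_alternating_cycles) (use XY in auto)
  also have "real (Suc k) * (- 1) ^ 0 * (\<Sum>\<sigma>\<in>?P. of_int (sign \<sigma>) * Y \<sigma>) / (fact (Suc k) * fact l) =
      (1 / (fact k * fact l)) * (\<Sum>\<sigma>\<in>?P. of_int (sign \<sigma>) * Y \<sigma>)"
  proof -
    have "(fact (Suc k) :: real) = real (Suc k) * fact k" by (rule fact_Suc)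
    then show ?thesis by (simp only:) (simp add: divide_simps del: of_nat_Suc)
  qed
  finally show ?thesis unfolding Y_def .
qed

text \<open>The differentiated slot \<open>k + i\<close> is moved to the front across the \<open>k\<close> slots of \<open>\<beta>\<close>, which
  produces the sign \<open>(- 1) ^ k\<close>.\<close>

lemma wedge_ext_deriv_right:
  fixes E :: "nat \<Rightarrow> 'a::real_normed_vector" and L :: "'a \<Rightarrow> 'b"
  assumes e: "e = map E [0..<Suc k + l]"
    and \<beta>: "\<And>v. length v = k \<Longrightarrow> \<beta> x v = \<omega> z (map L v)"
  shows "wedge k (Suc l) \<beta> (ext_deriv \<alpha>) x e = (- 1) ^ k * (1 / (fact k * fact l)) *
    (\<Sum>\<sigma> | \<sigma> permutes {..<Suc k + l}. of_int (sign \<sigma>) *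
       (frechet_derivative (\<lambda>y. \<alpha> y (map (\<lambda>j. E (\<sigma> (Suc k + j))) [0..<l])) (at x) (E (\<sigma> 0)) *
        \<omega> z (map (\<lambda>i. L (E (\<sigma> (Suc i)))) [0..<k])))"
proof -
  let ?m = "k + Suc l"
  have m: "Suc k + l = ?m" by simp
  let ?P = "{\<sigma>. \<sigma> permutes {..<?m}}"
  define Y where "Y \<sigma> = frechet_derivative (\<lambda>y. \<alpha> y (map (\<lambda>j. E (\<sigma> (Suc k + j))) [0..<l])) (at x) (E (\<sigma> 0)) *
        \<omega> z (map (\<lambda>i. L (E (\<sigma> (Suc i)))) [0..<k])" for \<sigma> :: "nat \<Rightarrow> nat"
  define X where "X i \<sigma> = dcoef \<alpha> x (E (\<sigma> (k + i))) (take i (map (\<lambda>j. E (\<sigma> (k + j))) [0..<Suc l]) @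
        drop (Suc i) (map (\<lambda>j. E (\<sigma> (k + j))) [0..<Suc l])) *
        \<omega> z (map (\<lambda>i. L (E (\<sigma> i))) [0..<k])" for i and \<sigma> :: "nat \<Rightarrow> nat"
  have XY: "X i \<sigma> = Y (\<sigma> \<circ> cyc (k + i))" if i: "i < Suc l" for i and \<sigma> :: "nat \<Rightarrow> nat"
  proof -
    have c: "cyc (k + i) (Suc k + j) = k + cyc i (Suc j)" for j by (auto simp: cyc_def)
    have "map (\<lambda>j. E (((\<lambda>j. \<sigma> (k + j)) \<circ> cyc i) (Suc j))) [0..<l] =
        take i (map (\<lambda>j. E (\<sigma> (k + j))) [0..<Suc l]) @ drop (Suc i) (map (\<lambda>j. E (\<sigma> (k + j))) [0..<Suc l])"
      using i by (intro map_cyc_eq_remove[of i l E "\<lambda>j. \<sigma> (k + j)"]) simp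
    moreover have "map (\<lambda>j. E ((\<sigma> \<circ> cyc (k + i)) (Suc k + j))) [0..<l] =
        map (\<lambda>j. E (((\<lambda>j. \<sigma> (k + j)) \<circ> cyc i) (Suc j))) [0..<l]"
      unfolding comp_apply c ..
    moreover have "map (\<lambda>i'. L (E ((\<sigma> \<circ> cyc (k + i)) (Suc i')))) [0..<k] = map (\<lambda>i. L (E (\<sigma> i))) [0..<k]"
      by (intro map_cong refl) (simp add: cyc_def)
    moreover have "(\<sigma> \<circ> cyc (k + i)) 0 = \<sigma> (k + i)" by (simp add: cyc_def)
    ultimately show ?thesis unfolding X_def Y_def dcoef_def by (simp only:)
  qed
  have term1: "\<beta> x (take k (permute_list \<sigma> e)) * ext_deriv \<alpha> x (drop k (permute_list \<sigma> e)) =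
      (\<Sum>i<Suc l. (- 1) ^ i * X i \<sigma>)" if s: "\<sigma> permutes {..<?m}" for \<sigma>
  proof -
    have pl: "permute_list \<sigma> e = map (\<lambda>i. E (\<sigma> i)) [0..<?m]"
      unfolding permute_list_def e m
    proof (rule map_cong)
      fix i assume "i \<in> set [0..<?m]"
      then have "\<sigma> i \<in> {..<?m}" using s permutes_in_image by fastforce
      then show "map E [0..<?m] ! \<sigma> i = E (\<sigma> i)" by (simp del: upt_Suc)
    qed simp
    have p: "take k (permute_list \<sigma> e) = map (\<lambda>i. E (\<sigma> i)) [0..<k]"
        "drop k (permute_list \<sigma> e) = map (\<lambda>j. E (\<sigma> (k + j))) [0..<Suc l]"
      unfolding pl take_map_upt drop_map_upt by (rule refl)+
    have "\<beta> x (map (\<lambda>i. E (\<sigma> i)) [0..<k]) = \<omega> z (map (\<lambda>i. L (E (\<sigma> i))) [0..<k])"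
      by (subst \<beta>) (simp_all add: o_def)
    moreover have "ext_deriv \<alpha> x (map (\<lambda>j. E (\<sigma> (k + j))) [0..<Suc l]) =
        (\<Sum>i<Suc l. (- 1) ^ i * dcoef \<alpha> x (E (\<sigma> (k + i)))
        (take i (map (\<lambda>j. E (\<sigma> (k + j))) [0..<Suc l]) @ drop (Suc i) (map (\<lambda>j. E (\<sigma> (k + j))) [0..<Suc l])))"
      unfolding ext_deriv_eq_dcoef by (rule sum.cong) (auto simp del: upt_Suc)
    ultimately show ?thesis unfolding p X_def by (simp only: sum_distrib_left mult_ac)
  qed
  have "wedge k (Suc l) \<beta> (ext_deriv \<alpha>) x e = (\<Sum>\<sigma>\<in>?P. of_int (sign \<sigma>) * (\<Sum>i<Suc l. (- 1) ^ i * X i \<sigma>)) / (fact k * fact (Suc l))"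
    unfolding wedge_def
    by (rule arg_cong2[where f="(/)", OF sum.cong[OF refl] refl]) (simp only: mult.assoc term1 mem_Collect_eq)
  also have "(\<Sum>\<sigma>\<in>?P. of_int (sign \<sigma>) * (\<Sum>i<Suc l. (- 1) ^ i * X i \<sigma>)) =
      real (Suc l) * (- 1) ^ k * (\<Sum>\<sigma>\<in>?P. of_int (sign \<sigma>) * Y \<sigma>)"
    by (rule sum_sign_alternating_cycles) (use XY in auto)
  also have "real (Suc l) * (- 1) ^ k * (\<Sum>\<sigma>\<in>?P. of_int (sign \<sigma>) * Y \<sigma>) / (fact k * fact (Suc l)) =
      (- 1) ^ k * (1 / (fact k * fact l)) * (\<Sum>\<sigma>\<in>?P. of_int (sign \<sigma>) * Y \<sigma>)"
  proof -
    have "(fact (Suc l) :: real) = real (Suc l) * fact l" by (rule fact_Suc)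
    then show ?thesis by (simp only:) (simp add: divide_simps del: of_nat_Suc)
  qed
  finally show ?thesis unfolding Y_def m .
qed

text \<open>The difference of the two integrands is a combination of integrands \<open>I \<sigma>\<close> with integral zero. In
  \<open>I \<sigma>\<close> the test function is the coefficient of \<open>\<alpha>\<close> on the last \<open>l\<close> basis vectors, which a
  permutation of the first \<open>k + 1\<close> positions does not change.\<close>

theorem weak_ext_deriv_pullback_utuple:
  fixes f :: "real ^ 'm::{finite, wellorder} \<Rightarrow> (real ^ 'n, 'd::finite) utuple"
  assumes U: "open U" and f: "C-lipschitz_on U f" and \<omega>: "invariant_form k \<omega>"
  shows "weak_ext_deriv U k (pullback_utuple f \<omega>) (pullback_utuple f (ext_deriv \<omega>))"
  unfolding weak_ext_deriv_def
proof (intro allI impI)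
  fix l and \<alpha> :: "(real ^ 'm::{finite, wellorder}) form" assume kl: "k + 1 + l = CARD('m)" and \<alpha>: "test_form U l \<alpha>"
  let ?G = "perm_group :: ((real ^ 'n) ^ 'd \<Rightarrow> (real ^ 'n) ^ 'd) set"
  let ?m = "Suc k + l"
  let ?P = "{\<sigma>. \<sigma> permutes {..<?m}}"
  have C: "0 \<le> C" using f by (rule lipschitz_on_nonneg)
  have \<omega>1: "C1_form k \<omega>" and inv: "invariant_tensor ?G k \<omega>"
  proof -
    show "C1_form k \<omega>" using \<omega> smooth_form_C1 unfolding invariant_form_def by blast
    show "invariant_tensor ?G k \<omega>"
      using \<omega> unfolding invariant_form_def invariant_tensor_def perm_group_def by blast
  qed
  have q0: "cont_tensor k \<omega>" by (rule C1_form_cont_tensor[OF \<omega>1])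
  have q1: "cont_tensor (Suc k) (ext_deriv \<omega>)" by (rule ext_deriv_cont_tensor[OF \<omega>1])
  have inv1: "invariant_tensor ?G (Suc k) (ext_deriv \<omega>)"
    by (rule ext_deriv_invariant[OF \<omega>1 inv perm_group.linear_G])
  have \<alpha>1: "C1_form l \<alpha>" using \<alpha> smooth_form_C1 unfolding test_form_def by blast
  obtain K where K: "compact K" "K \<subseteq> U" "\<And>x v. x \<notin> K \<Longrightarrow> length v = l \<Longrightarrow> \<alpha> x v = 0"
    using \<alpha> unfolding test_form_def by blast
  define E :: "nat \<Rightarrow> real ^ 'm::{finite, wellorder}" where "E i = std_basis ! i" for i
  have e: "(std_basis :: (real ^ 'm::{finite, wellorder}) list) = map E [0..<?m]"
  proof -
    have "length (std_basis :: (real ^ 'm::{finite, wellorder}) list) = ?m"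
      using kl by (simp add: std_basis_def)
    then show ?thesis unfolding E_def by (metis map_nth)
  qed
  define y where "y x = rep_utuple (f x)" for x
  have y: "orbit_lipschitz ?G C U y" unfolding y_def by (rule rep_orbit_lipschitz[OF f])
  let ?L = "orbit_derivative ?G y"
  define tail where "tail \<sigma> = map (\<lambda>j. E (\<sigma> (Suc k + j))) [0..<l]" for \<sigma>
  have len_tail: "length (tail \<sigma>) = l" for \<sigma> by (simp add: tail_def)
  define I where "I \<sigma> x = stokes_integrand k \<omega> (\<lambda>i. E (\<sigma> i)) (y x) (?L x) (\<alpha> x (tail \<sigma>))
      (frechet_derivative (\<lambda>x. \<alpha> x (tail \<sigma>)) (at x))" for \<sigma> x
  have I0: "has_bochner_integral (lebesgue_on U) (I \<sigma>) 0" for \<sigma>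
  proof -
    have "lip_test U (\<lambda>x. \<alpha> x (tail \<sigma>))"
    proof (rule lip_test_C1[OF C1_form_has_derivative[OF \<alpha>1 len_tail] _ K(1,2)])
      show "continuous_on UNIV (\<lambda>x. dcoef \<alpha> x u (tail \<sigma>))" for u
        using \<alpha>1 len_tail unfolding C1_form_def by blast
      show "\<alpha> x (tail \<sigma>) = 0" if "x \<notin> K" for x using K(3)[OF that len_tail] .
    qed
    from weak_stokes_orbit[OF isometry_group_perm_group U C y inv this \<omega>1, of "\<lambda>i. E (\<sigma> i)"]
    have *: "has_bochner_integral lebesgue (I \<sigma>) 0" unfolding weak_stokes_def I_def .
    have "I \<sigma> x = 0" if "x \<notin> U" for x
    proof -
      have x: "x \<notin> K" using that K(2) by blast
      show ?thesis unfolding I_def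
        using K(3)[OF x len_tail] frechet_derivative_eq_0_outside[OF compact_imp_closed[OF K(1)] K(3)[OF _ len_tail] x]
        by (simp add: stokes_integrand_zero)
    qed
    then have "(\<lambda>x. indicator U x *\<^sub>R I \<sigma> x) = I \<sigma>" by (auto simp: fun_eq_iff indicator_def)
    then show ?thesis
      using * U by (simp add: has_bochner_integral_iff integrable_restrict_space integral_restrict_space)
  qed
  let ?\<beta> = "pullback_utuple f \<omega>" and ?\<gamma> = "pullback_utuple f (ext_deriv \<omega>)"
  let ?F = "\<lambda>x. wedge (k + 1) l ?\<gamma> \<alpha> x std_basis"
  let ?H = "\<lambda>x. wedge k (l + 1) ?\<beta> (ext_deriv \<alpha>) x std_basis"
  define c :: real where "c = 1 / (fact k * fact l)"
  have main: "AE x in lebesgue_on U. ?F x - (- 1) ^ (k + 1) * ?H x =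
      (\<Sum>\<sigma>\<in>?P. c / fact (Suc k) * of_int (sign \<sigma>) * I \<sigma> x)"
    using AE_pullback_utuple[OF f U]
  proof eventually_elim
    case (elim x)
    then have L: "has_orbit_derivative ?G (\<lambda>x. rep_utuple (f x)) x (?L x)" unfolding y_def by blast
    have yx: "rep_utuple (f x) = y x" by (simp add: y_def)
    define Y1 where "Y1 \<sigma> = dcoef \<omega> (y x) (?L x (E (\<sigma> 0))) (map (\<lambda>i. ?L x (E (\<sigma> (Suc i)))) [0..<k]) * \<alpha> x (tail \<sigma>)" for \<sigma>
    define Y2 where "Y2 \<sigma> = frechet_derivative (\<lambda>y. \<alpha> y (tail \<sigma>)) (at x) (E (\<sigma> 0)) *
        \<omega> (y x) (map (\<lambda>i. ?L x (E (\<sigma> (Suc i)))) [0..<k])" for \<sigma>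
    have F: "?F x = c * (\<Sum>\<sigma>\<in>?P. of_int (sign \<sigma>) * Y1 \<sigma>)"
      unfolding Y1_def tail_def c_def Suc_eq_plus1[symmetric]
      by (rule wedge_ext_deriv_left[OF e]) (use pullback_utuple_eq[OF L inv1] in \<open>simp add: yx\<close>)
    have H: "?H x = (- 1) ^ k * c * (\<Sum>\<sigma>\<in>?P. of_int (sign \<sigma>) * Y2 \<sigma>)"
      unfolding Y2_def tail_def c_def Suc_eq_plus1[symmetric]
      by (rule wedge_ext_deriv_right[OF e]) (use pullback_utuple_eq[OF L inv] in \<open>simp add: yx\<close>)
    have sgn: "(- 1 :: real) ^ (k + 1) * ((- 1) ^ k * c * S) = - (c * S)" for S
      by (simp add: mult.assoc[symmetric] power_mult_distrib[symmetric])
    have Ieq: "I \<sigma> x = (\<Sum>\<pi> | \<pi> permutes {..k}. of_int (sign \<pi>) * (Y1 (\<sigma> \<circ> \<pi>) + Y2 (\<sigma> \<circ> \<pi>)))" for \<sigma>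
      unfolding I_def stokes_integrand_def
    proof (rule sum.cong[OF refl])
      fix \<pi> assume "\<pi> \<in> {\<pi>. \<pi> permutes {..k}}"
      then have "\<pi> (Suc k + j) = Suc k + j" for j by (simp add: permutes_not_in)
      then have "tail (\<sigma> \<circ> \<pi>) = tail \<sigma>" unfolding tail_def by simp
      then show "of_int (sign \<pi>) * (\<alpha> x (tail \<sigma>) * dcoef \<omega> (y x) (?L x (E (\<sigma> (\<pi> 0)))) (map (\<lambda>i. ?L x (E (\<sigma> (\<pi> (Suc i))))) [0..<k]) +
          frechet_derivative (\<lambda>x. \<alpha> x (tail \<sigma>)) (at x) (E (\<sigma> (\<pi> 0))) * \<omega> (y x) (map (\<lambda>i. ?L x (E (\<sigma> (\<pi> (Suc i))))) [0..<k])) =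
          of_int (sign \<pi>) * (Y1 (\<sigma> \<circ> \<pi>) + Y2 (\<sigma> \<circ> \<pi>))"
        unfolding Y1_def Y2_def by (simp add: mult.commute)
    qed
    have "?F x - (- 1) ^ (k + 1) * ?H x = c * (\<Sum>\<sigma>\<in>?P. of_int (sign \<sigma>) * (Y1 \<sigma> + Y2 \<sigma>))"
      unfolding F H sgn by (simp add: distrib_left sum.distrib)
    also have "\<dots> = c / fact (Suc k) * (fact (Suc k) * (\<Sum>\<sigma>\<in>?P. of_int (sign \<sigma>) * (Y1 \<sigma> + Y2 \<sigma>)))"
      by (simp del: fact_Suc)
    also have "\<dots> = c / fact (Suc k) * (\<Sum>\<sigma>\<in>?P. of_int (sign \<sigma>) * I \<sigma> x)"
      unfolding Ieq by (subst sum_sign_average_prefix) auto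
    also have "\<dots> = (\<Sum>\<sigma>\<in>?P. c / fact (Suc k) * of_int (sign \<sigma>) * I \<sigma> x)"
      by (simp add: sum_distrib_left mult.assoc del: fact_Suc)
    finally show ?case .
  qed
  have "compact ((\<lambda>x. norm (y x)) ` K)"
  proof (rule compact_continuous_image[OF _ K(1)])
    have "(1 * C)-lipschitz_on U (\<lambda>x. norm (y x))"
      by (rule orbit_lipschitz_invariant[OF y]) (use perm_group.norm_G C norm_triangle_ineq3 in \<open>auto simp: dist_real_def dist_norm\<close>)
    then show "continuous_on K (\<lambda>x. norm (y x))"
      using K(2) continuous_on_subset lipschitz_on_continuous_on by blast
  qed
  then obtain Z where Z: "\<And>x. x \<in> K \<Longrightarrow> norm (y x) \<le> Z"
    using compact_imp_bounded by (force simp: bounded_iff)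
  have int: "integrable (lebesgue_on U) (\<lambda>x. pullback_utuple f q x v * a x)"
    if q: "cont_tensor n q" "invariant_tensor ?G n q" and v: "length v = n"
      and a: "continuous_on UNIV a" "\<And>x. x \<notin> K \<Longrightarrow> a x = 0" for n q v and a :: "real ^ 'm::{finite, wellorder} \<Rightarrow> real"
  proof -
    obtain M where M: "0 \<le> M" "\<And>z v. norm z \<le> Z \<Longrightarrow> length v = n \<Longrightarrow> \<bar>q z v\<bar> \<le> M * (\<Prod>i<n. norm (v ! i))"
      by (rule cont_tensor_bound_prod[OF q(1), of Z], rule that)
    have "AE x in lebesgue_on U. x \<in> K \<longrightarrow> (\<forall>v. length v = n \<longrightarrow>
        \<bar>pullback_utuple f q x v\<bar> \<le> (M * C ^ n) * (\<Prod>i<n. norm (v ! i)))"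
      by (rule AE_pullback_bound[OF f U q(2) M(1)]) (use M(2) Z in \<open>auto simp: y_def\<close>)
    then have "AE x in lebesgue_on U. x \<in> K \<longrightarrow> \<bar>pullback_utuple f q x v\<bar> \<le> (M * C ^ n) * (\<Prod>i<n. norm (v ! i))"
      by eventually_elim (use v in blast)
    from integrable_mult_compact_support[OF pullback_utuple_measurable[OF f U q v] this a(1) K(1) a(2) U K(2)]
    show ?thesis .
  qed
  have len_e: "length (std_basis :: (real ^ 'm::{finite, wellorder}) list) = ?m"
    unfolding e by simp
  have Fint: "integrable (lebesgue_on U) ?F"
  proof -
    have "integrable (lebesgue_on U) (\<lambda>x. ?\<gamma> x v * \<alpha> x v')" if "length v = Suc k" "length v' = l" for v v'
      by (rule int[OF q1 inv1 that(1) C1_form_continuous[OF \<alpha>1 that(2)]]) (use K(3) that(2) in blast)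
    then show ?thesis
      unfolding wedge_def mult.assoc
      by (intro integrable_divide Bochner_Integration.integrable_sum integrable_mult_right) (auto simp: len_e)
  qed
  have Hint: "integrable (lebesgue_on U) ?H"
  proof -
    have "integrable (lebesgue_on U) (\<lambda>x. ?\<beta> x v * ext_deriv \<alpha> x v')" if v: "length v = k" "length v' = Suc l" for v v'
    proof (rule int[OF q0 inv v(1)])
      show "continuous_on UNIV (\<lambda>x. ext_deriv \<alpha> x v')"
        using ext_deriv_cont_tensor[OF \<alpha>1] v(2) unfolding cont_tensor_def by blast
      fix x assume x: "x \<notin> K"
      show "ext_deriv \<alpha> x v' = 0"
        unfolding ext_deriv_def
      proof (rule sum.neutral, rule ballI)
        fix i assume "i \<in> {..<length v'}"
        then have "length (take i v' @ drop (Suc i) v') = l" using v(2) by simp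
        then have "frechet_derivative (\<lambda>y. \<alpha> y (take i v' @ drop (Suc i) v')) (at x) = (\<lambda>v. 0)"
          using K(3) by (intro frechet_derivative_eq_0_outside[OF compact_imp_closed[OF K(1)] _ x]) blast
        then show "(- 1) ^ i * frechet_derivative (\<lambda>y. \<alpha> y (take i v' @ drop (Suc i) v')) (at x) (v' ! i) = 0" by simp
      qed
    qed
    then show ?thesis
      unfolding wedge_def mult.assoc
      by (intro integrable_divide Bochner_Integration.integrable_sum integrable_mult_right) (auto simp: len_e)
  qed
  have hb: "has_bochner_integral (lebesgue_on U) (\<lambda>x. \<Sum>\<sigma>\<in>?P. c / fact (Suc k) * of_int (sign \<sigma>) * I \<sigma> x)
      (\<Sum>\<sigma>\<in>?P. c / fact (Suc k) * of_int (sign \<sigma>) * 0)"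
    by (intro has_bochner_integral_sum has_bochner_integral_mult_right I0)
  have S: "(\<integral>x. (\<Sum>\<sigma>\<in>?P. c / fact (Suc k) * of_int (sign \<sigma>) * I \<sigma> x) \<partial>lebesgue_on U) = 0"
      "(\<lambda>x. \<Sum>\<sigma>\<in>?P. c / fact (Suc k) * of_int (sign \<sigma>) * I \<sigma> x) \<in> borel_measurable (lebesgue_on U)"
    using has_bochner_integral_integral_eq[OF hb] borel_measurable_has_bochner_integral[OF hb] by simp_all
  have "(\<integral>x. ?F x - (- 1) ^ (k + 1) * ?H x \<partial>lebesgue_on U) = 0"
    unfolding S(1)[symmetric]
    by (rule integral_cong_AE[OF _ S(2) main])
      (use borel_measurable_integrable[OF Fint] borel_measurable_integrable[OF Hint] in measurable)
  then have "(\<integral>x. ?F x \<partial>lebesgue_on U) = (- 1) ^ (k + 1) * (\<integral>x. ?H x \<partial>lebesgue_on U)"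
    using Fint Hint by simp
  then show "form_integrable U (wedge (k + 1) l ?\<gamma> \<alpha>) \<and>
      form_integrable U (wedge k (l + 1) ?\<beta> (ext_deriv \<alpha>)) \<and>
      form_integral U (wedge (k + 1) l ?\<gamma> \<alpha>) =
        (- 1) ^ (k + 1) * form_integral U (wedge k (l + 1) ?\<beta> (ext_deriv \<alpha>))"
    unfolding form_integrable_def form_integral_def using Fint Hint by blast
qed

theorem theorem4p7:
  fixes U :: "(real ^ 'm::{finite, wellorder}) set"
    and f :: "real ^ 'm::{finite, wellorder} \<Rightarrow> (real ^ 'n, 'd::finite) utuple"
    and \<omega> :: "((real ^ 'n) ^ 'd::finite) form"
    and k :: nat
  assumes "open U"
    and "\<exists>C. C-lipschitz_on U f"
    and "invariant_form k \<omega>"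
  shows "weak_ext_deriv U k (pullback_utuple f \<omega>) (pullback_utuple f (ext_deriv \<omega>)) \<and>
    (\<forall>V. open V \<and> V \<subseteq> U \<and> bounded (f ` V) \<longrightarrow> flat_form V k (pullback_utuple f \<omega>)) \<and>
    (bounded_form_on {y. utuple y \<in> f ` U} k \<omega> \<and>
     bounded_form_on {y. utuple y \<in> f ` U} (k + 1) (ext_deriv \<omega>)
     \<longrightarrow> flat_form U k (pullback_utuple f \<omega>))"
proof -
  let ?G = "perm_group :: ((real ^ 'n) ^ 'd \<Rightarrow> (real ^ 'n) ^ 'd) set"
  obtain C where f: "C-lipschitz_on U f" using assms(2) by blast
  have \<omega>1: "C1_form k \<omega>" and alt: "\<And>z. alternating_form k (\<omega> z)"
    using assms(3) smooth_form_C1 unfolding invariant_form_def by blast+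
  have inv: "invariant_tensor ?G k \<omega>"
    using assms(3) unfolding invariant_form_def invariant_tensor_def perm_group_def by blast
  have inv1: "invariant_tensor ?G (Suc k) (ext_deriv \<omega>)"
    by (rule ext_deriv_invariant[OF \<omega>1 inv perm_group.linear_G])
  note q0 = C1_form_cont_tensor[OF \<omega>1] and q1 = ext_deriv_cont_tensor[OF \<omega>1]
    and alt1 = ext_deriv_alternating[OF \<omega>1 alt]
  have flat: "flat_form V k (pullback_utuple f \<omega>)"
    if V: "open V" "V \<subseteq> U"
      and b0: "\<And>x v. x \<in> V \<Longrightarrow> length v = k \<Longrightarrow> \<bar>\<omega> (rep_utuple (f x)) v\<bar> \<le> M * (\<Prod>i<k. norm (v ! i))"
      and b1: "\<And>x v. x \<in> V \<Longrightarrow> length v = Suc k \<Longrightarrow> \<bar>ext_deriv \<omega> (rep_utuple (f x)) v\<bar> \<le> M' * (\<Prod>i<Suc k. norm (v ! i))"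
    for V M M'
  proof -
    have fV: "C-lipschitz_on V f" using f V(2) by (rule lipschitz_on_subset)
    have "Linfty_form V k (pullback_utuple f \<omega>)"
      by (rule Linfty_form_pullback_utuple[OF fV V(1) q0 inv alt b0])
    moreover have "Linfty_form V (Suc k) (pullback_utuple f (ext_deriv \<omega>))"
      by (rule Linfty_form_pullback_utuple[OF fV V(1) q1 inv1 alt1 b1])
    moreover have "weak_ext_deriv V k (pullback_utuple f \<omega>) (pullback_utuple f (ext_deriv \<omega>))"
      by (rule weak_ext_deriv_pullback_utuple[OF V(1) fV assms(3)])
    ultimately show ?thesis unfolding flat_form_def by auto
  qed
  show ?thesis
  proof (intro conjI allI impI)
    show "weak_ext_deriv U k (pullback_utuple f \<omega>) (pullback_utuple f (ext_deriv \<omega>))"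
      by (rule weak_ext_deriv_pullback_utuple[OF assms(1) f assms(3)])
  next
    fix V assume V: "open V \<and> V \<subseteq> U \<and> bounded (f ` V)"
    then obtain Z where Z: "\<And>x. x \<in> V \<Longrightarrow> dist (utuple 0) (f x) \<le> Z"
      unfolding bounded_any_center[where a="utuple 0"] by blast
    have nZ: "norm (rep_utuple (f x)) \<le> Z" if "x \<in> V" for x
      using Z[OF that] by (simp add: norm_rep_utuple dist_commute)
    obtain M where M: "0 \<le> M" "\<And>z v. norm z \<le> Z \<Longrightarrow> length v = k \<Longrightarrow> \<bar>\<omega> z v\<bar> \<le> M * (\<Prod>i<k. norm (v ! i))"
      by (rule cont_tensor_bound_prod[OF q0, of Z], rule that)
    obtain M' where M': "0 \<le> M'" "\<And>z v. norm z \<le> Z \<Longrightarrow> length v = Suc k \<Longrightarrow> \<bar>ext_deriv \<omega> z v\<bar> \<le> M' * (\<Prod>i<Suc k. norm (v ! i))"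
      by (rule cont_tensor_bound_prod[OF q1, of Z], rule that)
    show "flat_form V k (pullback_utuple f \<omega>)"
      by (rule flat[of V M M']) (use V M(2) M'(2) nZ in blast)+
  next
    assume b: "bounded_form_on {y. utuple y \<in> f ` U} k \<omega> \<and>
      bounded_form_on {y. utuple y \<in> f ` U} (k + 1) (ext_deriv \<omega>)"
    have inY: "rep_utuple (f x) \<in> {y. utuple y \<in> f ` U}" if "x \<in> U" for x
      using that by (simp add: utuple_rep_utuple)
    obtain M where M: "\<And>y v. y \<in> {y. utuple y \<in> f ` U} \<Longrightarrow> length v = k \<Longrightarrow> \<bar>\<omega> y v\<bar> \<le> M * (\<Prod>i<k. norm (v ! i))"
      using b unfolding bounded_form_on_def by blast
    obtain M' where M': "\<And>y v. y \<in> {y. utuple y \<in> f ` U} \<Longrightarrow> length v = Suc k \<Longrightarrow>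
        \<bar>ext_deriv \<omega> y v\<bar> \<le> M' * (\<Prod>i<Suc k. norm (v ! i))"
      using b unfolding bounded_form_on_def Suc_eq_plus1 by blast
    show "flat_form U k (pullback_utuple f \<omega>)"
      by (rule flat[OF assms(1) subset_refl]) (use M[OF inY] M'[OF inY] in blast)+
  qed
qed

end
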